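(* Let $\varphi(\alpha)$ be a $\forall\Sigma^0_2$ formula of second-order arithmetic. If $\mathsf{WKL_0}+\mathrm{RT}^2_2$ proves $\forall\alpha<\omega^\omega\,(\mathrm{WO}(\alpha)\to\varphi(\alpha))$, then $\mathsf{RCA_0}$ proves $\forall\alpha<\omega^\omega\,(\mathrm{WO}(\alpha)\to\varphi(\alpha))$.
   Context: $\mathsf{RCA_0}$ is the second-order arithmetic theory consisting of basic axioms for $\mathbb{N}$ as a discrete ordered semiring, $\Delta^0_1$-comprehension and $\Sigma^0_1$-induction. $\mathsf{WKL_0}$ is $\mathsf{RCA_0}$ plus weak König's lemma (every infinite binary tree has an infinite path). $\mathrm{RT}^2_2$ is the statement: for every $P:[\mathbb{N}]^2\to2$ there is an infinite $P$-homogeneous set. A $\Sigma^0_n$ formula has no second-order quantifiers and consists of at most $n$ alternating first-order quantifiers beginning with $\exists$ followed by a formula with only bounded quantifiers; a $\forall\Sigma^0_n$ formula is a block of universal (possibly second-order) quantifiers followed by a $\Sigma^0_n$ formula. Ordinals $<\omega^\omega$ are coded by codes of non-increasing finite sequences $\langle n_0,\dots,n_{k-1}\rangle$ representing $\omega^{n_0}+\dots+\omega^{n_{k-1}}$, with the usual ordinal ordering; $\alpha<\omega^\omega$ ranges over such codes. $\mathrm{WO}(\alpha)$ is the statement that there is no infinite descending sequence of ordinals starting from $\alpha$. *)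

theory Defs
  imports Main
begin

text \<open>Number terms over 0, 1, +, *; number variables and set variables are
  indexed by natural numbers (two separate name spaces).\<close>

datatype tm = TV nat | TZ | TO | TPlus tm tm | TTimes tm tm

datatype fm =
    FEq tm tm | FLess tm tm | FMem tm nat
  | FNeg fm | FImp fm fm
  | FAll nat fm
  | FAllS nat fm

definition FAnd :: "fm \<Rightarrow> fm \<Rightarrow> fm" where "FAnd a b = FNeg (FImp a (FNeg b))"
definition FOr :: "fm \<Rightarrow> fm \<Rightarrow> fm" where "FOr a b = FImp (FNeg a) b"
definition FIff :: "fm \<Rightarrow> fm \<Rightarrow> fm" where "FIff a b = FAnd (FImp a b) (FImp b a)"
definition FEx :: "nat \<Rightarrow> fm \<Rightarrow> fm" where "FEx x a = FNeg (FAll x (FNeg a))"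
definition FExS :: "nat \<Rightarrow> fm \<Rightarrow> fm" where "FExS X a = FNeg (FAllS X (FNeg a))"

fun fvt :: "tm \<Rightarrow> nat set" where
  "fvt (TV x) = {x}" | "fvt TZ = {}" | "fvt TO = {}"
| "fvt (TPlus s t) = fvt s \<union> fvt t" | "fvt (TTimes s t) = fvt s \<union> fvt t"

fun fv :: "fm \<Rightarrow> nat set" where
  "fv (FEq s t) = fvt s \<union> fvt t" | "fv (FLess s t) = fvt s \<union> fvt t"
| "fv (FMem t X) = fvt t" | "fv (FNeg a) = fv a" | "fv (FImp a b) = fv a \<union> fv b"
| "fv (FAll x a) = fv a - {x}" | "fv (FAllS X a) = fv a"

fun fvs :: "fm \<Rightarrow> nat set" where
  "fvs (FEq s t) = {}" | "fvs (FLess s t) = {}"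
| "fvs (FMem t X) = {X}" | "fvs (FNeg a) = fvs a" | "fvs (FImp a b) = fvs a \<union> fvs b"
| "fvs (FAll x a) = fvs a" | "fvs (FAllS X a) = fvs a - {X}"

fun substt :: "nat \<Rightarrow> tm \<Rightarrow> tm \<Rightarrow> tm" where
  "substt x r (TV y) = (if y = x then r else TV y)" | "substt x r TZ = TZ" | "substt x r TO = TO"
| "substt x r (TPlus s t) = TPlus (substt x r s) (substt x r t)"
| "substt x r (TTimes s t) = TTimes (substt x r s) (substt x r t)"

text \<open>replace free occurrences of number variable x by term r (no renaming)\<close>
fun substf :: "nat \<Rightarrow> tm \<Rightarrow> fm \<Rightarrow> fm" where
  "substf x r (FEq s t) = FEq (substt x r s) (substt x r t)"
| "substf x r (FLess s t) = FLess (substt x r s) (substt x r t)"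
| "substf x r (FMem t X) = FMem (substt x r t) X"
| "substf x r (FNeg a) = FNeg (substf x r a)"
| "substf x r (FImp a b) = FImp (substf x r a) (substf x r b)"
| "substf x r (FAll y a) = (if y = x then FAll y a else FAll y (substf x r a))"
| "substf x r (FAllS X a) = FAllS X (substf x r a)"

fun free_for :: "tm \<Rightarrow> nat \<Rightarrow> fm \<Rightarrow> bool" where
  "free_for r x (FEq s t) = True" | "free_for r x (FLess s t) = True"
| "free_for r x (FMem t X) = True"
| "free_for r x (FNeg a) = free_for r x a"
| "free_for r x (FImp a b) = (free_for r x a \<and> free_for r x b)"
| "free_for r x (FAll y a) = (x \<notin> fv (FAll y a) \<or> (y \<notin> fvt r \<and> free_for r x a))"
| "free_for r x (FAllS X a) = free_for r x a"

fun substs :: "nat \<Rightarrow> nat \<Rightarrow> fm \<Rightarrow> fm" where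
  "substs X Y (FEq s t) = FEq s t" | "substs X Y (FLess s t) = FLess s t"
| "substs X Y (FMem t Z) = FMem t (if Z = X then Y else Z)"
| "substs X Y (FNeg a) = FNeg (substs X Y a)"
| "substs X Y (FImp a b) = FImp (substs X Y a) (substs X Y b)"
| "substs X Y (FAll y a) = FAll y (substs X Y a)"
| "substs X Y (FAllS Z a) = (if Z = X then FAllS Z a else FAllS Z (substs X Y a))"

fun free_fors :: "nat \<Rightarrow> nat \<Rightarrow> fm \<Rightarrow> bool" where
  "free_fors Y X (FEq s t) = True" | "free_fors Y X (FLess s t) = True"
| "free_fors Y X (FMem t Z) = True"
| "free_fors Y X (FNeg a) = free_fors Y X a"
| "free_fors Y X (FImp a b) = (free_fors Y X a \<and> free_fors Y X b)"
| "free_fors Y X (FAll y a) = free_fors Y X a"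
| "free_fors Y X (FAllS Z a) = (X \<notin> fvs (FAllS Z a) \<or> (Z \<noteq> Y \<and> free_fors Y X a))"

fun evalP :: "(fm \<Rightarrow> bool) \<Rightarrow> fm \<Rightarrow> bool" where
  "evalP v (FNeg a) = (\<not> evalP v a)"
| "evalP v (FImp a b) = (evalP v a \<longrightarrow> evalP v b)"
| "evalP v a = v a"

definition taut :: "fm \<Rightarrow> bool" where "taut a = (\<forall>v. evalP v a)"

inductive logax :: "fm \<Rightarrow> bool" where
  tautology: "taut a \<Longrightarrow> logax a"
| inst: "free_for r x a \<Longrightarrow> logax (FImp (FAll x a) (substf x r a))"
| instS: "free_fors Y X a \<Longrightarrow> logax (FImp (FAllS X a) (substs X Y a))"
| distr: "x \<notin> fv a \<Longrightarrow> logax (FImp (FAll x (FImp a b)) (FImp a (FAll x b)))"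
| distrS: "X \<notin> fvs a \<Longrightarrow> logax (FImp (FAllS X (FImp a b)) (FImp a (FAllS X b)))"
| eq_refl: "logax (FEq (TV x) (TV x))"
| eq_eq: "logax (FImp (FEq (TV x) (TV y)) (FImp (FEq (TV x) (TV z)) (FEq (TV y) (TV z))))"
| eq_plus: "logax (FImp (FEq (TV x1) (TV y1)) (FImp (FEq (TV x2) (TV y2))
            (FEq (TPlus (TV x1) (TV x2)) (TPlus (TV y1) (TV y2)))))"
| eq_times: "logax (FImp (FEq (TV x1) (TV y1)) (FImp (FEq (TV x2) (TV y2))
            (FEq (TTimes (TV x1) (TV x2)) (TTimes (TV y1) (TV y2)))))"
| eq_less: "logax (FImp (FEq (TV x1) (TV y1)) (FImp (FEq (TV x2) (TV y2))
            (FImp (FLess (TV x1) (TV x2)) (FLess (TV y1) (TV y2)))))"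
| eq_mem: "logax (FImp (FEq (TV x) (TV y)) (FImp (FMem (TV x) X) (FMem (TV y) X)))"

text \<open>T \<turnstile> a. Non-logical axioms are read as implicitly universally closed
  (hence the generalization rules).\<close>
inductive prov :: "fm set \<Rightarrow> fm \<Rightarrow> bool" for T where
  hyp: "a \<in> T \<Longrightarrow> prov T a"
| ax: "logax a \<Longrightarrow> prov T a"
| mp: "prov T (FImp a b) \<Longrightarrow> prov T a \<Longrightarrow> prov T b"
| gen: "prov T a \<Longrightarrow> prov T (FAll x a)"
| genS: "prov T a \<Longrightarrow> prov T (FAllS X a)"

inductive bounded :: "fm \<Rightarrow> bool" where
  "bounded (FEq s t)" | "bounded (FLess s t)" | "bounded (FMem t X)"
| "bounded a \<Longrightarrow> bounded (FNeg a)"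
| "bounded a \<Longrightarrow> bounded b \<Longrightarrow> bounded (FImp a b)"
| "x \<notin> fvt t \<Longrightarrow> bounded a \<Longrightarrow> bounded (FAll x (FImp (FLess (TV x) t) a))"
| "x \<notin> fvt t \<Longrightarrow> bounded a \<Longrightarrow> bounded (FEx x (FAnd (FLess (TV x) t) a))"

fun sigma :: "nat \<Rightarrow> fm \<Rightarrow> bool" and pi :: "nat \<Rightarrow> fm \<Rightarrow> bool" where
  "sigma 0 a = bounded a"
| "pi 0 a = bounded a"
| "sigma (Suc n) a = (sigma n a \<or> (\<exists>x b. a = FEx x b \<and> pi n b))"
| "pi (Suc n) a = (pi n a \<or> (\<exists>x b. a = FAll x b \<and> sigma n b))"

inductive allSigma2 :: "fm \<Rightarrow> bool" where
  "sigma 2 a \<Longrightarrow> allSigma2 a"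
| "allSigma2 a \<Longrightarrow> allSigma2 (FAll x a)"
| "allSigma2 a \<Longrightarrow> allSigma2 (FAllS X a)"

definition tw :: tm where "tw = TPlus TO TO"

text \<open>Cantor pairing: z = ((s+t)(s+t+1))/2 + s\<close>
definition pairT :: "tm \<Rightarrow> tm \<Rightarrow> tm \<Rightarrow> fm" where
  "pairT s t z = FEq (TTimes tw z) (TPlus (TTimes (TPlus s t) (TPlus (TPlus s t) TO)) (TTimes tw s))"

text \<open>(s,t) \<in> X; bound variable b must not occur in s, t\<close>
definition pairInF :: "nat \<Rightarrow> tm \<Rightarrow> tm \<Rightarrow> nat \<Rightarrow> fm" where
  "pairInF b s t X = FEx b (FAnd (pairT s t (TV b)) (FMem (TV b) X))"

text \<open>Every number s = (k,(c,d)) codes the sequence of length k whose i-th entry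
  is c mod (1+(i+1)d) (Goedel beta function). entF b s i v: entry i of s is v.
  Internal bound variables are b..b+4 (all free arguments must be < b).\<close>
definition entF :: "nat \<Rightarrow> nat \<Rightarrow> nat \<Rightarrow> nat \<Rightarrow> fm" where
  "entF b s i v = (let k = b; c = b+1; d = b+2; p = b+3; q = b+4;
      m = TPlus TO (TTimes (TPlus (TV i) TO) (TV d)) in
    FEx k (FEx c (FEx d (FEx p (FAnd (pairT (TV c) (TV d) (TV p))
      (FAnd (pairT (TV k) (TV p) (TV s))
      (FAnd (FLess (TV i) (TV k))
        (FEx q (FAnd (FEq (TV c) (TPlus (TTimes (TV q) m) (TV v))) (FLess (TV v) m))))))))))"

text \<open>lhF b s l: the length of s is l (bound variables b..b+2)\<close>
definition lhF :: "nat \<Rightarrow> nat \<Rightarrow> nat \<Rightarrow> fm" where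
  "lhF b s l = (let c = b; d = b+1; p = b+2 in
    FEx c (FEx d (FEx p (FAnd (pairT (TV c) (TV d) (TV p)) (pairT (TV l) (TV p) (TV s))))))"

text \<open>x codes a non-increasing sequence n_0 \<ge> ... \<ge> n_{k-1}, i.e. an ordinal
  omega^n_0 + ... + omega^n_{k-1} < omega^omega\<close>
definition ordF :: "nat \<Rightarrow> nat \<Rightarrow> fm" where
  "ordF b x = (let i = b; j = b+1; u = b+2; v = b+3; h = b+4 in
    FAll i (FAll j (FAll u (FAll v (FImp
      (FAnd (entF h x i u) (FAnd (entF h x j v) (FLess (TV i) (TV j))))
      (FOr (FLess (TV v) (TV u)) (FEq (TV v) (TV u))))))))"

text \<open>ordinal ordering x < y of such codes (lexicographic, proper prefix smaller)\<close>
definition ordLtF :: "nat \<Rightarrow> nat \<Rightarrow> nat \<Rightarrow> fm" where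
  "ordLtF b x y = (let i = b; j = b+1; u = b+2; v = b+3; k = b+4; h = b+5 in
    FEx i (FAnd
      (FAll j (FImp (FLess (TV j) (TV i)) (FAll u (FIff (entF h x j u) (entF h y j u)))))
      (FOr (FAnd (lhF h x i) (FEx k (FAnd (lhF h y k) (FLess (TV i) (TV k)))))
           (FEx u (FEx v (FAnd (entF h x i u) (FAnd (entF h y i v) (FLess (TV u) (TV v)))))))))"

text \<open>WO(a): there is no function F : N \<rightarrow> N (coded as a set of pairs) with
  F(0) = a and F(n+1) < F(n) for all n, all values being ordinal codes\<close>
definition woF :: "nat \<Rightarrow> nat \<Rightarrow> fm" where
  "woF b a = (let F = 0; n = b; m = b+1; m' = b+2; u = b+3; v = b+4; h = b+5 in
    FNeg (FExS F (FAnd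
      (FAll n (FEx m (pairInF h (TV n) (TV m) F)))
     (FAnd
      (FAll n (FAll m (FAll m' (FImp (FAnd (pairInF h (TV n) (TV m) F) (pairInF h (TV n) (TV m') F))
                                      (FEq (TV m) (TV m'))))))
     (FAnd
      (pairInF h TZ (TV a) F)
      (FAll n (FAll u (FAll v (FImp
          (FAnd (pairInF h (TV n) (TV u) F) (pairInF h (TPlus (TV n) TO) (TV v) F))
          (FAnd (ordF h u) (ordLtF h v u)))))))))))"

definition ordStmt :: "nat \<Rightarrow> fm \<Rightarrow> fm" where
  "ordStmt a phi = FAll a (FImp (ordF (Suc a) a) (FImp (woF (Suc a) a) phi))"

definition basicAx :: "fm set" where
  "basicAx = (let m = TV 0; n = TV 1 in
   { FAll 0 (FNeg (FEq (TPlus m TO) TZ)),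
     FAll 0 (FAll 1 (FImp (FEq (TPlus m TO) (TPlus n TO)) (FEq m n))),
     FAll 0 (FEq (TPlus m TZ) m),
     FAll 0 (FAll 1 (FEq (TPlus m (TPlus n TO)) (TPlus (TPlus m n) TO))),
     FAll 0 (FEq (TTimes m TZ) TZ),
     FAll 0 (FAll 1 (FEq (TTimes m (TPlus n TO)) (TPlus (TTimes m n) m))),
     FAll 0 (FNeg (FLess m TZ)),
     FAll 0 (FAll 1 (FIff (FLess m (TPlus n TO)) (FOr (FLess m n) (FEq m n)))),
     FAllS 0 (FImp (FAnd (FMem TZ 0) (FAll 1 (FImp (FMem n 0) (FMem (TPlus n TO) 0))))
                   (FAll 1 (FMem n 0))) })"

definition sigma1Ind :: "fm set" where
  "sigma1Ind = { FImp (FAnd (substf n TZ a) (FAll n (FImp a (substf n (TPlus (TV n) TO) a))))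
                      (FAll n a) | a n. sigma 1 a }"

definition delta1CA :: "fm set" where
  "delta1CA = { FImp (FAll n (FIff a b)) (FExS X (FAll n (FIff (FMem (TV n) X) a)))
                | a b n X. sigma 1 a \<and> pi 1 b \<and> X \<notin> fvs a }"

definition RCA0 :: "fm set" where "RCA0 = basicAx \<union> sigma1Ind \<union> delta1CA"

text \<open>Weak Koenig's lemma: every infinite tree of binary sequences has a path.
  T = set var 0, path P = set var 1.\<close>
definition wklAx :: fm where
  "wklAx = (let s = 0; t = 1; i = 2; u = 3; k = 4; h = 5;
     bin = FAll i (FAll u (FImp (entF h s i u) (FLess (TV u) tw)));
     tree = FAnd (FAll s (FImp (FMem (TV s) 0) bin))
                 (FAll s (FAll t (FImp (FAnd (FMem (TV s) 0)
                      (FAll i (FAll u (FImp (entF h t i u) (entF h s i u))))) (FMem (TV t) 0))));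
     inf = FAll k (FEx s (FAnd (FMem (TV s) 0) (lhF h s k)));
     path = FExS 1 (FAll k (FEx s (FAnd (FMem (TV s) 0) (FAnd (lhF h s k)
              (FAll i (FAll u (FImp (entF h s i u) (FIff (FEq (TV u) TO) (FMem (TV i) 1)))))))))
   in FAllS 0 (FImp (FAnd tree inf) path))"

definition WKL0 :: "fm set" where "WKL0 = insert wklAx RCA0"

text \<open>RT^2_2: the colouring P : [N]^2 \<rightarrow> 2 is coded by a set (colour of {x<y} is 1
  iff (x,y) \<in> P); H = set var 1 is an infinite homogeneous set\<close>
definition rt22Ax :: fm where
  "rt22Ax = (let n = 0; m = 1; x = 2; y = 3; h = 4;
     infH = FAll n (FEx m (FAnd (FLess (TV n) (TV m)) (FMem (TV m) 1)));
     c1 = pairInF h (TV x) (TV y) 0;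
     hom = (\<lambda>c. FAll x (FAll y (FImp (FAnd (FMem (TV x) 1) (FAnd (FMem (TV y) 1)
                 (FLess (TV x) (TV y)))) c)))
   in FAllS 0 (FExS 1 (FAnd infH (FOr (hom (FNeg c1)) (hom c1)))))"

definition WKL0_RT22 :: "fm set" where "WKL0_RT22 = insert rt22Ax WKL0"

end

theory Submission
  imports Defs "HOL-Library.Countable_Set"
begin

text \<open>Suppose that some such implication, provable with weak Koenig's lemma and Ramsey's theorem for pairs, is not
  provable in \<open>RCA\<^sub>0\<close>. Completeness and compactness yield a countable nonstandard model \<open>M\<close> of \<open>RCA\<^sub>0\<close> in
  which it fails at some \<open>\<alpha>\<close>. Since \<open>M\<close> believes that \<open>\<alpha>\<close> with leading exponent \<open>m\<close> is well-ordered, every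
  unbounded set of \<open>M\<close> has \<open>\<omega>\<^sup>m\<close>-large finite subsets, hence \<open>\<omega>\<^sup>j\<close>-large ones with \<open>j = (m + 1) k\<close> for
  every standard \<open>k\<close>, and by overspill for some nonstandard \<open>k\<close>. Such a finite set, taken sparse with respect to a
  Skolem function witnessing the failure of the \<open>\<Sigma>\<^sup>0\<^sub>2\<close> matrix, is thinned out countably often. Each
  step consumes only a standard multiple of \<open>m + 1\<close>, makes one colouring of pairs homogeneous (an \<open>\<omega>\<^bsup>8n+8\<^esup>\<close>-large
  sparse set has an \<open>\<omega>\<^sup>n\<close>-large homogeneous subset), and keeps the values of one function away from the cut.
  The cut \<open>I\<close> determined by the least elements of the thinned sets satisfies weak Koenig's lemma and Ramsey's theorem
  for pairs with the sets of \<open>M\<close> restricted to \<open>I\<close>, and the Skolem function keeps the counterexample alive. Finally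
  \<open>\<alpha>\<close> is still well-ordered in \<open>I\<close>: along a sparse \<open>\<omega>\<^bsup>m+1\<^esup>\<close>-large set a descending sequence must drop
  at a term with exponent above \<open>m\<close>, and \<open>\<alpha>\<close> has none.\<close>

text \<open>Two obstacles shape the argument. The model has induction for
  \<open>\<Sigma>\<^sup>0\<^sub>1\<close> formulas only, while exponents and multiplicities may be
  nonstandard. So every notion that is recursed on gets a decidable form with bounded witnesses, and
  the inductions run over decidable statements or over those behind one unbounded quantifier. The
  property \<open>LL\<close>, which quantifies over all unbounded sets, has no such form: it is
  iterated only standardly often, outside the model, and overspill is applied afterwards to a single
  set. Secondly, a descending sequence in the cut is the trace of a set of the model that need not
  descend past the cut, so the well-orderedness known in the model does not pass to the cut by
  itself. For this reason each thinning step also reserves a large block lying below all later sets;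
  the cut then contains such blocks beyond each of its elements. The growth rate \<open>gg\<close>
  of sparse sets is chosen so that the head of a block dominates the number of colour classes to be
  sorted out behind it.\<close>

instance tm :: countable by countable_datatype
instance fm :: countable by countable_datatype

section \<open>Semantics and soundness\<close>

record 'm str =
  Dm :: "'m set"
  Z0 :: 'm
  O1 :: 'm
  Pl :: "'m \<Rightarrow> 'm \<Rightarrow> 'm"
  Ti :: "'m \<Rightarrow> 'm \<Rightarrow> 'm"
  Ls :: "'m \<Rightarrow> 'm \<Rightarrow> bool"
  Ss :: "'m set set"

fun ev :: "('m, 'z) str_scheme \<Rightarrow> (nat \<Rightarrow> 'm) \<Rightarrow> tm \<Rightarrow> 'm" where
  "ev M e (TV x) = e x"
| "ev M e TZ = Z0 M"
| "ev M e TO = O1 M"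
| "ev M e (TPlus s t) = Pl M (ev M e s) (ev M e t)"
| "ev M e (TTimes s t) = Ti M (ev M e s) (ev M e t)"

fun sat :: "('m, 'z) str_scheme \<Rightarrow> (nat \<Rightarrow> 'm) \<Rightarrow> (nat \<Rightarrow> 'm set) \<Rightarrow> fm \<Rightarrow> bool" where
  "sat M e s (FEq t u) = (ev M e t = ev M e u)"
| "sat M e s (FLess t u) = Ls M (ev M e t) (ev M e u)"
| "sat M e s (FMem t X) = (ev M e t \<in> s X)"
| "sat M e s (FNeg a) = (\<not> sat M e s a)"
| "sat M e s (FImp a b) = (sat M e s a \<longrightarrow> sat M e s b)"
| "sat M e s (FAll x a) = (\<forall>d\<in>Dm M. sat M (e(x := d)) s a)"
| "sat M e s (FAllS X a) = (\<forall>A\<in>Ss M. sat M e (s(X := A)) a)"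

lemma sat_derived [simp]:
  "sat M e s (FAnd a b) = (sat M e s a \<and> sat M e s b)"
  "sat M e s (FOr a b) = (sat M e s a \<or> sat M e s b)"
  "sat M e s (FIff a b) = (sat M e s a = sat M e s b)"
  "sat M e s (FEx x a) = (\<exists>d\<in>Dm M. sat M (e(x := d)) s a)"
  "sat M e s (FExS X a) = (\<exists>A\<in>Ss M. sat M e (s(X := A)) a)"
  by (auto simp: FAnd_def FOr_def FIff_def FEx_def FExS_def)

definition wfm :: "('m, 'z) str_scheme \<Rightarrow> bool" where
  "wfm M \<longleftrightarrow> Z0 M \<in> Dm M \<and> O1 M \<in> Dm M \<and> Ss M \<noteq> {} \<and>
    (\<forall>x\<in>Dm M. \<forall>y\<in>Dm M. Pl M x y \<in> Dm M \<and> Ti M x y \<in> Dm M)"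

definition wfe :: "('m, 'z) str_scheme \<Rightarrow> (nat \<Rightarrow> 'm) \<Rightarrow> (nat \<Rightarrow> 'm set) \<Rightarrow> bool" where
  "wfe M e s \<longleftrightarrow> (\<forall>n. e n \<in> Dm M) \<and> (\<forall>n. s n \<in> Ss M)"

definition models :: "('m, 'z) str_scheme \<Rightarrow> fm set \<Rightarrow> bool" where
  "models M T \<longleftrightarrow> (\<forall>a\<in>T. \<forall>e s. wfe M e s \<longrightarrow> sat M e s a)"

lemma ev_Dm: "wfm M \<Longrightarrow> wfe M e s \<Longrightarrow> ev M e t \<in> Dm M"
  by (induction t) (auto simp: wfm_def wfe_def)

lemma wfe_upd: "wfe M e s \<Longrightarrow> d \<in> Dm M \<Longrightarrow> wfe M (e(x := d)) s"
  by (auto simp: wfe_def)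

lemma wfe_updS: "wfe M e s \<Longrightarrow> A \<in> Ss M \<Longrightarrow> wfe M e (s(x := A))"
  by (auto simp: wfe_def)

lemma ev_cong: "(\<And>x. x \<in> fvt t \<Longrightarrow> e x = e' x) \<Longrightarrow> ev M e t = ev M e' t"
  by (induction t) auto

lemma sat_cong:
  "(\<And>x. x \<in> fv a \<Longrightarrow> e x = e' x) \<Longrightarrow> (\<And>X. X \<in> fvs a \<Longrightarrow> s X = s' X) \<Longrightarrow> sat M e s a = sat M e' s' a"
proof (induction a arbitrary: e e' s s')
  case (FEq t u)
  then have "ev M e t = ev M e' t" "ev M e u = ev M e' u" by (auto intro: ev_cong)
  then show ?case by simp
next
  case (FLess t u)
  then have "ev M e t = ev M e' t" "ev M e u = ev M e' u" by (auto intro: ev_cong)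
  then show ?case by simp
next
  case (FMem t X)
  then have "ev M e t = ev M e' t" by (auto intro: ev_cong)
  then show ?case using FMem by simp
next
  case (FNeg a)
  have "sat M e s a = sat M e' s' a" by (rule FNeg.IH) (use FNeg.prems in auto)
  then show ?case by simp
next
  case (FImp a b)
  have "sat M e s a = sat M e' s' a" "sat M e s b = sat M e' s' b"
    by (rule FImp.IH; use FImp.prems in auto)+
  then show ?case by simp
next
  case (FAll x a)
  have "sat M (e(x:=d)) s a = sat M (e'(x:=d)) s' a" for d by (rule FAll.IH) (use FAll.prems in auto)
  then show ?case by simp
next
  case (FAllS X a)
  have "sat M e (s(X:=d)) a = sat M e' (s'(X:=d)) a" for d by (rule FAllS.IH) (use FAllS.prems in auto)
  then show ?case by simp
qed

lemma ev_substt: "ev M e (substt x r t) = ev M (e(x := ev M e r)) t"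
  by (induction t) auto

lemma substt_id: "x \<notin> fvt t \<Longrightarrow> substt x r t = t"
  by (induction t) auto

lemma substf_id: "x \<notin> fv a \<Longrightarrow> substf x r a = a"
  by (induction a) (auto simp: substt_id)

lemma substs_id: "X \<notin> fvs a \<Longrightarrow> substs X Y a = a"
  by (induction a) auto

lemma sat_substf: "free_for r x a \<Longrightarrow> sat M e s (substf x r a) = sat M (e(x := ev M e r)) s a"
proof (induction a arbitrary: e s)
  case (FAll y b)
  show ?case
  proof (cases "x \<notin> fv (FAll y b)")
    case True
    then have "substf x r (FAll y b) = FAll y b" by (rule substf_id)
    moreover have "sat M e s (FAll y b) = sat M (e(x := ev M e r)) s (FAll y b)"
      by (rule sat_cong) (use True in auto)
    ultimately show ?thesis by (simp only:)
  next
    case False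
    then have y: "y \<noteq> x" "y \<notin> fvt r" "free_for r x b" using FAll.prems by auto
    have "ev M (e(y:=d)) r = ev M e r" for d by (rule ev_cong) (use y in auto)
    then show ?thesis using y FAll.IH[OF y(3)] by (simp add: fun_upd_twist del: fun_upd_apply)
  qed
qed (auto simp: ev_substt)

lemma sat_substs: "free_fors Y X a \<Longrightarrow> sat M e s (substs X Y a) = sat M e (s(X := s Y)) a"
proof (induction a arbitrary: e s)
  case (FAllS Z b)
  show ?case
  proof (cases "X \<notin> fvs (FAllS Z b)")
    case True
    then have "substs X Y (FAllS Z b) = FAllS Z b" by (rule substs_id)
    moreover have "sat M e s (FAllS Z b) = sat M e (s(X := s Y)) (FAllS Z b)"
      by (rule sat_cong) (use True in auto)
    ultimately show ?thesis by (simp only:)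
  next
    case False
    then have y: "Z \<noteq> X" "Z \<noteq> Y" "free_fors Y X b" using FAllS.prems by auto
    moreover have "(s(Z := A)) Y = s Y" for A using y by simp
    ultimately show ?thesis using FAllS.IH[OF y(3)] by (simp add: fun_upd_twist del: fun_upd_apply)
  qed
qed auto

lemma evalP_sat: "evalP (sat M e s) a = sat M e s a"
  by (induction a) auto

lemma logax_sound: "logax a \<Longrightarrow> wfm M \<Longrightarrow> wfe M e s \<Longrightarrow> sat M e s a"
proof (induction rule: logax.induct)
  case (tautology a)
  then show ?case by (metis taut_def evalP_sat)
next
  case (inst r x a)
  then show ?case using ev_Dm[OF inst.prems] by (auto simp: sat_substf)
next
  case (instS Y X a)
  then show ?case by (auto simp: sat_substs wfe_def)
next
  case (distr x a b)
  then have "sat M (e(x:=d)) s a = sat M e s a" for d by (intro sat_cong) auto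
  then show ?case by auto
next
  case (distrS X a b)
  then have "sat M e (s(X:=d)) a = sat M e s a" for d by (intro sat_cong) auto
  then show ?case by auto
qed auto

theorem soundness:
  assumes "prov T a" "wfm M" "models M T" "wfe M e s"
  shows "sat M e s a"
  using assms(1,4)
proof (induction arbitrary: e s rule: prov.induct)
  case (hyp a) then show ?case using assms(3) by (auto simp: models_def)
next
  case (ax a) then show ?case using logax_sound assms(2) by blast
next
  case (mp a b) then show ?case by auto
next
  case (gen a x) then show ?case by (auto intro!: gen.IH wfe_upd)
next
  case (genS a X) then show ?case by (auto intro!: genS.IH wfe_updS)
qed

section \<open>Completeness\<close>

fun bv :: "fm \<Rightarrow> nat set" where
  "bv (FNeg a) = bv a" | "bv (FImp a b) = bv a \<union> bv b"
| "bv (FAll x a) = insert x (bv a)" | "bv (FAllS X a) = bv a" | "bv _ = {}"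

fun bvs :: "fm \<Rightarrow> nat set" where
  "bvs (FNeg a) = bvs a" | "bvs (FImp a b) = bvs a \<union> bvs b"
| "bvs (FAll x a) = bvs a" | "bvs (FAllS X a) = insert X (bvs a)" | "bvs _ = {}"

lemma finite_vars [simp]: "finite (fvt t)" "finite (fv a)" "finite (fvs a)" "finite (bv a)" "finite (bvs a)"
proof -
  show "finite (fvt t)" for t by (induction t) auto
  then show "finite (fv a)" by (induction a) auto
  show "finite (fvs a)" by (induction a) auto
  show "finite (bv a)" by (induction a) auto
  show "finite (bvs a)" by (induction a) auto
qed

lemma free_for_fresh: "bv a \<inter> fvt r = {} \<Longrightarrow> free_for r x a"
  by (induction a) auto

lemma free_fors_fresh: "Y \<notin> bvs a \<Longrightarrow> free_fors Y X a"
  by (induction a) auto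

lemma substt_back: "y \<notin> fvt t \<Longrightarrow> substt y (TV x) (substt x (TV y) t) = t"
  by (induction t) auto

lemma substf_back: "y \<notin> fv a \<Longrightarrow> y \<notin> bv a \<Longrightarrow> substf y (TV x) (substf x (TV y) a) = a"
  by (induction a) (auto simp: substt_back substf_id)

lemma substs_back: "Y \<notin> fvs a \<Longrightarrow> Y \<notin> bvs a \<Longrightarrow> substs Y X (substs X Y a) = a"
  by (induction a) (auto simp: substs_id)

lemma free_for_back: "y \<notin> fv a \<Longrightarrow> y \<notin> bv a \<Longrightarrow> y \<noteq> x \<Longrightarrow> free_for (TV x) y (substf x (TV y) a)"
  by (induction a) (auto simp: free_for_fresh)

lemma free_fors_back: "Y \<notin> fvs a \<Longrightarrow> Y \<notin> bvs a \<Longrightarrow> Y \<noteq> X \<Longrightarrow> free_fors X Y (substs X Y a)"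
  by (induction a) auto

lemma fvt_substt: "fvt (substt x r t) \<subseteq> (fvt t - {x}) \<union> fvt r"
  by (induction t) auto

lemma fv_substf: "fv (substf x r a) \<subseteq> (fv a - {x}) \<union> fvt r"
proof (induction a)
  case (FEq t u) then show ?case using fvt_substt[of x r t] fvt_substt[of x r u] by auto
next
  case (FLess t u) then show ?case using fvt_substt[of x r t] fvt_substt[of x r u] by auto
next
  case (FMem t u) then show ?case using fvt_substt[of x r t] by auto
qed auto

lemma fvs_substs: "fvs (substs X Y a) \<subseteq> (fvs a - {X}) \<union> {Y}"
  by (induction a) auto

lemma evalP_imps [simp]: "evalP v (foldr FImp L c) = ((\<forall>x\<in>set L. evalP v x) \<longrightarrow> evalP v c)"
  by (induction L) auto

lemma sat_imps [simp]: "sat M e s (foldr FImp L c) = ((\<forall>x\<in>set L. sat M e s x) \<longrightarrow> sat M e s c)"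
  by (induction L) auto

lemma prov_taut: "taut a \<Longrightarrow> prov T a"
  by (intro prov.ax logax.tautology)

lemma prov_gen_imps:
  assumes "prov T (foldr FImp L b)" "\<And>a. a \<in> set L \<Longrightarrow> y \<notin> fv a"
  shows "prov T (foldr FImp L (FAll y b))"
proof -
  have "prov T (FAll y (foldr FImp L b))" using assms(1) by (rule prov.gen)
  moreover have "prov T (FImp (FAll y (foldr FImp L b)) (foldr FImp L (FAll y b)))"
    using assms(2)
  proof (induction L)
    case Nil show ?case by (rule prov_taut) (simp add: taut_def)
  next
    case (Cons a L)
    have "prov T (FImp (FAll y (FImp a (foldr FImp L b))) (FImp a (FAll y (foldr FImp L b))))"
      by (intro prov.ax logax.distr) (use Cons.prems in auto)
    moreover have "prov T (FImp (FAll y (foldr FImp L b)) (foldr FImp L (FAll y b)))"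
      by (rule Cons.IH) (use Cons.prems in auto)
    moreover have "prov T (FImp (FImp (FAll y (FImp a (foldr FImp L b))) (FImp a (FAll y (foldr FImp L b))))
        (FImp (FImp (FAll y (foldr FImp L b)) (foldr FImp L (FAll y b)))
          (FImp (FAll y (foldr FImp (a # L) b)) (foldr FImp (a # L) (FAll y b)))))"
      by (rule prov_taut) (simp add: taut_def)
    ultimately show ?case by (blast intro: prov.mp)
  qed
  ultimately show ?thesis by (blast intro: prov.mp)
qed

lemma prov_gen_impsS:
  assumes "prov T (foldr FImp L b)" "\<And>a. a \<in> set L \<Longrightarrow> y \<notin> fvs a"
  shows "prov T (foldr FImp L (FAllS y b))"
proof -
  have "prov T (FAllS y (foldr FImp L b))" using assms(1) by (rule prov.genS)
  moreover have "prov T (FImp (FAllS y (foldr FImp L b)) (foldr FImp L (FAllS y b)))"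
    using assms(2)
  proof (induction L)
    case Nil show ?case by (rule prov_taut) (simp add: taut_def)
  next
    case (Cons a L)
    have "prov T (FImp (FAllS y (FImp a (foldr FImp L b))) (FImp a (FAllS y (foldr FImp L b))))"
      by (intro prov.ax logax.distrS) (use Cons.prems in auto)
    moreover have "prov T (FImp (FAllS y (foldr FImp L b)) (foldr FImp L (FAllS y b)))"
      by (rule Cons.IH) (use Cons.prems in auto)
    moreover have "prov T (FImp (FImp (FAllS y (FImp a (foldr FImp L b))) (FImp a (FAllS y (foldr FImp L b))))
        (FImp (FImp (FAllS y (foldr FImp L b)) (foldr FImp L (FAllS y b)))
          (FImp (FAllS y (foldr FImp (a # L) b)) (foldr FImp (a # L) (FAllS y b)))))"
      by (rule prov_taut) (simp add: taut_def)
    ultimately show ?case by (blast intro: prov.mp)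
  qed
  ultimately show ?thesis by (blast intro: prov.mp)
qed

text \<open>Substitution never renames, so a change of bound variable has to be derived: putting
  \<open>x\<close> back for the fresh \<open>y\<close> restores \<open>b\<close>, and the instance
  is then generalised over \<open>x\<close>.\<close>

lemma prov_alpha:
  assumes "y \<notin> fv b" "y \<notin> bv b" "y \<noteq> x"
  shows "prov T (FImp (FAll y (substf x (TV y) b)) (FAll x b))"
proof -
  have "prov T (foldr FImp [FAll y (substf x (TV y) b)] b)"
    using prov.ax[OF logax.inst[OF free_for_back[OF assms]]] by (simp add: substf_back assms)
  from prov_gen_imps[OF this, of x] show ?thesis using fv_substf[of x "TV y" b] assms by auto
qed

lemma prov_alphaS:
  assumes "y \<notin> fvs b" "y \<notin> bvs b" "y \<noteq> x"
  shows "prov T (FImp (FAllS y (substs x y b)) (FAllS x b))"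
proof -
  have "prov T (foldr FImp [FAllS y (substs x y b)] b)"
    using prov.ax[OF logax.instS[OF free_fors_back[OF assms]]] by (simp add: substs_back assms)
  from prov_gen_impsS[OF this, of x] show ?thesis using fvs_substs[of x y b] assms by auto
qed

definition ent :: "fm set \<Rightarrow> fm set \<Rightarrow> fm \<Rightarrow> bool" where
  "ent T G a \<longleftrightarrow> (\<exists>L. set L \<subseteq> G \<and> prov T (foldr FImp L a))"

definition con :: "fm set \<Rightarrow> fm set \<Rightarrow> bool" where
  "con T G \<longleftrightarrow> \<not> (\<exists>a. ent T G a \<and> ent T G (FNeg a))"

lemma ent_prov: "prov T a \<Longrightarrow> ent T G a"
  unfolding ent_def by (rule exI[of _ "[]"]) simp

lemma ent_taut: "taut a \<Longrightarrow> ent T G a"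
  by (simp add: ent_prov prov_taut)

lemma ent_mp: assumes "ent T G (FImp a b)" "ent T G a" shows "ent T G b"
proof -
  obtain L1 L2 where L: "set L1 \<subseteq> G" "prov T (foldr FImp L1 (FImp a b))" "set L2 \<subseteq> G" "prov T (foldr FImp L2 a)"
    using assms unfolding ent_def by blast
  have "prov T (FImp (foldr FImp L1 (FImp a b)) (FImp (foldr FImp L2 a) (foldr FImp (L1 @ L2) b)))"
    by (rule prov_taut) (auto simp: taut_def simp del: foldr_append)
  then have "prov T (foldr FImp (L1 @ L2) b)" using L by (blast intro: prov.mp)
  moreover have "set (L1 @ L2) \<subseteq> G" using L by auto
  ultimately show ?thesis unfolding ent_def by blast
qed

lemma ent_mem: "a \<in> G \<Longrightarrow> ent T G a"
  unfolding ent_def by (rule exI[of _ "[a]"]) (auto intro: prov_taut simp: taut_def)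

lemma ent_deduction: assumes "ent T (insert a G) b" shows "ent T G (FImp a b)"
proof -
  obtain L where L: "set L \<subseteq> insert a G" "prov T (foldr FImp L b)" using assms unfolding ent_def by blast
  have "prov T (FImp (foldr FImp L b) (foldr FImp (filter (\<lambda>x. x \<noteq> a) L) (FImp a b)))"
    by (rule prov_taut) (auto simp: taut_def)
  then have "prov T (foldr FImp (filter (\<lambda>x. x \<noteq> a) L) (FImp a b))" using L by (blast intro: prov.mp)
  then show ?thesis unfolding ent_def using L by (intro exI[of _ "filter (\<lambda>x. x \<noteq> a) L"]) auto
qed

lemma ent_neg: assumes "\<not> con T (insert a G)" shows "ent T G (FNeg a)"
proof -
  obtain b where "ent T G (FImp a b)" "ent T G (FImp a (FNeg b))"
    using assms unfolding con_def by (blast intro: ent_deduction)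
  moreover have "ent T G (FImp (FImp a b) (FImp (FImp a (FNeg b)) (FNeg a)))"
    by (rule ent_taut) (simp add: taut_def)
  ultimately show ?thesis by (blast intro: ent_mp)
qed

lemma ent_negneg: "ent T G (FNeg (FNeg a)) \<Longrightarrow> ent T G a"
  by (rule ent_mp[OF ent_taut]) (simp_all add: taut_def)

lemma con_neg: assumes "con T G" "\<not> con T (insert a G)" shows "con T (insert (FNeg a) G)"
  using assms ent_neg ent_negneg unfolding con_def by metis

text \<open>If adding the witness were inconsistent, the instance at \<open>y\<close> would be
  derivable; since \<open>y\<close> is free in no premise, the derivation generalises to the
  quantified formula, whose negation is one of the premises.\<close>

lemma con_witness:
  assumes "con T (insert (FNeg (FAll x b)) G)" "\<And>a. a \<in> G \<Longrightarrow> y \<notin> fv a" "y \<notin> fv b" "y \<notin> bv b" "y \<noteq> x"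
  shows "con T (insert (FNeg (substf x (TV y) b)) (insert (FNeg (FAll x b)) G))"
proof (rule ccontr)
  assume "\<not> ?thesis"
  then have "ent T (insert (FNeg (FAll x b)) G) (substf x (TV y) b)" using ent_neg ent_negneg by blast
  then obtain L where L: "set L \<subseteq> insert (FNeg (FAll x b)) G" "prov T (foldr FImp L (substf x (TV y) b))"
    unfolding ent_def by blast
  have "prov T (foldr FImp L (FAll y (substf x (TV y) b)))"
    by (rule prov_gen_imps[OF L(2)]) (use L(1) assms in auto)
  then have "ent T (insert (FNeg (FAll x b)) G) (FAll y (substf x (TV y) b))" using L(1) unfolding ent_def by blast
  then have "ent T (insert (FNeg (FAll x b)) G) (FAll x b)"
    using ent_mp[OF ent_prov[OF prov_alpha[OF assms(3-5)]]] by blast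
  then show False using assms(1) ent_mem[of "FNeg (FAll x b)"] unfolding con_def by blast
qed

lemma con_witnessS:
  assumes "con T (insert (FNeg (FAllS x b)) G)" "\<And>a. a \<in> G \<Longrightarrow> y \<notin> fvs a" "y \<notin> fvs b" "y \<notin> bvs b" "y \<noteq> x"
  shows "con T (insert (FNeg (substs x y b)) (insert (FNeg (FAllS x b)) G))"
proof (rule ccontr)
  assume "\<not> ?thesis"
  then have "ent T (insert (FNeg (FAllS x b)) G) (substs x y b)" using ent_neg ent_negneg by blast
  then obtain L where L: "set L \<subseteq> insert (FNeg (FAllS x b)) G" "prov T (foldr FImp L (substs x y b))"
    unfolding ent_def by blast
  have "prov T (foldr FImp L (FAllS y (substs x y b)))"
    by (rule prov_gen_impsS[OF L(2)]) (use L(1) assms in auto)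
  then have "ent T (insert (FNeg (FAllS x b)) G) (FAllS y (substs x y b))" using L(1) unfolding ent_def by blast
  then have "ent T (insert (FNeg (FAllS x b)) G) (FAllS x b)"
    using ent_mp[OF ent_prov[OF prov_alphaS[OF assms(3-5)]]] by blast
  then show False using assms(1) ent_mem[of "FNeg (FAllS x b)"] unfolding con_def by blast
qed

definition hstep :: "fm set \<Rightarrow> fm set \<Rightarrow> fm \<Rightarrow> fm set" where
  "hstep T G a = (if con T (insert a G) then insert a G else
     (case a of
        FAll x b \<Rightarrow> insert (FNeg (substf x (TV (SOME y. (\<forall>c\<in>G. y \<notin> fv c) \<and> y \<notin> fv b \<and> y \<notin> bv b \<and> y \<noteq> x)) b))
                      (insert (FNeg a) G)
      | FAllS x b \<Rightarrow> insert (FNeg (substs x (SOME y. (\<forall>c\<in>G. y \<notin> fvs c) \<and> y \<notin> fvs b \<and> y \<notin> bvs b \<and> y \<noteq> x) b))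
                      (insert (FNeg a) G)
      | _ \<Rightarrow> insert (FNeg a) G))"

lemma fresh_ex:
  assumes "finite (\<Union>c\<in>G. F c)" "finite A"
  shows "\<exists>y::nat. (\<forall>c\<in>G. y \<notin> F c) \<and> y \<notin> A"
proof -
  have "finite ((\<Union>c\<in>G. F c) \<union> A)" using assms by simp
  then obtain y where "y \<notin> (\<Union>c\<in>G. F c) \<union> A" using ex_new_if_finite[OF infinite_UNIV_nat] by blast
  then show ?thesis by blast
qed

lemma hstep_props:
  assumes "con T G" "finite (\<Union>c\<in>G. fv c)" "finite (\<Union>c\<in>G. fvs c)"
  shows "con T (hstep T G a) \<and> finite (\<Union>c\<in>hstep T G a. fv c) \<and> finite (\<Union>c\<in>hstep T G a. fvs c)
     \<and> G \<subseteq> hstep T G a \<and> (a \<in> hstep T G a \<or> FNeg a \<in> hstep T G a)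
     \<and> (\<forall>x b. a = FAll x b \<longrightarrow> FNeg a \<in> hstep T G a \<longrightarrow>
           a \<in> hstep T G a \<or> (\<exists>y. y \<notin> fv b \<and> y \<notin> bv b \<and> y \<noteq> x \<and> FNeg (substf x (TV y) b) \<in> hstep T G a))
     \<and> (\<forall>x b. a = FAllS x b \<longrightarrow> FNeg a \<in> hstep T G a \<longrightarrow>
           a \<in> hstep T G a \<or> (\<exists>y. y \<notin> fvs b \<and> y \<notin> bvs b \<and> y \<noteq> x \<and> FNeg (substs x y b) \<in> hstep T G a))"
proof (cases "con T (insert a G)")
  case True
  then show ?thesis using assms by (auto simp: hstep_def)
next
  case False
  then have c: "con T (insert (FNeg a) G)" using con_neg assms by blast
  show ?thesis
  proof (cases a)
    case (FAll x b)
    define y where "y = (SOME y. (\<forall>c\<in>G. y \<notin> fv c) \<and> y \<notin> fv b \<and> y \<notin> bv b \<and> y \<noteq> x)"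
    have "\<exists>y. (\<forall>c\<in>G. y \<notin> fv c) \<and> y \<notin> fv b \<and> y \<notin> bv b \<and> y \<noteq> x"
      using fresh_ex[OF assms(2), of "fv b \<union> bv b \<union> {x}"] by auto
    then have y: "(\<forall>c\<in>G. y \<notin> fv c) \<and> y \<notin> fv b \<and> y \<notin> bv b \<and> y \<noteq> x"
      unfolding y_def by (rule someI_ex)
    have e: "hstep T G a = insert (FNeg (substf x (TV y) b)) (insert (FNeg a) G)"
      using False by (simp add: hstep_def FAll y_def)
    have "con T (hstep T G a)" unfolding e unfolding FAll by (rule con_witness) (use y c FAll in auto)
    then show ?thesis using y assms unfolding e by (auto simp: FAll)
  next
    case (FAllS x b)
    define y where "y = (SOME y. (\<forall>c\<in>G. y \<notin> fvs c) \<and> y \<notin> fvs b \<and> y \<notin> bvs b \<and> y \<noteq> x)"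
    have "\<exists>y. (\<forall>c\<in>G. y \<notin> fvs c) \<and> y \<notin> fvs b \<and> y \<notin> bvs b \<and> y \<noteq> x"
      using fresh_ex[OF assms(3), of "fvs b \<union> bvs b \<union> {x}"] by auto
    then have y: "(\<forall>c\<in>G. y \<notin> fvs c) \<and> y \<notin> fvs b \<and> y \<notin> bvs b \<and> y \<noteq> x"
      unfolding y_def by (rule someI_ex)
    have e: "hstep T G a = insert (FNeg (substs x y b)) (insert (FNeg a) G)"
      using False by (simp add: hstep_def FAllS y_def)
    have "con T (hstep T G a)" unfolding e unfolding FAllS by (rule con_witnessS) (use y c FAllS in auto)
    then show ?thesis using y assms unfolding e by (auto simp: FAllS)
  qed (use False c assms in \<open>auto simp: hstep_def\<close>)
qed

primrec HG :: "fm set \<Rightarrow> fm set \<Rightarrow> nat \<Rightarrow> fm set" where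
  "HG T G 0 = G"
| "HG T G (Suc n) = hstep T (HG T G n) (from_nat n)"

locale henkin =
  fixes T G :: "fm set"
  assumes conG: "con T G" and finG: "finite (\<Union>c\<in>G. fv c)" "finite (\<Union>c\<in>G. fvs c)"
begin

lemma HG_inv: "con T (HG T G n) \<and> finite (\<Union>c\<in>HG T G n. fv c) \<and> finite (\<Union>c\<in>HG T G n. fvs c)"
proof (induction n)
  case 0 then show ?case using conG finG by simp
next
  case (Suc n)
  then show ?case using hstep_props[of T "HG T G n" "from_nat n"] by simp
qed

lemmas HG_step = hstep_props[OF HG_inv[THEN conjunct1] HG_inv[THEN conjunct2, THEN conjunct1] HG_inv[THEN conjunct2, THEN conjunct2]]

lemma HG_mono: "m \<le> n \<Longrightarrow> HG T G m \<subseteq> HG T G n"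
  by (rule lift_Suc_mono_le[of "HG T G"]) (use HG_step in auto)

definition U :: "fm set" where "U = (\<Union>n. HG T G n)"

lemma G_U: "G \<subseteq> U" unfolding U_def using HG.simps(1)[of T G] by blast

lemma fin_U: "finite A \<Longrightarrow> A \<subseteq> U \<Longrightarrow> \<exists>n. A \<subseteq> HG T G n"
proof (induction rule: finite_induct)
  case (insert a A)
  then obtain n m where "A \<subseteq> HG T G n" "a \<in> HG T G m" unfolding U_def by blast
  then have "insert a A \<subseteq> HG T G (max n m)" using HG_mono[of n "max n m"] HG_mono[of m "max n m"] by auto
  then show ?case by blast
qed auto

lemma con_U: "con T U"
proof (rule ccontr)
  assume "\<not> con T U"
  then obtain a L1 L2 where L: "set L1 \<subseteq> U" "prov T (foldr FImp L1 a)" "set L2 \<subseteq> U" "prov T (foldr FImp L2 (FNeg a))"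
    unfolding con_def ent_def by blast
  then obtain n where "set L1 \<union> set L2 \<subseteq> HG T G n" using fin_U[of "set L1 \<union> set L2"] by auto
  then have "ent T (HG T G n) a" "ent T (HG T G n) (FNeg a)" using L unfolding ent_def by blast+
  then show False using HG_inv unfolding con_def by blast
qed

lemma U_total: "a \<in> U \<or> FNeg a \<in> U"
proof -
  have "a \<in> HG T G (Suc (to_nat a)) \<or> FNeg a \<in> HG T G (Suc (to_nat a))"
    using HG_step[of "to_nat a" "from_nat (to_nat a)"] by simp
  then show ?thesis unfolding U_def by blast
qed

lemma U_not: "a \<in> U \<Longrightarrow> FNeg a \<notin> U"
  using con_U ent_mem unfolding con_def by blast

lemma U_neg [simp]: "FNeg a \<in> U \<longleftrightarrow> a \<notin> U"
  using U_total U_not by blast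

lemma U_ent: "ent T U a \<Longrightarrow> a \<in> U"
  using con_U ent_mem[of "FNeg a" U] U_total[of a] unfolding con_def by blast

lemma U_prov: "prov T a \<Longrightarrow> a \<in> U"
  by (simp add: U_ent ent_prov)

lemma U_mp: "FImp a b \<in> U \<Longrightarrow> a \<in> U \<Longrightarrow> b \<in> U"
  by (meson U_ent ent_mem ent_mp)

lemma U_imp [simp]: "FImp a b \<in> U \<longleftrightarrow> (a \<in> U \<longrightarrow> b \<in> U)"
proof
  show "FImp a b \<in> U \<Longrightarrow> a \<in> U \<longrightarrow> b \<in> U" using U_mp by blast
  have "FImp b (FImp a b) \<in> U" "FImp (FNeg a) (FImp a b) \<in> U"
    by (intro U_prov prov_taut; simp add: taut_def)+
  then show "(a \<in> U \<longrightarrow> b \<in> U) \<Longrightarrow> FImp a b \<in> U" using U_mp U_neg by blast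
qed

lemma U_imps [simp]: "foldr FImp L b \<in> U \<longleftrightarrow> (set L \<subseteq> U \<longrightarrow> b \<in> U)"
  by (induction L) auto

lemma U_inst: "FAll x b \<in> U \<Longrightarrow> free_for r x b \<Longrightarrow> substf x r b \<in> U"
  using U_prov[OF prov.ax[OF logax.inst]] by auto

lemma U_instS: "FAllS x b \<in> U \<Longrightarrow> free_fors r x b \<Longrightarrow> substs x r b \<in> U"
  using U_prov[OF prov.ax[OF logax.instS]] by auto

lemma U_all: assumes "FAll x b \<notin> U" shows "\<exists>y. y \<notin> fv b \<and> y \<notin> bv b \<and> y \<noteq> x \<and> substf x (TV y) b \<notin> U"
proof -
  define n where "n = to_nat (FAll x b)"
  have n: "from_nat n = FAll x b" by (simp add: n_def)
  have nin: "FAll x b \<notin> HG T G (Suc n)" using assms unfolding U_def by blast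
  have "FNeg (FAll x b) \<in> HG T G (Suc n)" using HG_step[of n "FAll x b"] nin n by simp
  then obtain y where "y \<notin> fv b \<and> y \<notin> bv b \<and> y \<noteq> x \<and> FNeg (substf x (TV y) b) \<in> HG T G (Suc n)"
    using HG_step[of n "FAll x b"] nin n by auto
  then have "y \<notin> fv b \<and> y \<notin> bv b \<and> y \<noteq> x" "FNeg (substf x (TV y) b) \<in> U" unfolding U_def by blast+
  then show ?thesis by auto
qed

lemma U_allS: assumes "FAllS x b \<notin> U" shows "\<exists>y. y \<notin> fvs b \<and> y \<notin> bvs b \<and> y \<noteq> x \<and> substs x y b \<notin> U"
proof -
  define n where "n = to_nat (FAllS x b)"
  have n: "from_nat n = FAllS x b" by (simp add: n_def)
  have nin: "FAllS x b \<notin> HG T G (Suc n)" using assms unfolding U_def by blast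
  have "FNeg (FAllS x b) \<in> HG T G (Suc n)" using HG_step[of n "FAllS x b"] nin n by simp
  then obtain y where "y \<notin> fvs b \<and> y \<notin> bvs b \<and> y \<noteq> x \<and> FNeg (substs x y b) \<in> HG T G (Suc n)"
    using HG_step[of n "FAllS x b"] nin n by auto
  then have "y \<notin> fvs b \<and> y \<notin> bvs b \<and> y \<noteq> x" "FNeg (substs x y b) \<in> U" unfolding U_def by blast+
  then show ?thesis by auto
qed

end

fun qfree :: "fm \<Rightarrow> bool" where
  "qfree (FNeg a) = qfree a" | "qfree (FImp a b) = (qfree a \<and> qfree b)"
| "qfree (FAll x a) = False" | "qfree (FAllS X a) = False" | "qfree _ = True"

lemma qfree_free_for: "qfree a \<Longrightarrow> free_for r x a"
  by (induction a) auto

lemma qfree_substf: "qfree (substf x r a) = qfree a"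
  by (induction a) auto

lemma qfree_imps: "qfree (foldr FImp L a) = ((\<forall>c\<in>set L. qfree c) \<and> qfree a)"
  by (induction L) auto

lemma prov_substf: "prov T a \<Longrightarrow> qfree a \<Longrightarrow> prov T (substf x r a)"
  using prov.mp[OF prov.ax[OF logax.inst[OF qfree_free_for]] prov.gen] by blast

lemma fresh4:
  assumes "finite (A::nat set)"
  obtains x y z w where "x \<notin> A" "y \<notin> A" "z \<notin> A" "w \<notin> A" "x \<noteq> y" "x \<noteq> z" "x \<noteq> w" "y \<noteq> z" "y \<noteq> w" "z \<noteq> w"
proof -
  obtain N where "\<forall>a\<in>A. a < N" using finite_nat_set_iff_bounded assms by blast
  then show ?thesis by (intro that[of N "N+1" "N+2" "N+3"]) auto
qed

lemma prov_eq_refl: "prov T (FEq t t)"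
  using prov_substf[OF prov.ax[OF logax.eq_refl[of 0]], where x=0 and r=t and T=T] by simp

lemma prov_eq_eq: "prov T (FImp (FEq s t) (FImp (FEq s r) (FEq t r)))"
proof -
  obtain x y z w where v: "x \<notin> fvt s \<union> fvt t \<union> fvt r" "y \<notin> fvt s \<union> fvt t \<union> fvt r" "z \<notin> fvt s \<union> fvt t \<union> fvt r"
     "w \<notin> fvt s \<union> fvt t \<union> fvt r" "x \<noteq> y" "x \<noteq> z" "x \<noteq> w" "y \<noteq> z" "y \<noteq> w" "z \<noteq> w"
    by (rule fresh4[of "fvt s \<union> fvt t \<union> fvt r"]) auto
  have "prov T (substf z r (substf y t (substf x s (FImp (FEq (TV x) (TV y)) (FImp (FEq (TV x) (TV z)) (FEq (TV y) (TV z)))))))"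
    by (intro prov_substf prov.ax logax.eq_eq) (auto simp: qfree_substf)
  then show ?thesis using v by (simp add: substt_id)
qed

lemma prov_eq_plus: "prov T (FImp (FEq s s') (FImp (FEq t t') (FEq (TPlus s t) (TPlus s' t'))))"
  and prov_eq_times: "prov T (FImp (FEq s s') (FImp (FEq t t') (FEq (TTimes s t) (TTimes s' t'))))"
  and prov_eq_less: "prov T (FImp (FEq s s') (FImp (FEq t t') (FImp (FLess s t) (FLess s' t'))))"
proof -
  let ?A = "fvt s \<union> fvt t \<union> fvt s' \<union> fvt t'"
  obtain x y z w where v: "x \<notin> ?A" "y \<notin> ?A" "z \<notin> ?A" "w \<notin> ?A"
     "x \<noteq> y" "x \<noteq> z" "x \<noteq> w" "y \<noteq> z" "y \<noteq> w" "z \<noteq> w"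
    by (rule fresh4[of "?A"]) auto
  have "prov T (substf w t' (substf z t (substf y s' (substf x s
     (FImp (FEq (TV x) (TV y)) (FImp (FEq (TV z) (TV w)) (FEq (TPlus (TV x) (TV z)) (TPlus (TV y) (TV w)))))))))"
    by (intro prov_substf prov.ax logax.eq_plus) (auto simp: qfree_substf)
  then show "prov T (FImp (FEq s s') (FImp (FEq t t') (FEq (TPlus s t) (TPlus s' t'))))"
    using v by (simp add: substt_id)
  have "prov T (substf w t' (substf z t (substf y s' (substf x s
     (FImp (FEq (TV x) (TV y)) (FImp (FEq (TV z) (TV w)) (FEq (TTimes (TV x) (TV z)) (TTimes (TV y) (TV w)))))))))"
    by (intro prov_substf prov.ax logax.eq_times) (auto simp: qfree_substf)
  then show "prov T (FImp (FEq s s') (FImp (FEq t t') (FEq (TTimes s t) (TTimes s' t'))))"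
    using v by (simp add: substt_id)
  have "prov T (substf w t' (substf z t (substf y s' (substf x s
     (FImp (FEq (TV x) (TV y)) (FImp (FEq (TV z) (TV w)) (FImp (FLess (TV x) (TV z)) (FLess (TV y) (TV w)))))))))"
    by (intro prov_substf prov.ax logax.eq_less) (auto simp: qfree_substf)
  then show "prov T (FImp (FEq s s') (FImp (FEq t t') (FImp (FLess s t) (FLess s' t'))))"
    using v by (simp add: substt_id)
qed

lemma prov_eq_mem: "prov T (FImp (FEq s t) (FImp (FMem s X) (FMem t X)))"
proof -
  let ?A = "fvt s \<union> fvt t"
  obtain x y z w where v: "x \<notin> ?A" "y \<notin> ?A" "z \<notin> ?A" "w \<notin> ?A"
     "x \<noteq> y" "x \<noteq> z" "x \<noteq> w" "y \<noteq> z" "y \<noteq> w" "z \<noteq> w"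
    by (rule fresh4[of "?A"]) auto
  have "prov T (substf y t (substf x s (FImp (FEq (TV x) (TV y)) (FImp (FMem (TV x) X) (FMem (TV y) X)))))"
    by (intro prov_substf prov.ax logax.eq_mem) (auto simp: qfree_substf)
  then show ?thesis using v by (simp add: substt_id)
qed

section \<open>Simultaneous renaming of free variables\<close>

fun rent :: "(nat \<Rightarrow> nat) \<Rightarrow> tm \<Rightarrow> tm" where
  "rent \<sigma> (TV x) = TV (\<sigma> x)" | "rent \<sigma> TZ = TZ" | "rent \<sigma> TO = TO"
| "rent \<sigma> (TPlus s t) = TPlus (rent \<sigma> s) (rent \<sigma> t)"
| "rent \<sigma> (TTimes s t) = TTimes (rent \<sigma> s) (rent \<sigma> t)"

fun ren :: "(nat \<Rightarrow> nat) \<Rightarrow> (nat \<Rightarrow> nat) \<Rightarrow> fm \<Rightarrow> fm" where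
  "ren \<sigma> \<tau> (FEq s t) = FEq (rent \<sigma> s) (rent \<sigma> t)"
| "ren \<sigma> \<tau> (FLess s t) = FLess (rent \<sigma> s) (rent \<sigma> t)"
| "ren \<sigma> \<tau> (FMem t X) = FMem (rent \<sigma> t) (\<tau> X)"
| "ren \<sigma> \<tau> (FNeg a) = FNeg (ren \<sigma> \<tau> a)"
| "ren \<sigma> \<tau> (FImp a b) = FImp (ren \<sigma> \<tau> a) (ren \<sigma> \<tau> b)"
| "ren \<sigma> \<tau> (FAll x a) = FAll x (ren (\<sigma>(x := x)) \<tau> a)"
| "ren \<sigma> \<tau> (FAllS X a) = FAllS X (ren \<sigma> (\<tau>(X := X)) a)"

lemma rent_id: "(\<And>x. x \<in> fvt t \<Longrightarrow> \<sigma> x = x) \<Longrightarrow> rent \<sigma> t = t"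
  by (induction t) auto

lemma ren_id: "(\<And>x. x \<in> fv a \<Longrightarrow> \<sigma> x = x) \<Longrightarrow> (\<And>x. x \<in> fvs a \<Longrightarrow> \<tau> x = x) \<Longrightarrow> ren \<sigma> \<tau> a = a"
  by (induction a arbitrary: \<sigma> \<tau>) (auto simp: rent_id)

lemma bv_ren [simp]: "bv (ren \<sigma> \<tau> a) = bv a" "bvs (ren \<sigma> \<tau> a) = bvs a"
  by (induction a arbitrary: \<sigma> \<tau>) auto

lemma substt_rent:
  "\<sigma> x = x \<Longrightarrow> (\<And>z. z \<in> fvt t \<Longrightarrow> z \<noteq> x \<Longrightarrow> \<sigma> z \<noteq> x) \<Longrightarrow> substt x (TV y) (rent \<sigma> t) = rent (\<sigma>(x := y)) t"
  by (induction t) auto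

lemma substf_ren:
  "\<sigma> x = x \<Longrightarrow> (\<And>z. z \<in> fv a \<Longrightarrow> z \<noteq> x \<Longrightarrow> \<sigma> z \<noteq> x) \<Longrightarrow> substf x (TV y) (ren \<sigma> \<tau> a) = ren (\<sigma>(x := y)) \<tau> a"
proof (induction a arbitrary: \<sigma> \<tau>)
  case (FAll z b)
  show ?case
  proof (cases "z = x")
    case True then show ?thesis by (simp del: fun_upd_apply)
  next
    case False
    have "substf x (TV y) (ren (\<sigma>(z := z)) \<tau> b) = ren ((\<sigma>(z := z))(x := y)) \<tau> b"
      by (rule FAll.IH) (use FAll.prems False in auto)
    then show ?thesis using False by (simp add: fun_upd_twist del: fun_upd_apply)
  qed
qed (auto simp: substt_rent)

lemma substs_ren:
  "\<tau> x = x \<Longrightarrow> (\<And>z. z \<in> fvs a \<Longrightarrow> z \<noteq> x \<Longrightarrow> \<tau> z \<noteq> x) \<Longrightarrow> substs x y (ren \<sigma> \<tau> a) = ren \<sigma> (\<tau>(x := y)) a"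
proof (induction a arbitrary: \<sigma> \<tau>)
  case (FAllS z b)
  show ?case
  proof (cases "z = x")
    case True then show ?thesis by (simp del: fun_upd_apply)
  next
    case False
    have "substs x y (ren \<sigma> (\<tau>(z := z)) b) = ren \<sigma> ((\<tau>(z := z))(x := y)) b"
      by (rule FAllS.IH) (use FAllS.prems False in auto)
    then show ?thesis using False by (simp add: fun_upd_twist del: fun_upd_apply)
  qed
qed auto

section \<open>Equality, representatives and truth in the Henkin structure\<close>

context henkin begin

abbreviation eqU where "eqU s t \<equiv> FEq s t \<in> U"

lemma eqU_refl [simp]: "eqU t t" by (rule U_prov[OF prov_eq_refl])
lemma eqU_eu: "eqU s t \<Longrightarrow> eqU s r \<Longrightarrow> eqU t r" using U_prov[OF prov_eq_eq[of T s t r]] by simp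
lemma eqU_sym: "eqU s t \<Longrightarrow> eqU t s" using eqU_eu eqU_refl by blast
lemma eqU_trans: "eqU s t \<Longrightarrow> eqU t r \<Longrightarrow> eqU s r" using eqU_eu eqU_sym by blast
lemma eqU_plus: "eqU s s' \<Longrightarrow> eqU t t' \<Longrightarrow> eqU (TPlus s t) (TPlus s' t')" using U_prov[OF prov_eq_plus] by simp
lemma eqU_times: "eqU s s' \<Longrightarrow> eqU t t' \<Longrightarrow> eqU (TTimes s t) (TTimes s' t')" using U_prov[OF prov_eq_times] by simp
lemma eqU_less: "eqU s s' \<Longrightarrow> eqU t t' \<Longrightarrow> FLess s t \<in> U \<longleftrightarrow> FLess s' t' \<in> U"
  using U_prov[OF prov_eq_less[of T s s' t t']] U_prov[OF prov_eq_less[of T s' s t' t]] eqU_sym by auto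
lemma eqU_mem: "eqU s t \<Longrightarrow> FMem s X \<in> U \<longleftrightarrow> FMem t X \<in> U"
  using U_prov[OF prov_eq_mem[of T s t X]] U_prov[OF prov_eq_mem[of T t s X]] eqU_sym by auto

text \<open>The dummy premises $v = v$ force the Henkin witness to avoid $V$.\<close>

lemma U_rep: assumes "finite V" shows "\<exists>y. y \<notin> V \<and> eqU t (TV y)"
proof -
  obtain vs where vs: "set vs = V" using finite_list assms by blast
  obtain x where x: "x \<notin> fvt t \<union> V" using ex_new_if_finite[OF infinite_UNIV_nat, of "fvt t \<union> V"] assms by auto
  define L where "L = map (\<lambda>v. FEq (TV v) (TV v)) vs"
  have sL: "set L \<subseteq> U" by (auto simp: L_def)
  have sub: "substf x r (foldr FImp L (FNeg (FEq t (TV x)))) = foldr FImp L (FNeg (FEq t r))" for r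
  proof -
    have "substf x r (foldr FImp (map (\<lambda>v. FEq (TV v) (TV v)) ws) (FNeg (FEq t (TV x)))) = foldr FImp (map (\<lambda>v. FEq (TV v) (TV v)) ws) (FNeg (FEq t r))"
      if "x \<notin> set ws" for ws
      using that x by (induction ws) (auto simp: substt_id)
    then show ?thesis using x vs unfolding L_def by blast
  qed
  have fvL: "V \<subseteq> fv (foldr FImp L a)" for a
  proof -
    have "set ws \<subseteq> fv (foldr FImp (map (\<lambda>v. FEq (TV v) (TV v)) ws) a)" for ws by (induction ws) auto
    then show ?thesis using vs L_def by blast
  qed
  have "FAll x (foldr FImp L (FNeg (FEq t (TV x)))) \<notin> U"
  proof
    assume "FAll x (foldr FImp L (FNeg (FEq t (TV x)))) \<in> U"
    then have "substf x t (foldr FImp L (FNeg (FEq t (TV x)))) \<in> U"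
      by (rule U_inst) (auto intro!: qfree_free_for simp: qfree_imps L_def)
    then show False using sL unfolding sub by simp
  qed
  then obtain y where "y \<notin> fv (foldr FImp L (FNeg (FEq t (TV x))))" "foldr FImp L (FNeg (FEq t (TV y))) \<notin> U"
    using U_all sub by metis
  then show ?thesis using fvL sL by auto
qed

text \<open>Set variables carry no equality, so agreement with \<open>X\<close> is expressed by a
  quantified equivalence. Tautologies about the members of \<open>V\<close> again force the witness
  to avoid \<open>V\<close>.\<close>

lemma U_repS: assumes "finite V" shows "\<exists>Y. Y \<notin> V \<and> (\<forall>t. FMem t X \<in> U \<longleftrightarrow> FMem t Y \<in> U)"
proof -
  obtain vs where vs: "set vs = V" using finite_list assms by blast
  obtain x where x: "x \<notin> insert X V" using ex_new_if_finite[OF infinite_UNIV_nat, of "insert X V"] assms by auto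
  define L where "L = map (\<lambda>v. FImp (FMem TZ v) (FMem TZ v)) vs"
  have sL: "set L \<subseteq> U" by (auto simp: L_def)
  define b where "b Y = FNeg (FAll 0 (FIff (FMem (TV 0) X) (FMem (TV 0) Y)))" for Y
  have b: "b Y \<in> U \<longleftrightarrow> FAll 0 (FIff (FMem (TV 0) X) (FMem (TV 0) Y)) \<notin> U" for Y by (simp add: b_def)
  have iff: "FIff p q \<in> U \<longleftrightarrow> (p \<in> U \<longleftrightarrow> q \<in> U)" for p q by (auto simp: FIff_def FAnd_def)
  have sub: "substs x r (foldr FImp L (b x)) = foldr FImp L (b r)" for r
  proof -
    have "substs x r (foldr FImp (map (\<lambda>v. FImp (FMem TZ v) (FMem TZ v)) ws) (b x)) = foldr FImp (map (\<lambda>v. FImp (FMem TZ v) (FMem TZ v)) ws) (b r)"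
      if "x \<notin> set ws" for ws
      using that x by (induction ws) (auto simp: b_def FIff_def FAnd_def)
    then show ?thesis using x vs unfolding L_def by blast
  qed
  have fvL: "V \<subseteq> fvs (foldr FImp L a)" for a
  proof -
    have "set ws \<subseteq> fvs (foldr FImp (map (\<lambda>v. FImp (FMem TZ v) (FMem TZ v)) ws) a)" for ws by (induction ws) auto
    then show ?thesis using vs L_def by blast
  qed
  have "FAllS x (foldr FImp L (b x)) \<notin> U"
  proof
    assume "FAllS x (foldr FImp L (b x)) \<in> U"
    moreover have "free_fors X x (foldr FImp L (b x))"
    proof -
      have "free_fors X x (foldr FImp (map (\<lambda>v. FImp (FMem TZ v) (FMem TZ v)) ws) (b x))" for ws
        by (induction ws) (auto simp: b_def FIff_def FAnd_def)
      then show ?thesis by (simp add: L_def)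
    qed
    ultimately have "substs x X (foldr FImp L (b x)) \<in> U" by (rule U_instS)
    then have "FAll 0 (FIff (FMem (TV 0) X) (FMem (TV 0) X)) \<notin> U" using sL unfolding sub by (simp add: b)
    moreover have "FAll 0 (FIff (FMem (TV 0) X) (FMem (TV 0) X)) \<in> U"
      by (intro U_prov prov.gen prov_taut) (auto simp: taut_def FIff_def FAnd_def)
    ultimately show False by simp
  qed
  then obtain y where y: "y \<notin> fvs (foldr FImp L (b x))" "foldr FImp L (b y) \<notin> U"
    using U_allS sub by metis
  then have all: "FAll 0 (FIff (FMem (TV 0) X) (FMem (TV 0) y)) \<in> U" using sL by (auto simp: b)
  have "FMem t X \<in> U \<longleftrightarrow> FMem t y \<in> U" for t
  proof -
    have "substf 0 t (FIff (FMem (TV 0) X) (FMem (TV 0) y)) \<in> U"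
      by (rule U_inst[OF all]) (auto simp: FIff_def FAnd_def)
    then have "FIff (FMem t X) (FMem t y) \<in> U" by (simp add: FIff_def FAnd_def)
    then show ?thesis by (simp add: iff)
  qed
  then show ?thesis using y fvL by blast
qed

text \<open>Instead of forming classes of terms, the least variable provably equal to a term
  represents its class. The domain is thereby a set of natural numbers.\<close>

definition val :: "tm \<Rightarrow> nat" where "val t = (LEAST y. eqU t (TV y))"

lemma eqU_val: "eqU t (TV (val t))"
  unfolding val_def by (rule LeastI_ex) (use U_rep[of "{}" t] in auto)

lemma val_eq: "val s = val t \<longleftrightarrow> eqU s t"
proof
  assume "val s = val t" then show "eqU s t" using eqU_val[of s] eqU_val[of t] eqU_trans eqU_sym by metis
next
  assume "eqU s t"
  then have "eqU s (TV y) \<longleftrightarrow> eqU t (TV y)" for y using eqU_eu eqU_trans by blast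
  then show "val s = val t" unfolding val_def by simp
qed

definition ext :: "nat \<Rightarrow> nat set" where "ext X = {d. FMem (TV d) X \<in> U}"

definition HM :: "nat str" where
  "HM = \<lparr>Dm = range val, Z0 = val TZ, O1 = val TO, Pl = (\<lambda>a b. val (TPlus (TV a) (TV b))),
     Ti = (\<lambda>a b. val (TTimes (TV a) (TV b))), Ls = (\<lambda>a b. FLess (TV a) (TV b) \<in> U), Ss = range ext\<rparr>"

lemma HM_simps [simp]: "Dm HM = range val" "Z0 HM = val TZ" "O1 HM = val TO"
  "Pl HM a b = val (TPlus (TV a) (TV b))" "Ti HM a b = val (TTimes (TV a) (TV b))"
  "Ls HM a b \<longleftrightarrow> FLess (TV a) (TV b) \<in> U" "Ss HM = range ext"
  by (simp_all add: HM_def)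

lemma wfm_HM: "wfm HM" by (auto simp: wfm_def)

lemma ev_HM: "ev HM (\<lambda>x. val (TV (\<sigma> x))) t = val (rent \<sigma> t)"
  by (induction t) (auto simp: val_eq intro!: eqU_plus eqU_times eqU_sym[OF eqU_val])

text \<open>The renamings carry the assignment: at a quantifier the induction passes from
  \<open>\<sigma>\<close> to \<open>\<sigma>(x := y)\<close>. The side conditions keep the images of
  free variables apart from the bound ones, so that instantiation with \<open>TV y\<close> captures
  nothing.\<close>

lemma truth:
  "(\<And>x. x \<in> fv a \<Longrightarrow> \<sigma> x \<notin> bv a) \<Longrightarrow> (\<And>x. x \<in> fvs a \<Longrightarrow> \<tau> x \<notin> bvs a) \<Longrightarrow>
   sat HM (\<lambda>x. val (TV (\<sigma> x))) (\<lambda>X. ext (\<tau> X)) a \<longleftrightarrow> ren \<sigma> \<tau> a \<in> U"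
proof (induction a arbitrary: \<sigma> \<tau>)
  case (FEq s t) then show ?case by (simp add: ev_HM val_eq)
next
  case (FLess s t)
  have "FLess (TV (val (rent \<sigma> s))) (TV (val (rent \<sigma> t))) \<in> U \<longleftrightarrow> FLess (rent \<sigma> s) (rent \<sigma> t) \<in> U"
    by (intro eqU_less eqU_sym[OF eqU_val])
  then show ?case by (simp add: ev_HM)
next
  case (FMem t X)
  then show ?case using eqU_mem[OF eqU_val] by (simp add: ev_HM ext_def)
next
  case (FNeg a) then show ?case by simp
next
  case (FImp a b) then show ?case by simp
next
  case (FAll x b)
  have IH: "sat HM ((\<lambda>x. val (TV (\<sigma> x)))(x := val (TV y))) (\<lambda>X. ext (\<tau> X)) b \<longleftrightarrow> ren (\<sigma>(x := y)) \<tau> b \<in> U" if "y \<notin> bv b" for y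
  proof -
    have "(\<lambda>x. val (TV (\<sigma> x)))(x := val (TV y)) = (\<lambda>z. val (TV ((\<sigma>(x := y)) z)))" by auto
    moreover have "sat HM (\<lambda>z. val (TV ((\<sigma>(x := y)) z))) (\<lambda>X. ext (\<tau> X)) b \<longleftrightarrow> ren (\<sigma>(x := y)) \<tau> b \<in> U"
      by (rule FAll.IH) (use FAll.prems that in auto)
    ultimately show ?thesis by simp
  qed
  have sub: "substf x (TV y) (ren (\<sigma>(x := x)) \<tau> b) = ren (\<sigma>(x := y)) \<tau> b" for y
    using substf_ren[of "\<sigma>(x := x)" x b y \<tau>] FAll.prems by auto
  show ?case
  proof
    assume L: "sat HM (\<lambda>x. val (TV (\<sigma> x))) (\<lambda>X. ext (\<tau> X)) (FAll x b)"
    show "ren \<sigma> \<tau> (FAll x b) \<in> U"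
    proof (rule ccontr)
      assume "ren \<sigma> \<tau> (FAll x b) \<notin> U"
      then obtain y where y: "y \<notin> bv b" "ren (\<sigma>(x := y)) \<tau> b \<notin> U"
        using U_all[of x "ren (\<sigma>(x := x)) \<tau> b"] sub by auto
      then show False using IH[OF y(1)] L by simp
    qed
  next
    assume R: "ren \<sigma> \<tau> (FAll x b) \<in> U"
    show "sat HM (\<lambda>x. val (TV (\<sigma> x))) (\<lambda>X. ext (\<tau> X)) (FAll x b)"
    proof (simp, intro allI)
      fix t
      \<comment> \<open>The element may be given by a term whose variables would be captured; an
        equal variable outside \<open>bv b\<close> names the same element.\<close>
      obtain y where y: "y \<notin> bv b" "eqU t (TV y)" using U_rep[of "bv b" t] by auto
      then have v: "val t = val (TV y)" by (simp add: val_eq)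
      have "ren (\<sigma>(x := y)) \<tau> b \<in> U" using U_inst[of x "ren (\<sigma>(x := x)) \<tau> b" "TV y"] R y free_for_fresh sub by auto
      then show "sat HM ((\<lambda>x. val (TV (\<sigma> x)))(x := val t)) (\<lambda>X. ext (\<tau> X)) b" using IH[OF y(1)] v by simp
    qed
  qed
next
  case (FAllS x b)
  have IH: "sat HM (\<lambda>x. val (TV (\<sigma> x))) ((\<lambda>X. ext (\<tau> X))(x := ext y)) b \<longleftrightarrow> ren \<sigma> (\<tau>(x := y)) b \<in> U" if "y \<notin> bvs b" for y
  proof -
    have "(\<lambda>X. ext (\<tau> X))(x := ext y) = (\<lambda>z. ext ((\<tau>(x := y)) z))" by (auto simp: fun_eq_iff)
    moreover have "sat HM (\<lambda>x. val (TV (\<sigma> x))) (\<lambda>z. ext ((\<tau>(x := y)) z)) b \<longleftrightarrow> ren \<sigma> (\<tau>(x := y)) b \<in> U"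
      by (rule FAllS.IH) (use FAllS.prems that in auto)
    ultimately show ?thesis by simp
  qed
  have sub: "substs x y (ren \<sigma> (\<tau>(x := x)) b) = ren \<sigma> (\<tau>(x := y)) b" for y
    using substs_ren[of "\<tau>(x := x)" x b y \<sigma>] FAllS.prems by auto
  show ?case
  proof
    assume L: "sat HM (\<lambda>x. val (TV (\<sigma> x))) (\<lambda>X. ext (\<tau> X)) (FAllS x b)"
    show "ren \<sigma> \<tau> (FAllS x b) \<in> U"
    proof (rule ccontr)
      assume "ren \<sigma> \<tau> (FAllS x b) \<notin> U"
      then obtain y where y: "y \<notin> bvs b" "ren \<sigma> (\<tau>(x := y)) b \<notin> U"
        using U_allS[of x "ren \<sigma> (\<tau>(x := x)) b"] sub by auto
      then show False using IH[OF y(1)] L by simp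
    qed
  next
    assume R: "ren \<sigma> \<tau> (FAllS x b) \<in> U"
    show "sat HM (\<lambda>x. val (TV (\<sigma> x))) (\<lambda>X. ext (\<tau> X)) (FAllS x b)"
    proof (simp, intro allI)
      fix t
      obtain y where y: "y \<notin> bvs b" "\<forall>r. FMem r t \<in> U \<longleftrightarrow> FMem r y \<in> U" using U_repS[of "bvs b" t] by auto
      then have v: "ext t = ext y" by (simp add: ext_def)
      have "ren \<sigma> (\<tau>(x := y)) b \<in> U" using U_instS[of x "ren \<sigma> (\<tau>(x := x)) b" y] R y free_fors_fresh sub by auto
      then show "sat HM (\<lambda>x. val (TV (\<sigma> x))) ((\<lambda>X. ext (\<tau> X))(x := ext t)) b" using IH[OF y(1)] v by simp
    qed
  qed
qed

lemma truth_id: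
  assumes "fv a \<inter> bv a = {}" "fvs a \<inter> bvs a = {}"
  shows "sat HM (\<lambda>x. val (TV x)) ext a \<longleftrightarrow> a \<in> U"
  using truth[of a "\<lambda>x. x" "\<lambda>x. x"] ren_id[of a "\<lambda>x. x" "\<lambda>x. x"] assms by auto

end

section \<open>Universal closures and completeness\<close>

definition clos :: "fm \<Rightarrow> fm" where
  "clos a = foldr FAll (sorted_list_of_set (fv a)) (foldr FAllS (sorted_list_of_set (fvs a)) a)"

lemma fv_foldr: "fv (foldr FAll xs a) = fv a - set xs" "fvs (foldr FAll xs a) = fvs a"
  "fv (foldr FAllS xs a) = fv a" "fvs (foldr FAllS xs a) = fvs a - set xs"
  by (induction xs) auto

lemma clos_closed: "fv (clos a) = {}" "fvs (clos a) = {}"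
  by (auto simp: clos_def fv_foldr)

lemma prov_clos: "prov T a \<Longrightarrow> prov T (clos a)"
proof -
  assume "prov T a"
  then have "prov T (foldr FAllS Xs a)" for Xs by (induction Xs) (auto intro: prov.genS)
  then have "prov T (foldr FAll xs (foldr FAllS Xs a))" for xs Xs by (induction xs) (auto intro: prov.gen)
  then show ?thesis by (simp add: clos_def)
qed

lemma sat_foldr_FAll:
  "sat M e s (foldr FAll xs a) \<Longrightarrow> (\<And>x. x \<in> set xs \<Longrightarrow> e' x \<in> Dm M) \<Longrightarrow> (\<And>x. x \<notin> set xs \<Longrightarrow> e' x = e x) \<Longrightarrow> sat M e' s a"
proof (induction xs arbitrary: e)
  case Nil
  then have "e' = e" by auto
  then show ?case using Nil by simp
next
  case (Cons x xs)
  have "sat M (e(x := e' x)) s (foldr FAll xs a)" using Cons.prems by auto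
  then show ?case by (rule Cons.IH) (use Cons.prems in auto)
qed

lemma sat_foldr_FAllS:
  "sat M e s (foldr FAllS xs a) \<Longrightarrow> (\<And>x. x \<in> set xs \<Longrightarrow> s' x \<in> Ss M) \<Longrightarrow> (\<And>x. x \<notin> set xs \<Longrightarrow> s' x = s x) \<Longrightarrow> sat M e s' a"
proof (induction xs arbitrary: s)
  case Nil
  then have "s' = s" by auto
  then show ?case using Nil by simp
next
  case (Cons x xs)
  have "sat M e (s(x := s' x)) (foldr FAllS xs a)" using Cons.prems by auto
  then show ?case by (rule Cons.IH) (use Cons.prems in auto)
qed

lemma sat_clos_inst: assumes "sat M e s (clos a)" "wfe M e' s'" shows "sat M e' s' a"
proof -
  define e1 where "e1 = (\<lambda>x. if x \<in> fv a then e' x else e x)"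
  define s1 where "s1 = (\<lambda>x. if x \<in> fvs a then s' x else s x)"
  have "sat M e1 s (foldr FAllS (sorted_list_of_set (fvs a)) a)"
    by (rule sat_foldr_FAll[OF assms(1)[unfolded clos_def]]) (use assms(2) in \<open>auto simp: e1_def wfe_def\<close>)
  then have "sat M e1 s1 a" by (rule sat_foldr_FAllS) (use assms(2) in \<open>auto simp: s1_def wfe_def\<close>)
  moreover have "sat M e1 s1 a = sat M e' s' a" by (rule sat_cong) (auto simp: e1_def s1_def)
  ultimately show ?thesis by simp
qed

text \<open>A formula of \<open>T\<close> may use one variable both free and bound, so truth is read
  off from its closure and then instantiated. Members of \<open>G\<close> are evaluated under the
  canonical assignment directly, which is why their free and bound variables have to be
  disjoint.\<close>

theorem completeness:
  assumes "con T G" "finite (\<Union>c\<in>G. fv c)" "finite (\<Union>c\<in>G. fvs c)"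
    "\<And>a. a \<in> G \<Longrightarrow> fv a \<inter> bv a = {}" "\<And>a. a \<in> G \<Longrightarrow> fvs a \<inter> bvs a = {}"
  shows "\<exists>(M::nat str) e s. wfm M \<and> wfe M e s \<and> models M T \<and> countable (Ss M) \<and> (\<forall>a\<in>G. sat M e s a)"
proof -
  interpret henkin T G by unfold_locales (use assms in auto)
  have "sat HM (\<lambda>x. val (TV x)) ext a" if "a \<in> G" for a
    using truth_id assms(4,5) that G_U by blast
  moreover have "models HM T" unfolding models_def
  proof (intro ballI allI impI)
    fix a e s assume "a \<in> T" "wfe HM e s"
    then have "clos a \<in> U" by (intro U_prov prov_clos prov.hyp)
    then have "sat HM (\<lambda>x. val (TV x)) ext (clos a)" using truth_id clos_closed by simp
    then show "sat HM e s a" using sat_clos_inst \<open>wfe HM e s\<close> by blast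
  qed
  moreover have "wfe HM (\<lambda>x. val (TV x)) ext" by (simp add: wfe_def)
  moreover have "countable (Ss HM)" by simp
  ultimately show ?thesis using wfm_HM by blast
qed

section \<open>Nonstandard countermodels\<close>

fun num :: "nat \<Rightarrow> tm" where
  "num 0 = TZ" | "num (Suc n) = TPlus (num n) TO"

lemma fvt_num [simp]: "fvt (num n) = {}" by (induction n) auto

lemma sat_clos: assumes "\<not> sat M e s (clos a)" "wfm M" "wfe M e s"
  shows "\<exists>e s. wfe M e s \<and> \<not> sat M e s a"
proof -
  have A: "\<exists>e. wfe M e s \<and> \<not> sat M e s a" if "\<not> sat M e s (foldr FAll xs a)" "wfe M e s" for e s xs a
    using that by (induction xs arbitrary: e) (auto, metis wfe_upd)
  have B: "\<exists>s. wfe M e s \<and> \<not> sat M e s a" if "\<not> sat M e s (foldr FAllS xs a)" "wfe M e s" for e s xs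
    using that by (induction xs arbitrary: s) (auto, metis wfe_updS)
  show ?thesis using A B assms unfolding clos_def by meson
qed

lemma num_less:
  assumes "wfm M" "models M basicAx" "m < n" "wfe M e s"
  shows "Ls M (ev M e (num m)) (ev M e (num n))"
proof -
  have "FAll 0 (FAll 1 (FIff (FLess (TV 0) (TPlus (TV 1) TO)) (FOr (FLess (TV 0) (TV 1)) (FEq (TV 0) (TV 1))))) \<in> basicAx"
    by (simp add: basicAx_def Let_def)
  then have ax: "\<forall>x\<in>Dm M. \<forall>y\<in>Dm M. Ls M x (Pl M y (O1 M)) \<longleftrightarrow> Ls M x y \<or> x = y"
    using assms(2,4) unfolding models_def by fastforce
  show ?thesis using assms(3)
  proof (induction n)
    case (Suc n)
    then show ?case using ax ev_Dm[OF assms(1,4)] by (cases "m = n") auto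
  qed simp
qed

text \<open>Compactness: variable \<open>0\<close> acts as a new constant, since the closed formula
  \<open>a\<close> and the numerals do not mention it. Finitely many of the inequalities are
  satisfied in an ordinary countermodel by assigning a large numeral to it.\<close>

theorem nonstandard_countermodel:
  assumes "\<not> prov T psi" "basicAx \<subseteq> T"
  shows "\<exists>(M::nat str) c. wfm M \<and> models M T \<and> countable (Ss M) \<and> (\<exists>e s. wfe M e s \<and> \<not> sat M e s psi) \<and>
     c \<in> Dm M \<and> (\<forall>n e. Ls M (ev M e (num n)) c)"
proof -
  define a where "a = FNeg (clos psi)"
  have "\<not> prov T (clos psi)"
  proof
    assume P: "prov T (clos psi)"
    have inst: "prov T b" if "prov T (foldr FAll xs b)" for xs b
      using that
    proof (induction xs)
      case (Cons x xs)
      have "free_for (TV x) x (foldr FAll xs b)"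
      proof -
        have "free_for (TV x) x c" for c by (induction c) auto
        then show ?thesis .
      qed
      moreover have "substf x (TV x) c = c" for c
      proof -
        have "substt x (TV x) t = t" for t by (induction t) auto
        then show ?thesis by (induction c) auto
      qed
      ultimately have "prov T (FImp (FAll x (foldr FAll xs b)) (foldr FAll xs b))" using prov.ax[OF logax.inst] by metis
      then show ?case using Cons by (auto intro: prov.mp)
    qed simp
    have instS: "prov T b" if "prov T (foldr FAllS xs b)" for xs b
      using that
    proof (induction xs)
      case (Cons x xs)
      have "free_fors x x c" for c by (induction c) auto
      moreover have "substs x x c = c" for c by (induction c) auto
      ultimately have "prov T (FImp (FAllS x (foldr FAllS xs b)) (foldr FAllS xs b))" using prov.ax[OF logax.instS] by metis
      then show ?case using Cons by (auto intro: prov.mp)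
    qed simp
    show False using P inst instS assms(1) unfolding clos_def by blast
  qed
  have c1: "con T {a}"
  proof (rule ccontr)
    assume "\<not> con T {a}"
    then have "ent T {} (clos psi)" unfolding a_def using ent_neg ent_negneg by blast
    then show False using \<open>\<not> prov T (clos psi)\<close> by (simp add: ent_def)
  qed
  obtain M1 :: "nat str" and e1 s1 where M1: "wfm M1" "wfe M1 e1 s1" "models M1 T" "sat M1 e1 s1 a"
    using completeness[OF c1] by (auto simp: a_def clos_closed)
  define G where "G = insert a (range (\<lambda>n. FLess (num n) (TV 0)))"
  have "con T G"
  proof (rule ccontr)
    assume "\<not> con T G"
    then obtain b L1 L2 where L: "set L1 \<subseteq> G" "prov T (foldr FImp L1 b)" "set L2 \<subseteq> G" "prov T (foldr FImp L2 (FNeg b))"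
      unfolding con_def ent_def by blast
    define A where "A = set L1 \<union> set L2"
    have "finite A" "A \<subseteq> G" using L by (auto simp: A_def)
    then have "\<exists>N. \<forall>n. FLess (num n) (TV 0) \<in> A \<longrightarrow> n < N"
    proof -
      have "inj (\<lambda>n. FLess (num n) (TV 0))"
      proof (rule injI)
        have "num n = num m \<Longrightarrow> n = m" for n m
          by (induction n arbitrary: m) (case_tac m; auto)+
        then show "FLess (num x) (TV 0) = FLess (num y) (TV 0) \<Longrightarrow> x = y" for x y by simp
      qed
      then have "finite {n. FLess (num n) (TV 0) \<in> A}"
        using finite_vimageI[OF \<open>finite A\<close>] by (simp add: vimage_def)
      then show ?thesis using finite_nat_set_iff_bounded by auto
    qed
    then obtain N where N: "\<And>n. FLess (num n) (TV 0) \<in> A \<Longrightarrow> n < N" by blast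
    define e2 where "e2 = e1(0 := ev M1 e1 (num N))"
    have w2: "wfe M1 e2 s1" unfolding e2_def by (rule wfe_upd[OF M1(2) ev_Dm[OF M1(1,2)]])
    have numc: "ev M1 e2 (num n) = ev M1 e1 (num n)" for n by (rule ev_cong) auto
    have "sat M1 e2 s1 c" if "c \<in> A" for c
    proof -
      have "c = a \<or> (\<exists>n. c = FLess (num n) (TV 0))" using that \<open>A \<subseteq> G\<close> by (auto simp: G_def)
      then show ?thesis
      proof
        assume "c = a"
        moreover have "sat M1 e2 s1 a = sat M1 e1 s1 a" by (rule sat_cong) (auto simp: a_def clos_closed)
        ultimately show ?thesis using M1 by simp
      next
        assume "\<exists>n. c = FLess (num n) (TV 0)"
        then obtain n where n: "c = FLess (num n) (TV 0)" by blast
        then have "n < N" using N that by blast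
        have "models M1 basicAx" using M1 assms(2) by (auto simp: models_def)
        then show ?thesis using num_less[OF M1(1) _ \<open>n < N\<close> M1(2)] numc n by (simp add: e2_def)
      qed
    qed
    moreover have "sat M1 e2 s1 (foldr FImp L1 b)" "sat M1 e2 s1 (foldr FImp L2 (FNeg b))"
      using soundness L M1 w2 by blast+
    ultimately show False unfolding A_def by auto
  qed
  moreover have "(\<Union>c\<in>G. fv c) = {0}" "(\<Union>c\<in>G. fvs c) = {}" by (auto simp: G_def a_def clos_closed)
  moreover have "fv c \<inter> bv c = {}" "fvs c \<inter> bvs c = {}" if "c \<in> G" for c
    using that by (auto simp: G_def a_def clos_closed)
  ultimately have "\<exists>(M::nat str) e s. wfm M \<and> wfe M e s \<and> models M T \<and> countable (Ss M) \<and> (\<forall>a\<in>G. sat M e s a)"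
    by (intro completeness) simp_all
  then obtain M :: "nat str" and e s where M: "wfm M" "wfe M e s" "models M T" "countable (Ss M)" "\<And>c. c \<in> G \<Longrightarrow> sat M e s c"
    by blast
  have "\<not> sat M e s (clos psi)" using M(5)[of a] by (simp add: G_def a_def)
  then have 1: "\<exists>e s. wfe M e s \<and> \<not> sat M e s psi" using sat_clos M by blast
  have "Ls M (ev M e' (num n)) (e 0)" for n e'
  proof -
    have "sat M e s (FLess (num n) (TV 0))" by (rule M(5)) (simp add: G_def)
    moreover have "ev M e' (num n) = ev M e (num n)" by (rule ev_cong) auto
    ultimately show ?thesis by simp
  qed
  then show ?thesis using M 1 by (intro exI[of _ M] exI[of _ "e 0"]) (auto simp: wfe_def)
qed

lemma bounded_derived:
  "bounded a \<Longrightarrow> bounded b \<Longrightarrow> bounded (FAnd a b)"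
  "bounded a \<Longrightarrow> bounded b \<Longrightarrow> bounded (FOr a b)"
  "bounded a \<Longrightarrow> bounded b \<Longrightarrow> bounded (FIff a b)"
  unfolding FAnd_def FOr_def FIff_def by (intro bounded.intros; assumption)+

lemmas bounded_intros = bounded.intros bounded_derived

lemma free_for_suc: "fvt r \<subseteq> {x} \<Longrightarrow> free_for r x a"
  by (induction a) auto

lemma sat_ind_instance:
  "sat M e s (FImp (FAnd (substf n TZ a) (FAll n (FImp a (substf n (TPlus (TV n) TO) a)))) (FAll n a)) \<longleftrightarrow>
   (sat M (e(n := Z0 M)) s a \<longrightarrow> (\<forall>d\<in>Dm M. sat M (e(n := d)) s a \<longrightarrow> sat M (e(n := Pl M d (O1 M))) s a) \<longrightarrow>
      (\<forall>d\<in>Dm M. sat M (e(n := d)) s a))"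
  by (auto simp: sat_substf free_for_suc)

lemma sat_ca_instance:
  assumes "X \<notin> fvs a"
  shows "sat M e s (FImp (FAll n (FIff a b)) (FExS X (FAll n (FIff (FMem (TV n) X) a)))) \<longleftrightarrow>
   ((\<forall>d\<in>Dm M. sat M (e(n := d)) s a \<longleftrightarrow> sat M (e(n := d)) s b) \<longrightarrow>
      (\<exists>A\<in>Ss M. \<forall>d\<in>Dm M. d \<in> A \<longleftrightarrow> sat M (e(n := d)) s a))"
proof -
  have "sat M e (s(X := A)) a = sat M e s a" for e A by (rule sat_cong) (use assms in auto)
  then show ?thesis by simp
qed

definition StdM :: "nat str" where
  "StdM = \<lparr>Dm = UNIV, Z0 = 0, O1 = 1, Pl = (+), Ti = (*), Ls = (<), Ss = UNIV\<rparr>"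

lemma StdM_simps [simp]: "Dm StdM = UNIV" "Z0 StdM = 0" "O1 StdM = 1" "Pl StdM = (+)" "Ti StdM = (*)" "Ls StdM = (<)" "Ss StdM = UNIV"
  by (simp_all add: StdM_def)

lemma StdM_RCA0: "models StdM RCA0" unfolding models_def
proof (intro ballI allI impI)
  fix a e s assume "a \<in> RCA0"
  then consider "a \<in> basicAx" | "a \<in> sigma1Ind" | "a \<in> delta1CA" by (auto simp: RCA0_def)
  then show "sat StdM e s a"
  proof cases
    case 1
    have ind: "0 \<in> A \<and> (\<forall>d. d \<in> A \<longrightarrow> Suc d \<in> A) \<longrightarrow> (\<forall>d::nat. d \<in> A)" for A
    proof (intro impI allI)
      fix d assume "0 \<in> A \<and> (\<forall>d. d \<in> A \<longrightarrow> Suc d \<in> A)" then show "d \<in> A" by (induction d) auto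
    qed
    from 1 show ?thesis unfolding basicAx_def Let_def
      by (elim insertE emptyE) (simp_all add: less_Suc_eq del: imp_conjL, use ind in blast)
  next
    case 2
    then obtain b n where a: "a = FImp (FAnd (substf n TZ b) (FAll n (FImp b (substf n (TPlus (TV n) TO) b)))) (FAll n b)"
      by (auto simp: sigma1Ind_def)
    show ?thesis unfolding a sat_ind_instance
    proof (intro impI ballI)
      fix d
      assume h: "sat StdM (e(n := Z0 StdM)) s b" "\<forall>d\<in>Dm StdM. sat StdM (e(n := d)) s b \<longrightarrow> sat StdM (e(n := Pl StdM d (O1 StdM))) s b"
      show "sat StdM (e(n := d)) s b"
      proof (induction d)
        case 0 show ?case using h(1) by (simp del: fun_upd_apply)
      next
        case (Suc d) then show ?case using h(2)[rule_format, of d] by (simp del: fun_upd_apply)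
      qed
    qed
  next
    case 3
    then obtain b c n X where a: "a = FImp (FAll n (FIff b c)) (FExS X (FAll n (FIff (FMem (TV n) X) b)))" "X \<notin> fvs b"
      by (auto simp: delta1CA_def)
    have "(\<exists>A\<in>Ss StdM. \<forall>d\<in>Dm StdM. d \<in> A \<longleftrightarrow> sat StdM (e(n := d)) s b)"
      by (rule bexI[of _ "{d. sat StdM (e(n := d)) s b}"]) simp_all
    then show ?thesis unfolding a(1) sat_ca_instance[OF a(2)] by blast
  qed
qed

section \<open>A model as a type\<close>

text \<open>To have type-class arithmetic available inside a countermodel, one model is chosen once and for all:
  a nonstandard countermodel if the theorem fails, and the standard model otherwise.\<close>

definition CE :: "fm \<Rightarrow> nat \<Rightarrow> bool" where
  "CE phi a \<longleftrightarrow> allSigma2 phi \<and> prov WKL0_RT22 (ordStmt a phi) \<and> \<not> prov RCA0 (ordStmt a phi)"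

definition goodM :: "nat str \<Rightarrow> bool" where
  "goodM M \<longleftrightarrow> wfm M \<and> models M RCA0 \<and> ((\<exists>phi a. CE phi a) \<longrightarrow> countable (Ss M) \<and>
     (\<exists>c\<in>Dm M. \<forall>n e. Ls M (ev M e (num n)) c) \<and>
     (\<exists>phi a e s. CE phi a \<and> wfe M e s \<and> \<not> sat M e s (ordStmt a phi)))"

lemma ex_goodM: "\<exists>M. goodM M"
proof (cases "\<exists>phi a. CE phi a")
  case True
  then obtain phi a where c: "CE phi a" by blast
  have "basicAx \<subseteq> RCA0" by (auto simp: RCA0_def)
  then show ?thesis using nonstandard_countermodel[of RCA0 "ordStmt a phi"] c unfolding goodM_def CE_def by metis
next
  case False
  have "wfm StdM" by (simp add: wfm_def)
  then show ?thesis using False StdM_RCA0 by (auto simp: goodM_def)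
qed

definition theM :: "nat str" where "theM = (SOME M. goodM M)"

lemma goodM_theM: "goodM theM" unfolding theM_def by (rule someI_ex[OF ex_goodM])

typedef hm = "Dm theM" morphisms Rep_hm Abs_hm
  using goodM_theM by (auto simp: goodM_def wfm_def)

instantiation hm :: "{zero, one, plus, times, ord, minus}" begin
definition "0 = Abs_hm (Z0 theM)"
definition "1 = Abs_hm (O1 theM)"
definition "x + y = Abs_hm (Pl theM (Rep_hm x) (Rep_hm y))"
definition "x * y = Abs_hm (Ti theM (Rep_hm x) (Rep_hm y))"
definition "x < y \<longleftrightarrow> Ls theM (Rep_hm x) (Rep_hm y)"
definition "(x::hm) \<le> y \<longleftrightarrow> x < y \<or> x = y"
definition "(x::hm) - y = (if y \<le> x then (SOME z. x = y + z) else 0)"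
instance ..
end

definition SS :: "hm set set" where "SS = (\<lambda>A. Rep_hm -` A) ` Ss theM"

definition MM :: "hm str" where
  "MM = \<lparr>Dm = UNIV, Z0 = 0, O1 = 1, Pl = (+), Ti = (*), Ls = (<), Ss = SS\<rparr>"

lemma MM_simps [simp]: "Dm MM = UNIV" "Z0 MM = 0" "O1 MM = 1" "Pl MM = (+)" "Ti MM = (*)" "Ls MM = (<)" "Ss MM = SS"
  by (simp_all add: MM_def)

lemma Rep_ops:
  "Rep_hm 0 = Z0 theM" "Rep_hm 1 = O1 theM" "Rep_hm (x + y) = Pl theM (Rep_hm x) (Rep_hm y)"
  "Rep_hm (x * y) = Ti theM (Rep_hm x) (Rep_hm y)"
  using goodM_theM Rep_hm
  by (auto simp: zero_hm_def one_hm_def plus_hm_def times_hm_def goodM_def wfm_def intro!: Abs_hm_inverse)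

lemma ev_iso: "Rep_hm (ev MM e t) = ev theM (\<lambda>x. Rep_hm (e x)) t"
  by (induction t) (auto simp: Rep_ops)

lemma sat_iso: "sat MM e (\<lambda>X. Rep_hm -` s X) a \<longleftrightarrow> sat theM (\<lambda>x. Rep_hm (e x)) s a"
proof (induction a arbitrary: e s)
  case (FEq t u) then show ?case by (simp add: ev_iso[symmetric] Rep_hm_inject)
next
  case (FLess t u) then show ?case by (simp add: ev_iso less_hm_def)
next
  case (FMem t X) then show ?case by (simp add: ev_iso)
next
  case (FAll x a)
  have 1: "(\<lambda>y. Rep_hm ((e(x := d)) y)) = (\<lambda>y. Rep_hm (e y))(x := Rep_hm d)" for d by (auto simp: fun_eq_iff)
  have "(\<forall>d. sat theM ((\<lambda>y. Rep_hm (e y))(x := Rep_hm d)) s a) \<longleftrightarrow> (\<forall>d\<in>Dm theM. sat theM ((\<lambda>y. Rep_hm (e y))(x := d)) s a)"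
    by (metis Rep_hm Abs_hm_inverse)
  then show ?case by (simp add: FAll.IH 1 del: fun_upd_apply)
next
  case (FAllS X a)
  have 1: "(\<lambda>Y. Rep_hm -` ((s(X := A)) Y)) = (\<lambda>Y. Rep_hm -` s Y)(X := Rep_hm -` A)" for A by (auto simp: fun_eq_iff)
  show ?case using FAllS.IH[of e "s(X := _)"] by (simp add: SS_def 1[symmetric] del: fun_upd_apply)
qed auto

lemma SS_env: assumes "\<And>n. s n \<in> SS" shows "\<exists>s'. (\<forall>n. s' n \<in> Ss theM) \<and> s = (\<lambda>n. Rep_hm -` s' n)"
proof -
  have "\<forall>n. \<exists>A. A \<in> Ss theM \<and> s n = Rep_hm -` A" using assms unfolding SS_def by blast
  then show ?thesis by metis
qed

lemma MM_models: "models MM RCA0" unfolding models_def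
proof (intro ballI allI impI)
  fix a e s assume "a \<in> RCA0" "wfe MM e s"
  then obtain s' where s': "\<forall>n. s' n \<in> Ss theM" "s = (\<lambda>n. Rep_hm -` s' n)" using SS_env[of s] by (auto simp: wfe_def)
  have "sat theM (\<lambda>x. Rep_hm (e x)) s' a"
    using goodM_theM \<open>a \<in> RCA0\<close> s' Rep_hm by (auto simp: goodM_def models_def wfe_def)
  then show "sat MM e s a" using s' sat_iso by simp
qed

lemma MM_sat: "a \<in> RCA0 \<Longrightarrow> (\<And>X. s X \<in> SS) \<Longrightarrow> sat MM e s a"
  using MM_models unfolding models_def wfe_def by (metis MM_simps(1,7) UNIV_I)

lemma MM_counter:
  assumes "CE phi0 a0"
  shows "countable SS" "\<exists>c. \<forall>n e. ev MM e (num n) < c"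
    "\<exists>phi a e s. CE phi a \<and> wfe MM e s \<and> \<not> sat MM e s (ordStmt a phi)"
proof -
  have g: "countable (Ss theM)" "\<exists>c\<in>Dm theM. \<forall>n e. Ls theM (ev theM e (num n)) c"
    "\<exists>phi a e s. CE phi a \<and> wfe theM e s \<and> \<not> sat theM e s (ordStmt a phi)"
    using goodM_theM assms unfolding goodM_def by blast+
  show "countable SS" using g(1) by (simp add: SS_def)
  obtain c where "c \<in> Dm theM" "\<And>n e. Ls theM (ev theM e (num n)) c" using g by blast
  then have "ev MM e (num n) < Abs_hm c" for n e by (simp add: less_hm_def ev_iso Abs_hm_inverse)
  then show "\<exists>c. \<forall>n e. ev MM e (num n) < c" by blast
  obtain phi a e s where c: "CE phi a" "wfe theM e s" "\<not> sat theM e s (ordStmt a phi)" using g by blast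
  have "(\<lambda>x. Rep_hm (Abs_hm (e x))) = e" using c(2) by (auto simp: wfe_def Abs_hm_inverse)
  then have "\<not> sat MM (\<lambda>x. Abs_hm (e x)) (\<lambda>X. Rep_hm -` s X) (ordStmt a phi)" using c sat_iso by simp
  moreover have "wfe MM (\<lambda>x. Abs_hm (e x)) (\<lambda>X. Rep_hm -` s X)" using c(2) by (auto simp: wfe_def SS_def)
  ultimately show "\<exists>phi a e s. CE phi a \<and> wfe MM e s \<and> \<not> sat MM e s (ordStmt a phi)" using c(1) by blast
qed

lemma SS_ne: "\<exists>A. A \<in> SS"
  using goodM_theM by (auto simp: goodM_def wfm_def SS_def)

definition s0 :: "nat \<Rightarrow> hm set" where "s0 n = (SOME A. A \<in> SS)"

lemma s0 [simp]: "s0 n \<in> SS" unfolding s0_def by (rule someI_ex[OF SS_ne])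

section \<open>Comprehension and induction of the model in semantic form\<close>

lemma comp_delta1:
  assumes "\<And>X. s X \<in> SS" "bounded a" "bounded b"
    "\<And>d. (\<exists>y. sat MM (e(n := d, m := y)) s a) \<longleftrightarrow> (\<forall>y. sat MM (e(n := d, m := y)) s b)"
  shows "{d. \<exists>y. sat MM (e(n := d, m := y)) s a} \<in> SS"
proof -
  obtain X where X: "X \<notin> fvs (FEx m a)" using ex_new_if_finite[OF infinite_UNIV_nat, of "fvs (FEx m a)"] by auto
  let ?c = "FImp (FAll n (FIff (FEx m a) (FAll m b))) (FExS X (FAll n (FIff (FMem (TV n) X) (FEx m a))))"
  have "sigma 1 (FEx m a)" "pi 1 (FAll m b)" using assms by auto
  then have "?c \<in> delta1CA" using X unfolding delta1CA_def by blast
  then have "sat MM e s ?c" by (intro MM_sat assms(1)) (unfold RCA0_def, blast)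
  then obtain A where "A \<in> SS" "\<forall>d. d \<in> A \<longleftrightarrow> (\<exists>y. sat MM (e(n := d, m := y)) s a)"
    unfolding sat_ca_instance[OF X] using assms(4) by (auto simp del: fun_upd_apply)
  moreover from this have "A = {d. \<exists>y. sat MM (e(n := d, m := y)) s a}" by blast
  ultimately show ?thesis by simp
qed

lemma comp_bounded:
  assumes "\<And>X. s X \<in> SS" "bounded a"
  shows "{d. sat MM (e(n := d)) s a} \<in> SS"
proof -
  obtain m where m: "m \<notin> insert n (fv a)" using ex_new_if_finite[OF infinite_UNIV_nat, of "insert n (fv a)"] by auto
  have "sat MM (e(n := d, m := y)) s a = sat MM (e(n := d)) s a" for d y by (rule sat_cong) (use m in auto)
  then show ?thesis using comp_delta1[of s a a e n m, OF assms(1) assms(2) assms(2)] by (simp del: fun_upd_apply)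
qed

lemma ind_sigma1:
  assumes "\<And>X. s X \<in> SS" "bounded a"
    "\<exists>y. sat MM (e(n := 0, m := y)) s a"
    "\<And>d. \<exists>y. sat MM (e(n := d, m := y)) s a \<Longrightarrow> \<exists>y. sat MM (e(n := d + 1, m := y)) s a"
  shows "\<exists>y. sat MM (e(n := d, m := y)) s a"
proof -
  let ?b = "FEx m a"
  let ?c = "FImp (FAnd (substf n TZ ?b) (FAll n (FImp ?b (substf n (TPlus (TV n) TO) ?b)))) (FAll n ?b)"
  have "sigma 1 ?b" using assms by auto
  then have "?c \<in> sigma1Ind" unfolding sigma1Ind_def by blast
  then have "sat MM e s ?c" by (intro MM_sat assms(1)) (unfold RCA0_def, blast)
  then show ?thesis unfolding sat_ind_instance using assms(3,4) by (simp del: fun_upd_apply)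
qed

lemma basic_ax: assumes "a \<in> basicAx" shows "sat MM (\<lambda>_. 0) s0 a"
  by (intro MM_sat s0) (use assms in \<open>unfold RCA0_def, blast\<close>)

lemma hm_basic:
  fixes x y :: hm
  shows "x + 1 \<noteq> 0" "x + 1 = y + 1 \<longleftrightarrow> x = y" "x + 0 = x" "x + (y + 1) = (x + y) + 1"
    "x * 0 = 0" "x * (y + 1) = x * y + x" "\<not> x < 0" "x < y + 1 \<longleftrightarrow> x < y \<or> x = y"
proof -
  have a1: "\<forall>x::hm. x + 1 \<noteq> 0"
    using basic_ax[of "FAll 0 (FNeg (FEq (TPlus (TV 0) TO) TZ))"] by (simp add: basicAx_def Let_def)
  have a2: "\<forall>x y::hm. x + 1 = y + 1 \<longrightarrow> x = y"
    using basic_ax[of "FAll 0 (FAll 1 (FImp (FEq (TPlus (TV 0) TO) (TPlus (TV 1) TO)) (FEq (TV 0) (TV 1))))"] by (simp add: basicAx_def Let_def)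
  have a3: "\<forall>x::hm. x + 0 = x"
    using basic_ax[of "FAll 0 (FEq (TPlus (TV 0) TZ) (TV 0))"] by (simp add: basicAx_def Let_def)
  have a4: "\<forall>x y::hm. x + (y + 1) = (x + y) + 1"
    using basic_ax[of "FAll 0 (FAll 1 (FEq (TPlus (TV 0) (TPlus (TV 1) TO)) (TPlus (TPlus (TV 0) (TV 1)) TO)))"] by (simp add: basicAx_def Let_def)
  have a5: "\<forall>x::hm. x * 0 = 0"
    using basic_ax[of "FAll 0 (FEq (TTimes (TV 0) TZ) TZ)"] by (simp add: basicAx_def Let_def)
  have a6: "\<forall>x y::hm. x * (y + 1) = x * y + x"
    using basic_ax[of "FAll 0 (FAll 1 (FEq (TTimes (TV 0) (TPlus (TV 1) TO)) (TPlus (TTimes (TV 0) (TV 1)) (TV 0))))"] by (simp add: basicAx_def Let_def)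
  have a7: "\<forall>x::hm. \<not> x < 0"
    using basic_ax[of "FAll 0 (FNeg (FLess (TV 0) TZ))"] by (simp add: basicAx_def Let_def)
  have a8: "\<forall>x y::hm. x < y + 1 \<longleftrightarrow> x < y \<or> x = y"
    using basic_ax[of "FAll 0 (FAll 1 (FIff (FLess (TV 0) (TPlus (TV 1) TO)) (FOr (FLess (TV 0) (TV 1)) (FEq (TV 0) (TV 1)))))"] by (simp add: basicAx_def Let_def)
  show "x + 1 \<noteq> 0" "x + 1 = y + 1 \<longleftrightarrow> x = y" "x + 0 = x" "x + (y + 1) = (x + y) + 1"
    "x * 0 = 0" "x * (y + 1) = x * y + x" "\<not> x < 0" "x < y + 1 \<longleftrightarrow> x < y \<or> x = y"
    using a1 a2 a3 a4 a5 a6 a7 a8 by blast+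
qed

lemma set_ind: assumes "A \<in> SS" "0 \<in> A" "\<And>x. x \<in> A \<Longrightarrow> x + 1 \<in> A" shows "x \<in> A"
proof -
  have "sat MM (\<lambda>_. 0) s0 (FAllS 0 (FImp (FAnd (FMem TZ 0) (FAll 1 (FImp (FMem (TV 1) 0) (FMem (TPlus (TV 1) TO) 0))))
                   (FAll 1 (FMem (TV 1) 0))))"
    by (rule basic_ax) (simp add: basicAx_def Let_def)
  then have "\<forall>A\<in>SS. 0 \<in> A \<and> (\<forall>d. d \<in> A \<longrightarrow> d + 1 \<in> A) \<longrightarrow> (\<forall>d. d \<in> A)"
    by (simp only: sat.simps sat_derived ev.simps MM_simps ball_UNIV fun_upd_same)
  then show ?thesis using assms by blast
qed

text \<open>Laws of arithmetic are expressed by bounded formulas in which variable \<open>0\<close>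
  carries the induction and variables \<open>1\<close> and \<open>2\<close> are the parameters
  \<open>y\<close> and \<open>z\<close>. Comprehension turns such a law into a set, to which the set
  induction axiom applies.\<close>

lemma ind_fm:
  assumes "bounded a" "\<And>x. sat MM ((\<lambda>k. if k = 1 then y else z)(0 := x)) s0 a = P x" "P 0" "\<And>x. P x \<Longrightarrow> P (x + 1)"
  shows "P x"
proof -
  have "{d. sat MM ((\<lambda>k. if k = 1 then y else z)(0 := d)) s0 a} \<in> SS" by (rule comp_bounded) (use assms(1) in auto)
  then have "{d. P d} \<in> SS" by (simp only: assms(2))
  then have "x \<in> {d. P d}" by (rule set_ind) (use assms(3,4) in blast)+
  then show ?thesis by blast
qed

abbreviation (input) "VX \<equiv> TV 0"
abbreviation (input) "VY \<equiv> TV 1"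
abbreviation (input) "VZ \<equiv> TV 2"

lemma hm_zadd: "0 + (x::hm) = x"
  by (rule ind_fm[where a = "FEq (TPlus TZ VX) VX"]) (auto intro!: bounded_intros simp: hm_basic)

lemma hm_sadd: "(y + 1) + (x::hm) = (y + x) + 1"
  by (rule ind_fm[where a = "FEq (TPlus (TPlus VY TO) VX) (TPlus (TPlus VY VX) TO)" and y = y])
    (auto intro!: bounded_intros simp: hm_basic)

lemma hm_addc: "y + x = x + (y::hm)"
  by (rule ind_fm[where a = "FEq (TPlus VY VX) (TPlus VX VY)" and y = y])
    (auto intro!: bounded_intros simp: hm_basic hm_zadd hm_sadd)

lemma hm_adda: "(y + z) + x = y + (z + (x::hm))"
  by (rule ind_fm[where a = "FEq (TPlus (TPlus VY VZ) VX) (TPlus VY (TPlus VZ VX))" and y = y and z = z])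
    (auto intro!: bounded_intros simp: hm_basic)

lemma hm_addac: "a + (b + c) = b + (a + (c::hm))" by (metis hm_adda hm_addc)

lemma hm_zmul: "0 * (x::hm) = 0"
  by (rule ind_fm[where a = "FEq (TTimes TZ VX) TZ"]) (auto intro!: bounded_intros simp: hm_basic)

lemma hm_smul: "(y + 1) * (x::hm) = y * x + x"
  by (rule ind_fm[where a = "FEq (TTimes (TPlus VY TO) VX) (TPlus (TTimes VY VX) VX)" and y = y])
    (auto intro!: bounded_intros simp: hm_basic hm_adda[symmetric], auto simp: hm_adda hm_addc hm_addac)

lemma hm_mulc: "y * x = x * (y::hm)"
  by (rule ind_fm[where a = "FEq (TTimes VY VX) (TTimes VX VY)" and y = y])
    (auto intro!: bounded_intros simp: hm_basic hm_zmul hm_smul)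

lemma hm_distr: "(y + z) * x = y * x + z * (x::hm)"
  by (rule ind_fm[where a = "FEq (TTimes (TPlus VY VZ) VX) (TPlus (TTimes VY VX) (TTimes VZ VX))" and y = y and z = z])
    (auto intro!: bounded_intros simp: hm_basic, auto simp: hm_adda hm_addc hm_addac)

lemma hm_distl: "x * (y + z) = x * y + x * (z::hm)" by (metis hm_distr hm_mulc)

lemma hm_mul1: "x * 1 = (x::hm)" by (metis hm_basic(5,6) hm_zadd)

lemma hm_mula: "(y * z) * x = y * (z * (x::hm))"
  by (rule ind_fm[where a = "FEq (TTimes (TTimes VY VZ) VX) (TTimes VY (TTimes VZ VX))" and y = y and z = z and P = "\<lambda>x. (y * z) * x = y * (z * x)"])
    (auto intro!: bounded_intros simp: hm_basic hm_distl hm_mul1)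

lemma hm_cancel: "y + x = z + x \<longleftrightarrow> y = (z::hm)"
  by (rule ind_fm[where a = "FIff (FEq (TPlus VY VX) (TPlus VZ VX)) (FEq VY VZ)" and y = y and z = z])
    (auto intro!: bounded_intros simp: hm_basic)

lemma hm_cancell: "x + y = x + z \<longleftrightarrow> y = (z::hm)" by (metis hm_cancel hm_addc)

lemma hm_less_self: "x < x + 1" for x :: hm by (simp add: hm_basic)

lemma hm_pred: "x = 0 \<or> (\<exists>w. x = w + 1)" for x :: hm
proof -
  \<comment> \<open>The predecessor is bounded by \<open>x\<close> only to keep the induction
    formula bounded.\<close>
  have "x = 0 \<or> (\<exists>w. w < x \<and> x = w + 1)"
    by (rule ind_fm[where a = "FOr (FEq VX TZ) (FEx 1 (FAnd (FLess VY VX) (FEq VX (TPlus VY TO))))" and P = "\<lambda>x. x = 0 \<or> (\<exists>w. w < x \<and> x = w + 1)"])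
      (auto intro!: bounded_intros simp: hm_basic)
  then show ?thesis by blast
qed

lemma hm_less_add: "y < y + (x + 1)" for x :: hm
  by (rule ind_fm[where a = "FLess VY (TPlus VY (TPlus VX TO))" and y = y])
    (auto intro!: bounded_intros simp: hm_basic hm_zadd)

lemma hm_less_iff_ex: "x < y \<longleftrightarrow> (\<exists>z. y = x + (z + 1))" for x y :: hm
proof -
  have "x < y \<longrightarrow> (\<exists>z. z < y \<and> y = x + (z + 1))"
  proof (rule ind_fm[where a = "FImp (FLess VY VX) (FEx 2 (FAnd (FLess VZ VX) (FEq VX (TPlus VY (TPlus VZ TO)))))" and y = x and x = y])
    fix y assume IH: "x < y \<longrightarrow> (\<exists>z. z < y \<and> y = x + (z + 1))"
    show "x < y + 1 \<longrightarrow> (\<exists>z. z < y + 1 \<and> y + 1 = x + (z + 1))"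
    proof
      assume "x < y + 1"
      then consider "x < y" | "x = y" by (auto simp: hm_basic)
      then show "\<exists>z. z < y + 1 \<and> y + 1 = x + (z + 1)"
      proof cases
        case 1
        then obtain z where "z < y" "y = x + (z + 1)" using IH by blast
        then have "y + 1 = x + ((z + 1) + 1)" by (simp add: hm_adda)
        moreover have "z + 1 < y + 1"
        proof -
          have "y = z + (x + 1)" using \<open>y = x + (z + 1)\<close> by (simp add: hm_addac hm_addc)
          then show ?thesis using hm_less_add[of "z + 1" x] by (simp add: hm_adda hm_addac hm_addc)
        qed
        ultimately show ?thesis by blast
      next
        case 2
        then have "y + 1 = x + (0 + 1)" by (simp add: hm_zadd)
        moreover have "0 < y + 1" using hm_less_add[of 0 y] by (simp add: hm_zadd)
        ultimately show ?thesis by blast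
      qed
    qed
  qed (auto intro!: bounded_intros simp: hm_basic)
  then show ?thesis using hm_less_add by blast
qed

lemma hm_irrefl: "\<not> x < x" for x :: hm
proof
  assume "x < x"
  then have "\<exists>z. x = x + (z + 1)" by (rule hm_less_iff_ex[THEN iffD1])
  then obtain z where "x = x + (z + 1)" by (rule exE)
  then have "x + 0 = x + (z + 1)" by (simp add: hm_basic)
  then show False using hm_cancell hm_basic(1) by metis
qed

lemma hm_trans: "x < y \<Longrightarrow> y < z \<Longrightarrow> x < z" for x y z :: hm
  unfolding hm_less_iff_ex by (metis hm_adda)

lemma hm_linear: "x < y \<or> x = y \<or> y < x" for x y :: hm
proof (rule ind_fm[where a = "FOr (FLess VY VX) (FOr (FEq VY VX) (FLess VX VY))" and y = x and x = y])
  show "x < 0 \<or> x = 0 \<or> 0 < x" using hm_pred[of x] hm_less_add[of 0] by (auto simp: hm_zadd)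
  fix y assume "x < y \<or> x = y \<or> y < x"
  then consider "x < y + 1" | "y < x" by (auto simp: hm_basic)
  then show "x < y + 1 \<or> x = y + 1 \<or> y + 1 < x"
  proof cases
    case 2
    then obtain z where z: "x = y + (z + 1)" using hm_less_iff_ex[of y x] by blast
    show ?thesis using hm_pred[of z]
    proof
      assume "z = 0" then show ?thesis using z by (simp add: hm_zadd)
    next
      assume "\<exists>w. z = w + 1"
      then obtain w where "z = w + 1" by blast
      then have "x = (y + 1) + (w + 1)" using z by (simp add: hm_adda hm_addac hm_addc)
      then show ?thesis using hm_less_add by blast
    qed
  qed auto
qed (auto intro!: bounded_intros)

lemma hm_le_iff_ex: "x \<le> y \<longleftrightarrow> (\<exists>z. y = x + z)" for x y :: hm
proof
  assume "x \<le> y" then show "\<exists>z. y = x + z" using hm_less_iff_ex hm_basic(3) unfolding less_eq_hm_def by metis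
next
  assume "\<exists>z. y = x + z"
  then obtain z where "y = x + z" by blast
  then show "x \<le> y" using hm_pred[of z] hm_less_iff_ex hm_basic(3) unfolding less_eq_hm_def by metis
qed

lemma hm_diff: "y \<le> x \<Longrightarrow> x = y + (x - y)" for x y :: hm
  unfolding minus_hm_def using someI_ex[OF hm_le_iff_ex[THEN iffD1]] by auto

lemma hm_add_diff: "a + b - a = b" for a b :: hm
  using hm_diff[of a "a + b"] hm_cancell hm_le_iff_ex by metis

lemma hm_diff0: "\<not> y \<le> x \<Longrightarrow> x - y = 0" for x y :: hm by (simp add: minus_hm_def)

instance hm :: linordered_semidom
proof
  fix a b c :: hm
  show "a + b + c = a + (b + c)" by (rule hm_adda)
  show "a + b = b + a" by (rule hm_addc)
  show "0 + a = a" by (rule hm_zadd)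
  show "a * b * c = a * (b * c)" by (rule hm_mula)
  show "a * b = b * a" by (rule hm_mulc)
  show "1 * a = a" using hm_mul1[of a] by (simp only: hm_mulc)
  show "(a + b) * c = a * c + b * c" by (rule hm_distr)
  show "a * (b + c) = a * b + a * c" by (rule hm_distl)
  show "0 * a = 0" "a * 0 = 0" by (simp_all add: hm_zmul hm_basic)
  show "(0::hm) \<noteq> 1" using hm_basic(1)[of 0] by (simp add: hm_zadd)
  show "a + b - a = b" by (rule hm_add_diff)
  show lin: "a \<le> b \<or> b \<le> a" for a b :: hm using hm_linear unfolding less_eq_hm_def by blast
  show "a < b \<longleftrightarrow> a \<le> b \<and> \<not> b \<le> a" unfolding less_eq_hm_def using hm_irrefl hm_trans by metis
  show "a \<le> a" by (simp add: less_eq_hm_def)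
  show tr: "a \<le> b \<Longrightarrow> b \<le> c \<Longrightarrow> a \<le> c" for a b c :: hm unfolding less_eq_hm_def using hm_trans by blast
  show "a \<le> b \<Longrightarrow> b \<le> a \<Longrightarrow> a = b" unfolding less_eq_hm_def using hm_irrefl hm_trans by metis
  show "a \<le> b \<Longrightarrow> c + a \<le> c + b" unfolding hm_le_iff_ex by (elim exE) (simp only: hm_adda, blast)
  show "(0::hm) < 1" using hm_less_self[of 0] by (simp add: hm_zadd)
  show "b \<le> a \<Longrightarrow> a - b + b = a" by (subst hm_addc) (rule hm_diff[symmetric])
  show d: "a - b - c = a - (b + c)" for a b c :: hm
  proof (cases "b + c \<le> a")
    case True
    then obtain z where z: "a = (b + c) + z" using hm_le_iff_ex by blast
    then have "a - b = c + z" by (simp only: hm_adda hm_add_diff)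
    moreover have "a - (b + c) = z" by (simp only: z hm_add_diff)
    ultimately show ?thesis by (simp only: hm_add_diff)
  next
    case False
    have "\<not> c \<le> a - b \<or> \<not> b \<le> a"
    proof (rule ccontr)
      assume "\<not> ?thesis"
      then obtain z where "a - b = c + z" "a = b + (a - b)" using hm_le_iff_ex hm_diff by blast
      then have "a = (b + c) + z" by (simp only: hm_adda)
      then show False using False hm_le_iff_ex by blast
    qed
    then show ?thesis
    proof
      assume "\<not> c \<le> a - b" then show ?thesis using False hm_diff0 by simp
    next
      assume "\<not> b \<le> a"
      moreover have "0 - c = 0"
      proof (cases "c \<le> 0")
        case True
        then have "c = 0" by (simp add: less_eq_hm_def hm_basic(7))
        then show ?thesis using hm_add_diff[of 0 0] by (simp add: hm_zadd)
      qed (simp add: hm_diff0)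
      ultimately show ?thesis using False hm_diff0 by simp
    qed
  qed
  have mono: "b \<le> c \<Longrightarrow> a * b \<le> a * c" for a b c :: hm unfolding hm_le_iff_ex by (elim exE) (simp only: hm_distl, blast)
  show "a * (b - c) = a * b - a * c"
  proof (cases "c \<le> b")
    case True
    then obtain z where z: "b = c + z" using hm_le_iff_ex by blast
    then show ?thesis by (simp add: hm_add_diff hm_distl)
  next
    case False
    then have "b \<le> c" using lin by blast
    then have le: "a * b \<le> a * c" using mono by blast
    have "a * b - a * c = 0"
    proof (cases "a * c \<le> a * b")
      case True
      then have "a * b = a * c" using le unfolding less_eq_hm_def using hm_irrefl hm_trans by metis
      then show ?thesis using hm_add_diff[of "a * c" 0] by (simp only: hm_basic(3))
    next
      case False then show ?thesis by (rule hm_diff0)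
    qed
    then show ?thesis using hm_diff0[OF False] by (simp add: hm_basic)
  qed
  show "a \<noteq> 0 \<Longrightarrow> b \<noteq> 0 \<Longrightarrow> a * b \<noteq> 0"
  proof -
    assume "a \<noteq> 0" "b \<noteq> 0"
    then obtain w v where "a = w + 1" "b = v + 1" using hm_pred by blast
    then have "a * b = (a * v + w) + 1" by (simp only: hm_basic(6) hm_adda)
    then show ?thesis using hm_basic(1) by simp
  qed
  show "a < b \<Longrightarrow> 0 < c \<Longrightarrow> c * a < c * b"
  proof -
    assume "a < b" "0 < c"
    then obtain z w where z: "b = a + (z + 1)" "c = 0 + (w + 1)" unfolding hm_less_iff_ex by blast
    have cw: "c = w + 1" using z(2) hm_zadd by simp
    have "c * z + c = (c * z + w) + 1" by (subst (2) cw) (simp only: hm_adda)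
    moreover have "c * b = c * a + (c * z + c)" by (simp only: z(1) hm_distl hm_mul1)
    ultimately have "c * b = c * a + ((c * z + w) + 1)" by (simp only:)
    then show ?thesis using hm_less_iff_ex by blast
  qed
qed

section \<open>The ordered ring of differences\<close>

text \<open>Linear arithmetic is only available over ordered rings, so inequalities in the model are
  decided in its ring of differences.\<close>

definition hzrel :: "hm \<times> hm \<Rightarrow> hm \<times> hm \<Rightarrow> bool" where
  "hzrel = (\<lambda>(a, b) (c, d). a + d = c + b)"

lemma hzrel_iff [simp]: "hzrel (a, b) (c, d) \<longleftrightarrow> a + d = c + b"
  by (simp add: hzrel_def)

quotient_type hz = "hm \<times> hm" / hzrel
proof (rule equivpI)
  show "reflp hzrel" by (auto simp: reflp_def)
  show "symp hzrel" by (auto simp: symp_def)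
  show "transp hzrel"
  proof (rule transpI)
    fix x y z assume h: "hzrel x y" "hzrel y z"
    obtain a b c d e f where p: "x = (a, b)" "y = (c, d)" "z = (e, f)" by (cases x; cases y; cases z) auto
    have "a + d = c + b" "c + f = e + d" using h p by simp_all
    then have "(a + d) + (c + f) = (c + b) + (e + d)" by (simp only:)
    then have "(a + f) + (c + d) = (e + b) + (c + d)" by (simp only: ac_simps)
    then show "hzrel x z" using p by simp
  qed
qed

instantiation hz :: comm_ring_1
begin
lift_definition zero_hz :: hz is "(0, 0)" .
lift_definition one_hz :: hz is "(1, 0)" .
lift_definition plus_hz :: "hz \<Rightarrow> hz \<Rightarrow> hz" is "\<lambda>(x, y) (u, v). (x + u, y + v)"
proof clarsimp
  fix a b a' b' c d c' d' :: hm assume "a + b' = a' + b" "c + d' = c' + d"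
  then have "(a + b') + (c + d') = (a' + b) + (c' + d)" by (simp only:)
  then show "a + c + (b' + d') = a' + c' + (b + d)" by (simp only: ac_simps)
qed
lift_definition uminus_hz :: "hz \<Rightarrow> hz" is "\<lambda>(x, y). (y, x)"
  by (clarsimp simp: add.commute)
lift_definition minus_hz :: "hz \<Rightarrow> hz \<Rightarrow> hz" is "\<lambda>(x, y) (u, v). (x + v, y + u)"
proof clarsimp
  fix a b a' b' c d c' d' :: hm assume "a + b' = a' + b" "c + d' = c' + d"
  then have "(a + b') + (c' + d) = (a' + b) + (c + d')" by (simp only:)
  then show "a + d + (b' + c') = a' + d' + (b + c)" by (simp only: ac_simps)
qed
lift_definition times_hz :: "hz \<Rightarrow> hz \<Rightarrow> hz" is "\<lambda>(x, y) (u, v). (x * u + y * v, x * v + y * u)"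
proof clarsimp
  fix s t u v w x y z :: hm
  assume "s + v = u + t" and "w + z = y + x"
  then have "(s + v) * w + (u + t) * x + u * (w + z) + v * (y + x) = (u + t) * w + (s + v) * x + u * (y + x) + v * (w + z)"
    by (simp only:)
  then have "(s * w + t * x + (u * z + v * y)) + (v * w + u * x + u * w + v * x) = (u * y + v * z + (s * x + t * w)) + (v * w + u * x + u * w + v * x)"
    by (simp only: distrib_left distrib_right ac_simps)
  then show "s * w + t * x + (u * z + v * y) = u * y + v * z + (s * x + t * w)" by simp
qed
instance
  by standard (transfer, clarsimp simp: algebra_simps)+
end

lemma hm_mult_mono_aux: "p < q \<Longrightarrow> c < c' \<Longrightarrow> c' * p + c * q < c' * q + c * (p::hm)"
proof -
  assume "p < q" "c < c'"
  then obtain k where k: "c' = c + k" "0 < k" by (metis add_diff_inverse le_add_diff_inverse less_imp_le not_gr_zero add.right_neutral less_irrefl zero_less_iff_neq_zero hm_less_iff_ex hm_less_add add.left_neutral)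
  have "k * p < k * q" using k \<open>p < q\<close> by (simp add: mult_strict_left_mono)
  then have "k * p + (c * p + c * q) < k * q + (c * p + c * q)" by simp
  then show ?thesis unfolding k by (simp only: distrib_right distrib_left ac_simps)
qed

instantiation hz :: linordered_idom
begin
lift_definition less_eq_hz :: "hz \<Rightarrow> hz \<Rightarrow> bool" is "\<lambda>(x, y) (u, v). x + v \<le> u + y"
proof clarsimp
  fix x y x' y' u v u' v' :: hm assume h: "x + y' = x' + y" "u + v' = u' + v"
  have "x + v \<le> u + y \<longleftrightarrow> (x + v) + (y' + v') \<le> (u + y) + (y' + v')" by simp
  also have "\<dots> \<longleftrightarrow> (x + y') + (v + v') \<le> (u + v') + (y + y')" by (simp only: ac_simps)
  also have "\<dots> \<longleftrightarrow> (x' + y) + (v + v') \<le> (u' + v) + (y + y')" by (simp only: h)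
  also have "\<dots> \<longleftrightarrow> (x' + v') + (y + v) \<le> (u' + y') + (y + v)" by (simp only: ac_simps)
  finally show "x + v \<le> u + y \<longleftrightarrow> x' + v' \<le> u' + y'" by simp
qed
definition less_hz :: "hz \<Rightarrow> hz \<Rightarrow> bool" where "less_hz x y \<longleftrightarrow> x \<le> y \<and> \<not> y \<le> x"
definition hz_abs: "\<bar>x::hz\<bar> = (if x < 0 then - x else x)"
definition sgn_hz :: "hz \<Rightarrow> hz" where "sgn_hz x = (if x = 0 then 0 else if 0 < x then 1 else - 1)"
instance
proof
  fix x y z :: hz
  show "x < y \<longleftrightarrow> x \<le> y \<and> \<not> y \<le> x" by (rule less_hz_def)
  show "x \<le> x" by transfer auto
  show "x \<le> y \<Longrightarrow> y \<le> z \<Longrightarrow> x \<le> z"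
  proof (transfer, clarsimp)
    fix a b c d e f :: hm assume "a + d \<le> c + b" "c + f \<le> e + d"
    then have "(a + d) + (c + f) \<le> (c + b) + (e + d)" by (rule add_mono)
    then have "(a + f) + (c + d) \<le> (e + b) + (c + d)" by (simp only: ac_simps)
    then show "a + f \<le> e + b" by simp
  qed
  show "x \<le> y \<Longrightarrow> y \<le> x \<Longrightarrow> x = y" by transfer auto
  show "x \<le> y \<or> y \<le> x" by transfer auto
  show "x \<le> y \<Longrightarrow> z + x \<le> z + y"
  proof (transfer, clarsimp)
    fix a b c d e f :: hm assume "a + d \<le> c + b"
    then have "(a + d) + (e + f) \<le> (c + b) + (e + f)" by simp
    then show "e + a + (f + d) \<le> e + c + (f + b)" by (simp only: ac_simps)
  qed
  show "\<bar>x\<bar> = (if x < 0 then - x else x)" by (rule hz_abs)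
  show "sgn x = (if x = 0 then 0 else if 0 < x then 1 else - 1)" by (rule sgn_hz_def)
  have "\<not> y \<le> x \<Longrightarrow> \<not> z \<le> 0 \<Longrightarrow> \<not> z * y \<le> z * x" for x y z :: hz
    apply transfer
    apply (clarsimp simp: not_le)
    apply (drule (1) hm_mult_mono_aux)
    apply (simp add: algebra_simps)
    done
  moreover have "x \<le> y \<or> y \<le> x" for x y :: hz by transfer auto
  ultimately show "x < y \<Longrightarrow> 0 < z \<Longrightarrow> z * x < z * y" unfolding less_hz_def by blast
qed
end

lift_definition ofm :: "hm \<Rightarrow> hz" is "\<lambda>x. (x, 0)" .

lemma ofm_simps [simp]:
  "ofm 0 = 0" "ofm 1 = 1" "ofm (x + y) = ofm x + ofm y" "ofm (x * y) = ofm x * ofm y"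
  by (transfer; simp)+

lemma ofm_le: "ofm x \<le> ofm y \<longleftrightarrow> x \<le> y" and ofm_eq: "ofm x = ofm y \<longleftrightarrow> x = y"
  by (transfer; simp)+

lemma ofm_numeral [simp]: "ofm (numeral k) = numeral k"
  by (induction k rule: num_induct) (simp_all only: numeral_One add_One numeral_inc ofm_simps)

lemma hm_nonneg [simp]: "(0::hm) \<le> x" unfolding hm_le_iff_ex by (rule exI[of _ x]) simp

lemma hm_not_less0 [simp]: "\<not> x < (0::hm)" by (simp add: not_less)

lemma hm_le0 [simp]: "x \<le> 0 \<longleftrightarrow> x = (0::hm)" by (metis antisym hm_nonneg order_refl)

lemma hm_gr0: "(0::hm) < x \<longleftrightarrow> x \<noteq> 0" by (metis hm_le0 not_le)

lemma ofm_nn: "0 \<le> ofm x" by (metis hm_nonneg ofm_simps(1) ofm_le)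

lemma hm_less_Suc: "x < y + 1 \<longleftrightarrow> x \<le> (y::hm)" by (simp add: hm_basic(8) le_less)

lemma hm_Suc_le: "x + 1 \<le> y \<longleftrightarrow> x < (y::hm)" by (metis hm_less_Suc not_le)

text \<open>Moves relations of the semiring into the ring of differences, where linear arithmetic
  and polynomial identities can be decided. By discreteness a strict inequality becomes a weak one
  with \<open>+ 1\<close>, so nothing is lost on the integers of the model.\<close>

lemma hz_trans: "x < y \<longleftrightarrow> ofm x + 1 \<le> ofm y" "x \<le> y \<longleftrightarrow> ofm x \<le> ofm y" "x = y \<longleftrightarrow> ofm x = ofm y"
  using hm_Suc_le[of x y] ofm_le[of "x + 1" y] by (simp_all add: ofm_le ofm_eq)

lemma hm_sq: "x \<le> x * (x::hm)"
proof (cases "x = 0")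
  case False
  then have "1 \<le> x" using hm_Suc_le[of 0 x] by (simp add: hm_gr0)
  then show ?thesis using mult_left_mono[of 1 x x] by simp
qed simp

section \<open>Pairing\<close>

text \<open>Evenness of \<open>n * (n + 1)\<close> makes the division by two in Cantor's pairing
  exact.\<close>

lemma hm_tri: "\<exists>w. n * (n + 1) = 2 * (w::hm)"
proof -
  have "\<exists>w. w < n * (n + 1) + 1 \<and> n * (n + 1) = (1 + 1) * w"
  proof (rule ind_fm[where a = "FEx 1 (FAnd (FLess VY (TPlus (TTimes VX (TPlus VX TO)) TO)) (FEq (TTimes VX (TPlus VX TO)) (TTimes tw VY)))" and P = "\<lambda>n. \<exists>w. w < n * (n + 1) + 1 \<and> n * (n + 1) = (1 + 1) * w"])
    fix n :: hm assume "\<exists>w. w < n * (n + 1) + 1 \<and> n * (n + 1) = (1 + 1) * w"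
    then obtain w where w: "n * (n + 1) = (1 + 1) * w" by blast
    then have e: "(n + 1) * (n + 1 + 1) = (1 + 1) * (w + n + 1)" by (simp only: distrib_left distrib_right mult_1 mult_1_right ac_simps)
    have "w + n + 1 \<le> (1 + 1) * (w + n + 1)" unfolding distrib_right by simp
    then show "\<exists>w. w < (n + 1) * (n + 1 + 1) + 1 \<and> (n + 1) * (n + 1 + 1) = (1 + 1) * w"
      unfolding e by (intro exI[of _ "w + n + 1"]) (simp add: hm_less_Suc)
  qed (auto intro!: bounded_intros simp: tw_def)
  then show ?thesis by (metis one_add_one)
qed

definition hpair :: "hm \<Rightarrow> hm \<Rightarrow> hm" where
  "hpair x y = (SOME z. 2 * z = (x + y) * (x + y + 1) + 2 * x)"

lemma hm_2cancel [simp]: "2 * x = 2 * y \<longleftrightarrow> x = (y::hm)" unfolding hz_trans by simp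

lemma hpair: "2 * hpair x y = (x + y) * (x + y + 1) + 2 * x"
proof -
  obtain w where "(x + y) * (x + y + 1) = 2 * w" using hm_tri by blast
  then have "2 * (w + x) = (x + y) * (x + y + 1) + 2 * x" by (simp add: distrib_left)
  then show ?thesis unfolding hpair_def by (rule someI)
qed

lemma hpair_eq: "z = hpair x y \<longleftrightarrow> 2 * z = (x + y) * (x + y + 1) + 2 * x"
  unfolding hpair[symmetric] by simp

text \<open>On the diagonal \<open>x + y = n\<close> the doubled code exceeds
  \<open>n * (n + 1)\<close> by at most \<open>2 * n\<close>, hence stays below the start of every
  later diagonal. Injectivity of pairing rests on this.\<close>

lemma tri_mono: "n < (m::hm) \<Longrightarrow> n * (n + 1) + 2 * n < m * (m + 1)"
proof -
  assume "n < m"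
  then have "(n + 1) * (n + 1 + 1) \<le> m * (m + 1)" by (intro mult_mono) (auto simp: hm_Suc_le)
  moreover have "n * (n + 1) + 2 * n < (n + 1) * (n + 1 + 1)"
    unfolding hz_trans by (simp add: algebra_simps)
  ultimately show ?thesis by order
qed

lemma hpair_inj: "hpair x y = hpair u v \<longleftrightarrow> x = u \<and> y = v"
proof
  assume e: "hpair x y = hpair u v"
  then have e2: "(x + y) * (x + y + 1) + 2 * x = (u + v) * (u + v + 1) + 2 * u" using hpair by metis
  have A: False if "x + y < u + v" "(x + y) * (x + y + 1) + 2 * x = (u + v) * (u + v + 1) + 2 * u" for x y u v :: hm
  proof -
    have "(x + y) * (x + y + 1) + 2 * x \<le> (x + y) * (x + y + 1) + 2 * (x + y)" by (simp add: mult_left_mono)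
    also have "\<dots> < (u + v) * (u + v + 1)" by (rule tri_mono[OF that(1)])
    also have "\<dots> \<le> (u + v) * (u + v + 1) + 2 * u" by simp
    finally show False using that(2) by simp
  qed
  have "x + y = u + v" using A[OF _ e2] A[OF _ e2[symmetric]] by (metis linorder_neqE)
  then show "x = u \<and> y = v" using e2 by simp
qed simp

lemma hpair_ge: "x \<le> hpair x y" "y \<le> hpair x y" "x + y \<le> hpair x y"
proof -
  have "x + y \<le> (x + y) * (x + y)" by (rule hm_sq)
  then have "2 * (x + y) \<le> 2 * hpair x y" unfolding hpair
    unfolding hz_trans using ofm_nn[of x] by (simp add: algebra_simps)
  then show "x + y \<le> hpair x y" unfolding hz_trans by simp
  then show "x \<le> hpair x y" "y \<le> hpair x y" by (meson add_increasing add_increasing2 hm_nonneg order_refl order_trans)+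
qed

text \<open>The successor walks along the diagonals: from \<open>(x, w + 1)\<close> to
  \<open>(x + 1, w)\<close>, and from the end \<open>(x, 0)\<close> of one to the start
  \<open>(0, x + 1)\<close> of the next.\<close>

lemma hpair_surj: "\<exists>x y. z = hpair x y"
proof -
  have "\<exists>x. x < z + 1 \<and> (\<exists>y. y < z + 1 \<and> (1 + 1) * z = (x + y) * ((x + y) + 1) + (1 + 1) * x)"
  proof (rule ind_fm[where a = "FEx 1 (FAnd (FLess VY (TPlus VX TO)) (FEx 2 (FAnd (FLess VZ (TPlus VX TO)) (pairT VY VZ VX))))" and
      P = "\<lambda>z. \<exists>x. x < z + 1 \<and> (\<exists>y. y < z + 1 \<and> (1 + 1) * z = (x + y) * ((x + y) + 1) + (1 + 1) * x)"])
    fix z :: hm assume "\<exists>x. x < z + 1 \<and> (\<exists>y. y < z + 1 \<and> (1 + 1) * z = (x + y) * ((x + y) + 1) + (1 + 1) * x)"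
    then obtain x y where "(1 + 1) * z = (x + y) * ((x + y) + 1) + (1 + 1) * x" by blast
    then have z: "2 * z = (x + y) * ((x + y) + 1) + 2 * x" by simp
    have "\<exists>u v. z + 1 = hpair u v"
    proof (cases "y = 0")
      case True
      have "2 * (z + 1) = (0 + (x + 1)) * (0 + (x + 1) + 1) + 2 * 0"
        using z True unfolding hz_trans by (simp add: algebra_simps)
      then show ?thesis using hpair_eq by blast
    next
      case False
      then obtain w where "y = w + 1" using hm_pred by blast
      then have "2 * (z + 1) = ((x + 1) + w) * ((x + 1) + w + 1) + 2 * (x + 1)"
        using z unfolding hz_trans by (simp add: algebra_simps)
      then show ?thesis using hpair_eq by blast
    qed
    then obtain u v where uv: "z + 1 = hpair u v" by blast
    then have "u < z + 1 + 1" "v < z + 1 + 1" "2 * (z + 1) = (u + v) * (u + v + 1) + 2 * u"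
      using hpair_ge[where x = u and y = v] hpair[of u v] by (auto simp: hm_less_Suc)
    then show "\<exists>x. x < z + 1 + 1 \<and> (\<exists>y. y < z + 1 + 1 \<and> (1 + 1) * (z + 1) = (x + y) * ((x + y) + 1) + (1 + 1) * x)"
      by auto
  next
    show "\<exists>x. x < 0 + 1 \<and> (\<exists>y. y < 0 + 1 \<and> (1 + 1) * 0 = (x + y) * ((x + y) + 1) + (1 + 1) * (x::hm))"
      by (intro exI[of _ 0] conjI) simp_all
  qed (auto intro!: bounded_intros simp: tw_def pairT_def)
  then show ?thesis unfolding hpair_eq by (metis one_add_one)
qed

definition hfst :: "hm \<Rightarrow> hm" where "hfst z = (THE x. \<exists>y. z = hpair x y)"
definition hsnd :: "hm \<Rightarrow> hm" where "hsnd z = (THE y. \<exists>x. z = hpair x y)"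

lemma hfst_pair [simp]: "hfst (hpair x y) = x" and hsnd_pair [simp]: "hsnd (hpair x y) = y"
  unfolding hfst_def hsnd_def by (auto simp: hpair_inj)

lemma hpair_fst_snd [simp]: "hpair (hfst z) (hsnd z) = z"
  using hpair_surj[of z] by auto

lemma sat_pairT [simp]: "sat MM e s (pairT t u v) \<longleftrightarrow> ev MM e v = hpair (ev MM e t) (ev MM e u)"
  by (simp add: pairT_def tw_def hpair_eq)

lemma bounded_pairT: "bounded (pairT s t u)" by (auto simp: pairT_def intro!: bounded_intros)

text \<open>A bounded counterpart of \<open>pairInF\<close>. As the language has no division, the
  bound is twice the pair plus one.\<close>

definition pairB :: "nat \<Rightarrow> tm \<Rightarrow> tm \<Rightarrow> nat \<Rightarrow> fm" where
  "pairB b s t X = FEx b (FAnd (FLess (TV b) (TPlus (TPlus (TTimes (TPlus s t) (TPlus (TPlus s t) TO)) (TTimes tw s)) TO)) (FAnd (pairT s t (TV b)) (FMem (TV b) X)))"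

lemma bounded_pairB: "b \<notin> fvt s \<Longrightarrow> b \<notin> fvt t \<Longrightarrow> bounded (pairB b s t X)"
  by (auto simp: pairB_def tw_def intro!: bounded_intros bounded_pairT)

lemma sat_pairB:
  assumes "b \<notin> fvt t" "b \<notin> fvt u"
  shows "sat MM e s (pairB b t u X) \<longleftrightarrow> hpair (ev MM e t) (ev MM e u) \<in> s X"
proof -
  have e: "ev MM (e(b := d)) t = ev MM e t" "ev MM (e(b := d)) u = ev MM e u" for d
    by (rule ev_cong; use assms in auto)+
  have "hpair x y < (x + y) * (x + y + 1) + 2 * x + 1" for x y
    unfolding hm_less_Suc hpair[symmetric] by (simp add: mult_2)
  then show ?thesis by (auto simp: pairB_def e tw_def)
qed

section \<open>Decidable predicates and recursive functions of the model\<close>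

text \<open>By \<open>\<Delta>\<^sup>0\<^sub>1\<close> comprehension this class is closed under
  relative computability. All arguments inside the model are phrased with \<open>dec\<close> and
  \<open>rec\<close> instead of with formulas.\<close>

definition dec :: "(hm \<Rightarrow> bool) \<Rightarrow> bool" where "dec P \<longleftrightarrow> {x. P x} \<in> SS"

definition rec :: "(hm \<Rightarrow> hm) \<Rightarrow> bool" where "rec f \<longleftrightarrow> dec (\<lambda>z. hsnd z = f (hfst z))"

definition senv :: "hm set \<Rightarrow> hm set \<Rightarrow> hm set \<Rightarrow> nat \<Rightarrow> hm set" where
  "senv A B C n = (if n = 0 then A else if n = 1 then B else C)"

lemma senv_simps [simp]: "senv A B C 0 = A" "senv A B C (Suc 0) = B" "senv A B C 2 = C"
  by (simp_all add: senv_def)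

lemma senv_SS: "A \<in> SS \<Longrightarrow> B \<in> SS \<Longrightarrow> C \<in> SS \<Longrightarrow> senv A B C n \<in> SS"
  by (simp add: senv_def)

lemma dec_fm:
  assumes "bounded a" "A \<in> SS" "B \<in> SS" "C \<in> SS" "\<And>x. P x \<longleftrightarrow> sat MM ((\<lambda>_. c)(0 := x)) (senv A B C) a"
  shows "dec P"
  unfolding dec_def assms(5) by (rule comp_bounded) (auto intro: assms(1-4) senv_SS)

lemma dec2_fm:
  assumes "bounded a" "A \<in> SS" "B \<in> SS" "C \<in> SS"
    "\<And>x y. Q x y \<longleftrightarrow> sat MM ((\<lambda>_. c)(0 := x, 1 := y)) (senv A B C) a" "fv a \<subseteq> {0, 1, 2, 3, 4, 5}"
  shows "dec (\<lambda>z. Q (hfst z) (hsnd z))"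
proof -
  \<comment> \<open>Variable \<open>6\<close> holds the pair, hence the restriction of
    \<open>a\<close> to the variables \<open>0\<close> to \<open>5\<close>.\<close>
  let ?b = "FEx 0 (FAnd (FLess (TV 0) (TPlus (TV 6) TO)) (FEx 1 (FAnd (FLess (TV 1) (TPlus (TV 6) TO)) (FAnd (pairT (TV 0) (TV 1) (TV 6)) a))))"
  have "{d. sat MM ((\<lambda>_. c)(6 := d)) (senv A B C) ?b} \<in> SS"
    by (rule comp_bounded) (auto intro!: assms(1-4) senv_SS bounded_intros bounded_pairT)
  moreover have "sat MM ((\<lambda>_. c)(6 := d)) (senv A B C) ?b \<longleftrightarrow> Q (hfst d) (hsnd d)" for d
  proof -
    have "sat MM ((\<lambda>_. c)(6 := d, 0 := x, 1 := y)) (senv A B C) a = sat MM ((\<lambda>_. c)(0 := x, 1 := y)) (senv A B C) a" for x y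
      by (rule sat_cong) (use assms(6) in auto)
    then have "sat MM ((\<lambda>_. c)(6 := d)) (senv A B C) ?b \<longleftrightarrow> (\<exists>x. x \<le> d \<and> (\<exists>y. y \<le> d \<and> d = hpair x y \<and> Q x y))"
      unfolding assms(5) by (simp add: hm_less_Suc del: fun_upd_apply)
        (simp add: fun_upd_def)
    also have "\<dots> \<longleftrightarrow> Q (hfst d) (hsnd d)"
    proof
      assume "Q (hfst d) (hsnd d)"
      then show "\<exists>x. x \<le> d \<and> (\<exists>y. y \<le> d \<and> d = hpair x y \<and> Q x y)"
        using hpair_ge[where x = "hfst d" and y = "hsnd d"] by (intro exI[of _ "hfst d"] conjI exI[of _ "hsnd d"]) simp_all
    qed auto
    finally show ?thesis .
  qed
  ultimately show ?thesis unfolding dec_def by simp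
qed

lemma dec_SS: "dec P \<Longrightarrow> {x. P x} \<in> SS" by (simp add: dec_def)

lemma SS_dec: "A \<in> SS \<Longrightarrow> dec (\<lambda>x. x \<in> A)" by (simp add: dec_def)

lemma dec_not: assumes "dec P" shows "dec (\<lambda>x. \<not> P x)"
  by (rule dec_fm[where a = "FNeg (FMem (TV 0) 0)", OF _ dec_SS[OF assms] dec_SS[OF assms] dec_SS[OF assms]])
    (auto intro!: bounded_intros)

lemma dec_imp: assumes "dec P" "dec Q" shows "dec (\<lambda>x. P x \<longrightarrow> Q x)"
  by (rule dec_fm[where a = "FImp (FMem (TV 0) 0) (FMem (TV 0) 1)", OF _ dec_SS[OF assms(1)] dec_SS[OF assms(2)] dec_SS[OF assms(1)]])
    (auto intro!: bounded_intros)

lemma dec_and: assumes "dec P" "dec Q" shows "dec (\<lambda>x. P x \<and> Q x)"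
  using dec_not[OF dec_imp[OF assms(1) dec_not[OF assms(2)]]] by simp

lemma dec_or: assumes "dec P" "dec Q" shows "dec (\<lambda>x. P x \<or> Q x)"
  using dec_imp[OF dec_not[OF assms(1)] assms(2)] by (simp add: disj_imp)

lemma dec_iff: assumes "dec P" "dec Q" shows "dec (\<lambda>x. P x \<longleftrightarrow> Q x)"
  using dec_and[OF dec_imp[OF assms] dec_imp[OF assms(2,1)]] by (simp add: iff_conv_conj_imp)

lemma SS0: "{} \<in> SS"
proof -
  have "dec (\<lambda>x. \<not> (x \<in> s0 0 \<longrightarrow> x \<in> s0 0))" by (intro dec_not dec_imp SS_dec s0)
  then show ?thesis by (simp add: dec_def)
qed

lemma delta1:
  assumes "dec (\<lambda>z. Q (hfst z) (hsnd z))" "dec (\<lambda>z. Q' (hfst z) (hsnd z))"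
    "\<And>x. (\<exists>y. Q x y) \<longleftrightarrow> (\<forall>y. Q' x y)"
  shows "dec (\<lambda>x. \<exists>y. Q x y)"
proof -
  let ?s = "senv {z. Q (hfst z) (hsnd z)} {z. Q' (hfst z) (hsnd z)} {}"
  let ?e = "\<lambda>_. 0 :: hm"
  have s: "?s X \<in> SS" for X by (intro senv_SS dec_SS assms SS0)
  have "{d. \<exists>y. sat MM (?e(0 := d, 1 := y)) ?s (pairB 2 (TV 0) (TV 1) 0)} \<in> SS"
    by (rule comp_delta1[where b = "pairB 2 (TV 0) (TV 1) 1"])
      (auto intro!: s bounded_pairB simp: sat_pairB assms(3))
  then show ?thesis by (simp add: sat_pairB dec_def)
qed

lemma sig_induct:
  assumes "dec (\<lambda>z. Q (hfst z) (hsnd z))" "\<exists>y. Q 0 y" "\<And>x y. Q x y \<Longrightarrow> \<exists>y. Q (x + 1) y"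
  shows "\<exists>y. Q x y"
proof -
  let ?s = "senv {z. Q (hfst z) (hsnd z)} {} {}"
  let ?e = "\<lambda>_. 0 :: hm"
  have s: "?s X \<in> SS" for X by (intro senv_SS dec_SS assms SS0)
  have e: "sat MM (?e(0 := d, 1 := y)) ?s (pairB 2 (TV 0) (TV 1) 0) \<longleftrightarrow> Q d y" for d y
    by (simp add: sat_pairB)
  have "\<exists>y. sat MM (?e(0 := x, 1 := y)) ?s (pairB 2 (TV 0) (TV 1) 0)"
    by (rule ind_sigma1[where m = 1]) (use s assms(2,3) in \<open>unfold e, auto intro!: bounded_pairB simp del: fun_upd_apply\<close>)
  then show ?thesis unfolding e .
qed

lemma dec_induct: assumes "dec P" "P 0" "\<And>x. P x \<Longrightarrow> P (x + 1)" shows "P x"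
  using set_ind[OF dec_SS[OF assms(1)], of x] assms(2,3) by blast

lemma graph_dec: "rec f \<Longrightarrow> {z. hsnd z = f (hfst z)} \<in> SS" unfolding rec_def by (rule dec_SS)

text \<open>Existence and uniqueness of the value turn the existential description of
  \<open>P (f x)\<close> into an equivalent universal one, as
  \<open>\<Delta>\<^sup>0\<^sub>1\<close> comprehension demands.\<close>

lemma rec_dec: assumes "rec f" "dec P" shows "dec (\<lambda>x. P (f x))"
proof -
  have 1: "dec (\<lambda>z. hsnd z = f (hfst z))" using assms(1) by (simp add: rec_def)
  have 2: "dec (\<lambda>z. P (hsnd z))"
    by (rule dec2_fm[where a = "FMem (TV 1) 0" and Q = "\<lambda>x y. P y", OF _ dec_SS[OF assms(2)] SS0 SS0]) (auto intro!: bounded_intros)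
  have "dec (\<lambda>x. \<exists>y. y = f x \<and> P y)"
    by (rule delta1[where Q' = "\<lambda>x y. y = f x \<longrightarrow> P y"]) (use dec_and[OF 1 2] dec_imp[OF 1 2] in simp_all)
  then show ?thesis by simp
qed

lemma rec_id: "rec (\<lambda>x. x)" unfolding rec_def
  by (rule dec2_fm[where a = "FEq (TV 1) (TV 0)" and Q = "\<lambda>x y. y = x", OF _ SS0 SS0 SS0]) (auto intro!: bounded_intros)

lemma rec_const: "rec (\<lambda>x. c)" unfolding rec_def
  by (rule dec2_fm[where a = "FEq (TV 1) (TV 2)" and Q = "\<lambda>x y. y = c" and c = c, OF _ SS0 SS0 SS0]) (auto intro!: bounded_intros)

lemma pair_ex: "(\<exists>u\<le>z. \<exists>v\<le>z. z = hpair u v \<and> P u v) \<longleftrightarrow> P (hfst z) (hsnd z)"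
proof
  assume "P (hfst z) (hsnd z)"
  then show "\<exists>u\<le>z. \<exists>v\<le>z. z = hpair u v \<and> P u v"
    using hpair_ge[where x = "hfst z" and y = "hsnd z"] by (intro exI[of _ "hfst z"] conjI exI[of _ "hsnd z"]) simp_all
qed auto

lemma fv_pairT [simp]: "fv (pairT s t u) = fvt s \<union> fvt t \<union> fvt u"
  by (auto simp: pairT_def tw_def)

lemma fv_derived [simp]: "fv (FAnd a b) = fv a \<union> fv b" "fv (FOr a b) = fv a \<union> fv b" "fv (FIff a b) = fv a \<union> fv b" "fv (FEx x a) = fv a - {x}"
  by (auto simp: FAnd_def FOr_def FIff_def FEx_def)

lemma fv_pairB [simp]: "b \<notin> fvt s \<Longrightarrow> b \<notin> fvt t \<Longrightarrow> fv (pairB b s t X) = fvt s \<union> fvt t"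
  by (auto simp: pairB_def tw_def)

text \<open>Both components are at most the pair, so unpairing costs only bounded
  quantifiers.\<close>

definition unp :: "nat \<Rightarrow> nat \<Rightarrow> nat \<Rightarrow> fm \<Rightarrow> fm" where
  "unp i n m a = FEx n (FAnd (FLess (TV n) (TPlus (TV i) TO)) (FEx m (FAnd (FLess (TV m) (TPlus (TV i) TO)) (FAnd (pairT (TV n) (TV m) (TV i)) a))))"

lemma sat_unp: "i \<noteq> n \<Longrightarrow> i \<noteq> m \<Longrightarrow> n \<noteq> m \<Longrightarrow> sat MM e s (unp i n m a) \<longleftrightarrow> sat MM (e(n := hfst (e i), m := hsnd (e i))) s a"
  using pair_ex[of "e i" "\<lambda>u v. sat MM (e(n := u, m := v)) s a"] by (simp add: unp_def hm_less_Suc)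

lemma bounded_unp: "i \<noteq> n \<Longrightarrow> i \<noteq> m \<Longrightarrow> bounded a \<Longrightarrow> bounded (unp i n m a)"
  by (auto simp: unp_def intro!: bounded_intros bounded_pairT)

lemma fv_unp [simp]: "fv (unp i n m a) = insert i (fv a - {n, m}) - {n}"
  by (auto simp: unp_def)

lemmas fm_simps = sat_pairB sat_unp hm_less_Suc bounded_pairB bounded_unp

lemma rec_comp: assumes "rec f" "rec g" shows "rec (\<lambda>x. f (g x))"
proof -
  let ?a = "\<lambda>F. unp 0 2 3 (F (pairB 5 (TV 2) (TV 1) 0) (pairB 5 (TV 1) (TV 3) 1))"
  have 1: "dec (\<lambda>w. hsnd w = g (hfst (hfst w)) \<and> hsnd (hfst w) = f (hsnd w))"
    by (rule dec2_fm[where a = "?a FAnd" and Q = "\<lambda>z u. u = g (hfst z) \<and> hsnd z = f u", OF _ graph_dec[OF assms(2)] graph_dec[OF assms(1)] SS0])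
      (auto intro!: bounded_intros bounded_unp bounded_pairB simp: fm_simps)
  have 2: "dec (\<lambda>w. hsnd w = g (hfst (hfst w)) \<longrightarrow> hsnd (hfst w) = f (hsnd w))"
    by (rule dec2_fm[where a = "?a FImp" and Q = "\<lambda>z u. u = g (hfst z) \<longrightarrow> hsnd z = f u", OF _ graph_dec[OF assms(2)] graph_dec[OF assms(1)] SS0])
      (auto intro!: bounded_intros bounded_unp bounded_pairB simp: fm_simps)
  have "dec (\<lambda>z. \<exists>u. u = g (hfst z) \<and> hsnd z = f u)"
    by (rule delta1[OF 1 2]) simp
  then show ?thesis by (simp add: rec_def)
qed

lemma rec_pair: assumes "rec s" "rec t" shows "rec (\<lambda>x. hpair (s x) (t x))"
  unfolding rec_def
proof (rule dec2_fm[where a = "unp 1 2 3 (FAnd (pairB 5 (TV 0) (TV 2) 0) (pairB 5 (TV 0) (TV 3) 1))"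
      and Q = "\<lambda>x y. y = hpair (s x) (t x)", OF _ graph_dec[OF assms(1)] graph_dec[OF assms(2)] SS0])
  fix x y :: hm
  have "y = hpair (s x) (t x) \<longleftrightarrow> hfst y = s x \<and> hsnd y = t x" by (metis hpair_fst_snd hfst_pair hsnd_pair)
  then show "y = hpair (s x) (t x) \<longleftrightarrow> sat MM ((\<lambda>_. 0)(0 := x, 1 := y)) (senv {z. hsnd z = s (hfst z)} {z. hsnd z = t (hfst z)} {}) (unp 1 2 3 (FAnd (pairB 5 (TV 0) (TV 2) 0) (pairB 5 (TV 0) (TV 3) 1)))"
    by (simp add: fm_simps)
qed (auto intro!: bounded_intros bounded_unp bounded_pairB simp: fm_simps)

lemma rec_hfst0: "rec hfst" unfolding rec_def
  by (rule dec2_fm[where a = "unp 0 2 3 (FEq (TV 1) (TV 2))" and Q = "\<lambda>x y. y = hfst x", OF _ SS0 SS0 SS0])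
   (auto intro!: bounded_intros bounded_unp bounded_pairB simp: fm_simps)

lemma rec_hsnd0: "rec hsnd" unfolding rec_def
  by (rule dec2_fm[where a = "unp 0 2 3 (FEq (TV 1) (TV 3))" and Q = "\<lambda>x y. y = hsnd x", OF _ SS0 SS0 SS0])
   (auto intro!: bounded_intros bounded_unp bounded_pairB simp: fm_simps)

lemmas rec_hfst = rec_comp[OF rec_hfst0] and rec_hsnd = rec_comp[OF rec_hsnd0]

lemma rec2: "rec (\<lambda>z. f (hfst z) (hsnd z)) \<Longrightarrow> rec s \<Longrightarrow> rec t \<Longrightarrow> rec (\<lambda>x. f (s x) (t x))"
  using rec_comp[OF _ rec_pair, of "\<lambda>z. f (hfst z) (hsnd z)" s t] by simp

lemma dec2: "dec (\<lambda>z. P (hfst z) (hsnd z)) \<Longrightarrow> rec s \<Longrightarrow> rec t \<Longrightarrow> dec (\<lambda>x. P (s x) (t x))"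
  using rec_dec[OF rec_pair, of s t "\<lambda>z. P (hfst z) (hsnd z)"] by simp

lemma rec_add: assumes "rec s" "rec t" shows "rec (\<lambda>x. s x + t x)"
proof -
  have "rec (\<lambda>z. hfst z + hsnd z)" unfolding rec_def
    by (rule dec2_fm[where a = "unp 0 2 3 (FEq (TV 1) (TPlus (TV 2) (TV 3)))" and Q = "\<lambda>x y. y = hfst x + hsnd x", OF _ SS0 SS0 SS0])
      (auto intro!: bounded_intros bounded_unp bounded_pairB simp: fm_simps)
  from rec2[OF this assms] show ?thesis .
qed

lemma rec_mult: assumes "rec s" "rec t" shows "rec (\<lambda>x. s x * t x)"
proof -
  have "rec (\<lambda>z. hfst z * hsnd z)" unfolding rec_def
    by (rule dec2_fm[where a = "unp 0 2 3 (FEq (TV 1) (TTimes (TV 2) (TV 3)))" and Q = "\<lambda>x y. y = hfst x * hsnd x", OF _ SS0 SS0 SS0])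
      (auto intro!: bounded_intros bounded_unp bounded_pairB simp: fm_simps)
  from rec2[OF this assms] show ?thesis .
qed

lemma dec_eq: "rec s \<Longrightarrow> rec t \<Longrightarrow> dec (\<lambda>x. s x = t x)"
  by (rule dec2[where P = "(=)"], rule dec2_fm[where a = "FEq (TV 0) (TV 1)" and Q = "(=)", OF _ SS0 SS0 SS0]) (auto intro!: bounded_intros)

lemma dec_less: "rec s \<Longrightarrow> rec t \<Longrightarrow> dec (\<lambda>x. s x < t x)"
  by (rule dec2[where P = "(<)"], rule dec2_fm[where a = "FLess (TV 0) (TV 1)" and Q = "(<)", OF _ SS0 SS0 SS0]) (auto intro!: bounded_intros)

lemma dec_le: "rec s \<Longrightarrow> rec t \<Longrightarrow> dec (\<lambda>x. s x \<le> t x)"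
  using dec_not[OF dec_less[of t s]] by (simp add: not_less)

lemma dec_mem: "A \<in> SS \<Longrightarrow> rec s \<Longrightarrow> dec (\<lambda>x. s x \<in> A)"
  by (rule rec_dec[OF _ SS_dec])

lemma dec_const: "dec (\<lambda>x. c)"
proof -
  have "dec (\<lambda>x::hm. x = x)" "dec (\<lambda>x::hm. x \<noteq> x)" by (intro dec_not dec_eq rec_id)+
  then show ?thesis by (cases c) auto
qed

lemma dec_all: assumes "dec (\<lambda>w. Q (hfst w) (hsnd w))" "rec t" shows "dec (\<lambda>x. \<forall>y<t x. Q x y)"
proof (rule dec2[where P = "\<lambda>x u. \<forall>y<u. Q x y", OF _ rec_id assms(2)])
  show "dec (\<lambda>z. \<forall>y<hsnd z. Q (hfst z) y)"
    by (rule dec2_fm[where a = "FAll 2 (FImp (FLess (TV 2) (TV 1)) (pairB 5 (TV 0) (TV 2) 0))" and Q = "\<lambda>x u. \<forall>y<u. Q x y", OF _ dec_SS[OF assms(1)] SS0 SS0])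
      (auto intro!: bounded_intros bounded_unp bounded_pairB simp: fm_simps)
qed

lemma dec_ex: assumes "dec (\<lambda>w. Q (hfst w) (hsnd w))" "rec t" shows "dec (\<lambda>x. \<exists>y<t x. Q x y)"
  using dec_not[OF dec_all[OF dec_not[OF assms(1)] assms(2)]] by simp

lemma dec_all_le: assumes "dec (\<lambda>w. Q (hfst w) (hsnd w))" "rec t" shows "dec (\<lambda>x. \<forall>y\<le>t x. Q x y)"
  using dec_all[OF assms(1) rec_add[OF assms(2) rec_const[of 1]]] by (simp add: hm_less_Suc)

lemma dec_ex_le: assumes "dec (\<lambda>w. Q (hfst w) (hsnd w))" "rec t" shows "dec (\<lambda>x. \<exists>y\<le>t x. Q x y)"
  using dec_ex[OF assms(1) rec_add[OF assms(2) rec_const[of 1]]] by (simp add: hm_less_Suc)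

lemma rec_if: assumes "dec P" "rec s" "rec t" shows "rec (\<lambda>x. if P x then s x else t x)"
proof -
  have "dec (\<lambda>z. P (hfst z) \<and> hsnd z = s (hfst z) \<or> \<not> P (hfst z) \<and> hsnd z = t (hfst z))"
    by (intro dec_or dec_and dec_not dec_eq rec_hsnd rec_id rec_comp[OF assms(2)] rec_comp[OF assms(3)] rec_hfst rec_dec[OF _ assms(1)])
  moreover have "(\<lambda>z. P (hfst z) \<and> hsnd z = s (hfst z) \<or> \<not> P (hfst z) \<and> hsnd z = t (hfst z)) = (\<lambda>z. hsnd z = (if P (hfst z) then s (hfst z) else t (hfst z)))"
    by auto
  ultimately show ?thesis unfolding rec_def by simp
qed

text \<open>Closure rules that reduce the decidability of a statement to its shape. The later
  collections \<open>rr1\<close> to \<open>rr6\<close> add functions and predicates as they become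
  available.\<close>

lemmas rr0 = dec_not dec_imp dec_and dec_or dec_iff dec_eq dec_less dec_le dec_all dec_ex dec_all_le dec_ex_le
  rec_if rec_add rec_mult rec_pair rec_hfst rec_hsnd rec_id rec_const dec_const

lemma dec_least: assumes "dec P" "P x" shows "\<exists>y. P y \<and> (\<forall>z<y. \<not> P z)"
proof (rule ccontr)
  assume n: "\<not> ?thesis"
  have "\<forall>z<y. \<not> P z" for y
  proof (rule dec_induct[of "\<lambda>y. \<forall>z<y. \<not> P z"])
    show "dec (\<lambda>y. \<forall>z<y. \<not> P z)" by (intro rr0 rec_dec[OF _ assms(1)])
  qed (use n in \<open>auto simp: hm_less_Suc le_less\<close>)
  then show False using assms(2) hm_less_self by blast
qed

lemma dec_Least: assumes "dec P" "P x" shows "P (LEAST y. P y)" "(LEAST y. P y) \<le> x" "z < (LEAST y. P y) \<Longrightarrow> \<not> P z"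
proof -
  obtain y where y: "P y" "\<forall>z<y. \<not> P z" using dec_least assms by blast
  then have "(LEAST y. P y) = y" by (intro Least_equality) (auto simp: not_less[symmetric])
  then show "P (LEAST y. P y)" "(LEAST y. P y) \<le> x" "z < (LEAST y. P y) \<Longrightarrow> \<not> P z"
    using y assms(2) by (auto simp: not_less[symmetric])
qed

lemma dec_section: assumes "dec (\<lambda>z. Q (hfst z) (hsnd z))" shows "dec (Q x)"
  using dec2[OF assms rec_const rec_id, of x] by simp

text \<open>Minimisation of a search that always succeeds: its graph says that the value is found
  and that nothing smaller is, which is decidable.\<close>

lemma rec_Least:
  assumes "dec (\<lambda>z. Q (hfst z) (hsnd z))" "\<And>x. \<exists>y. Q x y"
  shows "rec (\<lambda>x. LEAST y. Q x y)"
proof -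
  have "dec (\<lambda>z. Q (hfst z) (hsnd z) \<and> (\<forall>y<hsnd z. \<not> Q (hfst z) y))"
    by (intro rr0 assms dec2[OF assms(1)])
  moreover have "(\<lambda>z. Q (hfst z) (hsnd z) \<and> (\<forall>y<hsnd z. \<not> Q (hfst z) y)) = (\<lambda>z. hsnd z = (LEAST y. Q (hfst z) y))"
  proof (rule ext)
    fix z
    obtain y where "Q (hfst z) y" using assms(2) by blast
    from dec_Least[OF dec_section[OF assms(1)] this] show "(Q (hfst z) (hsnd z) \<and> (\<forall>y<hsnd z. \<not> Q (hfst z) y)) = (hsnd z = (LEAST y. Q (hfst z) y))"
      by (metis Least_equality not_less)
  qed
  ultimately show ?thesis unfolding rec_def by simp
qed

section \<open>Goedel's beta function and primitive recursion\<close>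

lemma dec3: "dec (\<lambda>z. P (hfst z) (hfst (hsnd z)) (hsnd (hsnd z))) \<Longrightarrow> rec a \<Longrightarrow> rec b \<Longrightarrow> rec c \<Longrightarrow> dec (\<lambda>x. P (a x) (b x) (c x))"
  using rec_dec[OF rec_pair[OF _ rec_pair], of a b c "\<lambda>z. P (hfst z) (hfst (hsnd z)) (hsnd (hsnd z))"] by simp

text \<open>Taking the least remainder makes the function total without a condition on the modulus;
  for \<open>m = 0\<close> its value is \<open>c\<close>.\<close>

definition hmod :: "hm \<Rightarrow> hm \<Rightarrow> hm" where "hmod c m = (LEAST r. \<exists>q\<le>c. c = q * m + r)"

lemma hmod_dec: "dec (\<lambda>w. \<exists>q\<le>hfst (hfst w). hfst (hfst w) = q * hsnd (hfst w) + hsnd w)"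
  by (intro rr0)

lemma rec_hmod: assumes "rec s" "rec t" shows "rec (\<lambda>x. hmod (s x) (t x))"
proof -
  have "rec (\<lambda>z. LEAST r. \<exists>q\<le>hfst z. hfst z = q * hsnd z + r)"
  proof (rule rec_Least[OF hmod_dec])
    fix x show "\<exists>y. \<exists>q\<le>hfst x. hfst x = q * hsnd x + y" by (intro exI[of _ "hfst x"] exI[of _ 0]) simp
  qed
  from rec2[where f = hmod, OF _ assms] this show ?thesis unfolding hmod_def by simp
qed

lemma hmod_ex0: "(\<exists>q\<le>c. c = q * m + hmod c m) \<and> (r < hmod c m \<longrightarrow> \<not> (\<exists>q\<le>c. c = q * m + r))"
proof -
  have d: "dec (\<lambda>r. \<exists>q\<le>c. c = q * m + r)" by (intro rr0)
  have "\<exists>q\<le>c. c = q * m + c" by (intro exI[of _ 0]) simp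
  from dec_Least(1,3)[of "\<lambda>r. \<exists>q\<le>c. c = q * m + r", OF d this] show ?thesis unfolding hmod_def by blast
qed

lemma hmod_ex: "\<exists>q. c = q * m + hmod c m" using hmod_ex0 by blast

lemma hm_le_mult: "0 < m \<Longrightarrow> q \<le> q * (m::hm)"
  using mult_left_mono[of 1 m q] hm_Suc_le[of 0 m] by simp

lemma hmod_less: assumes "0 < m" shows "hmod c m < m"
proof (rule ccontr)
  assume "\<not> hmod c m < m"
  then obtain r where r: "hmod c m = m + r" using hm_le_iff_ex by (auto simp: not_less)
  obtain q where q: "c = q * m + hmod c m" using hmod_ex by blast
  have c: "c = (q + 1) * m + r" using q unfolding r by (simp add: algebra_simps)
  moreover have "q + 1 \<le> (q + 1) * m" using hm_le_mult[OF assms] .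
  ultimately have "q + 1 \<le> c" by (metis add_increasing2 hm_nonneg)
  moreover have "r < hmod c m" using r assms by simp
  ultimately show False using hmod_ex0[of c m r] c by blast
qed

lemma div_unique: assumes "q * m + r = q' * m + r'" "r < m" "r' < (m::hm)" shows "r = r'"
proof -
  have A: False if "q * m + r = q' * m + r'" "r < m" "r' < m" "q < q'" for q r q' r' :: hm
  proof -
    have "(q + 1) * m \<le> q' * m" using that(4) by (intro mult_right_mono) (auto simp: hm_Suc_le)
    then show False using that(1,2) ofm_nn[of r'] unfolding hz_trans by (simp add: algebra_simps)
  qed
  then have "q = q'" using A[OF assms] A[OF assms(1)[symmetric] assms(3,2)] by (metis linorder_neqE)
  then show ?thesis using assms(1) by simp
qed

lemma hmod_unique: "c = q * m + r \<Longrightarrow> r < m \<Longrightarrow> hmod c m = r"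
  using div_unique hmod_ex[of c m] hmod_less[of m c] by (metis hm_gr0 hm_not_less0)

section \<open>Coprimality and the Chinese remainder theorem\<close>

definition cop :: "hm \<Rightarrow> hm \<Rightarrow> bool" where "cop P m \<longleftrightarrow> (\<exists>u v. u * P = 1 + v * m)"
text \<open>The bounded form of \<open>cop\<close>, equivalent to it for moduli above 1. Unlike the
  existential form it may occur negatively or under quantifiers in an induction statement.\<close>

definition copd :: "hm \<Rightarrow> hm \<Rightarrow> bool" where "copd P m \<longleftrightarrow> (\<exists>u<m. hmod (u * P) m = 1)"

lemma copd_cop: assumes "1 < m" shows "copd P m \<longleftrightarrow> cop P m"
proof
  assume "copd P m"
  then obtain u where "hmod (u * P) m = 1" unfolding copd_def by blast
  then show "cop P m" unfolding cop_def using hmod_ex[of "u * P" m] by (metis add.commute)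
next
  assume "cop P m"
  then obtain u v where uv: "u * P = 1 + v * m" unfolding cop_def by blast
  have m0: "0 < m" using assms by (metis hm_gr0 hm_not_less0)
  obtain q where q: "u = q * m + hmod u m" using hmod_ex by blast
  obtain q' where q': "hmod u m * P = q' * m + hmod (hmod u m * P) m" using hmod_ex by blast
  have "u * P = q * m * P + hmod u m * P" by (subst (1) q) (simp add: distrib_right)
  also have "\<dots> = (q * P + q') * m + hmod (hmod u m * P) m" by (subst (1) q') (simp add: algebra_simps)
  finally have "hmod (u * P) m = hmod (hmod u m * P) m" by (rule hmod_unique) (rule hmod_less[OF m0])
  moreover have "hmod (u * P) m = 1" by (rule hmod_unique[of _ v]) (use uv assms in \<open>auto simp: add.commute\<close>)
  ultimately show "copd P m" unfolding copd_def using hmod_less[OF m0] by (intro exI[of _ "hmod u m"]) simp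
qed

lemma cop_mult: assumes "cop P m" "cop P' m" shows "cop (P * P') m"
proof -
  obtain u v u' v' where "u * P = 1 + v * m" "u' * P' = 1 + v' * m" using assms unfolding cop_def by blast
  then have "(u * u') * (P * P') = 1 + (v + v' + v * v' * m) * m"
    unfolding hz_trans ofm_simps by algebra
  then show ?thesis unfolding cop_def by blast
qed

text \<open>Multiplying \<open>v * b = u * a - 1\<close> by \<open>a - 1\<close> changes the residue
  modulo \<open>a\<close> from -1 to 1; the remaining multiple of \<open>a\<close> is
  \<open>u * (a - 1) - 1\<close>, written as \<open>w\<close> to avoid subtraction.\<close>

lemma cop_sym: assumes "cop a b" "1 < a" shows "cop b a"
proof -
  obtain u v where uv: "u * a = 1 + v * b" using assms unfolding cop_def by blast
  obtain k where k: "a = 1 + (k + 1)" using assms(2) hm_less_iff_ex by blast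
  have "u \<noteq> 0" using uv hm_basic(1)[of "v * b"] by (auto simp: add.commute)
  then have "u * (k + 1) \<noteq> 0" using hm_basic(1) by simp
  then obtain w where w: "u * (k + 1) = w + 1" using hm_pred by blast
  have "(k + 1) * v * b = 1 + w * a" using uv w unfolding k hz_trans ofm_simps by algebra
  then show ?thesis unfolding cop_def by blast
qed

text \<open>Write \<open>m\<close> and \<open>m'\<close> for the two moduli. Eliminating
  \<open>d\<close> gives \<open>(i + 1) * m' = (j + 1) * m - e\<close>. Multiplication by
  \<open>(i + 1) * w\<close> replaces the error term by \<open>(i + 1) * d = m - 1\<close>, which
  yields a Bezout identity.\<close>

lemma cop_moduli:
  assumes "j = i + e" "d = e * w" "0 < w" "0 < e"
  shows "cop (1 + (i + 1) * d) (1 + (j + 1) * d)"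
proof -
  have "(i + 1) * (j + 1) * w \<noteq> 0" using assms(3) by (simp add: hm_gr0 hm_basic(1))
  then obtain v where v: "(i + 1) * (j + 1) * w = v + 1" using hm_pred by blast
  have "((i + 1) * (i + 1) * w) * (1 + (j + 1) * d) = 1 + v * (1 + (i + 1) * d)"
    using v assms(1,2) unfolding hz_trans ofm_simps by algebra
  then have "cop (1 + (j + 1) * d) (1 + (i + 1) * d)" unfolding cop_def by blast
  moreover have "1 < 1 + (j + 1) * d" using assms by (simp add: hm_gr0 hm_basic(1))
  ultimately show ?thesis by (rule cop_sym)
qed

lemma less_Suc_cases: "i < k + 1 \<Longrightarrow> (i < k \<Longrightarrow> P) \<Longrightarrow> (i = k \<Longrightarrow> P) \<Longrightarrow> P" for i k :: hm
  by (auto simp: hm_basic(8))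

lemma bound_ex: assumes "rec f" shows "\<exists>B. \<forall>i<k. f i < B"
proof (rule sig_induct[where Q = "\<lambda>k B. \<forall>i<k. f i < B"])
  show "dec (\<lambda>z. \<forall>i<hfst z. f i < hsnd z)" by (intro rr0 rec_comp[OF assms])
  fix k B assume "\<forall>i<k. f i < B"
  then have "f i < B + f k + 1" if "i < k + 1" for i
    using that by (elim less_Suc_cases) (auto simp: hm_less_Suc, meson add_increasing2 hm_nonneg less_imp_le)
  then show "\<exists>B. \<forall>i<k + 1. f i < B" by blast
qed simp

text \<open>A common multiple of \<open>1, ..., n\<close> replaces the factorial: primitive
  recursion is itself derived from the coding that this lemma serves.\<close>

lemma mult_ex: "\<exists>D::hm. 0 < D \<and> (\<forall>j<n. \<exists>w\<le>D. D = (j + 1) * w)"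
proof (rule sig_induct[where Q = "\<lambda>n D. 0 < D \<and> (\<forall>j<n. \<exists>w\<le>D. D = (j + 1) * w)"])
  show "dec (\<lambda>z. 0 < hsnd z \<and> (\<forall>j<hfst z. \<exists>w\<le>hsnd z. hsnd z = (j + 1) * w))" by (intro rr0)
  show "\<exists>D::hm. 0 < D \<and> (\<forall>j<0. \<exists>w\<le>D. D = (j + 1) * w)" by (intro exI[of _ 1]) simp
  fix n D :: hm assume D: "0 < D \<and> (\<forall>j<n. \<exists>w\<le>D. D = (j + 1) * w)"
  have n1: "0 < n + 1" by (simp add: hm_gr0 hm_basic(1))
  have "\<exists>w\<le>D * (n + 1). D * (n + 1) = (j + 1) * w" if "j < n + 1" for j
    using that
  proof (rule less_Suc_cases)
    assume "j < n"
    then obtain w where w: "w \<le> D" "D = (j + 1) * w" using D by blast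
    then have "w * (n + 1) \<le> D * (n + 1)" by (intro mult_right_mono) auto
    then show ?thesis using w(2) by (intro exI[of _ "w * (n + 1)"]) (simp add: mult.assoc)
  next
    assume "j = n"
    then show ?thesis using hm_le_mult[OF n1] by (intro exI[of _ D]) (simp add: mult.commute)
  qed
  then show "\<exists>D. 0 < D \<and> (\<forall>j<n + 1. \<exists>w\<le>D. D = (j + 1) * w)" using D n1
    by (intro exI[of _ "D * (n + 1)"]) (simp add: hm_gr0)
qed

definition hlen :: "hm \<Rightarrow> hm" where "hlen s = hfst s"
definition hent :: "hm \<Rightarrow> hm \<Rightarrow> hm" where "hent s i = hmod (hfst (hsnd s)) (1 + (i + 1) * hsnd (hsnd s))"

lemma rec_hlen: "rec s \<Longrightarrow> rec (\<lambda>x. hlen (s x))" unfolding hlen_def by (intro rr0)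
lemma rec_hent: "rec s \<Longrightarrow> rec t \<Longrightarrow> rec (\<lambda>x. hent (s x) (t x))" unfolding hent_def by (intro rr0 rec_hmod)
lemma dec_copd: "rec s \<Longrightarrow> rec t \<Longrightarrow> dec (\<lambda>x. copd (s x) (t x))"
  by (rule dec2[where P = copd]) (unfold copd_def, intro rr0 rec_hmod)

lemmas rr1 = rr0 rec_hmod rec_hlen rec_hent dec_copd

lemma seq_comp: assumes f: "rec f" shows "\<exists>s. hlen s = k \<and> (\<forall>i<k. hent s i = f i)"
proof -
  obtain B where B: "\<And>i. i < k \<Longrightarrow> f i < B" using bound_ex[OF f] by blast
  obtain D where D: "0 < D" "\<And>j. j < k \<Longrightarrow> \<exists>w\<le>D. D = (j + 1) * w" using mult_ex by blast
  \<comment> \<open>The factor \<open>D\<close> makes the moduli pairwise coprime, the factor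
    \<open>B + 1\<close> makes them exceed all values to be coded.\<close>
  define d where "d = D * (B + 1)"
  define m where "m i = 1 + (i + 1) * d" for i
  have dB: "B < d" using hm_le_mult[OF D(1), of "B + 1"] unfolding d_def by (simp add: hm_Suc_le mult.commute)
  have dm: "d < m i" for i
  proof -
    have "d \<le> d * (i + 1)" by (rule hm_le_mult) (simp add: hm_gr0 hm_basic(1))
    then show ?thesis unfolding m_def by (metis add.commute hm_less_Suc mult.commute)
  qed
  have fm: "f i < m i" if "i < k" for i j using B[OF that] dB dm[of i] by order
  have m1: "1 < m i" for i using dm[of i] dB by (metis hm_Suc_le add_0 hm_gr0 hm_not_less0 le_less_trans)
  have m0: "0 < m i" for i unfolding m_def by (simp add: add_pos_nonneg)
  have recm: "rec m" unfolding m_def by (intro rr0)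
  note rm = rec_comp[OF recm] rec_comp[OF f]
  \<comment> \<open>\<open>y\<close> pairs a solution of the first \<open>n\<close> congruences with
    a common multiple of their moduli that is coprime to the remaining moduli.\<close>
  define Q where "Q n y \<longleftrightarrow> (n \<le> k \<longrightarrow> (\<forall>i<n. hmod (hfst y) (m i) = f i) \<and> (\<forall>i<n. \<exists>w\<le>hsnd y. hsnd y = m i * w) \<and> (\<forall>j<k. n \<le> j \<longrightarrow> copd (hsnd y) (m j)))" for n y
  have "\<exists>y. Q k y"
  proof (rule sig_induct[of Q])
    show "dec (\<lambda>z. Q (hfst z) (hsnd z))" unfolding Q_def by (intro rr1 rm)
    have "cop 1 (m j)" for j unfolding cop_def by (intro exI[of _ 1] exI[of _ 0]) simp
    then have "Q 0 (hpair 0 1)" unfolding Q_def by (simp add: copd_cop[OF m1])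
    then show "\<exists>y. Q 0 y" by blast
  next
    fix n y assume IH: "Q n y"
    show "\<exists>y. Q (n + 1) y"
    proof (cases "n + 1 \<le> k")
      case False then show ?thesis unfolding Q_def by blast
    next
      case True
      then have nk: "n < k" by (simp add: hm_Suc_le)
      define c P where "c = hfst y" and "P = hsnd y"
      have 1: "\<And>i. i < n \<Longrightarrow> hmod c (m i) = f i" "\<And>i. i < n \<Longrightarrow> \<exists>w\<le>P. P = m i * w" "\<And>j. j < k \<Longrightarrow> n \<le> j \<Longrightarrow> copd P (m j)"
        using IH nk unfolding Q_def c_def P_def by auto
      obtain u v where uv: "u * P = 1 + v * m n" using 1(3)[OF nk] copd_cop[OF m1] unfolding cop_def by blast
      define R where "R = hmod c (m n)"
      obtain q where q: "c = q * m n + R" using hmod_ex unfolding R_def by blast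
      have "R \<le> m n" unfolding R_def using hmod_less[OF m0] by (rule less_imp_le)
      then obtain r where r: "m n = R + r" unfolding hm_le_iff_ex by blast
      \<comment> \<open>Modulo \<open>m n\<close> the product \<open>u * P\<close> is 1 and
        \<open>R + r\<close> is 0, so adding \<open>P * t\<close> moves the residue from
        \<open>R\<close> to \<open>f n\<close>. The earlier residues survive because their moduli
        divide \<open>P\<close>.\<close>
      define t where "t = u * (f n + r)"
      define c' where "c' = c + P * t"
      have "P * t = (u * P) * (f n + r)" unfolding t_def by (simp only: ac_simps)
      then have "c' = (q * m n + R) + (1 + v * m n) * (f n + r)"
        unfolding c'_def uv by (simp only: q)
      also have "\<dots> = q * m n + (R + r) + f n + v * m n * (f n + r)" by (simp add: algebra_simps)
      also have "\<dots> = q * m n + m n + f n + v * m n * (f n + r)" by (simp only: r)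
      also have "\<dots> = (q + 1 + v * (f n + r)) * m n + f n" by (simp add: algebra_simps)
      finally have "c' = (q + 1 + v * (f n + r)) * m n + f n" .
      then have a: "hmod c' (m n) = f n" by (rule hmod_unique) (rule fm[OF nk])
      have b: "hmod c' (m i) = f i" if i: "i < n" for i
      proof -
        obtain qi where qi: "c = qi * m i + f i" using hmod_ex[of c "m i"] 1(1)[OF i] by auto
        obtain w where w: "P = m i * w" using 1(2)[OF i] by blast
        have "c' = (qi + w * t) * m i + f i" unfolding c'_def by (subst qi, subst w) (simp add: algebra_simps)
        then show ?thesis by (rule hmod_unique) (rule fm, use i nk in order)
      qed
      have dv: "\<exists>w\<le>P * m n. P * m n = m i * w" if "i < n + 1" for i
      proof -
        have "\<exists>w. P * m n = m i * w"
          using that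
        proof (rule less_Suc_cases)
          assume "i < n"
          then obtain w where "P = m i * w" using 1(2) by blast
          then have "P * m n = m i * (w * m n)" by (simp add: mult.assoc)
          then show ?thesis by blast
        next
          assume "i = n" then show ?thesis by (metis mult.commute)
        qed
        then obtain w where "P * m n = m i * w" by blast
        then show ?thesis using hm_le_mult[OF m0, of w i] by (auto simp: mult.commute)
      qed
      have co: "copd (P * m n) (m j)" if jk: "j < k" "n + 1 \<le> j" for j
      proof -
        have nj: "n < j" using jk(2) by (simp add: hm_Suc_le)
        then obtain e where e: "j = n + (e + 1)" using hm_less_iff_ex by blast
        have "e < j" unfolding e using hm_less_add[of e n] by (simp add: ac_simps)
        then obtain w where w: "D = (e + 1) * w" using D(2)[OF less_trans[OF _ jk(1)]] by blast
        have "cop (m n) (m j)" unfolding m_def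
        proof (rule cop_moduli[OF e])
          show "d = (e + 1) * (w * (B + 1))" unfolding d_def w by (simp add: mult.assoc)
          show "0 < w * (B + 1)" using D(1) w by (auto simp: hm_gr0 hm_basic(1))
        qed (simp add: hm_gr0 hm_basic(1))
        moreover have "cop P (m j)" using 1(3)[OF jk(1)] nj copd_cop[OF m1] by simp
        ultimately show ?thesis using cop_mult copd_cop[OF m1] by blast
      qed
      have "Q (n + 1) (hpair c' (P * m n))" unfolding Q_def hfst_pair hsnd_pair
        using a b dv co by (auto elim!: less_Suc_cases)
      then show ?thesis by blast
    qed
  qed
  then obtain y where "Q k y" by blast
  then have "\<forall>i<k. hent (hpair k (hpair (hfst y) d)) i = f i" unfolding Q_def hent_def m_def by simp
  then show ?thesis by (intro exI[of _ "hpair k (hpair (hfst y) d)"]) (simp add: hlen_def)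
qed

section \<open>Primitive recursion by least traces\<close>

definition prtrace :: "(hm \<Rightarrow> hm) \<Rightarrow> (hm \<Rightarrow> hm) \<Rightarrow> hm \<Rightarrow> hm \<Rightarrow> hm \<Rightarrow> bool" where
  "prtrace f g x n s \<longleftrightarrow> hent s 0 = f x \<and> (\<forall>i<n. hent s (i + 1) = g (hpair x (hpair i (hent s i))))"

definition prc :: "(hm \<Rightarrow> hm) \<Rightarrow> (hm \<Rightarrow> hm) \<Rightarrow> hm \<Rightarrow> hm \<Rightarrow> hm" where
  "prc f g x n = hent (LEAST s. prtrace f g x n s) n"

context
  fixes f g :: "hm \<Rightarrow> hm"
  assumes fg: "rec f" "rec g"
begin

lemma prtrace_dec: "rec a \<Longrightarrow> rec b \<Longrightarrow> rec c \<Longrightarrow> dec (\<lambda>z. prtrace f g (a z) (b z) (c z))"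
  by (rule dec3[where P = "prtrace f g"]) (unfold prtrace_def, intro rr1 rec_comp[OF fg(1)] rec_comp[OF fg(2)])

lemma prtrace_ex: "\<exists>s. prtrace f g x n s"
proof (rule sig_induct[of "prtrace f g x"])
  show "dec (\<lambda>z. prtrace f g x (hfst z) (hsnd z))" by (intro prtrace_dec rr0)
  obtain s where "\<forall>i<1. hent s i = f x" using seq_comp[OF rec_const[of "f x"], of 1] by blast
  then have "hent s 0 = f x" using zero_less_one by blast
  then show "\<exists>s. prtrace f g x 0 s" unfolding prtrace_def by auto
next
  fix n s assume s: "prtrace f g x n s"
  define h where "h i = (if i \<le> n then hent s i else g (hpair x (hpair n (hent s n))))" for i
  have "rec h" unfolding h_def by (intro rr1)
  then obtain s' where s': "\<And>i. i < n + 1 + 1 \<Longrightarrow> hent s' i = h i" using seq_comp by blast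
  have "prtrace f g x (n + 1) s'" unfolding prtrace_def
  proof (intro conjI allI impI)
    show "hent s' 0 = f x" using s s'[of 0] by (simp add: h_def prtrace_def hm_less_Suc)
    fix i assume i: "i < n + 1"
    then have 1: "hent s' i = hent s i" using s'[of i] by (simp add: h_def hm_less_Suc add_increasing2)
    have 2: "hent s' (i + 1) = h (i + 1)" using s'[of "i + 1"] i by (simp add: hm_less_Suc)
    from i show "hent s' (i + 1) = g (hpair x (hpair i (hent s' i)))"
    proof (rule less_Suc_cases)
      assume "i < n" then show ?thesis using 1 2 s by (simp add: h_def hm_Suc_le prtrace_def)
    next
      assume "i = n" then show ?thesis using 1 2 by (simp add: h_def hm_Suc_le)
    qed
  qed
  then show "\<exists>y. prtrace f g x (n + 1) y" by blast
qed

lemma prtrace_Least: "prtrace f g x n (LEAST s. prtrace f g x n s)"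
  using prtrace_ex[of x n] dec_Least(1)[of "prtrace f g x n"] prtrace_dec[OF rec_const rec_const rec_id] by blast

lemma prtrace_unique: assumes "prtrace f g x n s" "prtrace f g x n' s'" "n \<le> n'" shows "hent s n = hent s' n"
proof -
  have "i \<le> n \<longrightarrow> hent s i = hent s' i" for i
  proof (rule dec_induct[of "\<lambda>i. i \<le> n \<longrightarrow> hent s i = hent s' i"])
    show "dec (\<lambda>i. i \<le> n \<longrightarrow> hent s i = hent s' i)" by (intro rr1)
    show "0 \<le> n \<longrightarrow> hent s 0 = hent s' 0" using assms by (simp add: prtrace_def)
    fix i assume IH: "i \<le> n \<longrightarrow> hent s i = hent s' i"
    show "i + 1 \<le> n \<longrightarrow> hent s (i + 1) = hent s' (i + 1)"
    proof
      assume "i + 1 \<le> n"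
      then have "i < n" "i < n'" using assms(3) by (auto simp: hm_Suc_le)
      then show "hent s (i + 1) = hent s' (i + 1)" using IH assms by (simp add: prtrace_def)
    qed
  qed
  then show ?thesis by blast
qed

lemma prtrace_D: "prtrace f g x n s \<Longrightarrow> hent s 0 = f x" "prtrace f g x n s \<Longrightarrow> i < n \<Longrightarrow> hent s (i + 1) = g (hpair x (hpair i (hent s i)))"
  by (auto simp: prtrace_def)

lemma prc_0: "prc f g x 0 = f x"
  unfolding prc_def by (rule prtrace_D(1)[OF prtrace_Least])

lemma prc_Suc: "prc f g x (n + 1) = g (hpair x (hpair n (prc f g x n)))"
proof -
  have "hent (LEAST s. prtrace f g x n s) n = hent (LEAST s. prtrace f g x (n + 1) s) n"
    by (rule prtrace_unique[OF prtrace_Least prtrace_Least]) (simp add: add_increasing2)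
  then show ?thesis unfolding prc_def using prtrace_D(2)[OF prtrace_Least[of x "n + 1"] hm_less_self] by simp
qed

lemma rec_prc: assumes "rec s" "rec t" shows "rec (\<lambda>x. prc f g (s x) (t x))"
proof (rule rec2[OF _ assms])
  have "rec (\<lambda>z. LEAST s. prtrace f g (hfst z) (hsnd z) s)"
    by (rule rec_Least) (intro prtrace_dec rr0, rule prtrace_ex)
  then show "rec (\<lambda>z. prc f g (hfst z) (hsnd z))" unfolding prc_def by (intro rr1)
qed

end

text \<open>Universal induction from existential induction: a counterexample at \<open>n\<close> is
  carried down step by step until it becomes one at \<open>0\<close>.\<close>

lemma pi_induct:
  assumes "dec (\<lambda>z. R (hfst z) (hsnd z))" "\<And>z. R 0 z" "\<And>n z. (\<And>z. R n z) \<Longrightarrow> R (n + 1) z"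
  shows "R n z"
proof (rule ccontr)
  assume n: "\<not> R n z"
  \<comment> \<open>After \<open>i\<close> steps the counterexample sits at \<open>m\<close> with
    \<open>m + i = n\<close>; the disjunct \<open>n < i\<close> makes the claim trivial past
    \<open>n\<close>. The instance wanted is \<open>i = n\<close>, where that disjunct is
    false.\<close>
  have "\<exists>y. n < n \<or> (\<exists>m\<le>n. m + n = n \<and> \<not> R m y)"
  proof (rule sig_induct[where Q = "\<lambda>i y. n < i \<or> (\<exists>m\<le>n. m + i = n \<and> \<not> R m y)" and x = n])
    show "dec (\<lambda>z. n < hfst z \<or> (\<exists>m\<le>n. m + hfst z = n \<and> \<not> R m (hsnd z)))"
      by (intro rr0 dec2[OF assms(1)])
    show "\<exists>y. n < 0 \<or> (\<exists>m\<le>n. m + 0 = n \<and> \<not> R m y)" using n by auto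
    fix i y assume "n < i \<or> (\<exists>m\<le>n. m + i = n \<and> \<not> R m y)"
    then show "\<exists>y. n < i + 1 \<or> (\<exists>m\<le>n. m + (i + 1) = n \<and> \<not> R m y)"
    proof
      assume "n < i" then show ?thesis by (auto simp: hm_basic(8))
    next
      assume "\<exists>m\<le>n. m + i = n \<and> \<not> R m y"
      then obtain m where m: "m \<le> n" "m + i = n" "\<not> R m y" by blast
      then have "m \<noteq> 0" using assms(2) by auto
      then obtain k where k: "m = k + 1" using hm_pred by blast
      then obtain y' where "\<not> R k y'" using assms(3) m(3) by blast
      moreover have "k + (i + 1) = n" using k m(2) by (simp add: ac_simps)
      moreover have "k \<le> n" using calculation(2) by (metis add_increasing2 hm_nonneg order_refl)
      ultimately show ?thesis by blast
    qed
  qed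
  then show False using assms(2) by (auto simp: add_eq_0_iff_both_eq_0)
qed

section \<open>Finite sets coded by binary expansions\<close>

definition p2 :: "hm \<Rightarrow> hm" where "p2 n = prc (\<lambda>_. 1) (\<lambda>z. 2 * hsnd (hsnd z)) 0 n"

lemma p2_aux: "rec (\<lambda>_. 1)" "rec (\<lambda>z. 2 * hsnd (hsnd z))" by (intro rr0)+

lemma p2_0 [simp]: "p2 0 = 1" unfolding p2_def by (rule prc_0[OF p2_aux])
lemma p2_Suc [simp]: "p2 (n + 1) = 2 * p2 n" unfolding p2_def using prc_Suc[OF p2_aux] by simp
lemma rec_p2: "rec s \<Longrightarrow> rec (\<lambda>x. p2 (s x))" unfolding p2_def by (intro rec_prc[OF p2_aux] rr0)

lemma p2_add: "p2 (a + b) = p2 a * p2 b"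
proof (rule dec_induct[of "\<lambda>b. p2 (a + b) = p2 a * p2 b"])
  show "dec (\<lambda>b. p2 (a + b) = p2 a * p2 b)" by (intro rr1 rec_p2)
  fix x assume "p2 (a + x) = p2 a * p2 x"
  then show "p2 (a + (x + 1)) = p2 a * p2 (x + 1)" by (simp only: add.assoc[symmetric] p2_Suc mult.left_commute)
qed simp

lemma p2_pos [simp]: "0 < p2 n"
  by (rule dec_induct[of "\<lambda>n. 0 < p2 n"]) (intro rr1 rec_p2, simp_all)

lemma p2_gt: "n < p2 n"
proof (rule dec_induct[of "\<lambda>n. n < p2 n"])
  show "dec (\<lambda>n. n < p2 n)" by (intro rr1 rec_p2)
  fix n assume "n < p2 n"
  then show "n + 1 < p2 (n + 1)" using p2_pos[of n] ofm_nn[of n] unfolding p2_Suc hz_trans by simp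
qed simp

lemma p2_mono: "a \<le> b \<Longrightarrow> p2 a \<le> p2 b"
  unfolding hm_le_iff_ex[of a b] by (auto simp: p2_add intro!: hm_le_mult)

lemma p2_strict: "a < b \<Longrightarrow> p2 a < p2 b"
proof -
  assume "a < b"
  then have "p2 (a + 1) \<le> p2 b" by (intro p2_mono) (simp add: hm_Suc_le)
  then show ?thesis using p2_pos[of a] unfolding p2_Suc hz_trans by simp
qed

lemma p2_less_iff: "p2 a < p2 b \<longleftrightarrow> a < b"
  using p2_strict p2_mono by (meson not_le)

text \<open>Ackermann membership: bit \<open>i\<close> of the binary expansion of
  \<open>c\<close>.\<close>

definition hmem :: "hm \<Rightarrow> hm \<Rightarrow> bool" where "hmem i c \<longleftrightarrow> p2 i \<le> hmod c (p2 (i + 1))"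

lemma dec_hmem: "rec s \<Longrightarrow> rec t \<Longrightarrow> dec (\<lambda>x. hmem (s x) (t x))"
  by (rule dec2[where P = hmem]) (unfold hmem_def, intro rr1 rec_p2)

lemmas rr2 = rr1 rec_p2 dec_hmem

lemma hmod_small: "c < m \<Longrightarrow> hmod c m = c" by (rule hmod_unique[of _ 0]) auto

lemma hmod_le: "hmod c m \<le> c" using hmod_ex[of c m] by (metis add_increasing hm_nonneg order_refl)

lemma hmem_le: "hmem i c \<Longrightarrow> p2 i \<le> c" unfolding hmem_def using hmod_le order_trans by blast

lemma hmem_less: "hmem i c \<Longrightarrow> i < c" using hmem_le p2_gt less_le_trans by blast

lemma hmem_bd: "c < p2 b \<Longrightarrow> hmem i c \<Longrightarrow> i < b" using hmem_le p2_less_iff le_less_trans by blast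

lemma hmem_0 [simp]: "\<not> hmem i 0" using hmem_less by force

lemma hmem_add: assumes c: "c < p2 b" shows "hmem i (c + p2 b) \<longleftrightarrow> hmem i c \<or> i = b"
proof -
  consider "i < b" | "i = b" | "b < i" by (metis linorder_neqE)
  then show ?thesis
  proof cases
    case 1
    then obtain k where k: "b = (i + 1) + k" using hm_less_iff_ex hm_Suc_le hm_le_iff_ex by blast
    define m where "m = p2 (i + 1)"
    have m: "0 < m" unfolding m_def by (rule p2_pos)
    obtain q where q: "c = q * m + hmod c m" using hmod_ex by blast
    have "c + p2 b = (q * m + hmod c m) + m * p2 k" using q unfolding k p2_add m_def by metis
    also have "\<dots> = (q + p2 k) * m + hmod c m" by (simp add: algebra_simps)
    finally have "hmod (c + p2 b) m = hmod c m" by (rule hmod_unique) (rule hmod_less[OF m])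
    then show ?thesis using 1 unfolding hmem_def m_def by auto
  next
    case 2
    have "c + p2 b < p2 (b + 1)" using c unfolding p2_Suc by (simp add: mult_2)
    then show ?thesis using 2 by (simp add: hmem_def hmod_small add_increasing)
  next
    case 3
    have "c + p2 b < p2 (b + 1)" using c unfolding p2_Suc by (simp add: mult_2)
    also have "\<dots> \<le> p2 i" using 3 by (intro p2_mono) (simp add: hm_Suc_le)
    finally have "c + p2 b < p2 i" .
    moreover have "c < p2 i" using c p2_strict[OF 3] by order
    ultimately show ?thesis using 3 hmem_le by (meson not_le less_irrefl)
  qed
qed

lemma set_ex: assumes "dec P" shows "\<exists>c<p2 b. \<forall>i<b. hmem i c \<longleftrightarrow> P i"
proof (rule dec_induct[of "\<lambda>b. \<exists>c<p2 b. \<forall>i<b. hmem i c \<longleftrightarrow> P i"])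
  show "dec (\<lambda>b. \<exists>c<p2 b. \<forall>i<b. hmem i c \<longleftrightarrow> P i)" by (intro rr2 rec_dec[OF _ assms])
  fix b assume "\<exists>c<p2 b. \<forall>i<b. hmem i c \<longleftrightarrow> P i"
  then obtain c where c: "c < p2 b" "\<And>i. i < b \<Longrightarrow> hmem i c \<longleftrightarrow> P i" by blast
  show "\<exists>c<p2 (b + 1). \<forall>i<b + 1. hmem i c \<longleftrightarrow> P i"
  proof (cases "P b")
    case True
    have "c + p2 b < p2 (b + 1)" using c(1) unfolding p2_Suc by (simp add: mult_2)
    moreover have "hmem i (c + p2 b) \<longleftrightarrow> P i" if "i < b + 1" for i
      using that by (rule less_Suc_cases) (use True c(2) in \<open>auto simp: hmem_add[OF c(1)]\<close>)
    ultimately show ?thesis by blast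
  next
    case False
    have "c < p2 (b + 1)" using c(1) p2_strict[OF hm_less_self[of b]] by order
    moreover have "hmem i c \<longleftrightarrow> P i" if "i < b + 1" for i
      using that by (rule less_Suc_cases) (use False c(2) hmem_bd[OF c(1)] in auto)
    ultimately show ?thesis by blast
  qed
qed (simp, rule exI[of _ 0], simp)

lemma hset_eqI: assumes "\<And>i. hmem i c \<longleftrightarrow> hmem i c'" shows "c = c'"
proof -
  have "\<forall>c<p2 b. \<forall>c'<p2 b. (\<forall>i<b. hmem i c \<longleftrightarrow> hmem i c') \<longrightarrow> c = c'" for b
  proof (rule dec_induct[of "\<lambda>b. \<forall>c<p2 b. \<forall>c'<p2 b. (\<forall>i<b. hmem i c \<longleftrightarrow> hmem i c') \<longrightarrow> c = c'"])
    show "dec (\<lambda>b. \<forall>c<p2 b. \<forall>c'<p2 b. (\<forall>i<b. hmem i c \<longleftrightarrow> hmem i c') \<longrightarrow> c = c')" by (intro rr2)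
    show "\<forall>c<p2 0. \<forall>c'<p2 0. (\<forall>i<0. hmem i c \<longleftrightarrow> hmem i c') \<longrightarrow> c = c'"
      by (metis hm_less_Suc add_0 hm_le0 p2_0)
    fix b assume IH: "\<forall>c<p2 b. \<forall>c'<p2 b. (\<forall>i<b. hmem i c \<longleftrightarrow> hmem i c') \<longrightarrow> c = c'"
    show "\<forall>c<p2 (b + 1). \<forall>c'<p2 (b + 1). (\<forall>i<b + 1. hmem i c \<longleftrightarrow> hmem i c') \<longrightarrow> c = c'"
    proof (intro allI impI)
      fix c c' assume c: "c < p2 (b + 1)" "c' < p2 (b + 1)" and e: "\<forall>i<b + 1. hmem i c \<longleftrightarrow> hmem i c'"
      have eb: "hmem i c \<longleftrightarrow> hmem i c'" if "i \<le> b" for i using e that by (simp add: hm_less_Suc)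
      have hb: "hmem b c \<longleftrightarrow> p2 b \<le> c" if "c < p2 (b + 1)" for c using that by (simp add: hmem_def hmod_small)
      show "c = c'"
      proof (cases "p2 b \<le> c")
        case False
        then have "\<not> p2 b \<le> c'" using eb[of b] hb c by simp
        then show ?thesis using False IH eb by (auto simp: not_le)
      next
        case True
        then have "p2 b \<le> c'" using eb[of b] hb c by simp
        then obtain d d' where d: "c = d + p2 b" "c' = d' + p2 b" using True by (metis add.commute hm_le_iff_ex)
        have dl: "d < p2 b" "d' < p2 b" using c unfolding d p2_Suc mult_2 by simp_all
        have "hmem i d \<longleftrightarrow> hmem i d'" if "i < b" for i
          using eb[OF less_imp_le[OF that]] that unfolding d hmem_add[OF dl(1)] hmem_add[OF dl(2)] by auto
        then have "d = d'" using IH dl by blast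
        then show ?thesis using d by simp
      qed
    qed
  qed
  moreover have "c < p2 (c + c')" "c' < p2 (c + c')"
    using p2_gt[of "c + c'"] by (meson add_increasing add_increasing2 hm_nonneg le_less_trans order_refl)+
  ultimately show ?thesis using assms by blast
qed

definition hset :: "(hm \<Rightarrow> bool) \<Rightarrow> hm \<Rightarrow> hm" where
  "hset P b = (LEAST c. c < p2 b \<and> (\<forall>i<b. hmem i c \<longleftrightarrow> P i))"

lemma hset_spec: assumes "dec P" shows "hset P b < p2 b" "hmem i (hset P b) \<longleftrightarrow> i < b \<and> P i"
proof -
  have d: "dec (\<lambda>c. c < p2 b \<and> (\<forall>i<b. hmem i c \<longleftrightarrow> P i))" by (intro rr2 rec_dec[OF _ assms])
  obtain c where "c < p2 b \<and> (\<forall>i<b. hmem i c \<longleftrightarrow> P i)" using set_ex[OF assms] by blast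
  from dec_Least(1)[of "\<lambda>c. c < p2 b \<and> (\<forall>i<b. hmem i c \<longleftrightarrow> P i)", OF d this]
  have *: "hset P b < p2 b \<and> (\<forall>i<b. hmem i (hset P b) \<longleftrightarrow> P i)" unfolding hset_def by blast
  then show "hset P b < p2 b" by blast
  show "hmem i (hset P b) \<longleftrightarrow> i < b \<and> P i" using * hmem_bd by blast
qed

lemma hset_bd: "(\<And>i. hmem i c \<Longrightarrow> i < b) \<Longrightarrow> c < p2 b"
proof -
  assume a: "\<And>i. hmem i c \<Longrightarrow> i < b"
  have d: "dec (\<lambda>i. hmem i c)" by (intro rr2)
  have "c = hset (\<lambda>i. hmem i c) b" by (rule hset_eqI) (use hset_spec(2)[OF d] a in auto)
  then show ?thesis using hset_spec(1)[OF d] by metis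
qed

lemma rec_hset:
  assumes "dec (\<lambda>z. Q (hfst z) (hsnd z))" "rec t"
  shows "rec (\<lambda>x. hset (Q x) (t x))"
  unfolding hset_def
proof (rule rec_Least)
  show "dec (\<lambda>z. hsnd z < p2 (t (hfst z)) \<and> (\<forall>i<t (hfst z). hmem i (hsnd z) \<longleftrightarrow> Q (hfst z) i))"
    by (intro rr2 rec_comp[OF assms(2)] dec2[OF assms(1)])
  show "\<exists>y. y < p2 (t x) \<and> (\<forall>i<t x. hmem i y \<longleftrightarrow> Q x i)" for x
    using set_ex[OF dec_section[OF assms(1)]] by blast
qed

definition lo :: "hm \<Rightarrow> hm \<Rightarrow> hm" where "lo Z p = hset (\<lambda>i. hmem i Z \<and> i < p) Z"
definition hi :: "hm \<Rightarrow> hm \<Rightarrow> hm" where "hi Z p = hset (\<lambda>i. hmem i Z \<and> p \<le> i) Z"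

lemma mem_lo [simp]: "hmem i (lo Z p) \<longleftrightarrow> hmem i Z \<and> i < p"
proof -
  have "dec (\<lambda>i. hmem i Z \<and> i < p)" by (intro rr2)
  from hset_spec(2)[OF this] show ?thesis unfolding lo_def using hmem_less by blast
qed

lemma mem_hi [simp]: "hmem i (hi Z p) \<longleftrightarrow> hmem i Z \<and> p \<le> i"
proof -
  have "dec (\<lambda>i. hmem i Z \<and> p \<le> i)" by (intro rr2)
  from hset_spec(2)[OF this] show ?thesis unfolding hi_def using hmem_less by blast
qed

lemma rec_lo: "rec s \<Longrightarrow> rec t \<Longrightarrow> rec (\<lambda>x. lo (s x) (t x))"
  by (rule rec2[where f = lo]) (unfold lo_def, intro rec_hset rr2)

lemma rec_hi: "rec s \<Longrightarrow> rec t \<Longrightarrow> rec (\<lambda>x. hi (s x) (t x))"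
  by (rule rec2[where f = hi]) (unfold hi_def, intro rec_hset rr2)

lemmas rr3 = rr2 rec_lo rec_hi rec_hset

lemma hset_ne: "c \<noteq> 0 \<longleftrightarrow> (\<exists>i. hmem i c)" using hset_eqI[of c 0] by auto

lemma lo_bd: "Z < p2 b \<Longrightarrow> lo Z p < p2 b" by (rule hset_bd) (auto dest: hmem_bd)
lemma hi_bd: "Z < p2 b \<Longrightarrow> hi Z p < p2 b" by (rule hset_bd) (auto dest: hmem_bd)
lemma lo_big: "Z < p2 b \<Longrightarrow> b \<le> p \<Longrightarrow> lo Z p = lo Z b" by (rule hset_eqI) (auto dest: hmem_bd)
lemma hi_big: "Z < p2 b \<Longrightarrow> b \<le> p \<Longrightarrow> hi Z p = hi Z b" by (rule hset_eqI) (auto dest: hmem_bd)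

section \<open>Largeness\<close>

text \<open>\<open>lg n Z\<close> says that \<open>Z\<close> is \<open>\<omega>\<^sup>n\<close>-large and \<open>lgs n q Z\<close> that it is \<open>\<omega>\<^sup>n \<cdot> q\<close>-large, for codes of finite
  sets. As \<open>n\<close> may be nonstandard, the recursion has to be carried out inside the model: \<open>TT b n\<close> codes the set of all
  \<open>\<omega>\<^sup>n\<close>-large subsets of \<open>{0..<b}\<close>.\<close>

definition UUs :: "hm \<Rightarrow> hm" where
  "UUs z = hset (\<lambda>Z. \<exists>p\<le>hfst (hfst z). hmem (lo Z p) (hsnd (hfst z)) \<and> hmem (hi Z p) (hsnd (hsnd z))) (p2 (hfst (hfst z)))"
definition UU :: "hm \<Rightarrow> hm \<Rightarrow> hm \<Rightarrow> hm" where
  "UU b T q = prc (\<lambda>x. hset (\<lambda>_. True) (p2 (hfst x))) UUs (hpair b T) q"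

lemma UU_aux: "rec (\<lambda>x. hset (\<lambda>_. True) (p2 (hfst x)))" "rec UUs"
  unfolding UUs_def by (intro rr3)+

lemma rec_UU: "rec a \<Longrightarrow> rec b \<Longrightarrow> rec c \<Longrightarrow> rec (\<lambda>x. UU (a x) (b x) (c x))"
  unfolding UU_def by (intro rec_prc[OF UU_aux] rr3)

lemma UU_0: "hmem Z (UU b T 0) \<longleftrightarrow> Z < p2 b"
  unfolding UU_def prc_0[OF UU_aux] by (simp add: hset_spec(2)[OF dec_const])

lemma UU_Suc: "hmem Z (UU b T (q + 1)) \<longleftrightarrow> Z < p2 b \<and> (\<exists>p\<le>b. hmem (lo Z p) T \<and> hmem (hi Z p) (UU b T q))"
proof -
  have "dec (\<lambda>Z. \<exists>p\<le>b. hmem (lo Z p) T \<and> hmem (hi Z p) V)" for V by (intro rr3)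
  then show ?thesis unfolding UU_def prc_Suc[OF UU_aux] UUs_def[of "hpair _ _"] by (simp add: hset_spec(2))
qed

definition TTs :: "hm \<Rightarrow> hm" where
  "TTs z = hset (\<lambda>Z. \<exists>x<hfst z. hmem x Z \<and> hmem (hi Z (x + 1)) (UU (hfst z) (hsnd (hsnd z)) x)) (p2 (hfst z))"
definition TT :: "hm \<Rightarrow> hm \<Rightarrow> hm" where
  "TT b n = prc (\<lambda>b. hset (\<lambda>Z. Z \<noteq> 0) (p2 b)) TTs b n"

lemma TT_aux: "rec (\<lambda>b. hset (\<lambda>Z. Z \<noteq> 0) (p2 b))" "rec TTs"
  unfolding TTs_def by (intro rr3 rec_UU)+

lemma rec_TT: "rec a \<Longrightarrow> rec b \<Longrightarrow> rec (\<lambda>x. TT (a x) (b x))"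
  unfolding TT_def by (intro rec_prc[OF TT_aux] rr3)

lemma TT_0: "hmem Z (TT b 0) \<longleftrightarrow> Z < p2 b \<and> Z \<noteq> 0"
proof -
  have "dec (\<lambda>Z::hm. Z \<noteq> 0)" by (intro rr3)
  then show ?thesis unfolding TT_def prc_0[OF TT_aux] by (simp add: hset_spec(2))
qed

lemma TT_Suc: "hmem Z (TT b (n + 1)) \<longleftrightarrow> Z < p2 b \<and> (\<exists>x<b. hmem x Z \<and> hmem (hi Z (x + 1)) (UU b (TT b n) x))"
proof -
  have "dec (\<lambda>Z. \<exists>x<b. hmem x Z \<and> hmem (hi Z (x + 1)) (UU b V x))" for V by (intro rr3 rec_UU)
  then show ?thesis unfolding TT_def prc_Suc[OF TT_aux] TTs_def[of "hpair _ _"] by (simp add: hset_spec(2))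
qed

text \<open>Cuts beyond the ambient bound split a set just as the cut at the bound does, so the
  tables for two bounds agree wherever both apply. This makes largeness a property of the set
  alone.\<close>

lemma UU_indep:
  assumes "\<And>Z. Z < p2 b \<Longrightarrow> Z < p2 b' \<Longrightarrow> hmem Z T \<longleftrightarrow> hmem Z T'" "Z < p2 b" "Z < p2 b'"
  shows "hmem Z (UU b T q) \<longleftrightarrow> hmem Z (UU b' T' q)"
proof -
  have "Z < p2 b \<longrightarrow> Z < p2 b' \<longrightarrow> (hmem Z (UU b T q) \<longleftrightarrow> hmem Z (UU b' T' q))" for Z
  proof (rule pi_induct[where R = "\<lambda>q Z. Z < p2 b \<longrightarrow> Z < p2 b' \<longrightarrow> (hmem Z (UU b T q) \<longleftrightarrow> hmem Z (UU b' T' q))" and n = q and z = Z])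
    show "dec (\<lambda>z. hsnd z < p2 b \<longrightarrow> hsnd z < p2 b' \<longrightarrow> (hmem (hsnd z) (UU b T (hfst z)) \<longleftrightarrow> hmem (hsnd z) (UU b' T' (hfst z))))"
      by (intro rr3 rec_UU)
    show "Z < p2 b \<longrightarrow> Z < p2 b' \<longrightarrow> (hmem Z (UU b T 0) \<longleftrightarrow> hmem Z (UU b' T' 0))" for Z by (simp add: UU_0)
    fix q Z assume IH: "\<And>Z. Z < p2 b \<longrightarrow> Z < p2 b' \<longrightarrow> (hmem Z (UU b T q) \<longleftrightarrow> hmem Z (UU b' T' q))"
    show "Z < p2 b \<longrightarrow> Z < p2 b' \<longrightarrow> (hmem Z (UU b T (q + 1)) \<longleftrightarrow> hmem Z (UU b' T' (q + 1)))"
    proof (intro impI)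
      assume Z: "Z < p2 b" "Z < p2 b'"
      have e: "(hmem (lo Z p) T \<and> hmem (hi Z p) (UU b T q)) \<longleftrightarrow> (hmem (lo Z p) T' \<and> hmem (hi Z p) (UU b' T' q))" for p
        using IH[of "hi Z p"] assms(1)[of "lo Z p"] Z by (simp add: lo_bd hi_bd)
      have cut: "(\<exists>p\<le>b. P (lo Z p) (hi Z p)) \<longleftrightarrow> (\<exists>p. P (lo Z p) (hi Z p))" if "Z < p2 b" for b P
        using lo_big[OF that] hi_big[OF that] by (metis linear order_refl)
      show "hmem Z (UU b T (q + 1)) \<longleftrightarrow> hmem Z (UU b' T' (q + 1))"
        unfolding UU_Suc using Z e cut[OF Z(1), of "\<lambda>l h. hmem l T \<and> hmem h (UU b T q)"] cut[OF Z(2), of "\<lambda>l h. hmem l T' \<and> hmem h (UU b' T' q)"] by simp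
    qed
  qed
  then show ?thesis using assms(2,3) by blast
qed

lemma TT_indep: assumes "Z < p2 b" "Z < p2 b'" shows "hmem Z (TT b n) \<longleftrightarrow> hmem Z (TT b' n)"
proof -
  have "Z < p2 b \<longrightarrow> Z < p2 b' \<longrightarrow> (hmem Z (TT b n) \<longleftrightarrow> hmem Z (TT b' n))"
  proof (rule pi_induct[where R = "\<lambda>n Z. Z < p2 b \<longrightarrow> Z < p2 b' \<longrightarrow> (hmem Z (TT b n) \<longleftrightarrow> hmem Z (TT b' n))" and n = n and z = Z])
    show "dec (\<lambda>z. hsnd z < p2 b \<longrightarrow> hsnd z < p2 b' \<longrightarrow> (hmem (hsnd z) (TT b (hfst z)) \<longleftrightarrow> hmem (hsnd z) (TT b' (hfst z))))"
      by (intro rr3 rec_TT)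
    show "Z < p2 b \<longrightarrow> Z < p2 b' \<longrightarrow> (hmem Z (TT b 0) \<longleftrightarrow> hmem Z (TT b' 0))" for Z by (simp add: TT_0)
    fix n Z assume IH: "\<And>Z. Z < p2 b \<longrightarrow> Z < p2 b' \<longrightarrow> (hmem Z (TT b n) \<longleftrightarrow> hmem Z (TT b' n))"
    show "Z < p2 b \<longrightarrow> Z < p2 b' \<longrightarrow> (hmem Z (TT b (n + 1)) \<longleftrightarrow> hmem Z (TT b' (n + 1)))"
    proof (intro impI)
      assume Z: "Z < p2 b" "Z < p2 b'"
      have "hmem (hi Z p) (UU b (TT b n) q) \<longleftrightarrow> hmem (hi Z p) (UU b' (TT b' n) q)" for p q
        by (rule UU_indep) (use IH Z hi_bd in auto)
      then show "hmem Z (TT b (n + 1)) \<longleftrightarrow> hmem Z (TT b' (n + 1))"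
        unfolding TT_Suc using Z hmem_bd by blast
    qed
  qed
  then show ?thesis using assms by blast
qed

text \<open>Since \<open>Z < p2 Z\<close>, the code can act as its own ambient bound.\<close>

definition lg :: "hm \<Rightarrow> hm \<Rightarrow> bool" where "lg n Z \<longleftrightarrow> hmem Z (TT Z n)"
definition lgs :: "hm \<Rightarrow> hm \<Rightarrow> hm \<Rightarrow> bool" where "lgs n q Z \<longleftrightarrow> hmem Z (UU Z (TT Z n) q)"

lemma lg_TT: "Z < p2 b \<Longrightarrow> hmem Z (TT b n) \<longleftrightarrow> lg n Z"
  unfolding lg_def by (rule TT_indep) (auto intro: p2_gt)

lemma lgs_UU: "Z < p2 b \<Longrightarrow> hmem Z (UU b (TT b n) q) \<longleftrightarrow> lgs n q Z"
  unfolding lgs_def by (rule UU_indep[OF TT_indep _ p2_gt])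

lemma dec_lg: "rec a \<Longrightarrow> rec b \<Longrightarrow> dec (\<lambda>x. lg (a x) (b x))"
  unfolding lg_def by (intro rr3 rec_TT)

lemma dec_lgs: "rec a \<Longrightarrow> rec b \<Longrightarrow> rec c \<Longrightarrow> dec (\<lambda>x. lgs (a x) (b x) (c x))"
  unfolding lgs_def by (intro rr3 rec_TT rec_UU)

lemmas rr4 = rr3 dec_lg dec_lgs

lemma lg_0: "lg 0 Z \<longleftrightarrow> (\<exists>i. hmem i Z)"
  unfolding lg_def TT_0 hset_ne using p2_gt by simp

lemma lg_Suc: "lg (n + 1) Z \<longleftrightarrow> (\<exists>x. hmem x Z \<and> lgs n x (hi Z (x + 1)))"
  unfolding lg_def TT_Suc by (simp add: lgs_UU[OF hi_bd[OF p2_gt]] p2_gt) (use hmem_less in blast)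

lemma lgs_0 [simp]: "lgs n 0 Z" unfolding lgs_def UU_0 by (rule p2_gt)

lemma lgs_Suc: "lgs n (q + 1) Z \<longleftrightarrow> (\<exists>p. lg n (lo Z p) \<and> lgs n q (hi Z p))"
proof -
  have "lgs n (q + 1) Z \<longleftrightarrow> (\<exists>p\<le>Z. lg n (lo Z p) \<and> lgs n q (hi Z p))"
    unfolding lgs_def[of n "q + 1"] UU_Suc using lgs_UU[OF hi_bd[OF p2_gt]] lg_TT[OF lo_bd[OF p2_gt]] p2_gt by auto
  then show ?thesis using lo_big[OF p2_gt] hi_big[OF p2_gt] by (metis linear order_refl)
qed

lemma pi_induct2:
  assumes "dec (\<lambda>z. R (hfst z) (hfst (hsnd z)) (hsnd (hsnd z)))" "\<And>x y. R 0 x y" "\<And>n x y. (\<And>x y. R n x y) \<Longrightarrow> R (n + 1) x y"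
  shows "R n x y"
proof -
  have "R n (hfst (hpair x y)) (hsnd (hpair x y))"
    by (rule pi_induct[of "\<lambda>n z. R n (hfst z) (hsnd z)"]) (use assms(1) assms(2) in simp, use assms(2) in simp,
      metis assms(3) hfst_pair hsnd_pair)
  then show ?thesis by simp
qed

lemma pi_induct3:
  assumes "dec (\<lambda>z. R (hfst z) (hfst (hsnd z)) (hfst (hsnd (hsnd z))) (hsnd (hsnd (hsnd z))))" "\<And>x y w. R 0 x y w"
    "\<And>n x y w. (\<And>x y w. R n x y w) \<Longrightarrow> R (n + 1) x y w"
  shows "R n x y w"
proof -
  have "R n x (hfst (hpair y w)) (hsnd (hpair y w))"
    by (rule pi_induct2[of "\<lambda>n x z. R n x (hfst z) (hsnd z)"]) (use assms(1) assms(2) in simp, use assms(2) in simp,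
      metis assms(3) hfst_pair hsnd_pair)
  then show ?thesis by simp
qed

text \<open>Minimisation needs a search that always succeeds; from \<open>K\<close> on the search
  condition is made trivially true, so that the default value is 0.\<close>

lemma rec_choice:
  assumes "dec (\<lambda>z. Q (hfst z) (hsnd z))" "\<And>j. j < K \<Longrightarrow> \<exists>y. Q j y"
  obtains f where "rec f" "\<And>j. j < K \<Longrightarrow> Q j (f j)"
proof -
  define f where "f j = (LEAST y. K \<le> j \<or> Q j y)" for j
  have d: "dec (\<lambda>z. K \<le> hfst z \<or> Q (hfst z) (hsnd z))" by (intro rr0 assms(1))
  have "rec f" unfolding f_def by (rule rec_Least[OF d]) (use assms(2) in \<open>auto simp: not_le[symmetric]\<close>)
  moreover have "Q j (f j)" if j: "j < K" for j
  proof -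
    obtain y where "Q j y" using assms(2)[OF j] by blast
    then have "K \<le> j \<or> Q j (f j)" unfolding f_def using dec_Least(1)[OF dec_section[OF d], of j] by blast
    then show ?thesis using j by auto
  qed
  ultimately show ?thesis using that by blast
qed

definition hsub :: "hm \<Rightarrow> hm \<Rightarrow> bool" where "hsub Y Z \<longleftrightarrow> (\<forall>i<Y. hmem i Y \<longrightarrow> hmem i Z)"

lemma hsub_iff: "hsub Y Z \<longleftrightarrow> (\<forall>i. hmem i Y \<longrightarrow> hmem i Z)" unfolding hsub_def using hmem_less by blast

lemma hsubI: "(\<And>i. hmem i Y \<Longrightarrow> hmem i Z) \<Longrightarrow> hsub Y Z" by (simp add: hsub_iff)
lemma hsubD: "hsub Y Z \<Longrightarrow> hmem i Y \<Longrightarrow> hmem i Z" by (simp add: hsub_iff)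
lemma hsub_refl [simp]: "hsub Y Y" by (simp add: hsub_iff)
lemma hsub_trans: "hsub X Y \<Longrightarrow> hsub Y Z \<Longrightarrow> hsub X Z" by (simp add: hsub_iff)
lemma hsub_lohi [simp]: "hsub (lo Z p) Z" "hsub (hi Z p) Z" by (auto intro: hsubI)
lemma hsub_bd: "hsub Y Z \<Longrightarrow> Y < p2 Z" by (rule hset_bd) (auto dest: hsubD hmem_less)

lemma dec_hsub: "rec s \<Longrightarrow> rec t \<Longrightarrow> dec (\<lambda>x. hsub (s x) (t x))"
  by (rule dec2[where P = hsub]) (unfold hsub_def, intro rr4)

lemmas rr5 = rr4 dec_hsub

text \<open>\<open>lg (n + 1)\<close> is defined through \<open>lgs n\<close>, so monotonicity needs
  an induction on \<open>q\<close> inside the one on \<open>n\<close>. The inner one is isolated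
  here, with its hypothesis about \<open>n\<close> as a premise.\<close>

lemma lgs_mono_of:
  assumes M: "\<And>Z Z'. lg n Z \<Longrightarrow> hsub Z Z' \<Longrightarrow> lg n Z'"
  shows "lgs n q Z \<Longrightarrow> hsub Z Z' \<Longrightarrow> lgs n q Z'"
proof -
  have "lgs n q Z \<longrightarrow> hsub Z Z' \<longrightarrow> lgs n q Z'"
  proof (rule pi_induct2[where R = "\<lambda>q Z Z'. lgs n q Z \<longrightarrow> hsub Z Z' \<longrightarrow> lgs n q Z'"])
    fix q Z Z' assume IH: "\<And>Z Z'. lgs n q Z \<longrightarrow> hsub Z Z' \<longrightarrow> lgs n q Z'"
    show "lgs n (q + 1) Z \<longrightarrow> hsub Z Z' \<longrightarrow> lgs n (q + 1) Z'"
    proof (intro impI)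
      assume "lgs n (q + 1) Z" and s: "hsub Z Z'"
      then obtain p where p: "lg n (lo Z p)" "lgs n q (hi Z p)" unfolding lgs_Suc by blast
      have "hsub (lo Z p) (lo Z' p)" "hsub (hi Z p) (hi Z' p)" using s by (auto intro!: hsubI dest: hsubD)
      then show "lgs n (q + 1) Z'" unfolding lgs_Suc using p M IH by blast
    qed
  qed (intro rr5, simp)
  then show "lgs n q Z \<Longrightarrow> hsub Z Z' \<Longrightarrow> lgs n q Z'" by blast
qed

lemma lg_mono: "lg n Z \<Longrightarrow> hsub Z Z' \<Longrightarrow> lg n Z'"
proof -
  have "lg n Z \<longrightarrow> hsub Z Z' \<longrightarrow> lg n Z'"
  proof (rule pi_induct2[where R = "\<lambda>n Z Z'. lg n Z \<longrightarrow> hsub Z Z' \<longrightarrow> lg n Z'"])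
    show "lg 0 Z \<longrightarrow> hsub Z Z' \<longrightarrow> lg 0 Z'" for Z Z' unfolding lg_0 by (auto dest: hsubD)
    fix n Z Z' assume IH: "\<And>Z Z'. lg n Z \<longrightarrow> hsub Z Z' \<longrightarrow> lg n Z'"
    show "lg (n + 1) Z \<longrightarrow> hsub Z Z' \<longrightarrow> lg (n + 1) Z'"
    proof (intro impI)
      assume "lg (n + 1) Z" and s: "hsub Z Z'"
      then obtain x where x: "hmem x Z" "lgs n x (hi Z (x + 1))" unfolding lg_Suc by blast
      have "hsub (hi Z (x + 1)) (hi Z' (x + 1))" using s by (auto intro!: hsubI dest: hsubD)
      then have "lgs n x (hi Z' (x + 1))" using lgs_mono_of[of n] IH x(2) by blast
      then show "lg (n + 1) Z'" unfolding lg_Suc using x(1) s hsubD by blast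
    qed
  qed (intro rr5)
  then show "lg n Z \<Longrightarrow> hsub Z Z' \<Longrightarrow> lg n Z'" by blast
qed

lemma lgs_mono: "lgs n q Z \<Longrightarrow> hsub Z Z' \<Longrightarrow> lgs n q Z'"
  using lgs_mono_of[of n q Z Z'] lg_mono by blast

lemma lg_ne: "lg n Z \<Longrightarrow> \<exists>i. hmem i Z"
  using hm_pred[of n] lg_0 lg_Suc by metis

text \<open>Cuts past \<open>Z\<close> act like the cut at \<open>Z\<close>; bounding the cut keeps
  statements about splittings decidable.\<close>

lemma cut_le: "(\<exists>p. P (lo Z p) (hi Z p)) \<longleftrightarrow> (\<exists>p\<le>Z. P (lo Z p) (hi Z p))"
  using lo_big[OF p2_gt] hi_big[OF p2_gt] by (metis linear order_refl)

lemma lgs_split: "lgs n (a + b) Z \<Longrightarrow> \<exists>p. lgs n a (lo Z p) \<and> lgs n b (hi Z p)"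
proof -
  have "lgs n (a + b) Z \<longrightarrow> (\<exists>p\<le>Z. lgs n a (lo Z p) \<and> lgs n b (hi Z p))"
  proof (rule pi_induct[where R = "\<lambda>a Z. lgs n (a + b) Z \<longrightarrow> (\<exists>p\<le>Z. lgs n a (lo Z p) \<and> lgs n b (hi Z p))"])
    show "dec (\<lambda>z. lgs n (hfst z + b) (hsnd z) \<longrightarrow> (\<exists>p\<le>hsnd z. lgs n (hfst z) (lo (hsnd z) p) \<and> lgs n b (hi (hsnd z) p)))"
      by (intro rr5)
    show "lgs n (0 + b) Z \<longrightarrow> (\<exists>p\<le>Z. lgs n 0 (lo Z p) \<and> lgs n b (hi Z p))" for Z
      by (intro impI exI[of _ 0]) (auto elim!: lgs_mono intro!: hsubI)
    fix a Z assume IH: "\<And>Z. lgs n (a + b) Z \<longrightarrow> (\<exists>p\<le>Z. lgs n a (lo Z p) \<and> lgs n b (hi Z p))"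
    show "lgs n (a + 1 + b) Z \<longrightarrow> (\<exists>p\<le>Z. lgs n (a + 1) (lo Z p) \<and> lgs n b (hi Z p))"
    proof
      assume "lgs n (a + 1 + b) Z"
      then have "lgs n ((a + b) + 1) Z" by (simp add: ac_simps)
      then obtain p where p: "lg n (lo Z p)" "lgs n (a + b) (hi Z p)" unfolding lgs_Suc by blast
      then obtain p' where p': "lgs n a (lo (hi Z p) p')" "lgs n b (hi (hi Z p) p')" using IH by blast
      define P where "P = max p p'"
      have "lg n (lo (lo Z P) p)" using p(1) by (rule lg_mono) (auto intro!: hsubI simp: P_def less_max_iff_disj)
      moreover have "lgs n a (hi (lo Z P) p)" using p'(1) by (rule lgs_mono) (auto intro!: hsubI simp: P_def less_max_iff_disj)
      ultimately have "lgs n (a + 1) (lo Z P)" unfolding lgs_Suc by blast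
      moreover have "lgs n b (hi Z P)" using p'(2) by (rule lgs_mono) (auto intro!: hsubI simp: P_def)
      ultimately show "\<exists>p\<le>Z. lgs n (a + 1) (lo Z p) \<and> lgs n b (hi Z p)"
        using cut_le[of "\<lambda>l h. lgs n (a + 1) l \<and> lgs n b h" Z] by blast
    qed
  qed
  then show "lgs n (a + b) Z \<Longrightarrow> \<exists>p. lgs n a (lo Z p) \<and> lgs n b (hi Z p)" by blast
qed

lemma lgs_join: "lgs n a (lo Z p) \<Longrightarrow> lgs n b (hi Z p) \<Longrightarrow> lgs n (a + b) Z"
proof -
  have "lgs n a (lo Z p) \<longrightarrow> lgs n b (hi Z p) \<longrightarrow> lgs n (a + b) Z"
  proof (rule pi_induct2[where R = "\<lambda>a Z p. lgs n a (lo Z p) \<longrightarrow> lgs n b (hi Z p) \<longrightarrow> lgs n (a + b) Z"])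
    show "dec (\<lambda>z. lgs n (hfst z) (lo (hfst (hsnd z)) (hsnd (hsnd z))) \<longrightarrow> lgs n b (hi (hfst (hsnd z)) (hsnd (hsnd z))) \<longrightarrow> lgs n (hfst z + b) (hfst (hsnd z)))"
      by (intro rr5)
    show "lgs n 0 (lo Z p) \<longrightarrow> lgs n b (hi Z p) \<longrightarrow> lgs n (0 + b) Z" for Z p
      by (auto elim!: lgs_mono intro!: hsubI)
    fix a Z p assume IH: "\<And>Z p. lgs n a (lo Z p) \<longrightarrow> lgs n b (hi Z p) \<longrightarrow> lgs n (a + b) Z"
    show "lgs n (a + 1) (lo Z p) \<longrightarrow> lgs n b (hi Z p) \<longrightarrow> lgs n (a + 1 + b) Z"
    proof (intro impI)
      assume "lgs n (a + 1) (lo Z p)" and b: "lgs n b (hi Z p)"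
      then obtain p' where p': "lg n (lo (lo Z p) p')" "lgs n a (hi (lo Z p) p')" unfolding lgs_Suc by blast
      define P where "P = min p p'"
      have 1: "lg n (lo Z P)" using p'(1) by (rule lg_mono) (auto intro!: hsubI simp: P_def)
      have 2: "lgs n a (lo (hi Z P) p)" using p'(2) by (rule lgs_mono) (auto intro!: hsubI simp: P_def min_le_iff_disj)
      have "lgs n b (hi (hi Z P) p)" using b by (rule lgs_mono) (auto intro!: hsubI simp: P_def min_le_iff_disj)
      then have "lgs n (a + b) (hi Z P)" using IH 2 by blast
      then have "lgs n ((a + b) + 1) Z" unfolding lgs_Suc using 1 by blast
      then show "lgs n (a + 1 + b) Z" by (simp add: ac_simps)
    qed
  qed
  then show "lgs n a (lo Z p) \<Longrightarrow> lgs n b (hi Z p) \<Longrightarrow> lgs n (a + b) Z" by blast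
qed

lemma lgs_le: assumes "lgs n q Z" "q' \<le> q" shows "lgs n q' Z"
proof -
  obtain k where "q = q' + k" using assms(2) hm_le_iff_ex by blast
  then obtain p where "lgs n q' (lo Z p)" using lgs_split assms(1) by blast
  then show ?thesis by (rule lgs_mono) simp
qed

lemma lgs_1: "lgs n 1 Z \<longleftrightarrow> lg n Z"
proof
  assume "lgs n 1 Z"
  then obtain p where "lg n (lo Z p)" using lgs_Suc[of n 0 Z] by auto
  then show "lg n Z" by (rule lg_mono) simp
next
  assume "lg n Z"
  then have "lg n (lo Z Z)" by (rule lg_mono) (auto intro!: hsubI dest: hmem_less)
  then show "lgs n 1 Z" using lgs_Suc[of n 0 Z] by auto
qed

lemma lg_Suc_lg: assumes "lg (n + 1) Z" "\<And>x. hmem x Z \<Longrightarrow> 0 < x" shows "lg n Z"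
proof -
  obtain x where x: "hmem x Z" "lgs n x (hi Z (x + 1))" using assms(1) unfolding lg_Suc by blast
  then have "lgs n 1 (hi Z (x + 1))" using assms(2)[OF x(1)] hm_Suc_le[of 0 x] by (auto elim: lgs_le)
  then show ?thesis unfolding lgs_1 by (rule lg_mono) simp
qed

lemma lg_le: assumes "lg n Z" "m \<le> n" "\<And>x. hmem x Z \<Longrightarrow> 0 < x" shows "lg m Z"
proof -
  obtain k where k: "n = m + k" using assms(2) hm_le_iff_ex by blast
  have "lg (m + k) Z \<longrightarrow> lg m Z"
  proof (rule dec_induct[of "\<lambda>k. lg (m + k) Z \<longrightarrow> lg m Z"])
    show "dec (\<lambda>k. lg (m + k) Z \<longrightarrow> lg m Z)" by (intro rr5)
    fix k assume "lg (m + k) Z \<longrightarrow> lg m Z"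
    then show "lg (m + (k + 1)) Z \<longrightarrow> lg m Z" using lg_Suc_lg[of "m + k" Z] assms(3) by (simp add: add.assoc)
  qed simp
  then show ?thesis using k assms(1) by simp
qed

text \<open>The least element of the next set is a cut that separates it from the union of the
  previous ones, so the blocks can be counted up one at a time. That least element exists because
  large sets are nonempty.\<close>

lemma lgs_build:
  assumes C: "rec C" and 1: "\<And>j. j < q \<Longrightarrow> lg n (C j)" "\<And>j. j < q \<Longrightarrow> hsub (C j) Y"
    and 2: "\<And>j j' u v. j < j' \<Longrightarrow> j' < q \<Longrightarrow> hmem u (C j) \<Longrightarrow> hmem v (C j') \<Longrightarrow> u < v"
  shows "lgs n q Y"
proof -
  define D where "D k = hset (\<lambda>i. hmem i Y \<and> (\<exists>j<k. hmem i (C j))) Y" for k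
  have dD: "dec (\<lambda>i. hmem i Y \<and> (\<exists>j<k. hmem i (C j)))" for k by (intro rr5 rec_comp[OF C])
  have D: "hmem i (D k) \<longleftrightarrow> hmem i Y \<and> (\<exists>j<k. hmem i (C j))" for i k
    unfolding D_def hset_spec(2)[OF dD] using hmem_less by blast
  have recD: "rec D" unfolding D_def by (intro rr5 rec_comp[OF C])
  have "k \<le> q \<longrightarrow> lgs n k (D k)" for k
  proof (rule dec_induct[of "\<lambda>k. k \<le> q \<longrightarrow> lgs n k (D k)"])
    show "dec (\<lambda>k. k \<le> q \<longrightarrow> lgs n k (D k))" by (intro rr5 rec_comp[OF recD])
    fix k assume IH: "k \<le> q \<longrightarrow> lgs n k (D k)"
    show "k + 1 \<le> q \<longrightarrow> lgs n (k + 1) (D (k + 1))"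
    proof
      assume "k + 1 \<le> q"
      then have kq: "k < q" by (simp add: hm_Suc_le)
      have "dec (\<lambda>i. hmem i (C k))" by (intro rr5)
      moreover obtain x where "hmem x (C k)" using lg_ne 1(1)[OF kq] by blast
      ultimately obtain p where p: "hmem p (C k)" "\<And>i. i < p \<Longrightarrow> \<not> hmem i (C k)" using dec_least by blast
      have "lgs n k (lo (D (k + 1)) p)"
        by (rule lgs_mono[OF IH[rule_format]]) (use kq 2[OF _ kq _ p(1)] in \<open>auto intro!: hsubI simp: D hm_less_Suc, blast intro: less_imp_le\<close>)
      moreover have "lg n (hi (D (k + 1)) p)"
      proof (rule lg_mono[OF 1(1)[OF kq]], rule hsubI)
        fix i assume i: "hmem i (C k)"
        then have "p \<le> i" using p(2) not_less by blast
        moreover have "hmem i Y" using i 1(2)[OF kq] hsubD by blast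
        ultimately show "hmem i (hi (D (k + 1)) p)" unfolding mem_hi D using i hm_less_self[of k] by blast
      qed
      ultimately show "lgs n (k + 1) (D (k + 1))" using lgs_join lgs_1 by blast
    qed
  qed simp
  then have "lgs n q (D q)" by blast
  then show ?thesis by (rule lgs_mono) (auto intro!: hsubI simp: D)
qed

lemma mono_seq: assumes "rec f" "\<And>j. f j \<le> f (j + 1)" "j \<le> k" shows "f j \<le> (f k :: hm)"
proof -
  obtain e where e: "k = j + e" using assms(3) hm_le_iff_ex by blast
  have "f j \<le> f (j + e)"
  proof (rule dec_induct[of "\<lambda>e. f j \<le> f (j + e)"])
    show "dec (\<lambda>e. f j \<le> f (j + e))" by (intro rr5 rec_comp[OF assms(1)])
    fix e assume "f j \<le> f (j + e)"
    then show "f j \<le> f (j + (e + 1))" using assms(2)[of "j + e"] by (simp add: add.assoc)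
  qed simp
  then show ?thesis using e by simp
qed

text \<open>The definition only provides nested existential cuts. A uniform sequence of blocks is
  extracted by always taking the shortest possible next block.\<close>

lemma lgs_blocks:
  assumes "lgs n q Z"
  obtains C where "rec C" "\<And>j. j < q \<Longrightarrow> lg n (C j)" "\<And>j. hsub (C j) Z"
    "\<And>j j' u v. j < j' \<Longrightarrow> hmem u (C j) \<Longrightarrow> hmem v (C j') \<Longrightarrow> u < v"
proof -
  \<comment> \<open>The earliest end of a block that starts at \<open>p0\<close>;
    \<open>Z + p0\<close> bounds the search and is reached when there is no further block.\<close>
  define nx where "nx p0 = (LEAST p. lg n (lo (hi Z p0) p) \<or> p = Z + p0)" for p0
  have d: "dec (\<lambda>z. lg n (lo (hi Z (hfst z)) (hsnd z)) \<or> hsnd z = Z + hfst z)" by (intro rr5)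
  have rn: "rec nx" unfolding nx_def by (rule rec_Least[OF d]) auto
  have nxI: "lg n (lo (hi Z p0) (nx p0)) \<or> nx p0 = Z + p0" "lg n (lo (hi Z p0) p) \<Longrightarrow> nx p0 \<le> p" for p0 p
    using dec_Least(1,2)[OF dec_section[OF d], of p0] unfolding nx_def by blast+
  have nx_ge: "p0 \<le> nx p0" for p0
    using nxI(1)[of p0] lg_ne[of n "lo (hi Z p0) (nx p0)"] by (auto simp: add_increasing)
  define pp where "pp = prc (\<lambda>_. 0) (\<lambda>z. nx (hsnd (hsnd z))) 0"
  have aux: "rec (\<lambda>_. 0)" "rec (\<lambda>z. nx (hsnd (hsnd z)))" by (intro rr5 rec_comp[OF rn])+
  have pp0: "pp 0 = 0" and ppS: "pp (j + 1) = nx (pp j)" for j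
    unfolding pp_def prc_0[OF aux] prc_Suc[OF aux] by simp_all
  have rp: "rec pp" unfolding pp_def using rec_prc[OF aux rec_const rec_id] by simp
  have ppm: "j \<le> k \<Longrightarrow> pp j \<le> pp k" for j k by (rule mono_seq[OF rp]) (auto simp: ppS nx_ge)
  \<comment> \<open>The greedy end never exceeds the end given by any other splitting, so the
    remaining part still holds the blocks not yet taken.\<close>
  have main: "j \<le> q \<longrightarrow> (\<exists>k\<le>q. j + k = q \<and> lgs n k (hi Z (pp j)))" for j
  proof (rule dec_induct[of "\<lambda>j. j \<le> q \<longrightarrow> (\<exists>k\<le>q. j + k = q \<and> lgs n k (hi Z (pp j)))"])
    show "dec (\<lambda>j. j \<le> q \<longrightarrow> (\<exists>k\<le>q. j + k = q \<and> lgs n k (hi Z (pp j))))" by (intro rr5 rec_comp[OF rp])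
    show "0 \<le> q \<longrightarrow> (\<exists>k\<le>q. 0 + k = q \<and> lgs n k (hi Z (pp 0)))"
      using assms by (auto simp: pp0 elim!: lgs_mono intro!: hsubI)
    fix j assume IH: "j \<le> q \<longrightarrow> (\<exists>k\<le>q. j + k = q \<and> lgs n k (hi Z (pp j)))"
    show "j + 1 \<le> q \<longrightarrow> (\<exists>k\<le>q. j + 1 + k = q \<and> lgs n k (hi Z (pp (j + 1))))"
    proof
      assume jq: "j + 1 \<le> q"
      then have "j < q" by (simp add: hm_Suc_le)
      then obtain k where k: "j + k = q" "lgs n k (hi Z (pp j))" using IH less_imp_le by blast
      then have "k \<noteq> 0" using \<open>j < q\<close> by auto
      then obtain l where l: "k = l + 1" using hm_pred by blast
      then obtain p where p: "lg n (lo (hi Z (pp j)) p)" "lgs n l (hi (hi Z (pp j)) p)" using k(2) lgs_Suc by blast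
      have "lgs n l (hi Z (pp (j + 1)))" using p(2)
        by (rule lgs_mono) (use nxI(2)[OF p(1)] in \<open>auto intro!: hsubI simp: ppS\<close>)
      moreover have "j + 1 + l = q" using k(1) l by (simp add: ac_simps)
      moreover have "l \<le> q" using calculation(2) by (metis add_increasing hm_nonneg order_refl)
      ultimately show "\<exists>k\<le>q. j + 1 + k = q \<and> lgs n k (hi Z (pp (j + 1)))" by blast
    qed
  qed
  define C where "C j = lo (hi Z (pp j)) (pp (j + 1))" for j
  show ?thesis
  proof (rule that[of C])
    show "rec C" unfolding C_def by (intro rr5 rec_comp[OF rp])
    show "hsub (C j) Z" for j unfolding C_def by (auto intro!: hsubI)
    show "lg n (C j)" if j: "j < q" for j
    proof -
      obtain k where k: "j + k = q" "lgs n k (hi Z (pp j))" using main[of j] j less_imp_le by blast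
      then have "k \<noteq> 0" using j by auto
      then obtain l where l: "k = l + 1" using hm_pred by blast
      then obtain p where pl: "lg n (lo (hi Z (pp j)) p)" using k(2) lgs_Suc by blast
      show ?thesis
      proof (cases "lg n (lo (hi Z (pp j)) (nx (pp j)))")
        case True then show ?thesis by (simp add: C_def ppS)
      next
        case False
        then have "nx (pp j) = Z + pp j" using nxI(1) by blast
        moreover have "i < Z + pp j" if "hmem i Z" for i
          using less_le_trans[OF hmem_less[OF that], of "Z + pp j"] by simp
        ultimately have "hsub (hi Z (pp j)) (lo (hi Z (pp j)) (nx (pp j)))"
          by (auto intro!: hsubI)
        then show ?thesis using False pl lg_mono hsub_trans hsub_lohi by blast
      qed
    qed
    show "u < v" if "j < j'" "hmem u (C j)" "hmem v (C j')" for j j' u v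
      using that ppm[of "j + 1" j'] unfolding C_def by (auto simp: hm_Suc_le)
  qed
qed

lemma hm_add0: "x + y = 0 \<longleftrightarrow> x = 0 \<and> y = (0::hm)"
  by (rule add_nonneg_eq_0_iff[OF hm_nonneg hm_nonneg])

section \<open>Pigeonhole principles for large sets\<close>

text \<open>The triple exponential covers the three demands made on the gap between consecutive
  points: a linear bound for the pigeonhole step (\<open>gg_a\<close>), a power of four counting the
  colour patterns of earlier points (\<open>gg_b\<close>), and the number of blocks required by the
  finite Ramsey theorem, exponentiated once more (\<open>gg_c\<close>).\<close>

definition gg :: "hm \<Rightarrow> hm" where "gg x = p2 (p2 (p2 (4 * x + 4)))"

lemma rec_gg: "rec s \<Longrightarrow> rec (\<lambda>x. gg (s x))" unfolding gg_def by (intro rr5)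

lemma gg_a: "4 * u + 4 < gg u"
  unfolding gg_def using p2_gt[of "4 * u + 4"] p2_gt[of "p2 (4 * u + 4)"] p2_gt[of "p2 (p2 (4 * u + 4))"] by order

lemma gg_b: "p2 (2 * (u + 1)) \<le> gg u"
proof -
  have "2 * (u + 1) \<le> 4 * u + 4" using ofm_nn[of u] unfolding hz_trans by simp
  then have "2 * (u + 1) \<le> p2 (p2 (4 * u + 4))" using p2_gt[of "4 * u + 4"] p2_gt[of "p2 (4 * u + 4)"] by order
  then show ?thesis unfolding gg_def by (rule p2_mono)
qed

lemma gg_c: "p2 (2 * p2 (12 * u)) \<le> gg u"
proof -
  have 4: "p2 4 = 16"
  proof -
    have "p2 4 = p2 (0 + 1 + 1 + 1 + 1)" by simp
    then show ?thesis by (simp only: p2_Suc p2_0) simp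
  qed
  have "4 * u < p2 (4 * u)" by (rule p2_gt)
  then have "12 * u + 1 \<le> p2 (4 * u + 4)" unfolding p2_add 4 hz_trans using ofm_nn[of u] by simp
  then have "p2 (12 * u + 1) \<le> p2 (p2 (4 * u + 4))" by (rule p2_mono)
  then show ?thesis unfolding gg_def p2_Suc by (rule p2_mono)
qed

text \<open>The element 0 is excluded because a block headed by 0 requires nothing to follow it;
  with positive heads, one block of the next lower exponent is always guaranteed.\<close>

definition Sp :: "hm \<Rightarrow> bool" where
  "Sp Z \<longleftrightarrow> (\<forall>x<Z. hmem x Z \<longrightarrow> 0 < x \<and> (\<forall>y<Z. hmem y Z \<longrightarrow> x < y \<longrightarrow> gg x < y))"

lemma dec_Sp: "rec s \<Longrightarrow> dec (\<lambda>x. Sp (s x))"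
  by (rule rec_dec[where P = Sp], assumption) (unfold Sp_def, intro rr5 rec_gg)

lemma Sp_iff: "Sp Z \<longleftrightarrow> (\<forall>x. hmem x Z \<longrightarrow> 0 < x \<and> (\<forall>y. hmem y Z \<longrightarrow> x < y \<longrightarrow> gg x < y))"
  unfolding Sp_def using hmem_less by blast

lemma Sp_pos: "Sp Z \<Longrightarrow> hmem x Z \<Longrightarrow> 0 < x" unfolding Sp_iff by blast
lemma Sp_gg: "Sp Z \<Longrightarrow> hmem x Z \<Longrightarrow> hmem y Z \<Longrightarrow> x < y \<Longrightarrow> gg x < y" unfolding Sp_iff by blast
lemma Sp_sub: "Sp Z \<Longrightarrow> hsub Y Z \<Longrightarrow> Sp Y" unfolding Sp_iff by (auto dest: hsubD)

definition rs :: "hm set \<Rightarrow> hm \<Rightarrow> hm" where "rs A Z = hset (\<lambda>i. hmem i Z \<and> i \<in> A) Z"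

lemma rec_rs: "A \<in> SS \<Longrightarrow> rec s \<Longrightarrow> rec (\<lambda>x. rs A (s x))"
  by (rule rec_comp[where f = "rs A"]) (unfold rs_def, intro rr5 dec_mem)

lemma mem_rs: "A \<in> SS \<Longrightarrow> hmem i (rs A Z) \<longleftrightarrow> hmem i Z \<and> i \<in> A"
proof -
  assume "A \<in> SS"
  then have "dec (\<lambda>i. hmem i Z \<and> i \<in> A)" by (intro rr5 dec_mem)
  from hset_spec(2)[OF this] show ?thesis unfolding rs_def using hmem_less by blast
qed

lemma SS_compl: "A \<in> SS \<Longrightarrow> - A \<in> SS"
  using dec_not[OF SS_dec[of A]] by (simp add: dec_def Collect_neg_eq)

lemma rs_lohi: assumes "A \<in> SS" shows "lo (rs A Z) p = rs A (lo Z p)" "hi (rs A Z) p = rs A (hi Z p)"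
  by (rule hset_eqI; auto simp: mem_rs[OF assms])+

lemma rs_mono: "A \<in> SS \<Longrightarrow> hsub Y Z \<Longrightarrow> hsub (rs A Y) (rs A Z)"
  by (auto intro!: hsubI simp: mem_rs dest: hsubD)

text \<open>Each pair of consecutive blocks contains a large part of one colour by \<open>G\<close>,
  and this pays for one unit of \<open>q\<close> or one of \<open>r\<close>; hence the factor 2 and
  the induction on \<open>q + r\<close>. The predicate \<open>P\<close> stands for sparseness or for
  no condition at all.\<close>

lemma pigeon_lgs:
  assumes A: "A \<in> SS" and P: "dec P" "\<And>Y Z. P Z \<Longrightarrow> hsub Y Z \<Longrightarrow> P Y"
    and G: "\<And>Z. P Z \<Longrightarrow> lgs a 2 Z \<Longrightarrow> lg a (rs A Z) \<or> lg a (rs (- A) Z)"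
    and Z: "P Z" "lgs a (2 * (q + r)) Z"
  shows "lgs a q (rs A Z) \<or> lgs a r (rs (- A) Z)"
proof -
  note B = SS_compl[OF A]
  have "q + r = s \<longrightarrow> P Z \<longrightarrow> lgs a (2 * s) Z \<longrightarrow> lgs a q (rs A Z) \<or> lgs a r (rs (- A) Z)" for s
  proof (rule pi_induct3[where R = "\<lambda>s Z q r. q + r = s \<longrightarrow> P Z \<longrightarrow> lgs a (2 * s) Z \<longrightarrow> lgs a q (rs A Z) \<or> lgs a r (rs (- A) Z)"])
    show "dec (\<lambda>z. hfst (hsnd (hsnd z)) + hsnd (hsnd (hsnd z)) = hfst z \<longrightarrow> P (hfst (hsnd z)) \<longrightarrow> lgs a (2 * hfst z) (hfst (hsnd z)) \<longrightarrow>
        lgs a (hfst (hsnd (hsnd z))) (rs A (hfst (hsnd z))) \<or> lgs a (hsnd (hsnd (hsnd z))) (rs (- A) (hfst (hsnd z))))"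
      by (intro rr5 rec_rs[OF A] rec_rs[OF B] rec_dec[OF _ P(1)])
    show "q + r = 0 \<longrightarrow> P Z \<longrightarrow> lgs a (2 * 0) Z \<longrightarrow> lgs a q (rs A Z) \<or> lgs a r (rs (- A) Z)" for Z q r
      by (auto simp: hm_add0)
    fix s Z q r
    assume IH: "\<And>Z q r. q + r = s \<longrightarrow> P Z \<longrightarrow> lgs a (2 * s) Z \<longrightarrow> lgs a q (rs A Z) \<or> lgs a r (rs (- A) Z)"
    show "q + r = s + 1 \<longrightarrow> P Z \<longrightarrow> lgs a (2 * (s + 1)) Z \<longrightarrow> lgs a q (rs A Z) \<or> lgs a r (rs (- A) Z)"
    proof (intro impI)
      assume e: "q + r = s + 1" and PZ: "P Z" and "lgs a (2 * (s + 1)) Z"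
      then have "lgs a (2 + 2 * s) Z" by (simp add: distrib_left add.commute)
      then obtain p where p: "lgs a 2 (lo Z p)" "lgs a (2 * s) (hi Z p)" using lgs_split by blast
      have PP: "P (lo Z p)" "P (hi Z p)" using P(2)[OF PZ] by simp_all
      show "lgs a q (rs A Z) \<or> lgs a r (rs (- A) Z)"
      proof (cases "q = 0 \<or> r = 0")
        case True then show ?thesis by auto
      next
        case False
        then obtain q' r' where qr: "q = q' + 1" "r = r' + 1" using hm_pred by blast
        have e1: "q' + r = s" "q + r' = s" using e unfolding qr by (simp_all add: add.assoc[symmetric] hm_basic(2)) (simp_all add: ac_simps)
        show ?thesis using G[OF PP(1) p(1)]
        proof
          assume 1: "lg a (rs A (lo Z p))"
          have "lgs a q' (rs A (hi Z p)) \<or> lgs a r (rs (- A) (hi Z p))" using IH[of q' r "hi Z p"] e1 PP(2) p(2) by blast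
          then show ?thesis
          proof
            assume "lgs a q' (rs A (hi Z p))"
            then show ?thesis using 1 lgs_Suc unfolding qr rs_lohi[OF A, symmetric] by blast
          next
            assume "lgs a r (rs (- A) (hi Z p))"
            then show ?thesis using lgs_mono rs_mono[OF B] hsub_lohi by blast
          qed
        next
          assume 1: "lg a (rs (- A) (lo Z p))"
          have "lgs a q (rs A (hi Z p)) \<or> lgs a r' (rs (- A) (hi Z p))" using IH[of q r' "hi Z p"] e1 PP(2) p(2) by blast
          then show ?thesis
          proof
            assume "lgs a r' (rs (- A) (hi Z p))"
            then show ?thesis using 1 lgs_Suc unfolding qr rs_lohi[OF B, symmetric] by blast
          next
            assume "lgs a q (rs A (hi Z p))"
            then show ?thesis using lgs_mono rs_mono[OF A] hsub_lohi by blast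
          qed
        qed
      qed
    qed
  qed
  then show ?thesis using Z by blast
qed

lemma pigeon0: assumes A: "A \<in> SS" and l: "lgs 0 (2 * (q + r)) Z"
  shows "lgs 0 q (rs A Z) \<or> lgs 0 r (rs (- A) Z)"
proof (rule pigeon_lgs[OF A dec_const[of True] _ _ _ l])
  fix Z assume "lgs 0 2 Z"
  then have "lgs 0 1 Z" by (rule lgs_le) simp
  then obtain i where "hmem i Z" unfolding lgs_1 lg_0 by blast
  then show "lg 0 (rs A Z) \<or> lg 0 (rs (- A) Z)" unfolding lg_0 mem_rs[OF A] mem_rs[OF SS_compl[OF A]] by blast
qed simp_all

text \<open>If the first of the two blocks has one colour only, it is the set wanted. Otherwise it
  contains heads \<open>u1\<close> and \<open>u2\<close> of both colours, and sparseness puts the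
  head \<open>x\<close> of the second block above \<open>2 * (u1 + u2)\<close>. The blocks of lower
  exponent behind \<open>x\<close> then give \<open>u1\<close> blocks of the first colour or
  \<open>u2\<close> of the second, and the matching head completes them.\<close>

lemma pigeon1: assumes A: "A \<in> SS" shows "Sp Z \<Longrightarrow> lgs a 2 Z \<Longrightarrow> lg a (rs A Z) \<or> lg a (rs (- A) Z)"
proof -
  note B = SS_compl[OF A]
  have "Sp Z \<longrightarrow> lgs a 2 Z \<longrightarrow> lg a (rs A Z) \<or> lg a (rs (- A) Z)"
  proof (rule pi_induct[where R = "\<lambda>a Z. Sp Z \<longrightarrow> lgs a 2 Z \<longrightarrow> lg a (rs A Z) \<or> lg a (rs (- A) Z)"])
    show "dec (\<lambda>z. Sp (hsnd z) \<longrightarrow> lgs (hfst z) 2 (hsnd z) \<longrightarrow> lg (hfst z) (rs A (hsnd z)) \<or> lg (hfst z) (rs (- A) (hsnd z)))"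
      by (intro rr5 dec_Sp rec_rs[OF A] rec_rs[OF B])
    show "Sp Z \<longrightarrow> lgs 0 2 Z \<longrightarrow> lg 0 (rs A Z) \<or> lg 0 (rs (- A) Z)" for Z
      using pigeon0[OF A, of 1 0 Z] pigeon0[OF A, of 0 1 Z] lgs_1 by (metis A B lgs_le lg_0 mem_rs one_le_numeral ComplI)
    fix a Z assume IH: "\<And>Z. Sp Z \<longrightarrow> lgs a 2 Z \<longrightarrow> lg a (rs A Z) \<or> lg a (rs (- A) Z)"
    show "Sp Z \<longrightarrow> lgs (a + 1) 2 Z \<longrightarrow> lg (a + 1) (rs A Z) \<or> lg (a + 1) (rs (- A) Z)"
    proof (intro impI)
      assume Sp: "Sp Z" and "lgs (a + 1) 2 Z"
      then have "lgs (a + 1) (1 + 1) Z" by simp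
      then obtain p where p: "lgs (a + 1) 1 (lo Z p)" "lgs (a + 1) 1 (hi Z p)" using lgs_split by blast
      then obtain x where x: "hmem x (hi Z p)" "lgs a x (hi (hi Z p) (x + 1))" unfolding lgs_1 lg_Suc by blast
      have l1: "lg (a + 1) (lo Z p)" using p(1) lgs_1 by blast
      show "lg (a + 1) (rs A Z) \<or> lg (a + 1) (rs (- A) Z)"
      proof (cases "\<forall>i. hmem i (lo Z p) \<longrightarrow> i \<in> A")
        case True
        then have "hsub (lo Z p) (rs A Z)" by (auto intro!: hsubI simp: mem_rs[OF A])
        then show ?thesis using l1 lg_mono by blast
      next
        case F: False
        then obtain u2 where u2: "hmem u2 (lo Z p)" "u2 \<in> - A" by blast
        show ?thesis
        proof (cases "\<forall>i. hmem i (lo Z p) \<longrightarrow> i \<in> - A")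
          case True
          then have "hsub (lo Z p) (rs (- A) Z)" by (auto intro!: hsubI simp: mem_rs[OF B])
          then show ?thesis using l1 lg_mono by blast
        next
          case False
          then obtain u1 where u1: "hmem u1 (lo Z p)" "u1 \<in> A" by blast
          have ux: "u1 < x" "u2 < x" using u1(1) u2(1) x(1) by (auto intro: less_le_trans)
          have "gg u1 < x" "gg u2 < x" using Sp_gg[OF Sp] u1 u2 x(1) ux by simp_all
          then have "2 * (u1 + u2) \<le> x" using gg_a[of u1] gg_a[of u2] ofm_nn[of u1] ofm_nn[of u2] unfolding hz_trans by simp
          then have "lgs a (2 * (u1 + u2)) (hi (hi Z p) (x + 1))" using x(2) lgs_le by blast
          moreover have "Sp (hi (hi Z p) (x + 1))" using Sp_sub[OF Sp] hsub_trans hsub_lohi by blast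
          ultimately have "lgs a u1 (rs A (hi (hi Z p) (x + 1))) \<or> lgs a u2 (rs (- A) (hi (hi Z p) (x + 1)))"
            using pigeon_lgs[OF A, of Sp a "hi (hi Z p) (x + 1)" u1 u2] IH Sp_sub dec_Sp[OF rec_id] by blast
          then show ?thesis
          proof
            assume "lgs a u1 (rs A (hi (hi Z p) (x + 1)))"
            then have "lgs a u1 (hi (rs A Z) (u1 + 1))"
              by (rule lgs_mono) (use ux in \<open>auto intro!: hsubI simp: mem_rs[OF A] hm_Suc_le\<close>)
            moreover have "hmem u1 (rs A Z)" using u1 by (simp add: mem_rs[OF A])
            ultimately show ?thesis unfolding lg_Suc by blast
          next
            assume "lgs a u2 (rs (- A) (hi (hi Z p) (x + 1)))"
            then have "lgs a u2 (hi (rs (- A) Z) (u2 + 1))"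
              by (rule lgs_mono) (use ux in \<open>auto intro!: hsubI simp: mem_rs[OF B] hm_Suc_le\<close>)
            moreover have "hmem u2 (rs (- A) Z)" using u2 by (simp add: mem_rs[OF B])
            ultimately show ?thesis unfolding lg_Suc by blast
          qed
        qed
      qed
    qed
  qed
  then show "Sp Z \<Longrightarrow> lgs a 2 Z \<Longrightarrow> lg a (rs A Z) \<or> lg a (rs (- A) Z)" by blast
qed

text \<open>The case \<open>q = r\<close> of the weighted version, whence the factor 4.\<close>

lemma pigeon: assumes A: "A \<in> SS" "Sp Z" "lgs a (4 * q) Z"
  shows "lgs a q (rs A Z) \<or> lgs a q (rs (- A) Z)"
  by (rule pigeon_lgs[OF A(1) dec_Sp[OF rec_id] Sp_sub pigeon1[OF A(1)] A(2)]) (use A(3) in \<open>auto simp: mult_2[symmetric]\<close>)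

definition cst :: "(hm \<Rightarrow> bool) \<Rightarrow> hm \<Rightarrow> bool" where
  "cst f Y \<longleftrightarrow> (\<forall>i<Y. \<forall>j<Y. hmem i Y \<longrightarrow> hmem j Y \<longrightarrow> (f i \<longleftrightarrow> f j))"

lemma cst_iff: "cst f Y \<longleftrightarrow> (\<forall>i j. hmem i Y \<longrightarrow> hmem j Y \<longrightarrow> (f i \<longleftrightarrow> f j))"
  unfolding cst_def using hmem_less by blast

lemma cst_sub: "cst f Z \<Longrightarrow> hsub Y Z \<Longrightarrow> cst f Y" unfolding cst_iff by (auto dest: hsubD)

lemma dec_cst: assumes "dec (\<lambda>z. \<phi> (hfst z) (hsnd z))" "rec s" "rec t" shows "dec (\<lambda>x. cst (\<phi> (s x)) (t x))"
  by (rule dec2[where P = "\<lambda>u v. cst (\<phi> u) v", OF _ assms(2,3)]) (unfold cst_def, intro rr5 dec2[OF assms(1)])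

text \<open>Every predicate of the family costs one application of \<open>pigeon\<close>, that is a
  factor 4 in the multiplicity; \<open>t\<close> of them use up \<open>p2 (2 * t)\<close> and leave
  a single block.\<close>

lemma family:
  assumes d: "dec (\<lambda>z. \<phi> (hfst z) (hsnd z))" and Sp: "Sp Z" and l: "lgs a (p2 (2 * t)) Z"
  shows "\<exists>Y. hsub Y Z \<and> lg a Y \<and> (\<forall>s<t. cst (\<phi> s) Y)"
proof -
  define Q where "Q s Y k \<longleftrightarrow> s + k = t \<and> hsub Y Z \<and> lgs a (p2 (2 * k)) Y \<and> (\<forall>s'<s. cst (\<phi> s') Y)" for s Y k
  have "s \<le> t \<longrightarrow> (\<exists>Y<p2 Z. \<exists>k\<le>t. Q s Y k)" for s
  proof (rule dec_induct[of "\<lambda>s. s \<le> t \<longrightarrow> (\<exists>Y<p2 Z. \<exists>k\<le>t. Q s Y k)"])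
    show "dec (\<lambda>s. s \<le> t \<longrightarrow> (\<exists>Y<p2 Z. \<exists>k\<le>t. Q s Y k))" unfolding Q_def by (intro rr5 dec_cst[OF d])
    have "Q 0 Z t" using l by (simp add: Q_def)
    then show "0 \<le> t \<longrightarrow> (\<exists>Y<p2 Z. \<exists>k\<le>t. Q 0 Y k)" using p2_gt by blast
    fix s assume IH: "s \<le> t \<longrightarrow> (\<exists>Y<p2 Z. \<exists>k\<le>t. Q s Y k)"
    show "s + 1 \<le> t \<longrightarrow> (\<exists>Y<p2 Z. \<exists>k\<le>t. Q (s + 1) Y k)"
    proof
      assume "s + 1 \<le> t"
      then have st: "s < t" by (simp add: hm_Suc_le)
      then obtain Y k where Q: "Q s Y k" using IH less_imp_le by blast
      then have "k \<noteq> 0" using st by (auto simp: Q_def)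
      then obtain k' where k: "k = k' + 1" using hm_pred by blast
      have "p2 (2 * k) = 4 * p2 (2 * k')"
      proof -
        have "2 * k = 2 * k' + 1 + 1" unfolding k by (simp add: distrib_left add.assoc)
        then show ?thesis by (simp only: p2_Suc) simp
      qed
      then have lk: "lgs a (4 * p2 (2 * k')) Y" using Q by (simp add: Q_def)
      have A: "{i. \<phi> s i} \<in> SS" using dec_SS[OF dec_section[OF d]] .
      have Y: "hsub Y Z" "\<And>s'. s' < s \<Longrightarrow> cst (\<phi> s') Y" using Q by (auto simp: Q_def)
      have e: "s + 1 + k' = t" using Q k by (auto simp: Q_def ac_simps)
      have main: "\<exists>Y<p2 Z. \<exists>k\<le>t. Q (s + 1) Y k" if "lgs a (p2 (2 * k')) (rs B Y)" "B \<in> SS" "cst (\<phi> s) (rs B Y)" for B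
      proof -
        have sb: "hsub (rs B Y) Y" using that(2) by (auto intro!: hsubI simp: mem_rs)
        have "Q (s + 1) (rs B Y) k'" unfolding Q_def
          using e that hsub_trans[OF sb Y(1)] cst_sub[OF Y(2) sb] by (auto elim!: less_Suc_cases)
        moreover have "rs B Y < p2 Z" using hsub_bd hsub_trans[OF sb Y(1)] by blast
        moreover have "k' \<le> t" using e by (metis add_increasing hm_nonneg order_refl)
        ultimately show ?thesis by blast
      qed
      from pigeon[OF A Sp_sub[OF Sp Y(1)] lk] show "\<exists>Y<p2 Z. \<exists>k\<le>t. Q (s + 1) Y k"
      proof
        assume "lgs a (p2 (2 * k')) (rs {i. \<phi> s i} Y)"
        then show ?thesis by (rule main[OF _ A]) (simp add: cst_iff mem_rs[OF A])
      next
        assume "lgs a (p2 (2 * k')) (rs (- {i. \<phi> s i}) Y)"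
        then show ?thesis by (rule main[OF _ SS_compl[OF A]]) (simp add: cst_iff mem_rs[OF SS_compl[OF A]])
      qed
    qed
  qed
  then obtain Y k where "Q t Y k" by blast
  then have "hsub Y Z \<and> lg a Y \<and> (\<forall>s<t. cst (\<phi> s) Y)" unfolding Q_def by (auto simp: lgs_1)
  then show ?thesis by blast
qed

definition hom :: "(hm \<Rightarrow> hm \<Rightarrow> bool) \<Rightarrow> bool \<Rightarrow> hm \<Rightarrow> bool" where
  "hom \<chi> d Y \<longleftrightarrow> (\<forall>i<Y. \<forall>j<Y. hmem i Y \<longrightarrow> hmem j Y \<longrightarrow> i < j \<longrightarrow> (\<chi> i j \<longleftrightarrow> d))"

lemma hom_iff: "hom \<chi> d Y \<longleftrightarrow> (\<forall>i j. hmem i Y \<longrightarrow> hmem j Y \<longrightarrow> i < j \<longrightarrow> (\<chi> i j \<longleftrightarrow> d))"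
  unfolding hom_def using hmem_less by blast

lemma dec_hom: assumes "dec (\<lambda>z. \<chi> (hfst z) (hsnd z))" "rec t" shows "dec (\<lambda>x. hom \<chi> d (t x))"
  by (rule rec_dec[where P = "hom \<chi> d", OF assms(2)]) (unfold hom_def, intro rr5 dec2[OF assms(1)])

text \<open>The usual recursion on \<open>s + t\<close>: a point is removed and the rest is split by
  its colour towards that point. Exponent 0 only counts elements, so the hypothesis provides
  \<open>8 ^ (s + t)\<close> of them. The homogeneous sets are bounded by \<open>p2 J\<close> in the
  induction to keep it decidable.\<close>

lemma ramsey:
  assumes \<chi>: "dec (\<lambda>z. \<chi> (hfst z) (hsnd z))" and l: "lgs 0 (p2 (3 * (s + t))) J"
  shows "(\<exists>H. hsub H J \<and> lgs 0 s H \<and> hom \<chi> True H) \<or> (\<exists>H. hsub H J \<and> lgs 0 t H \<and> hom \<chi> False H)"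
proof -
  define R where "R n J s t \<longleftrightarrow> (s + t = n \<longrightarrow> lgs 0 (p2 (3 * n)) J \<longrightarrow>
     (\<exists>H<p2 J. hsub H J \<and> lgs 0 s H \<and> hom \<chi> True H) \<or> (\<exists>H<p2 J. hsub H J \<and> lgs 0 t H \<and> hom \<chi> False H))" for n J s t
  have triv: "(\<exists>H<p2 J. hsub H J \<and> lgs 0 0 H \<and> hom \<chi> d H)" for J d
    by (rule exI[of _ 0]) (simp add: hsub_iff hom_iff)
  have "R (s + t) J s t"
  proof (rule pi_induct3[of R])
    show "dec (\<lambda>z. R (hfst z) (hfst (hsnd z)) (hfst (hsnd (hsnd z))) (hsnd (hsnd (hsnd z))))"
      unfolding R_def by (intro rr5 dec_hom[OF \<chi>])
    show "R 0 J s t" for J s t unfolding R_def using triv by (auto simp: hm_add0)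
    fix n J s t assume IH: "\<And>J s t. R n J s t"
    show "R (n + 1) J s t" unfolding R_def
    proof (intro impI)
      assume e: "s + t = n + 1" and l: "lgs 0 (p2 (3 * (n + 1))) J"
      show "(\<exists>H<p2 J. hsub H J \<and> lgs 0 s H \<and> hom \<chi> True H) \<or> (\<exists>H<p2 J. hsub H J \<and> lgs 0 t H \<and> hom \<chi> False H)"
      proof (cases "s = 0 \<or> t = 0")
        case True then show ?thesis using triv by auto
      next
        case False
        then obtain s' t' where st: "s = s' + 1" "t = t' + 1" using hm_pred by blast
        have e1: "s' + t = n" "s + t' = n" using e unfolding st by (simp_all add: add.assoc[symmetric] hm_basic(2)) (simp_all add: ac_simps)
        have "p2 (3 * (n + 1)) = 8 * p2 (3 * n)"
        proof -
          have "3 * (n + 1) = 3 * n + 1 + 1 + 1" by (simp add: distrib_left add.assoc)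
          then show ?thesis by (simp only: p2_Suc) simp
        qed
        \<comment> \<open>One point plus twice the two demands fits into the eightfold supply; this
          is where the base 8 comes from.\<close>
        then have "1 + 2 * (p2 (3 * n) + p2 (3 * n)) \<le> p2 (3 * (n + 1))" using p2_pos[of "3 * n"] unfolding hz_trans by simp
        then have "lgs 0 (1 + 2 * (p2 (3 * n) + p2 (3 * n))) J" using l lgs_le by blast
        then obtain p where p: "lgs 0 1 (lo J p)" "lgs 0 (2 * (p2 (3 * n) + p2 (3 * n))) (hi J p)" using lgs_split by blast
        then obtain j0 where j0: "hmem j0 (lo J p)" unfolding lgs_1 lg_0 by blast
        have A: "{j. \<chi> j0 j} \<in> SS" using dec_SS[OF dec_section[OF \<chi>]] .
        have main: "(\<exists>H<p2 J. hsub H J \<and> lgs 0 s H \<and> hom \<chi> True H) \<or> (\<exists>H<p2 J. hsub H J \<and> lgs 0 t H \<and> hom \<chi> False H)"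
          if B: "B \<in> SS" "lgs 0 (p2 (3 * n)) (rs B (hi J p))" "\<And>j. j \<in> B \<Longrightarrow> \<chi> j0 j \<longleftrightarrow> d" for B d
        proof -
          let ?J = "rs B (hi J p)"
          have sJ: "hsub ?J J" by (auto intro!: hsubI simp: mem_rs[OF B(1)])
          define s1 where "s1 = (if d then s' else s)"
          define t1 where "t1 = (if d then t else t')"
          have "s1 + t1 = n" using e1 by (simp add: s1_def t1_def)
          then have "(\<exists>H<p2 ?J. hsub H ?J \<and> lgs 0 s1 H \<and> hom \<chi> True H) \<or> (\<exists>H<p2 ?J. hsub H ?J \<and> lgs 0 t1 H \<and> hom \<chi> False H)"
            using IH[of ?J s1 t1] B(2) unfolding R_def by blast
          then obtain c H where H: "hsub H ?J" "lgs 0 (if c then s1 else t1) H" "hom \<chi> c H" by (metis (full_types))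
          have HJ: "hsub H J" using hsub_trans[OF H(1) sJ] .
          have "hsub H J \<and> H < p2 J" using HJ hsub_bd by blast
          show ?thesis
          proof (cases "c = d")
            case False
            then have "lgs 0 (if c then s else t) H" using H(2) by (auto simp: s1_def t1_def split: if_splits)
            then show ?thesis using H(3) HJ hsub_bd by (cases c) auto
          next
            case True
            define H' where "H' = hset (\<lambda>i. i = j0 \<or> hmem i H) J"
            have dH: "dec (\<lambda>i. i = j0 \<or> hmem i H)" by (intro rr5)
            have mH: "hmem i H' \<longleftrightarrow> i = j0 \<or> hmem i H" for i
              unfolding H'_def hset_spec(2)[OF dH] using hmem_less[of i J] j0 hsubD[OF HJ] by auto
            have sH: "hsub H' J" using j0 hsubD[OF HJ] by (auto intro!: hsubI simp: mH)
            have Hp: "p \<le> i" "i \<in> B" if "hmem i H" for i using hsubD[OF H(1) that] by (simp_all add: mem_rs[OF B(1)])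
            have "lg 0 (lo H' p)" unfolding lg_0 using j0 by (auto simp: mH)
            moreover have "lgs 0 (if c then s' else t') (hi H' p)"
              by (rule lgs_mono[of _ _ H]) (use H(2) True Hp in \<open>auto intro!: hsubI simp: mH s1_def t1_def split: if_splits\<close>)
            ultimately have "lgs 0 ((if c then s' else t') + 1) H'" unfolding lgs_Suc by blast
            moreover have "hom \<chi> c H'" unfolding hom_iff
            proof (intro allI impI)
              fix i j assume ij: "hmem i H'" "hmem j H'" "i < j"
              have "j \<noteq> j0"
              proof
                assume "j = j0"
                then have lt: "i < j0" "j0 < p" using ij j0 by simp_all
                then have "hmem i H" using ij(1) by (auto simp: mH)
                then show False using Hp(1) lt by (meson not_le less_trans)
              qed
              then have jH: "hmem j H" using ij by (simp add: mH)
              show "\<chi> i j \<longleftrightarrow> c"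
              proof (cases "i = j0")
                case True then show ?thesis using B(3) Hp(2)[OF jH] \<open>c = d\<close> by simp
              next
                case False then show ?thesis using H(3) ij jH unfolding hom_iff mH by blast
              qed
            qed
            ultimately show ?thesis using sH hsub_bd[OF sH] st by (cases c) auto
          qed
        qed
        from pigeon0[OF A p(2)] show ?thesis
        proof
          assume "lgs 0 (p2 (3 * n)) (rs {j. \<chi> j0 j} (hi J p))"
          then show ?thesis by (rule main[OF A, of True]) simp
        next
          assume "lgs 0 (p2 (3 * n)) (rs (- {j. \<chi> j0 j}) (hi J p))"
          then show ?thesis by (rule main[OF SS_compl[OF A], of False]) simp
        qed
      qed
    qed
  qed
  then show ?thesis unfolding R_def using l by blast
qed

section \<open>Ramsey's theorem for pairs and large sets\<close>

text \<open>With \<open>t\<close> one above the greatest predecessor of \<open>z\<close>, sparseness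
  leaves room for \<open>p2 (2 * t)\<close> below \<open>z\<close>. So a block with head
  \<open>z\<close> can be made constant with respect to the colours from all earlier points at
  once.\<close>

lemma pred_bound: assumes Sp: "Sp W" and z: "hmem z W"
  shows "\<exists>t. (\<forall>x. hmem x W \<longrightarrow> x < z \<longrightarrow> x < t) \<and> p2 (2 * t) \<le> z"
proof -
  define T where "T t \<longleftrightarrow> (\<forall>x<W. hmem x W \<longrightarrow> x < z \<longrightarrow> x < t)" for t
  have "dec T" unfolding T_def by (intro rr5)
  moreover have "T z" by (simp add: T_def)
  ultimately obtain t where t: "T t" "\<And>s. s < t \<Longrightarrow> \<not> T s" using dec_least by blast
  have "p2 (2 * t) \<le> z"
  proof (cases "t = 0")
    case True then show ?thesis using Sp_pos[OF Sp z] hm_Suc_le[of 0 z] by simp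
  next
    case False
    then obtain y where y: "t = y + 1" using hm_pred by blast
    then have "\<not> T y" using t(2) hm_less_self by simp
    then obtain x where x: "hmem x W" "x < z" "\<not> x < y" "x < W" unfolding T_def by blast
    then have "x < y + 1" using t(1) unfolding T_def y by blast
    then have "x = y" using x(3) by (auto simp: hm_basic(8))
    then have "gg y < z" using Sp_gg[OF Sp x(1) z x(2)] by simp
    then show ?thesis unfolding y using gg_b[of y] by order
  qed
  then show ?thesis using t(1) hmem_less unfolding T_def by blast
qed

lemma lg_lgs: assumes "lg (a + 1) Z" "\<And>z. hmem z Z \<Longrightarrow> q \<le> z" shows "\<exists>z. hmem z Z \<and> lgs a q (hi Z (z + 1))"
  using assms lgs_le unfolding lg_Suc by blast

text \<open>Two rounds of \<open>family\<close>, each costing one exponent. In the first, every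
  block becomes constant as seen from each point before it; this is affordable since its head
  dominates those points. In the second, every block becomes constant in its colours towards one
  representative \<open>e s\<close> of each of the \<open>K\<close> blocks, affordable by the lower
  bound on \<open>W\<close>. Then the colour between two blocks depends on their indices
  only.\<close>

lemma grouping:
  assumes \<chi>: "dec (\<lambda>z. \<chi> (hfst z) (hsnd z))" and Sp: "Sp W" and l: "lgs (a + 1 + 1) K W"
    and K: "\<And>z. hmem z W \<Longrightarrow> p2 (2 * K) \<le> z"
  obtains C \<psi> where "rec C" "\<And>j. j < K \<Longrightarrow> lg a (C j)" "\<And>j. j < K \<Longrightarrow> hsub (C j) W"
    "\<And>j j' u v. j < j' \<Longrightarrow> j' < K \<Longrightarrow> hmem u (C j) \<Longrightarrow> hmem v (C j') \<Longrightarrow> u < v"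
    "dec (\<lambda>z. \<psi> (hfst z) (hsnd z))"
    "\<And>j j' u v. j < j' \<Longrightarrow> j' < K \<Longrightarrow> hmem u (C j) \<Longrightarrow> hmem v (C j') \<Longrightarrow> \<chi> u v \<longleftrightarrow> \<psi> j j'"
proof -
  obtain C0 where C0: "rec C0" "\<And>j. j < K \<Longrightarrow> lg (a + 1 + 1) (C0 j)" "\<And>j. hsub (C0 j) W"
    "\<And>j j' u v. j < j' \<Longrightarrow> hmem u (C0 j) \<Longrightarrow> hmem v (C0 j') \<Longrightarrow> u < v"
    using lgs_blocks[OF l] by blast
  define Q1 where "Q1 j Y \<longleftrightarrow> hsub Y (C0 j) \<and> lg (a + 1) Y \<and> (\<forall>x<W. hmem x W \<longrightarrow> (\<forall>y<W. hmem y (C0 j) \<longrightarrow> x < y) \<longrightarrow> cst (\<chi> x) Y)" for j Y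
  have Q1: "\<exists>Y. Q1 j Y" if j: "j < K" for j
  proof -
    obtain z where z: "hmem z (C0 j)" "lgs (a + 1) z (hi (C0 j) (z + 1))" using C0(2)[OF j] unfolding lg_Suc by blast
    have zW: "hmem z W" using z(1) C0(3) hsubD by blast
    obtain t where t: "\<And>x. hmem x W \<Longrightarrow> x < z \<Longrightarrow> x < t" "p2 (2 * t) \<le> z" using pred_bound[OF Sp zW] by blast
    have sub: "hsub (hi (C0 j) (z + 1)) (C0 j)" by simp
    have SpC: "Sp (hi (C0 j) (z + 1))" using Sp_sub[OF Sp] C0(3) hsub_trans[OF sub] by blast
    obtain Y where Y: "hsub Y (hi (C0 j) (z + 1))" "lg (a + 1) Y" "\<And>s. s < t \<Longrightarrow> cst (\<chi> s) Y"
      using family[OF \<chi> SpC lgs_le[OF z(2) t(2)]] by blast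
    have "Q1 j Y" unfolding Q1_def
    proof (intro conjI allI impI)
      show "hsub Y (C0 j)" using hsub_trans[OF Y(1) sub] .
      fix x assume "hmem x W" "\<forall>y<W. hmem y (C0 j) \<longrightarrow> x < y"
      then have "x < z" using z(1) hmem_less[OF zW] by blast
      then show "cst (\<chi> x) Y" using Y(3) t(1) \<open>hmem x W\<close> by blast
    qed (rule Y(2))
    then show ?thesis by blast
  qed
  have "dec (\<lambda>z. Q1 (hfst z) (hsnd z))" unfolding Q1_def by (intro rr5 dec_cst[OF \<chi>] rec_comp[OF C0(1)])
  then obtain C1 where C1: "rec C1" "\<And>j. j < K \<Longrightarrow> Q1 j (C1 j)" using rec_choice[of Q1 K] Q1 by blast
  have C1l: "lg (a + 1) (C1 j)" "hsub (C1 j) (C0 j)" "hsub (C1 j) W" if "j < K" for j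
    using C1(2)[OF that] C0(3) hsub_trans unfolding Q1_def by blast+
  have "dec (\<lambda>z. hmem (hsnd z) (C1 (hfst z)))" by (intro rr5 rec_comp[OF C1(1)])
  then obtain e where e: "rec e" "\<And>j. j < K \<Longrightarrow> hmem (e j) (C1 j)"
    using rec_choice[of "\<lambda>j y. hmem y (C1 j)" K] C1l(1) lg_ne by blast
  have const1: "\<chi> u v \<longleftrightarrow> \<chi> u (e j')" if jj: "j < j'" "j' < K" "hmem u (C1 j)" "hmem v (C1 j')" for j j' u v
  proof -
    have jK: "j < K" using jj by order
    have u0: "hmem u (C0 j)" "hmem u W" using C1l(2,3)[OF jK] jj(3) hsubD by blast+
    have "\<forall>y<W. hmem y (C0 j') \<longrightarrow> u < y" using C0(4)[OF jj(1) u0(1)] by blast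
    then have "cst (\<chi> u) (C1 j')" using C1(2)[OF jj(2)] u0(2) hmem_less unfolding Q1_def by blast
    then show ?thesis using jj(4) e(2)[OF jj(2)] unfolding cst_iff by blast
  qed
  \<comment> \<open>By the first round a later block is represented by one of its points, so only
    \<open>K\<close> predicates are left to be made constant.\<close>
  define \<phi> where "\<phi> s x \<longleftrightarrow> \<chi> x (e s)" for s x
  have d\<phi>: "dec (\<lambda>z. \<phi> (hfst z) (hsnd z))" unfolding \<phi>_def by (intro dec2[OF \<chi>] rr5 rec_comp[OF e(1)])
  define Q2 where "Q2 j Y \<longleftrightarrow> hsub Y (C1 j) \<and> lg a Y \<and> (\<forall>s<K. cst (\<phi> s) Y)" for j Y
  have Q2: "\<exists>Y. Q2 j Y" if j: "j < K" for j
  proof -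
    obtain z where z: "lgs a (p2 (2 * K)) (hi (C1 j) (z + 1))"
      using lg_lgs[OF C1l(1)[OF j], of "p2 (2 * K)"] K C1l(3)[OF j] hsubD by blast
    have SpC: "Sp (hi (C1 j) (z + 1))" using Sp_sub[OF Sp] C1l(3)[OF j] hsub_trans hsub_lohi by blast
    show ?thesis using family[OF d\<phi> SpC z] hsub_trans hsub_lohi unfolding Q2_def by blast
  qed
  have "dec (\<lambda>z. Q2 (hfst z) (hsnd z))" unfolding Q2_def by (intro rr5 dec_cst[OF d\<phi>] rec_comp[OF C1(1)])
  then obtain C where C: "rec C" "\<And>j. j < K \<Longrightarrow> Q2 j (C j)" using rec_choice[of Q2 K] Q2 by blast
  have Cl: "lg a (C j)" "hsub (C j) (C1 j)" if "j < K" for j using C(2)[OF that] unfolding Q2_def by blast+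
  have "dec (\<lambda>z. hmem (hsnd z) (C (hfst z)))" by (intro rr5 rec_comp[OF C(1)])
  then obtain e2 where e2: "rec e2" "\<And>j. j < K \<Longrightarrow> hmem (e2 j) (C j)"
    using rec_choice[of "\<lambda>j y. hmem y (C j)" K] Cl(1) lg_ne by blast
  show ?thesis
  proof (rule that[of C "\<lambda>i j. \<chi> (e2 i) (e j)"])
    show "rec C" by (rule C(1))
    show "dec (\<lambda>z. \<chi> (e2 (hfst z)) (e (hsnd z)))" by (intro dec2[OF \<chi>] rr5 rec_comp[OF e(1)] rec_comp[OF e2(1)])
    show "lg a (C j)" if "j < K" for j using Cl(1)[OF that] .
    show "hsub (C j) W" if "j < K" for j using Cl(2)[OF that] C1l(3)[OF that] hsub_trans by blast
    fix j j' u v assume jj: "j < j'" "j' < K" "hmem u (C j)" "hmem v (C j')"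
    have jK: "j < K" using jj by order
    have uv: "hmem u (C1 j)" "hmem v (C1 j')" using jj Cl(2)[OF jK] Cl(2)[OF jj(2)] hsubD by blast+
    show "u < v" using C0(4)[OF jj(1)] uv C1l(2)[OF jK] C1l(2)[OF jj(2)] hsubD by blast
    have "\<chi> u v \<longleftrightarrow> \<chi> u (e j')" by (rule const1[OF jj(1,2) uv])
    also have "\<dots> \<longleftrightarrow> \<chi> (e2 j) (e j')"
      using C(2)[OF jK] jj(2,3) e2(2)[OF jK] unfolding Q2_def cst_iff \<phi>_def by blast
    finally show "\<chi> u v \<longleftrightarrow> \<chi> (e2 j) (e j')" .
  qed
qed

lemma mem_sng: "hmem i (p2 j) \<longleftrightarrow> i = j" using hmem_add[of 0 j i] by simp

lemma lgs_init: "lgs 0 K (hset (\<lambda>_. True) K)"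
  by (rule lgs_build[of p2]) (use rec_p2[OF rec_id] in \<open>auto simp: lg_0 mem_sng hset_spec(2)[OF dec_const] intro!: hsubI\<close>)

lemma lgs_enum: assumes "lgs 0 q H"
  obtains h where "rec h" "\<And>j. j < q \<Longrightarrow> hmem (h j) H" "\<And>j j'. j < j' \<Longrightarrow> j' < q \<Longrightarrow> h j < h j'"
proof -
  obtain C where C: "rec C" "\<And>j. j < q \<Longrightarrow> lg 0 (C j)" "\<And>j. hsub (C j) H"
    "\<And>j j' u v. j < j' \<Longrightarrow> hmem u (C j) \<Longrightarrow> hmem v (C j') \<Longrightarrow> u < v"
    using lgs_blocks[OF assms] by blast
  have "dec (\<lambda>z. hmem (hsnd z) (C (hfst z)))" by (intro rr5 rec_comp[OF C(1)])
  then obtain h where h: "rec h" "\<And>j. j < q \<Longrightarrow> hmem (h j) (C j)"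
    using rec_choice[of "\<lambda>j y. hmem y (C j)" q] C(2) lg_ne by blast
  show ?thesis
  proof (rule that[OF h(1)])
    show "hmem (h j) H" if "j < q" for j using h(2)[OF that] C(3) hsubD by blast
    show "h j < h j'" if jj: "j < j'" "j' < q" for j j'
      using C(4)[OF jj(1) h(2) h(2)[OF jj(2)]] jj by (meson less_trans)
  qed
qed

text \<open>The invariant of the Ramsey induction: the head \<open>x\<close> merely counts the
  blocks of the homogeneous set behind it and need not be homogeneous with it. Nothing is known
  about the colours between \<open>x\<close> and \<open>Y\<close>. All witnesses are bounded for
  decidability.\<close>

definition Out :: "(hm \<Rightarrow> hm \<Rightarrow> bool) \<Rightarrow> bool \<Rightarrow> hm \<Rightarrow> hm \<Rightarrow> bool" where
  "Out \<chi> d n X \<longleftrightarrow> n = 0 \<or> (\<exists>m<n. n = m + 1 \<and> (\<exists>x<X. hmem x X \<and> (\<exists>Y<p2 X. hsub Y X \<and> (\<forall>i<Y. hmem i Y \<longrightarrow> x < i) \<and> hom \<chi> d Y \<and> lgs m x Y)))"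

lemma Out_Suc: "Out \<chi> d (m + 1) X \<longleftrightarrow> (\<exists>x Y. hmem x X \<and> hsub Y X \<and> (\<forall>i. hmem i Y \<longrightarrow> x < i) \<and> hom \<chi> d Y \<and> lgs m x Y)" (is "?L \<longleftrightarrow> ?R")
proof
  assume ?L then show ?R unfolding Out_def using hm_basic(1,2) hmem_less by metis
next
  assume ?R
  then obtain x Y where "hmem x X" "hsub Y X" "\<forall>i. hmem i Y \<longrightarrow> x < i" "hom \<chi> d Y" "lgs m x Y" by blast
  then show ?L unfolding Out_def using hmem_less hsub_bd hm_less_self by blast
qed

lemma Out_mono: "Out \<chi> d n X \<Longrightarrow> hsub X X' \<Longrightarrow> Out \<chi> d n X'"
proof -
  assume a: "Out \<chi> d n X" "hsub X X'"
  show "Out \<chi> d n X'"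
  proof (cases "n = 0")
    case True then show ?thesis by (simp add: Out_def)
  next
    case False
    then obtain m where nm: "n = m + 1" using hm_pred by blast
    show ?thesis using a(1) hsubD[OF a(2)] hsub_trans[OF _ a(2)] unfolding nm Out_Suc by blast
  qed
qed

lemma dec_Out: assumes "dec (\<lambda>z. \<chi> (hfst z) (hsnd z))" "rec s" "rec t" shows "dec (\<lambda>x. Out \<chi> d (s x) (t x))"
  by (rule dec2[where P = "Out \<chi> d", OF _ assms(2,3)]) (unfold Out_def, intro rr5 dec_hom[OF assms(1)])

text \<open>The sets \<open>D j\<close> are used in pairs. The head found inside
  \<open>D (2 * i + 1)\<close> may have wrong colours and is discarded; an arbitrary point of
  \<open>D (2 * i)\<close> takes its place, which is smaller and has colour \<open>d\<close> towards
  the whole of the next set. So \<open>2 * x0\<close> sets produce \<open>x0\<close> homogeneous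
  blocks, as many as the head \<open>x0\<close> asks for.\<close>

lemma Out_step:
  assumes \<chi>: "dec (\<lambda>z. \<chi> (hfst z) (hsnd z))" and D: "rec D" "\<And>j. j < 2 * x0 \<Longrightarrow> Out \<chi> d m (D j)" "\<And>j. j < 2 * x0 \<Longrightarrow> hsub (D j) X"
    and ne: "\<And>j. j < 2 * x0 \<Longrightarrow> \<exists>i. hmem i (D j)"
    and ord: "\<And>j j' u v. j < j' \<Longrightarrow> j' < 2 * x0 \<Longrightarrow> hmem u (D j) \<Longrightarrow> hmem v (D j') \<Longrightarrow> u < v \<and> (\<chi> u v \<longleftrightarrow> d)"
    and x0: "hmem x0 X" "\<And>j u. j < 2 * x0 \<Longrightarrow> hmem u (D j) \<Longrightarrow> x0 < u"
  shows "Out \<chi> d (m + 1) X"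
proof -
  have idx: "2 * i < 2 * x0" "2 * i + 1 < 2 * x0" if "i < x0" for i
    using that unfolding hz_trans by simp_all
  define Q where "Q i E \<longleftrightarrow> (\<forall>v<E. hmem v E \<longrightarrow> hmem v (D (2 * i)) \<or> hmem v (D (2 * i + 1))) \<and> hom \<chi> d E \<and> lg m E" for i E
  have Q: "\<exists>E. Q i E" if i: "i < x0" for i
  proof -
    obtain y where y: "hmem y (D (2 * i))" using ne idx(1)[OF i] by blast
    show ?thesis
    proof (cases "m = 0")
      case True
      have "Q i (p2 y)" unfolding Q_def hom_iff using True y by (auto simp: mem_sng lg_0)
      then show ?thesis by blast
    next
      case False
      then obtain m' where m': "m = m' + 1" using hm_pred by blast
      obtain x' Y' where Y': "hmem x' (D (2 * i + 1))" "hsub Y' (D (2 * i + 1))" "\<And>v. hmem v Y' \<Longrightarrow> x' < v" "hom \<chi> d Y'" "lgs m' x' Y'"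
        using D(2)[OF idx(2)[OF i]] unfolding m' Out_Suc by blast
      have o: "y < v \<and> (\<chi> y v \<longleftrightarrow> d)" if "hmem v (D (2 * i + 1))" for v
        by (rule ord[OF hm_less_self idx(2)[OF i] y that])
      define E where "E = hset (\<lambda>v. v = y \<or> hmem v Y') (y + Y' + 1)"
      have dE: "dec (\<lambda>v. v = y \<or> hmem v Y')" by (intro rr5)
      have E: "hmem v E \<longleftrightarrow> v = y \<or> hmem v Y'" for v
        unfolding E_def hset_spec(2)[OF dE] using hmem_less[of v Y'] by (auto simp: hm_less_Suc intro: add_increasing less_imp_le)
      have "lgs m' y (hi E (y + 1))"
      proof (rule lgs_mono)
        show "lgs m' y Y'" using Y'(5) o[OF Y'(1)] by (auto elim: lgs_le)
        show "hsub Y' (hi E (y + 1))" using o hsubD[OF Y'(2)] by (auto intro!: hsubI simp: E hm_Suc_le)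
      qed
      then have "lg m E" unfolding m' lg_Suc using E by blast
      moreover have "hom \<chi> d E" unfolding hom_iff
      proof (intro allI impI)
        fix u v assume uv: "hmem u E" "hmem v E" "u < v"
        have "v \<noteq> y" using uv o hsubD[OF Y'(2)] by (auto simp: E dest: less_asym)
        then have v: "hmem v Y'" using uv(2) E by blast
        show "\<chi> u v \<longleftrightarrow> d"
        proof (cases "u = y")
          case True then show ?thesis using o[OF hsubD[OF Y'(2) v]] by simp
        next
          case False then show ?thesis using Y'(4) uv v E unfolding hom_iff by blast
        qed
      qed
      ultimately have "Q i E" unfolding Q_def using y hsubD[OF Y'(2)] E by auto
      then show ?thesis by blast
    qed
  qed
  have "dec (\<lambda>z. Q (hfst z) (hsnd z))" unfolding Q_def by (intro rr5 dec_hom[OF \<chi>] rec_comp[OF D(1)])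
  then obtain E where E: "rec E" "\<And>i. i < x0 \<Longrightarrow> Q i (E i)" using rec_choice[of Q x0] Q by blast
  have EQ: "hmem v (D (2 * i)) \<or> hmem v (D (2 * i + 1))" if "i < x0" "hmem v (E i)" for i v
    using E(2)[OF that(1)] that(2) hmem_less unfolding Q_def by blast
  have EX: "hmem v X" "x0 < v" if "i < x0" "hmem v (E i)" for i v
    using EQ[OF that] idx[OF that(1)] D(3) x0(2) hsubD by blast+
  have EE: "u < v \<and> (\<chi> u v \<longleftrightarrow> d)" if ii: "i < i'" "i' < x0" "hmem u (E i)" "hmem v (E i')" for i i' u v
  proof -
    have iK: "i < x0" using ii by order
    have "2 * i + 1 < 2 * i'" "2 * i < 2 * i'" "2 * i + 1 < 2 * i' + 1" "2 * i < 2 * i' + 1" using ii(1) unfolding hz_trans by simp_all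
    then show ?thesis using EQ[OF iK ii(3)] EQ[OF ii(2,4)] ord idx[OF ii(2)] by blast
  qed
  define Y where "Y = hset (\<lambda>v. \<exists>i<x0. hmem v (E i)) X"
  have dY: "dec (\<lambda>v. \<exists>i<x0. hmem v (E i))" by (intro rr5 rec_comp[OF E(1)])
  have Y: "hmem v Y \<longleftrightarrow> (\<exists>i<x0. hmem v (E i))" for v
    unfolding Y_def hset_spec(2)[OF dY] using EX(1) hmem_less by blast
  have "lgs m x0 Y"
  proof (rule lgs_build[OF E(1)])
    show "lg m (E j)" if "j < x0" for j using E(2)[OF that] unfolding Q_def by blast
    show "hsub (E j) Y" if "j < x0" for j using that by (auto intro!: hsubI simp: Y)
  qed (use EE in blast)
  moreover have "hom \<chi> d Y" unfolding hom_iff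
  proof (intro allI impI)
    fix u v assume uv: "hmem u Y" "hmem v Y" "u < v"
    then obtain i j where ij: "i < x0" "hmem u (E i)" "j < x0" "hmem v (E j)" unfolding Y by blast
    consider "i < j" | "i = j" | "j < i" by (metis linorder_neqE)
    then show "\<chi> u v \<longleftrightarrow> d"
    proof cases
      case 1 then show ?thesis using EE ij by blast
    next
      case 2 then show ?thesis using E(2)[OF ij(1)] ij uv(3) unfolding Q_def hom_iff by blast
    next
      case 3 then show ?thesis using EE[OF 3 ij(1) ij(4,2)] uv(3) by (meson less_asym)
    qed
  qed
  moreover have "hsub Y X" "\<forall>i. hmem i Y \<longrightarrow> x0 < i" using EX by (auto intro!: hsubI simp: Y)
  ultimately show ?thesis unfolding Out_Suc using x0(1) by blast
qed

text \<open>Each increase of \<open>N\<close> costs four exponents: one for the head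
  \<open>x0\<close>, one for a second head \<open>x1\<close> that exceeds every quantity computed
  from \<open>x0\<close>, and two for \<open>grouping\<close>. The induction hypothesis is then
  applied inside each of the \<open>2 * x0\<close> blocks that remain after the finite Ramsey
  theorem.\<close>

lemma ramsey_Out:
  assumes \<chi>: "dec (\<lambda>z. \<chi> (hfst z) (hsnd z))"
  shows "n1 + n0 = N \<Longrightarrow> Sp X \<Longrightarrow> lg (4 * N) X \<Longrightarrow> Out \<chi> True n1 X \<or> Out \<chi> False n0 X"
proof -
  define R where "R N X n1 n0 \<longleftrightarrow> (n1 + n0 = N \<longrightarrow> Sp X \<longrightarrow> lg (4 * N) X \<longrightarrow> Out \<chi> True n1 X \<or> Out \<chi> False n0 X)" for N X n1 n0
  have "R N X n1 n0"
  proof (rule pi_induct3[of R])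
    show "dec (\<lambda>z. R (hfst z) (hfst (hsnd z)) (hfst (hsnd (hsnd z))) (hsnd (hsnd (hsnd z))))"
      unfolding R_def by (intro rr5 dec_Out[OF \<chi>] dec_Sp)
    show "R 0 X n1 n0" for X n1 n0 unfolding R_def Out_def by (auto simp: hm_add0)
    fix N X n1 n0 assume IH: "\<And>X n1 n0. R N X n1 n0"
    show "R (N + 1) X n1 n0" unfolding R_def
    proof (intro impI)
      assume e: "n1 + n0 = N + 1" and Sp: "Sp X" and l: "lg (4 * (N + 1)) X"
      show "Out \<chi> True n1 X \<or> Out \<chi> False n0 X"
      proof (cases "n1 = 0 \<or> n0 = 0")
        case True then show ?thesis by (auto simp: Out_def)
      next
        case False
        then obtain m1 m0 where m: "n1 = m1 + 1" "n0 = m0 + 1" using hm_pred by blast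
        have e1: "m1 + n0 = N" "n1 + m0 = N" using e unfolding m by (simp_all add: add.assoc[symmetric] hm_basic(2)) (simp_all add: ac_simps)
        have "4 * (N + 1) = 4 * N + 1 + 1 + 1 + 1" by (simp add: distrib_left add.assoc)
        then have "lg (4 * N + 1 + 1 + 1 + 1) X" using l by (simp only:)
        then obtain x0 where x0: "hmem x0 X" "lgs (4 * N + 1 + 1 + 1) x0 (hi X (x0 + 1))" unfolding lg_Suc by blast
        then have "lgs (4 * N + 1 + 1 + 1) 1 (hi X (x0 + 1))" using Sp_pos[OF Sp x0(1)] hm_Suc_le[of 0 x0] by (auto elim: lgs_le)
        then obtain x1 where x1: "hmem x1 (hi X (x0 + 1))" "lgs (4 * N + 1 + 1) x1 (hi (hi X (x0 + 1)) (x1 + 1))"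
          unfolding lgs_1 lg_Suc by blast
        define W where "W = hi (hi X (x0 + 1)) (x1 + 1)"
        \<comment> \<open>This is \<open>8 ^ (2 * x0 + 2 * x0)\<close>, the number of blocks from
          which \<open>ramsey\<close> selects \<open>2 * x0\<close> with one colour between any two
          of them.\<close>
        define K where "K = p2 (12 * x0)"
        have WX: "hsub W X" unfolding W_def by (auto intro!: hsubI)
        have x01: "x0 < x1" using x1(1) by (simp add: hm_Suc_le)
        have gx: "gg x0 < x1" using Sp_gg[OF Sp x0(1) _ x01] x1(1) by simp
        have pK: "p2 (2 * K) < x1" using gg_c[of x0] gx unfolding K_def by order
        have "K \<le> x1" using p2_gt[of "2 * K"] pK ofm_nn[of K] unfolding hz_trans by simp
        then have lW: "lgs (4 * N + 1 + 1) K W" using x1(2) lgs_le unfolding W_def by blast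
        have Wx: "x1 < z" if "hmem z W" for z using that unfolding W_def by (simp add: hm_Suc_le)
        have "p2 (2 * K) \<le> z" if "hmem z W" for z using pK Wx[OF that] by order
        then obtain C \<psi> where C: "rec C" "\<And>j. j < K \<Longrightarrow> lg (4 * N) (C j)" "\<And>j. j < K \<Longrightarrow> hsub (C j) W"
          "\<And>j j' u v. j < j' \<Longrightarrow> j' < K \<Longrightarrow> hmem u (C j) \<Longrightarrow> hmem v (C j') \<Longrightarrow> u < v"
          "dec (\<lambda>z. \<psi> (hfst z) (hsnd z))"
          "\<And>j j' u v. j < j' \<Longrightarrow> j' < K \<Longrightarrow> hmem u (C j) \<Longrightarrow> hmem v (C j') \<Longrightarrow> \<chi> u v \<longleftrightarrow> \<psi> j j'"
          using grouping[OF \<chi> Sp_sub[OF Sp WX] lW] by blast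
        have "3 * (2 * x0 + 2 * x0) = 12 * x0" by (simp add: mult_2[symmetric] mult.assoc[symmetric])
        then have "lgs 0 (p2 (3 * (2 * x0 + 2 * x0))) (hset (\<lambda>_. True) K)" using lgs_init[of K] by (simp add: K_def)
        from ramsey[OF C(5) this]
        obtain d H where H: "hsub H (hset (\<lambda>_. True) K)" "lgs 0 (2 * x0) H" "hom \<psi> d H" by blast
        obtain h where h: "rec h" "\<And>j. j < 2 * x0 \<Longrightarrow> hmem (h j) H" "\<And>j j'. j < j' \<Longrightarrow> j' < 2 * x0 \<Longrightarrow> h j < h j'"
          using lgs_enum[OF H(2)] by blast
        have hK: "h j < K" if "j < 2 * x0" for j using hsubD[OF H(1) h(2)[OF that]] hset_spec(2)[OF dec_const] by blast
        define D where "D j = C (h j)" for j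
        have rD: "rec D" unfolding D_def by (rule rec_comp[OF C(1) h(1)])
        have DX: "hsub (D j) X" "lg (4 * N) (D j)" "\<And>u. hmem u (D j) \<Longrightarrow> x0 < u" if "j < 2 * x0" for j
          using C(2,3)[OF hK[OF that]] hsub_trans[OF _ WX] hsubD[OF C(3)[OF hK[OF that]]] Wx x01 unfolding D_def by (auto dest: Wx intro: less_trans)
        have ord: "u < v \<and> (\<chi> u v \<longleftrightarrow> d)" if jj: "j < j'" "j' < 2 * x0" "hmem u (D j)" "hmem v (D j')" for j j' u v
        proof -
          have j: "j < 2 * x0" using jj by order
          have hh: "h j < h j'" using h(3) jj by blast
          have "\<psi> (h j) (h j') \<longleftrightarrow> d" using H(3) h(2)[OF j] h(2)[OF jj(2)] hh unfolding hom_iff by blast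
          then show ?thesis using C(4,6)[OF hh hK[OF jj(2)]] jj(3,4) unfolding D_def by blast
        qed
        \<comment> \<open>Either some block already yields the full demand for the opposite colour,
          or all of them yield the demand for \<open>d\<close> lowered by one, and
          \<open>Out_step\<close> raises it again.\<close>
        have fin: "Out \<chi> d (m' + 1) X \<or> Out \<chi> (\<not> d) n' X" if r: "\<And>j. j < 2 * x0 \<Longrightarrow> Out \<chi> d m' (D j) \<or> Out \<chi> (\<not> d) n' (D j)" for m' n'
        proof (cases "\<exists>j<2 * x0. Out \<chi> (\<not> d) n' (D j)")
          case True then show ?thesis using Out_mono DX(1) by blast
        next
          case False
          then have a: "Out \<chi> d m' (D j)" if "j < 2 * x0" for j using r that by blast
          have "Out \<chi> d (m' + 1) X"
            by (rule Out_step[OF \<chi> rD a DX(1) _ ord x0(1) DX(3)]) (use lg_ne DX(2) in blast)+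
          then show ?thesis by blast
        qed
        have IHD: "Out \<chi> True a (D j) \<or> Out \<chi> False b (D j)" if "j < 2 * x0" "a + b = N" for j a b
          using IH[of "D j" a b] that DX(2)[OF that(1)] Sp_sub[OF Sp DX(1)[OF that(1)]] unfolding R_def by blast
        show ?thesis
        proof (cases d)
          case True
          then show ?thesis using fin[of m1 n0] IHD e1(1) m(1) by auto
        next
          case False
          then show ?thesis using fin[of m0 n1] IHD e1(2) m(2) by auto
        qed
      qed
    qed
  qed
  then show "n1 + n0 = N \<Longrightarrow> Sp X \<Longrightarrow> lg (4 * N) X \<Longrightarrow> Out \<chi> True n1 X \<or> Out \<chi> False n0 X" unfolding R_def by blast
qed

text \<open>The demand is raised to \<open>n + 1\<close> for both colours: the head in
  \<open>Out\<close> is positive and therefore guarantees one homogeneous block of exponent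
  \<open>n\<close>. The constants are \<open>4 * ((n + 1) + (n + 1))\<close>.\<close>

theorem ramsey_large:
  assumes \<chi>: "dec (\<lambda>z. \<chi> (hfst z) (hsnd z))" and Sp: "Sp X" and l: "lg (8 * n + 8) X"
  shows "\<exists>d Y. hsub Y X \<and> hom \<chi> d Y \<and> lg n Y"
proof -
  have "4 * ((n + 1) + (n + 1)) = 8 * n + 8" unfolding hz_trans by simp
  then have "Out \<chi> True (n + 1) X \<or> Out \<chi> False (n + 1) X" using ramsey_Out[OF \<chi> refl Sp] l by metis
  then obtain d x Y where Y: "hmem x X" "hsub Y X" "hom \<chi> d Y" "lgs n x Y" unfolding Out_Suc by blast
  then have "lgs n 1 Y" using Sp_pos[OF Sp Y(1)] hm_Suc_le[of 0 x] by (auto elim: lgs_le)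
  then show ?thesis using Y lgs_1 by blast
qed

section \<open>Ordinals below omega to the omega\<close>

text \<open>Describes truncated subtraction as a search, so that \<open>rec_Least\<close> shows it
  recursive.\<close>

lemma minus_Least: "x - y = (LEAST z. x \<le> y + (z::hm))"
proof (rule Least_equality[symmetric])
  show "x \<le> y + (x - y)" by (cases "y \<le> x") (simp_all add: hm_diff[symmetric] add_increasing2 less_imp_le)
  fix z assume z: "x \<le> y + z"
  show "x - y \<le> z"
  proof (cases "y \<le> x")
    case True
    then have "y + (x - y) \<le> y + z" using z by (simp add: hm_diff[symmetric])
    then show ?thesis by simp
  next
    case False then show ?thesis by (simp add: hm_diff0)
  qed
qed

lemma rec_minus: "rec s \<Longrightarrow> rec t \<Longrightarrow> rec (\<lambda>x. s x - t x)"
proof (rule rec2[where f = "(-)"])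
  show "rec (\<lambda>z. hfst z - hsnd z)" unfolding minus_Least
  proof (rule rec_Least)
    show "dec (\<lambda>z. hfst (hfst z) \<le> hsnd (hfst z) + hsnd z)" by (intro rr5)
    show "\<exists>y. hfst x \<le> hsnd x + y" for x by (rule exI[of _ "hfst x"]) simp
  qed
qed

lemmas rr6 = rr5 rec_minus

definition isord :: "hm \<Rightarrow> bool" where "isord s \<longleftrightarrow> (\<forall>j<hlen s. \<forall>i<j. hent s j \<le> hent s i)"

text \<open>The order of the ordinals refined by the exponent at which the comparison is decided:
  \<open>drp 0\<close> is the order itself, and a larger \<open>e\<close> asks that the first term
  of \<open>s'\<close> to be lost or lowered has exponent at least \<open>e\<close>.\<close>

definition drp :: "hm \<Rightarrow> hm \<Rightarrow> hm \<Rightarrow> bool" where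
  "drp e s s' \<longleftrightarrow> (\<exists>i<hlen s'. e \<le> hent s' i \<and> (\<forall>j<i. j < hlen s \<and> hent s j = hent s' j) \<and> (hlen s = i \<or> i < hlen s \<and> hent s i < hent s' i))"

lemma dec_isord: "rec s \<Longrightarrow> dec (\<lambda>x. isord (s x))"
  by (rule rec_dec[where P = isord], assumption) (unfold isord_def, intro rr5)

lemma dec_drp: "rec a \<Longrightarrow> rec b \<Longrightarrow> rec c \<Longrightarrow> dec (\<lambda>x. drp (a x) (b x) (c x))"
  by (rule dec3[where P = drp]) (unfold drp_def, intro rr5)

lemma isordD: "isord s \<Longrightarrow> i \<le> j \<Longrightarrow> j < hlen s \<Longrightarrow> hent s j \<le> hent s i"
  unfolding isord_def by (cases "i = j") auto

lemma drp_mono: "drp e s s' \<Longrightarrow> e' \<le> e \<Longrightarrow> drp e' s s'" unfolding drp_def by (blast intro: order_trans)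

text \<open>The leftmost of the two places of decrease decides the composite comparison. If it lies
  further left than the first one, the exponent there is no smaller because \<open>s'\<close> is
  non-increasing.\<close>

lemma drp_trans1: assumes "drp e s s'" "drp 0 s'' s" "isord s'" shows "drp e s'' s'"
proof -
  obtain i where i: "i < hlen s'" "e \<le> hent s' i" "\<And>j. j < i \<Longrightarrow> j < hlen s \<and> hent s j = hent s' j" "hlen s = i \<or> i < hlen s \<and> hent s i < hent s' i"
    using assms(1) unfolding drp_def by blast
  obtain k where k: "k < hlen s" "\<And>j. j < k \<Longrightarrow> j < hlen s'' \<and> hent s'' j = hent s j" "hlen s'' = k \<or> k < hlen s'' \<and> hent s'' k < hent s k"
    using assms(2) unfolding drp_def by blast
  show ?thesis
  proof (cases "k < i")
    case True
    then have "k < hlen s'" "hent s k = hent s' k" using i(1,3) by auto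
    moreover have "e \<le> hent s' k" using isordD[OF assms(3) less_imp_le[OF True] i(1)] i(2) by order
    moreover have "\<forall>j<k. j < hlen s'' \<and> hent s'' j = hent s' j" using k(2) i(3) True by (metis less_trans)
    ultimately show ?thesis using k(3) unfolding drp_def by metis
  next
    case False
    then have ik: "i \<le> k" by simp
    then have is1: "i < hlen s" "hent s i < hent s' i" using i(4) k(1) by auto
    have "hlen s'' = i \<or> i < hlen s'' \<and> hent s'' i < hent s' i"
    proof (cases "i = k")
      case True then show ?thesis using k(3) is1(2) by (metis less_trans)
    next
      case False then show ?thesis using ik k(2)[of i] is1(2) by simp
    qed
    moreover have "\<forall>j<i. j < hlen s'' \<and> hent s'' j = hent s' j" using k(2) i(3) ik by (metis less_le_trans)
    ultimately show ?thesis using i(1,2) unfolding drp_def by blast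
  qed
qed

lemma drp_trans2: assumes "drp 0 s s'" "drp e s'' s" "isord s" shows "drp e s'' s'"
proof -
  obtain i where i: "i < hlen s'" "\<And>j. j < i \<Longrightarrow> j < hlen s \<and> hent s j = hent s' j" "hlen s = i \<or> i < hlen s \<and> hent s i < hent s' i"
    using assms(1) unfolding drp_def by blast
  obtain k where k: "k < hlen s" "e \<le> hent s k" "\<And>j. j < k \<Longrightarrow> j < hlen s'' \<and> hent s'' j = hent s j" "hlen s'' = k \<or> k < hlen s'' \<and> hent s'' k < hent s k"
    using assms(2) unfolding drp_def by blast
  show ?thesis
  proof (cases "k < i")
    case True
    then have "k < hlen s'" "hent s k = hent s' k" using i(1,2) by auto
    moreover have "\<forall>j<k. j < hlen s'' \<and> hent s'' j = hent s' j" using k(3) i(2) True by (metis less_trans)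
    ultimately show ?thesis using k(2,4) unfolding drp_def by metis
  next
    case False
    then have ik: "i \<le> k" by simp
    then have is1: "i < hlen s" "hent s i < hent s' i" using i(3) k(1) by auto
    have "e \<le> hent s' i" using isordD[OF assms(3) ik k(1)] k(2) is1(2) by order
    moreover have "hlen s'' = i \<or> i < hlen s'' \<and> hent s'' i < hent s' i"
    proof (cases "i = k")
      case True then show ?thesis using k(4) is1(2) by (metis less_trans)
    next
      case False then show ?thesis using ik k(3)[of i] is1(2) by simp
    qed
    moreover have "\<forall>j<i. j < hlen s'' \<and> hent s'' j = hent s' j" using k(3) i(2) ik by (metis less_le_trans)
    ultimately show ?thesis using i(1) unfolding drp_def by blast
  qed
qed

text \<open>For a non-increasing sequence this is the number of its terms with exponent at least
  \<open>e\<close>.\<close>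

definition te :: "hm \<Rightarrow> hm \<Rightarrow> hm" where "te e s = (LEAST i. hlen s \<le> i \<or> hent s i < e)"

lemma te_dec: "dec (\<lambda>i. hlen s \<le> i \<or> hent s i < e)" by (intro rr5)

lemma te_le: "hlen s \<le> i \<or> hent s i < e \<Longrightarrow> te e s \<le> i"
  unfolding te_def by (rule dec_Least(2)[OF te_dec])

lemma te_gt: assumes "isord s" "i < hlen s" "e \<le> hent s i" shows "i < te e s"
proof (rule ccontr)
  assume "\<not> i < te e s"
  then have le: "te e s \<le> i" by simp
  have "hlen s \<le> te e s \<or> hent s (te e s) < e" unfolding te_def by (rule dec_Least(1)[OF te_dec]) (rule disjI1, rule order_refl)
  moreover have "hent s i \<le> hent s (te e s)" by (rule isordD[OF assms(1) le assms(2)])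
  ultimately show False using assms(2,3) le by (elim disjE; order)
qed

text \<open>A drop that is decided at exponent exactly \<open>e\<close> happens at a term counted by
  \<open>te e s'\<close>, and nothing from that place on is counted in \<open>s\<close>.\<close>

lemma drp_te: assumes "drp e s s'" "\<not> drp (e + 1) s s'" "isord s'" shows "te e s + 1 \<le> te e s'"
proof -
  obtain i where i: "i < hlen s'" "e \<le> hent s' i" "\<forall>j<i. j < hlen s \<and> hent s j = hent s' j" "hlen s = i \<or> i < hlen s \<and> hent s i < hent s' i"
    using assms(1) unfolding drp_def by blast
  then have "\<not> e + 1 \<le> hent s' i" using assms(2) unfolding drp_def by blast
  then have e: "hent s' i = e" using i(2) by (simp add: hm_Suc_le)
  have "te e s \<le> i" using i(4) e by (intro te_le) auto
  moreover have "i < te e s'" by (rule te_gt[OF assms(3) i(1,2)])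
  ultimately show ?thesis by (simp add: hm_Suc_le)
qed

lemma hlen_le: "hlen s \<le> s" unfolding hlen_def using hpair_ge(1)[of "hfst s" "hsnd s"] by simp

lemma te_self: "te e s \<le> s" using te_le[of s "hlen s" e] hlen_le[of s] by simp

lemma max_ex: assumes "hmem x Z" shows "\<exists>m. hmem m Z \<and> (\<forall>i. hmem i Z \<longrightarrow> i \<le> m)"
proof -
  define T where "T m \<longleftrightarrow> (\<forall>i<Z. hmem i Z \<longrightarrow> i \<le> m)" for m
  have "dec T" unfolding T_def by (intro rr5)
  moreover have "T Z" by (simp add: T_def less_imp_le)
  ultimately obtain m where m: "T m" "\<And>k. k < m \<Longrightarrow> \<not> T k" using dec_least by blast
  have "hmem m Z"
  proof (cases "m = 0")
    case True
    then have "x = 0" using m(1) assms hmem_less unfolding T_def by fastforce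
    then show ?thesis using True assms by simp
  next
    case False
    then obtain k where k: "m = k + 1" using hm_pred by blast
    then obtain i where i: "i < Z" "hmem i Z" "\<not> i \<le> k" using m(2)[of k] hm_less_self unfolding T_def by blast
    then have "i \<le> k + 1" using m(1) unfolding T_def k by blast
    then have "i = k + 1" using i(3) by (simp add: le_less hm_basic(8) not_le)
    then show ?thesis using i(2) k by simp
  qed
  then show ?thesis using m(1) hmem_less unfolding T_def by blast
qed

text \<open>By induction on \<open>e\<close>. Across \<open>q\<close> consecutive blocks of exponent
  \<open>e\<close>, either a drop above \<open>e\<close> occurs or the number of terms with exponent
  at least \<open>e\<close> falls by \<open>q\<close>. A block of exponent \<open>e + 1\<close> has
  a head greater than \<open>g x\<close>, which already bounds that number, so the drop above
  \<open>e\<close> must occur. The set \<open>F\<close> is sparse for \<open>g\<close>, hence the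
  comparison with \<open>g\<close> is available again at each later starting point.\<close>

lemma descent_bound:
  assumes g: "rec g" and o: "\<And>n. n \<le> b \<Longrightarrow> isord (g n)" and d: "\<And>n. n + 1 \<le> b \<Longrightarrow> drp 0 (g (n + 1)) (g n)"
    and F: "\<And>x y. hmem x F \<Longrightarrow> hmem y F \<Longrightarrow> x < y \<Longrightarrow> g x < y"
  shows "lg e T \<Longrightarrow> hsub T F \<Longrightarrow> (\<And>z. hmem z T \<Longrightarrow> x < z \<and> g x < z \<and> z \<le> y) \<Longrightarrow> y \<le> b \<Longrightarrow> drp e (g y) (g x)"
proof -
  have dd: "x < y \<Longrightarrow> y \<le> b \<Longrightarrow> drp 0 (g y) (g x)" for x y
  proof -
    assume "x < y" "y \<le> b"
    then obtain k where k: "y = x + (k + 1)" using hm_less_iff_ex by blast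
    have "x + (k + 1) \<le> b \<longrightarrow> drp 0 (g (x + (k + 1))) (g x)"
    proof (rule dec_induct[of "\<lambda>k. x + (k + 1) \<le> b \<longrightarrow> drp 0 (g (x + (k + 1))) (g x)"])
      show "dec (\<lambda>k. x + (k + 1) \<le> b \<longrightarrow> drp 0 (g (x + (k + 1))) (g x))" by (intro rr5 dec_drp rec_comp[OF g])
      show "x + (0 + 1) \<le> b \<longrightarrow> drp 0 (g (x + (0 + 1))) (g x)" using d by simp
      fix k assume IH: "x + (k + 1) \<le> b \<longrightarrow> drp 0 (g (x + (k + 1))) (g x)"
      show "x + (k + 1 + 1) \<le> b \<longrightarrow> drp 0 (g (x + (k + 1 + 1))) (g x)"
      proof
        assume a: "x + (k + 1 + 1) \<le> b"
        then have a': "(x + (k + 1)) + 1 \<le> b" by (simp add: ac_simps)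
        then have "x + (k + 1) \<le> b" "x \<le> b" by (meson add_increasing2 order_trans hm_nonneg order_refl le_add_same_cancel1)+
        then have "drp 0 (g (x + (k + 1) + 1)) (g x)" using drp_trans1[OF _ d[OF a'] o] IH by blast
        then show "drp 0 (g (x + (k + 1 + 1))) (g x)" by (simp add: ac_simps)
      qed
    qed
    then show ?thesis using k \<open>y \<le> b\<close> by simp
  qed
  \<comment> \<open>The counting alternative; it is quantified over sets and end points because the
    induction on \<open>q\<close> moves the starting point to the end of the first block.\<close>
  define S where "S e q T x y \<longleftrightarrow> (hsub T F \<longrightarrow> (\<forall>z<T. hmem z T \<longrightarrow> x < z \<and> g x < z \<and> z \<le> y) \<longrightarrow> y \<le> b \<longrightarrow> x < y \<longrightarrow> lgs e q T \<longrightarrow>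
     drp (e + 1) (g y) (g x) \<or> q + te e (g y) \<le> te e (g x))" for e q T x y
  define R where "R e T x y \<longleftrightarrow> (lg e T \<longrightarrow> hsub T F \<longrightarrow> (\<forall>z<T. hmem z T \<longrightarrow> x < z \<and> g x < z \<and> z \<le> y) \<longrightarrow> y \<le> b \<longrightarrow> drp e (g y) (g x))" for e T x y
  have drec: "rec (\<lambda>z. te (s z) (t z))" if "rec s" "rec t" for s t
  proof (rule rec2[where f = te, OF _ that])
    show "rec (\<lambda>z. te (hfst z) (hsnd z))" unfolding te_def
    proof (rule rec_Least)
      show "dec (\<lambda>z. hlen (hsnd (hfst z)) \<le> hsnd z \<or> hent (hsnd (hfst z)) (hsnd z) < hfst (hfst z))" by (intro rr5)
      show "\<exists>i. hlen (hsnd z) \<le> i \<or> hent (hsnd z) i < hfst z" for z by (rule exI[of _ "hlen (hsnd z)"]) simp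
    qed
  qed
  have RS: "S e q T x y" if R: "\<And>T x y. R e T x y" for e q T x y
  proof (rule pi_induct3[of "S e"])
    show "dec (\<lambda>z. S e (hfst z) (hfst (hsnd z)) (hfst (hsnd (hsnd z))) (hsnd (hsnd (hsnd z))))"
      unfolding S_def by (intro rr5 dec_drp drec rec_comp[OF g])
    show "S e 0 T x y" for T x y unfolding S_def
    proof (intro impI)
      assume a: "y \<le> b" "x < y"
      then have xb: "x \<le> b" by order
      show "drp (e + 1) (g y) (g x) \<or> 0 + te e (g y) \<le> te e (g x)"
      proof (cases "drp e (g y) (g x)")
        case True then show ?thesis using drp_te[OF True _ o[OF xb]] by (cases "drp (e + 1) (g y) (g x)") (simp_all add: hm_Suc_le less_imp_le)
      next
        case False
        obtain i where i: "i < hlen (g x)" "\<forall>j<i. j < hlen (g y) \<and> hent (g y) j = hent (g x) j" "hlen (g y) = i \<or> i < hlen (g y) \<and> hent (g y) i < hent (g x) i"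
          using dd[OF a(2,1)] unfolding drp_def by blast
        have ie: "hent (g x) i < e"
        proof (rule ccontr)
          assume "\<not> hent (g x) i < e"
          then have "e \<le> hent (g x) i" by simp
          then have "drp e (g y) (g x)" unfolding drp_def using i by blast
          then show False using False by blast
        qed
        have "te e (g y) \<le> te e (g x)"
        proof -
          have "te e (g x) \<le> i" using ie by (intro te_le) simp
          moreover have "hlen (g x) \<le> te e (g x) \<or> hent (g x) (te e (g x)) < e" unfolding te_def by (rule dec_Least(1)[OF te_dec]) (rule disjI1, rule order_refl)
          ultimately have "hlen (g y) \<le> te e (g x) \<or> hent (g y) (te e (g x)) < e"
            using i ie by (cases "te e (g x) = i") (auto dest: le_neq_trans intro: less_trans)
          then show ?thesis by (rule te_le)
        qed
        then show ?thesis by simp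
      qed
    qed
    fix q T x y assume IH: "\<And>T x y. S e q T x y"
    show "S e (q + 1) T x y" unfolding S_def
    proof (intro impI)
      assume a: "hsub T F" "\<forall>z<T. hmem z T \<longrightarrow> x < z \<and> g x < z \<and> z \<le> y" "y \<le> b" "x < y" "lgs e (q + 1) T"
      obtain p where p: "lg e (lo T p)" "lgs e q (hi T p)" using a(5) unfolding lgs_Suc by blast
      obtain u where "hmem u (lo T p)" using lg_ne p(1) by blast
      then obtain m where m: "hmem m (lo T p)" "\<And>i. hmem i (lo T p) \<Longrightarrow> i \<le> m" using max_ex by blast
      have mT: "hmem m T" "m < p" using m(1) by simp_all
      have xm: "x < m" "m \<le> y" using a(2) mT hmem_less by blast+
      have mb: "m \<le> b" "x \<le> b" using xm a(3,4) by order+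
      have 1: "drp e (g m) (g x)"
      proof -
        have "hsub (lo T p) F" using a(1) hsub_trans hsub_lohi by blast
        moreover have "\<forall>z<lo T p. hmem z (lo T p) \<longrightarrow> x < z \<and> g x < z \<and> z \<le> m" using a(2) m(2) hmem_less by simp
        ultimately show ?thesis using R[of "lo T p" x m] p(1) mb(1) unfolding R_def by blast
      qed
      show "drp (e + 1) (g y) (g x) \<or> q + 1 + te e (g y) \<le> te e (g x)"
      proof (cases "drp (e + 1) (g m) (g x)")
        case True
        then show ?thesis using drp_trans1[OF True dd o[OF mb(2)]] xm(2) a(3) by (cases "m = y") auto
      next
        case False
        have 2: "te e (g m) + 1 \<le> te e (g x)" by (rule drp_te[OF 1 False o[OF mb(2)]])
        show ?thesis
        proof (cases "m = y")
          case True
          \<comment> \<open>A further block would contain a point past \<open>m\<close>, but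
            \<open>m\<close> is already the end of the interval.\<close>
          have "q = 0"
          proof (rule ccontr)
            assume "q \<noteq> 0"
            then have "lgs e 1 (hi T p)" using p(2) hm_Suc_le[of 0 q] by (auto simp: hm_gr0 elim: lgs_le)
            then obtain v where "hmem v (hi T p)" unfolding lgs_1 using lg_ne by blast
            then have "p \<le> v" "v \<le> y" using a(2) hmem_less by auto
            then show False using True mT(2) by order
          qed
          then show ?thesis using 2 True by (simp add: add.commute)
        next
          case False
          then have my: "m < y" using xm(2) by simp
          have "hsub (hi T p) F" using a(1) hsub_trans hsub_lohi by blast
          moreover have "\<forall>z<hi T p. hmem z (hi T p) \<longrightarrow> m < z \<and> g m < z \<and> z \<le> y"
            using a(1,2) mT hmem_less F hsubD by (auto intro: less_le_trans)
          ultimately have "drp (e + 1) (g y) (g m) \<or> q + te e (g y) \<le> te e (g m)"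
            using IH[of "hi T p" m y] p(2) a(3) my unfolding S_def by blast
          then show ?thesis
          proof
            assume "drp (e + 1) (g y) (g m)"
            then show ?thesis using drp_trans2[OF drp_mono[OF 1] _ o[OF mb(1)]] by simp
          next
            assume "q + te e (g y) \<le> te e (g m)"
            then have "(q + te e (g y)) + 1 \<le> te e (g x)" using 2 by (meson add_right_mono order_trans)
            then show ?thesis by (simp add: ac_simps)
          qed
        qed
      qed
    qed
  qed
  have "R e T x y"
  proof (rule pi_induct3[of R])
    show "dec (\<lambda>z. R (hfst z) (hfst (hsnd z)) (hfst (hsnd (hsnd z))) (hsnd (hsnd (hsnd z))))"
      unfolding R_def by (intro rr5 dec_drp rec_comp[OF g])
    show "R 0 T x y" for T x y unfolding R_def
    proof (intro impI)
      assume a: "lg 0 T" "\<forall>z<T. hmem z T \<longrightarrow> x < z \<and> g x < z \<and> z \<le> y" "y \<le> b"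
      then obtain z where "hmem z T" unfolding lg_0 by blast
      then have "x < y" using a(2) hmem_less less_le_trans by blast
      then show "drp 0 (g y) (g x)" using dd a(3) by blast
    qed
    fix e T x y assume IH: "\<And>T x y. R e T x y"
    show "R (e + 1) T x y" unfolding R_def
    proof (intro impI)
      assume a: "lg (e + 1) T" "hsub T F" "\<forall>z<T. hmem z T \<longrightarrow> x < z \<and> g x < z \<and> z \<le> y" "y \<le> b"
      obtain x0 where x0: "hmem x0 T" "lgs e x0 (hi T (x0 + 1))" using a(1) unfolding lg_Suc by blast
      have xy: "x < x0" "g x < x0" "x0 \<le> y" using a(3) x0(1) hmem_less by blast+
      have "hsub (hi T (x0 + 1)) F" using a(2) hsub_trans hsub_lohi by blast
      moreover have "\<forall>z<hi T (x0 + 1). hmem z (hi T (x0 + 1)) \<longrightarrow> x < z \<and> g x < z \<and> z \<le> y" using a(3) hmem_less by simp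
      ultimately have "drp (e + 1) (g y) (g x) \<or> x0 + te e (g y) \<le> te e (g x)"
        using RS[OF IH, of x0 "hi T (x0 + 1)" x y] x0(2) a(4) xy unfolding S_def by (meson less_le_trans)
      \<comment> \<open>The number of terms is at most the code \<open>g x\<close>, and the head
        \<open>x0\<close> exceeds that code.\<close>
      moreover have "\<not> x0 + te e (g y) \<le> te e (g x)"
        using te_self[of e "g x"] xy(2) by (meson add_increasing2 hm_nonneg leD order_refl order_trans le_less_trans)
      ultimately show "drp (e + 1) (g y) (g x)" by blast
    qed
  qed
  then show "lg e T \<Longrightarrow> hsub T F \<Longrightarrow> (\<And>z. hmem z T \<Longrightarrow> x < z \<and> g x < z \<and> z \<le> y) \<Longrightarrow> y \<le> b \<Longrightarrow> drp e (g y) (g x)"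
    unfolding R_def by blast
qed

section \<open>Well-orderedness yields large sets\<close>

lemma hm_minus_le: "x - y \<le> (x::hm)"
proof (cases "y \<le> x")
  case True
  have "x - y \<le> y + (x - y)" by simp
  then show ?thesis using hm_diff[OF True, symmetric] by (simp only:)
qed (simp add: hm_diff0)

definition unb :: "hm set \<Rightarrow> bool" where "unb X \<longleftrightarrow> X \<in> SS \<and> (\<forall>b. \<exists>x\<in>X. b < x)"

text \<open>The quantifier over all unbounded sets of the model lets blocks be replaced by points
  when exponents are added. It also puts the statement out of reach of the induction available in
  the model.\<close>

definition LL :: "hm \<Rightarrow> bool" where
  "LL n \<longleftrightarrow> (\<forall>X. unb X \<longrightarrow> (\<exists>Z. (\<forall>i. hmem i Z \<longrightarrow> i \<in> X) \<and> lg n Z))"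

lemma enum_ex:
  assumes "unb X"
  obtains xs where "rec xs" "\<And>k. xs k \<in> X" "\<And>k. xs k < xs (k + 1)" "\<And>j k. j < k \<Longrightarrow> xs j < xs k" "\<And>k. k \<le> xs k"
proof -
  have X: "X \<in> SS" "\<And>b. \<exists>x\<in>X. b < x" using assms by (auto simp: unb_def)
  define nx where "nx b = (LEAST y. y \<in> X \<and> b < y)" for b
  have d: "dec (\<lambda>z. hsnd z \<in> X \<and> hfst z < hsnd z)" by (intro rr5 dec_mem[OF X(1)])
  have rn: "rec nx" unfolding nx_def by (rule rec_Least[OF d]) (use X(2) in blast)
  have nx: "nx b \<in> X \<and> b < nx b" for b
  proof -
    obtain y where "y \<in> X \<and> b < y" using X(2) by blast
    then show ?thesis unfolding nx_def by (rule dec_Least(1)[OF dec_section[OF d]])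
  qed
  define xs where "xs = prc (\<lambda>_. nx 0) (\<lambda>z. nx (hsnd (hsnd z))) 0"
  have aux: "rec (\<lambda>_. nx 0)" "rec (\<lambda>z. nx (hsnd (hsnd z)))" by (intro rr5 rec_comp[OF rn])+
  have 0: "xs 0 = nx 0" and S: "xs (k + 1) = nx (xs k)" for k unfolding xs_def prc_0[OF aux] prc_Suc[OF aux] by simp_all
  have r: "rec xs" unfolding xs_def using rec_prc[OF aux rec_const rec_id] by simp
  have lt: "xs k < xs (k + 1)" for k unfolding S using nx by blast
  have sm: "xs j < xs k" if "j < k" for j k
  proof -
    have "xs (j + 1) \<le> xs k" by (rule mono_seq[OF r]) (use that lt less_imp_le in \<open>auto simp: hm_Suc_le\<close>)
    then show ?thesis using lt[of j] by order
  qed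
  show ?thesis
  proof (rule that[OF r _ lt sm])
    show "xs k \<in> X" for k using hm_pred[of k] nx 0 S by auto
    show "k \<le> xs k" for k
    proof (rule dec_induct[of "\<lambda>k. k \<le> xs k"])
      show "dec (\<lambda>k. k \<le> xs k)" by (intro rr5 rec_comp[OF r])
      fix k assume "k \<le> xs k" then show "k + 1 \<le> xs (k + 1)" using lt[of k] unfolding hm_Suc_le by order
    qed simp
  qed
qed

text \<open>The first element \<open>xs 0\<close> heads the next \<open>xs 0\<close>
  elements.\<close>

lemma LL_1: "LL 1" unfolding LL_def
proof (intro allI impI)
  fix X assume "unb X"
  then obtain xs where xs: "rec xs" "\<And>k. xs k \<in> X" "\<And>j k. j < k \<Longrightarrow> xs j < xs k" by (rule enum_ex) blast
  define P where "P i \<longleftrightarrow> (\<exists>j\<le>xs 0. i = xs j)" for i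
  define Z where "Z = hset P (xs (xs 0 + 1))"
  have dP: "dec P" unfolding P_def by (intro rr5 rec_comp[OF xs(1)])
  have Z: "hmem i Z \<longleftrightarrow> P i" for i unfolding Z_def hset_spec(2)[OF dP] using xs(3) unfolding P_def by (auto simp: hm_less_Suc)
  have "lgs 0 (xs 0) (hi Z (xs 0 + 1))"
  proof (rule lgs_build[of "\<lambda>j. p2 (xs (j + 1))"])
    show "rec (\<lambda>j. p2 (xs (j + 1)))" by (intro rr5 rec_comp[OF xs(1)])
    show "lg 0 (p2 (xs (j + 1)))" for j by (auto simp: lg_0 mem_sng)
    show "hsub (p2 (xs (j + 1))) (hi Z (xs 0 + 1))" if "j < xs 0" for j
      using that xs(3)[of 0 "j + 1"] unfolding hsub_iff mem_sng mem_hi Z P_def by (auto simp: hm_Suc_le hm_gr0 hm_basic(1) intro!: exI[of _ "j + 1"])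
    show "u < v" if "j < j'" "hmem u (p2 (xs (j + 1)))" "hmem v (p2 (xs (j' + 1)))" for j j' u v
      using that xs(3)[of "j + 1" "j' + 1"] by (simp add: mem_sng)
  qed
  moreover have "hmem (xs 0) Z" unfolding Z P_def by (rule exI[of _ 0]) simp
  ultimately have "lg (0 + 1) Z" unfolding lg_Suc by blast
  then show "\<exists>Z. (\<forall>i. hmem i Z \<longrightarrow> i \<in> X) \<and> lg 1 Z" using Z xs(2) unfolding P_def by (intro exI[of _ Z]) auto
qed

lemma lgs_cons: assumes "lg n A" "lgs n q B" "hsub A Y" "hsub B Y" "\<And>u v. hmem u A \<Longrightarrow> hmem v B \<Longrightarrow> u < v"
  shows "lgs n (q + 1) Y"
proof -
  have "\<exists>p. (\<forall>u. hmem u A \<longrightarrow> u < p) \<and> (\<forall>v. hmem v B \<longrightarrow> p \<le> v)"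
  proof (cases "\<exists>v. hmem v B")
    case True
    moreover have "dec (\<lambda>v. hmem v B)" by (intro rr5)
    ultimately obtain p where "hmem p B" "\<forall>z<p. \<not> hmem z B" using dec_least by blast
    then show ?thesis using assms(5) not_less by blast
  next
    case False then show ?thesis using hmem_less by blast
  qed
  then obtain p where p: "\<And>u. hmem u A \<Longrightarrow> u < p" "\<And>v. hmem v B \<Longrightarrow> p \<le> v" by blast
  have "lg n (lo Y p)" by (rule lg_mono[OF assms(1)]) (use p hsubD[OF assms(3)] in \<open>auto intro!: hsubI\<close>)
  moreover have "lgs n q (hi Y p)" by (rule lgs_mono[OF assms(2)]) (use p hsubD[OF assms(4)] in \<open>auto intro!: hsubI\<close>)
  ultimately show ?thesis unfolding lgs_Suc by blast
qed

text \<open>\<open>X\<close> is cut into successive blocks of exponent \<open>b\<close>, whose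
  minima form an unbounded set \<open>X'\<close>. In a subset of \<open>X'\<close> of exponent
  \<open>a\<close>, each point is blown up to its block. Largeness of the result follows by
  induction on the exponent of the outer set, the points of exponent 0 being replaced by whole
  blocks.\<close>

lemma LL_add: assumes a: "LL a" and b: "LL b" shows "LL (a + b)" unfolding LL_def
proof (intro allI impI)
  fix X assume u: "unb X"
  then have X: "X \<in> SS" "\<And>b. \<exists>x\<in>X. b < x" by (auto simp: unb_def)
  define Q where "Q p Z \<longleftrightarrow> (\<forall>i<Z. hmem i Z \<longrightarrow> i \<in> X \<and> p \<le> i) \<and> lg b Z" for p Z
  have dQ: "dec (\<lambda>z. Q (hfst z) (hsnd z))" unfolding Q_def by (intro rr5 dec_mem[OF X(1)])
  have Qex: "\<exists>Z. Q p Z" for p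
  proof -
    have "dec (\<lambda>x. x \<in> X \<and> p \<le> x)" by (intro rr5 dec_mem[OF X(1)])
    moreover have "\<exists>x. (x \<in> X \<and> p \<le> x) \<and> c < x" for c
      using X(2)[of "c + p"] by (meson add_increasing add_increasing2 hm_nonneg le_less_trans less_imp_le order_refl)
    ultimately have "unb {x. x \<in> X \<and> p \<le> x}" unfolding unb_def dec_def by auto
    then show ?thesis using b unfolding LL_def Q_def by blast
  qed
  define bl where "bl p = (LEAST Z. Q p Z)" for p
  have rbl: "rec bl" unfolding bl_def by (rule rec_Least[OF dQ Qex])
  have bl: "Q p (bl p)" for p
  proof -
    obtain Z where "Q p Z" using Qex by blast
    then show ?thesis unfolding bl_def by (rule dec_Least(1)[OF dec_section[OF dQ]])
  qed
  \<comment> \<open>The code of a block exceeds all its elements, so it also serves as the place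
    from which the next block is sought.\<close>
  define B where "B = prc (\<lambda>_. bl 0) (\<lambda>z. bl (hsnd (hsnd z))) 0"
  have aux: "rec (\<lambda>_. bl 0)" "rec (\<lambda>z. bl (hsnd (hsnd z)))" by (intro rr5 rec_comp[OF rbl])+
  have B0: "B 0 = bl 0" and BS: "B (j + 1) = bl (B j)" for j unfolding B_def prc_0[OF aux] prc_Suc[OF aux] by simp_all
  have rB: "rec B" unfolding B_def using rec_prc[OF aux rec_const rec_id] by simp
  have Bl: "lg b (B j)" and BX: "hmem i (B j) \<Longrightarrow> i \<in> X" for i j
    using hm_pred[of j] bl B0 BS hmem_less unfolding Q_def by metis+
  have Bge: "hmem i (B (j + 1)) \<Longrightarrow> B j \<le> i" for i j using bl[of "B j"] hmem_less unfolding Q_def BS by blast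
  have Bm: "B j \<le> B (j + 1)" for j using lg_ne[OF Bl[of "j + 1"]] Bge[of _ j] hmem_less by (meson le_less_trans less_imp_le)
  have Bord: "u < v" if jj: "j < j'" "hmem u (B j)" "hmem v (B j')" for j j' u v
  proof -
    obtain k where k: "j' = k + 1" using jj(1) hm_pred[of j'] by auto
    then have "B j \<le> B k" using that(1) by (intro mono_seq[OF rB Bm]) (simp add: hm_less_Suc)
    moreover have "B k \<le> v" using Bge that(3) k by blast
    ultimately show ?thesis using hmem_less[OF that(2)] by order
  qed
  define mu where "mu j = (LEAST i. hmem i (B j))" for j
  have dmu: "dec (\<lambda>z. hmem (hsnd z) (B (hfst z)))" by (intro rr5 rec_comp[OF rB])
  have rmu: "rec mu" unfolding mu_def by (rule rec_Least[OF dmu]) (use lg_ne Bl in blast)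
  have mu: "hmem (mu j) (B j)" "hmem i (B j) \<Longrightarrow> mu j \<le> i" for i j
    using dec_Least(1,2)[OF dec_section[OF dmu]] lg_ne[OF Bl[of j]] unfolding mu_def by blast+
  have muord: "j < j' \<Longrightarrow> mu j < mu j'" for j j' using Bord mu(1) by blast
  have muge: "j \<le> mu j" for j
  proof (rule dec_induct[of "\<lambda>j. j \<le> mu j"])
    show "dec (\<lambda>j. j \<le> mu j)" by (intro rr5 rec_comp[OF rmu])
    fix k assume "k \<le> mu k" then show "k + 1 \<le> mu (k + 1)" using muord[OF hm_less_self[of k]] unfolding hm_Suc_le by order
  qed simp
  have muinj: "mu j = mu j' \<Longrightarrow> j = j'" for j j' using muord by (metis less_irrefl linorder_neqE)
  \<comment> \<open>Since \<open>j \<le> mu j\<close>, the index can be bounded and the set of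
    minima is decidable.\<close>
  define X' where "X' = {x. \<exists>j\<le>x. x = mu j}"
  have "dec (\<lambda>x. \<exists>j\<le>x. x = mu j)" by (intro rr5 rec_comp[OF rmu])
  then have "X' \<in> SS" by (simp add: X'_def dec_def)
  moreover have "\<exists>x\<in>X'. c < x" for c
  proof (rule bexI[of _ "mu (c + 1)"])
    show "c < mu (c + 1)" using muge[of "c + 1"] by (simp add: hm_Suc_le)
    show "mu (c + 1) \<in> X'" unfolding X'_def using muge by blast
  qed
  ultimately have "unb X'" by (simp add: unb_def)
  then obtain Z where Z: "\<And>i. hmem i Z \<Longrightarrow> i \<in> X'" "lg a Z" using a unfolding LL_def by blast
  define un where "un Z = hset (\<lambda>i. \<exists>j\<le>Z. hmem (mu j) Z \<and> hmem i (B j)) (B (Z + 1))" for Z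
  have dun: "dec (\<lambda>i. \<exists>j\<le>Z. hmem (mu j) Z \<and> hmem i (B j))" for Z by (intro rr5 rec_comp[OF rB] rec_comp[OF rmu])
  have un: "hmem i (un Z) \<longleftrightarrow> (\<exists>j. hmem (mu j) Z \<and> hmem i (B j))" for i Z
  proof
    assume "\<exists>j. hmem (mu j) Z \<and> hmem i (B j)"
    then obtain j where j: "hmem (mu j) Z" "hmem i (B j)" by blast
    have jZ: "j \<le> Z" using muge[of j] hmem_less[OF j(1)] by order
    then have "B j \<le> B (Z + 1)" by (intro mono_seq[OF rB Bm]) (simp add: add_increasing2)
    then have "i < B (Z + 1)" using hmem_less[OF j(2)] by order
    then show "hmem i (un Z)" unfolding un_def hset_spec(2)[OF dun] using j jZ by blast
  qed (auto simp: un_def hset_spec(2)[OF dun])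
  have run: "rec un" unfolding un_def by (intro rr5 rec_comp[OF rB] rec_comp[OF rmu])
  have inner: "lgs (c + b) q (un Z)" if h: "\<And>Z. (\<forall>i. hmem i Z \<longrightarrow> i \<in> X') \<Longrightarrow> lg c Z \<Longrightarrow> lg (c + b) (un Z)" and "\<forall>i. hmem i Z \<longrightarrow> i \<in> X'" "lgs c q Z" for c q Z
  proof -
    have "(\<forall>i<Z. hmem i Z \<longrightarrow> i \<in> X') \<longrightarrow> lgs c q Z \<longrightarrow> lgs (c + b) q (un Z)"
    proof (rule pi_induct[where R = "\<lambda>q Z. (\<forall>i<Z. hmem i Z \<longrightarrow> i \<in> X') \<longrightarrow> lgs c q Z \<longrightarrow> lgs (c + b) q (un Z)"])
      show "dec (\<lambda>z. (\<forall>i<hsnd z. hmem i (hsnd z) \<longrightarrow> i \<in> X') \<longrightarrow> lgs c (hfst z) (hsnd z) \<longrightarrow> lgs (c + b) (hfst z) (un (hsnd z)))"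
        by (intro rr5 dec_mem[OF \<open>X' \<in> SS\<close>] rec_comp[OF run])
      fix q Z assume IH: "\<And>Z. (\<forall>i<Z. hmem i Z \<longrightarrow> i \<in> X') \<longrightarrow> lgs c q Z \<longrightarrow> lgs (c + b) q (un Z)"
      show "(\<forall>i<Z. hmem i Z \<longrightarrow> i \<in> X') \<longrightarrow> lgs c (q + 1) Z \<longrightarrow> lgs (c + b) (q + 1) (un Z)"
      proof (intro impI)
        assume ZX: "\<forall>i<Z. hmem i Z \<longrightarrow> i \<in> X'" and "lgs c (q + 1) Z"
        then obtain p where p: "lg c (lo Z p)" "lgs c q (hi Z p)" unfolding lgs_Suc by blast
        have ZX': "\<And>i. hmem i Z \<Longrightarrow> i \<in> X'" using ZX hmem_less by blast
        have 1: "lg (c + b) (un (lo Z p))" by (rule h[OF _ p(1)]) (use ZX' in simp)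
        have 2: "lgs (c + b) q (un (hi Z p))" using IH[of "hi Z p"] p(2) ZX' by simp
        show "lgs (c + b) (q + 1) (un Z)"
        proof (rule lgs_cons[OF 1 2])
          show "hsub (un (lo Z p)) (un Z)" "hsub (un (hi Z p)) (un Z)" by (auto simp: hsub_iff un)
          fix u v assume "hmem u (un (lo Z p))" "hmem v (un (hi Z p))"
          then obtain j j' where j: "hmem u (B j)" "mu j < p" "hmem v (B j')" "p \<le> mu j'" by (auto simp: un)
          then have "mu j < mu j'" by order
          then have "j < j'" using muord by (metis less_asym less_irrefl linorder_neqE)
          then show "u < v" using Bord j by blast
        qed
      qed
    qed simp
    then show ?thesis using that(2,3) by blast
  qed
  have "(\<forall>i<Z. hmem i Z \<longrightarrow> i \<in> X') \<longrightarrow> lg a Z \<longrightarrow> lg (a + b) (un Z)"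
  proof (rule pi_induct[where R = "\<lambda>a Z. (\<forall>i<Z. hmem i Z \<longrightarrow> i \<in> X') \<longrightarrow> lg a Z \<longrightarrow> lg (a + b) (un Z)"])
    show "dec (\<lambda>z. (\<forall>i<hsnd z. hmem i (hsnd z) \<longrightarrow> i \<in> X') \<longrightarrow> lg (hfst z) (hsnd z) \<longrightarrow> lg (hfst z + b) (un (hsnd z)))"
      by (intro rr5 dec_mem[OF \<open>X' \<in> SS\<close>] rec_comp[OF run])
    show "(\<forall>i<Z. hmem i Z \<longrightarrow> i \<in> X') \<longrightarrow> lg 0 Z \<longrightarrow> lg (0 + b) (un Z)" for Z
    proof (intro impI)
      assume ZX: "\<forall>i<Z. hmem i Z \<longrightarrow> i \<in> X'" and "lg 0 Z"
      then obtain i j where "hmem i Z" "i = mu j" unfolding lg_0 X'_def using hmem_less by blast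
      then have "hsub (B j) (un Z)" by (auto simp: hsub_iff un)
      then show "lg (0 + b) (un Z)" using Bl[of j] lg_mono by simp
    qed
    fix c Z assume IH: "\<And>Z. (\<forall>i<Z. hmem i Z \<longrightarrow> i \<in> X') \<longrightarrow> lg c Z \<longrightarrow> lg (c + b) (un Z)"
    show "(\<forall>i<Z. hmem i Z \<longrightarrow> i \<in> X') \<longrightarrow> lg (c + 1) Z \<longrightarrow> lg (c + 1 + b) (un Z)"
    proof (intro impI)
      assume ZX: "\<forall>i<Z. hmem i Z \<longrightarrow> i \<in> X'" and "lg (c + 1) Z"
      then obtain x where x: "hmem x Z" "lgs c x (hi Z (x + 1))" unfolding lg_Suc by blast
      have ZX': "\<And>i. hmem i Z \<Longrightarrow> i \<in> X'" using ZX hmem_less by blast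
      obtain j where j: "x = mu j" using ZX'[OF x(1)] by (auto simp: X'_def)
      \<comment> \<open>The head \<open>x\<close> is the minimum of its own block, so it belongs to
        the blown-up set and prescribes the same number of blocks as before.\<close>
      have "lgs (c + b) x (un (hi Z (x + 1)))" by (rule inner[OF _ _ x(2)]) (use IH ZX' in auto)
      moreover have "hsub (un (hi Z (x + 1))) (hi (un Z) (x + 1))"
        unfolding hsub_iff mem_hi un using mu(2) by (meson order_trans)
      ultimately have "lgs (c + b) x (hi (un Z) (x + 1))" by (rule lgs_mono)
      moreover have "hmem x (un Z)" unfolding un using x(1) j mu(1) by blast
      ultimately have "lg (c + b + 1) (un Z)" unfolding lg_Suc by blast
      then show "lg (c + 1 + b) (un Z)" by (simp add: ac_simps)
    qed
  qed
  then have "lg (a + b) (un Z)" using Z by blast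
  moreover have "\<forall>i. hmem i (un Z) \<longrightarrow> i \<in> X" using BX by (auto simp: un)
  ultimately show "\<exists>Z. (\<forall>i. hmem i Z \<longrightarrow> i \<in> X) \<and> lg (a + b) Z" by blast
qed

text \<open>One step of the hydra: the last term \<open>\<omega>\<^sup>e\<close> becomes \<open>\<omega>\<^sup>e\<^sup>-\<^sup>1 \<cdot> x\<close>, or vanishes if \<open>e = 0\<close>.\<close>

lemma hydra_step:
  obtains h where "rec (\<lambda>z. h (hfst z) (hsnd z))"
    "\<And>s x l. hlen s = l + 1 \<Longrightarrow> hlen (h s x) = l + (if hent s l = 0 then 0 else x) \<and>
       (\<forall>i<hlen (h s x). hent (h s x) i = (if i < l then hent s i else hent s l - 1))"
proof -
  define L where "L s x = (hlen s - 1) + (if hent s (hlen s - 1) = 0 then 0 else x)" for s x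
  define Q where "Q z t \<longleftrightarrow> hlen t = L (hfst z) (hsnd z) \<and> (\<forall>i<hlen t. hent t i = (if i < hlen (hfst z) - 1 then hent (hfst z) i else hent (hfst z) (hlen (hfst z) - 1) - 1))" for z t
  have dQ: "dec (\<lambda>z. Q (hfst z) (hsnd z))" unfolding Q_def L_def by (intro rr6)
  have Qex: "\<exists>t. Q z t" for z
  proof -
    have "rec (\<lambda>i. if i < hlen (hfst z) - 1 then hent (hfst z) i else hent (hfst z) (hlen (hfst z) - 1) - 1)" by (intro rr6)
    from seq_comp[OF this, of "L (hfst z) (hsnd z)"] show ?thesis unfolding Q_def by metis
  qed
  define h where "h s x = (LEAST t. Q (hpair s x) t)" for s x
  have hQ: "Q (hpair s x) (h s x)" for s x
  proof -
    obtain t where "Q (hpair s x) t" using Qex by blast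
    then show ?thesis unfolding h_def by (rule dec_Least(1)[OF dec_section[OF dQ]])
  qed
  show ?thesis
  proof (rule that[of h])
    show "rec (\<lambda>z. h (hfst z) (hsnd z))" unfolding h_def using rec_Least[OF dQ Qex] by simp
    fix s x l assume l: "hlen s = l + 1"
    then have "hlen s - 1 = l" by simp
    then show "hlen (h s x) = l + (if hent s l = 0 then 0 else x) \<and> (\<forall>i<hlen (h s x). hent (h s x) i = (if i < l then hent s i else hent s l - 1))"
      using hQ[of s x] unfolding Q_def L_def by simp
  qed
qed

text \<open>The hydra \<alpha> is played with the elements of \<open>X\<close> as replacement
  numbers. Well-orderedness makes the play stop, and read backwards it splits the elements used into
  segments that are large for the exponents of the current terms. At the start the segment of the
  leading term is the set wanted.\<close>

lemma WO_large:
  assumes \<alpha>: "isord \<alpha>" "0 < hlen \<alpha>"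
    and wo: "\<not> (\<exists>f. rec f \<and> f 0 = \<alpha> \<and> (\<forall>n. isord (f n) \<and> drp 0 (f (n + 1)) (f n)))"
  shows "LL (hent \<alpha> 0)"
  unfolding LL_def
proof (intro allI impI)
  fix X assume "unb X"
  then obtain xs where xs: "rec xs" "\<And>k. xs k \<in> X" "\<And>j k. j < k \<Longrightarrow> xs j < xs k" by (rule enum_ex) blast
  obtain h where h: "rec (\<lambda>z. h (hfst z) (hsnd z))"
    "\<And>s x l. hlen s = l + 1 \<Longrightarrow> hlen (h s x) = l + (if hent s l = 0 then 0 else x) \<and>
       (\<forall>i<hlen (h s x). hent (h s x) i = (if i < l then hent s i else hent s l - 1))"
    using hydra_step by blast
  define st where "st = prc (\<lambda>_. \<alpha>) (\<lambda>z. h (hsnd (hsnd z)) (xs (hfst (hsnd z)))) 0"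
  have aux: "rec (\<lambda>_. \<alpha>)" "rec (\<lambda>z. h (hsnd (hsnd z)) (xs (hfst (hsnd z))))" by (intro rr5 rec2[OF h(1)] rec_comp[OF xs(1)])+
  have st0: "st 0 = \<alpha>" and stS: "st (k + 1) = h (st k) (xs k)" for k unfolding st_def prc_0[OF aux] prc_Suc[OF aux] by simp_all
  have rst: "rec st" unfolding st_def using rec_prc[OF aux rec_const rec_id] by simp
  have step: "hlen (st (k + 1)) = l + (if hent (st k) l = 0 then 0 else xs k)"
    "i < hlen (st (k + 1)) \<Longrightarrow> hent (st (k + 1)) i = (if i < l then hent (st k) i else hent (st k) l - 1)"
    if "hlen (st k) = l + 1" for k l i using h(2)[OF that, of "xs k"] unfolding stS by blast+
  \<comment> \<open>While terms are left, each move keeps the sequence non-increasing and lowers it,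
    so an endless play would be a recursive descending sequence from \<alpha>.\<close>
  have "\<exists>k. hlen (st k) = 0"
  proof (rule ccontr)
    assume ne: "\<nexists>k. hlen (st k) = 0"
    have o: "isord (st k)" for k
    proof (rule dec_induct[of "\<lambda>k. isord (st k)"])
      show "dec (\<lambda>k. isord (st k))" by (intro dec_isord rec_comp[OF rst] rec_id)
      show "isord (st 0)" using \<alpha> st0 by simp
      fix k assume IH: "isord (st k)"
      obtain l where l: "hlen (st k) = l + 1" using ne hm_pred by blast
      show "isord (st (k + 1))" unfolding isord_def
      proof (intro allI impI)
        fix j i assume ji: "j < hlen (st (k + 1))" "i < j"
        then have i: "i < hlen (st (k + 1))" by order
        have ll: "hent (st k) l - 1 \<le> hent (st k) l" by (rule hm_minus_le)
        have mono: "i \<le> j \<Longrightarrow> j \<le> l \<Longrightarrow> hent (st k) j \<le> hent (st k) i" for i j using isordD[OF IH, of i j] l by (simp add: hm_less_Suc)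
        show "hent (st (k + 1)) j \<le> hent (st (k + 1)) i"
          unfolding step(2)[OF l ji(1)] step(2)[OF l i] using ji(2) mono[of i j] mono[of i l] ll by (auto simp: less_imp_le intro: order_trans)
      qed
    qed
    have "drp 0 (st (k + 1)) (st k)" for k
    proof -
      obtain l where l: "hlen (st k) = l + 1" using ne hm_pred by blast
      have L: "l \<le> hlen (st (k + 1))" using step(1)[OF l] by simp
      have "hlen (st (k + 1)) = l \<or> l < hlen (st (k + 1)) \<and> hent (st (k + 1)) l < hent (st k) l"
      proof (cases "hlen (st (k + 1)) = l")
        case False
        then have lt: "l < hlen (st (k + 1))" using L by simp
        then have "hent (st k) l \<noteq> 0" using step(1)[OF l] by auto
        then obtain e where "hent (st k) l = e + 1" using hm_pred by blast
        then show ?thesis using lt step(2)[OF l lt] by (simp add: hm_less_self)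
      qed simp
      moreover have "\<forall>j<l. j < hlen (st (k + 1)) \<and> hent (st (k + 1)) j = hent (st k) j"
        using step(2)[OF l] L by (simp add: less_le_trans)
      ultimately show ?thesis unfolding drp_def using l hm_less_self by (intro exI[of _ l]) simp
    qed
    then show False using wo o rst st0 by blast
  qed
  then obtain ks where ks: "hlen (st ks) = 0" by blast
  define seg where "seg k k' = hset (\<lambda>i. \<exists>j<k'. k \<le> j \<and> i = xs j) (xs k')" for k k'
  have dseg: "dec (\<lambda>i. \<exists>j<k'. k \<le> j \<and> i = xs j)" for k k' by (intro rr5 rec_comp[OF xs(1)])
  have seg: "hmem i (seg k k') \<longleftrightarrow> (\<exists>j<k'. k \<le> j \<and> i = xs j)" for i k k'
    unfolding seg_def hset_spec(2)[OF dseg] using xs(3) by blast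
  have rseg: "rec (\<lambda>x. seg (s x) (t x))" if "rec s" "rec t" for s t
  proof (rule rec2[where f = seg, OF _ that])
    show "rec (\<lambda>z. seg (hfst z) (hsnd z))" unfolding seg_def by (intro rr5 rec_comp[OF xs(1)])
  qed
  \<comment> \<open>Term \<open>i\<close> of stage \<open>k\<close> owns the elements with indices
    from \<open>hent t (i + 1)\<close> up to \<open>hent t i\<close>. The last term burns first, so
    the boundaries decrease in \<open>i\<close> and end in \<open>k\<close>.\<close>
  define R where "R k t \<longleftrightarrow> hent t (hlen (st k)) = k \<and> (\<forall>i<hlen (st k). hent t (i + 1) \<le> hent t i \<and> lg (hent (st k) i) (seg (hent t (i + 1)) (hent t i)))" for k t
  \<comment> \<open>Backward induction from the empty stage \<open>ks\<close> down to stage 0;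
    \<open>j\<close> counts the stages already undone.\<close>
  have "\<exists>t. ks \<le> ks \<longrightarrow> R (ks - ks) t"
  proof (rule sig_induct[where Q = "\<lambda>j t. j \<le> ks \<longrightarrow> R (ks - j) t" and x = ks])
    show "dec (\<lambda>z. hfst z \<le> ks \<longrightarrow> R (ks - hfst z) (hsnd z))" unfolding R_def by (intro rr6 rseg rec_comp[OF rst])
    obtain t where t: "\<forall>i<1. hent t i = ks" using seq_comp[OF rec_const[of ks], of 1] by blast
    have "ks - 0 = ks" by simp
    moreover have "hent t 0 = ks" using t zero_less_one by blast
    ultimately have "R (ks - 0) t" unfolding R_def using ks by simp
    then show "\<exists>t. 0 \<le> ks \<longrightarrow> R (ks - 0) t" by blast
    fix j t assume IH: "j \<le> ks \<longrightarrow> R (ks - j) t"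
    show "\<exists>t. j + 1 \<le> ks \<longrightarrow> R (ks - (j + 1)) t"
    proof (cases "j + 1 \<le> ks")
      case False then show ?thesis by blast
    next
      case True
      define k where "k = ks - (j + 1)"
      have kj: "ks = (j + 1) + k" unfolding k_def by (rule hm_diff[OF True])
      have "ks - j = k + 1" unfolding kj by (simp add: add.assoc add.commute[of 1 k])
      moreover have "j \<le> ks" using True hm_less_self[of j] by order
      ultimately have Rt: "R (k + 1) t" using IH by simp
      show ?thesis
      proof (cases "hlen (st k) = 0")
        case True
        obtain t' where t': "\<forall>i<1. hent t' i = k" using seq_comp[OF rec_const[of k], of 1] by blast
        then have "R k t'" using True zero_less_one unfolding R_def by auto
        then show ?thesis unfolding k_def by blast
      next
        case False
        then obtain l where l: "hlen (st k) = l + 1" using hm_pred by blast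
        define L where "L = hlen (st (k + 1))"
        have lL: "l \<le> L" unfolding L_def using step(1)[OF l] by simp
        have tL: "hent t L = k + 1" and tdec: "\<And>i. i < L \<Longrightarrow> hent t (i + 1) \<le> hent t i"
          and tlg: "\<And>i. i < L \<Longrightarrow> lg (hent (st (k + 1)) i) (seg (hent t (i + 1)) (hent t i))"
          using Rt unfolding R_def L_def by auto
        have tmono: "hent t j \<le> hent t i" if "i \<le> j" "j \<le> L" for i j
        proof -
          obtain e where e: "j = i + e" using \<open>i \<le> j\<close> hm_le_iff_ex by blast
          have "i + e \<le> L \<longrightarrow> hent t (i + e) \<le> hent t i"
          proof (rule dec_induct[of "\<lambda>e. i + e \<le> L \<longrightarrow> hent t (i + e) \<le> hent t i"])
            show "dec (\<lambda>e. i + e \<le> L \<longrightarrow> hent t (i + e) \<le> hent t i)" by (intro rr5)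
            fix e assume "i + e \<le> L \<longrightarrow> hent t (i + e) \<le> hent t i"
            then show "i + (e + 1) \<le> L \<longrightarrow> hent t (i + (e + 1)) \<le> hent t i"
              using tdec[of "i + e"] by (auto simp: add.assoc[symmetric] hm_Suc_le dest: less_imp_le intro: order_trans)
          qed simp
          then show ?thesis using e \<open>j \<le> L\<close> by simp
        qed
        have tl: "k + 1 \<le> hent t l" using tmono[OF lL order_refl] tL by simp
        \<comment> \<open>Undoing a move merges the segments of all replacement terms into one: the
          boundaries up to \<open>l\<close> stay, and the new last boundary is
          \<open>k\<close>.\<close>
        define t' where "t' i = (if i \<le> l then hent t i else k)" for i
        have "rec t'" unfolding t'_def by (intro rr5)
        then obtain u where u: "\<And>i. i < l + 1 + 1 \<Longrightarrow> hent u i = t' i" using seq_comp[of t' "l + 1 + 1"] by blast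
        have ul: "hent u i = hent t i" if "i \<le> l" for i
          using u[of i] that by (simp add: t'_def hm_less_Suc add_increasing2)
        have ul1: "hent u (l + 1) = k" using u[of "l + 1"] by (simp add: t'_def hm_less_Suc hm_Suc_le)
        have last: "lg (hent (st k) l) (seg k (hent t l))"
        proof (cases "hent (st k) l = 0")
          case True
          have "hmem (xs k) (seg k (hent t l))" unfolding seg using tl by (auto simp: hm_Suc_le)
          then show ?thesis using True lg_0 by auto
        next
          case False
          then obtain e where e: "hent (st k) l = e + 1" using hm_pred by blast
          have LL: "L = l + xs k" unfolding L_def using step(1)[OF l] False by simp
          have ent: "hent (st (k + 1)) i = e" if "l \<le> i" "i < L" for i
            using step(2)[OF l, of i] leD[OF that(1)] that(2) e unfolding L_def by simp
          \<comment> \<open>The \<open>xs k\<close> copies of the replacement term supply the blocks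
            behind the head \<open>xs k\<close>. The last copy owns the earliest elements, so the
            copies are listed backwards by \<open>L - (j + 1)\<close>.\<close>
          have "lgs e (xs k) (hi (seg k (hent t l)) (xs k + 1))"
          proof (rule lgs_build[of "\<lambda>j. seg (hent t (L - j)) (hent t (L - (j + 1)))"])
            show "rec (\<lambda>j. seg (hent t (L - j)) (hent t (L - (j + 1))))" by (intro rr6 rseg)
            have idx: "L - j = (L - (j + 1)) + 1" "l \<le> L - (j + 1)" "L - (j + 1) < L" if jx: "j < xs k" for j
            proof -
              have "j + 1 \<le> xs k" using jx hm_Suc_le by simp
              then obtain r where r: "xs k = (j + 1) + r" using hm_le_iff_ex by blast
              have e1: "L = (j + 1) + (l + r)" and e2: "L = j + (l + r + 1)" and e3: "L = (l + r) + (j + 1)"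
                unfolding LL r by (simp_all only: ac_simps)
              have d1: "L - (j + 1) = l + r" by (simp only: e1 add_diff_cancel_left')
              have d2: "L - j = l + r + 1" by (simp only: e2 add_diff_cancel_left')
              show "L - j = (L - (j + 1)) + 1" by (simp only: d1 d2)
              show "l \<le> L - (j + 1)" unfolding d1 by simp
              show "L - (j + 1) < L" unfolding d1 by (subst e3) (rule hm_less_add)
            qed
            show "lg e (seg (hent t (L - j)) (hent t (L - (j + 1))))" if "j < xs k" for j
              using tlg[OF idx(3)[OF that]] ent[OF idx(2,3)[OF that]] idx(1)[OF that] by simp
            show "hsub (seg (hent t (L - j)) (hent t (L - (j + 1)))) (hi (seg k (hent t l)) (xs k + 1))" if "j < xs k" for j
              unfolding hsub_iff
            proof (intro allI impI)
              fix i assume "hmem i (seg (hent t (L - j)) (hent t (L - (j + 1))))"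
              then obtain m where m: "m < hent t (L - (j + 1))" "hent t (L - j) \<le> m" "i = xs m" unfolding seg by blast
              have "L - j \<le> L" using idx(1,3)[OF that] by (simp add: hm_Suc_le)
              then have "k + 1 \<le> hent t (L - j)" using tmono[of "L - j" L] tL by simp
              then have km: "k < m" using m(2) unfolding hm_Suc_le by order
              have "hent t (L - (j + 1)) \<le> hent t l" using tmono idx(2,3)[OF that] by (simp add: less_imp_le)
              then have "m < hent t l" using m(1) by order
              then show "hmem i (hi (seg k (hent t l)) (xs k + 1))"
                unfolding mem_hi seg m(3) hm_Suc_le using km xs(3)[OF km] less_imp_le by blast
            qed
            show "a < b" if jj: "j < j'" "j' < xs k" "hmem a (seg (hent t (L - j)) (hent t (L - (j + 1))))" "hmem b (seg (hent t (L - j')) (hent t (L - (j' + 1))))" for j j' a b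
            proof -
              obtain m m' where m: "m < hent t (L - (j + 1))" "a = xs m" "hent t (L - j') \<le> m'" "b = xs m'" using jj(3,4) unfolding seg by blast
              have "j < xs k" using jj by order
              have "j + 1 \<le> j'" using jj(1) hm_Suc_le by simp
              then obtain r where "j' = (j + 1) + r" using hm_le_iff_ex by blast
              then have "L - j' = L - (j + 1) - r" by (simp add: diff_diff_add)
              then have "L - j' \<le> L - (j + 1)" using hm_minus_le by simp
              then have "hent t (L - (j + 1)) \<le> hent t (L - j')" using tmono idx(3)[OF \<open>j < xs k\<close>] by (simp add: less_imp_le)
              then have "m < m'" using m by order
              then show ?thesis using xs(3) m by simp
            qed
          qed
          moreover have "hmem (xs k) (seg k (hent t l))" unfolding seg using tl by (auto simp: hm_Suc_le)
          ultimately show ?thesis unfolding e lg_Suc by blast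
        qed
        have "R k u" unfolding R_def l
        proof (intro conjI allI impI)
          show "hent u (l + 1) = k" by (rule ul1)
          fix i assume "i < l + 1"
          then have "(hent u (i + 1) \<le> hent u i) \<and> lg (hent (st k) i) (seg (hent u (i + 1)) (hent u i))"
          proof (rule less_Suc_cases)
            assume il: "i < l"
            then have iL: "i < L" using lL by order
            have "hent (st (k + 1)) i = hent (st k) i" using step(2)[OF l, of i] iL il unfolding L_def by simp
            then show ?thesis using tdec[OF iL] tlg[OF iL] il ul[of i] ul[of "i + 1"] by (simp add: hm_Suc_le less_imp_le)
          next
            assume "i = l"
            then show ?thesis using last ul1 ul[of l] tl hm_less_self[of k] by (auto simp: less_imp_le hm_Suc_le)
          qed
          then show "hent u (i + 1) \<le> hent u i" "lg (hent (st k) i) (seg (hent u (i + 1)) (hent u i))" by blast+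
        qed
        then show ?thesis unfolding k_def by blast
      qed
    qed
  qed
  moreover have "ks - ks = 0" by simp
  ultimately obtain t where "R 0 t" by auto
  then have "lg (hent \<alpha> 0) (seg (hent t (0 + 1)) (hent t 0))" unfolding R_def st0 using \<alpha>(2) by blast
  moreover have "\<forall>i. hmem i (seg (hent t (0 + 1)) (hent t 0)) \<longrightarrow> i \<in> X" unfolding seg using xs(2) by blast
  ultimately show "\<exists>Z. (\<forall>i. hmem i Z \<longrightarrow> i \<in> X) \<and> lg (hent \<alpha> 0) Z" by blast
qed

section \<open>Initial segments as structures\<close>

text \<open>The sets of the model are kept whole instead of being cut down to \<open>I\<close>.
  Membership is only ever tested for elements of \<open>I\<close>, so the truth values are those of
  the traces, and set parameters need no translation.\<close>

definition NN :: "hm set \<Rightarrow> hm str" where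
  "NN I = \<lparr>Dm = I, Z0 = 0, O1 = 1, Pl = (+), Ti = (*), Ls = (<), Ss = SS\<rparr>"

lemma NN_simps [simp]: "Dm (NN I) = I" "Z0 (NN I) = 0" "O1 (NN I) = 1" "Pl (NN I) = (+)" "Ti (NN I) = (*)" "Ls (NN I) = (<)" "Ss (NN I) = SS"
  by (simp_all add: NN_def)

lemma NN_UNIV: "NN UNIV = MM" by (simp add: NN_def MM_def)

lemma ev_NN [simp]: "ev (NN I) e t = ev MM e t" by (induction t) auto

lemma hent_le: "hent s i \<le> s"
proof -
  have "hent s i \<le> hfst (hsnd s)" unfolding hent_def by (rule hmod_le)
  then show ?thesis using hpair_ge(1)[of "hfst (hsnd s)" "hsnd (hsnd s)"] hpair_ge(2)[of "hsnd s" "hfst s"] by simp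
qed

locale cut =
  fixes I :: "hm set"
  assumes I1: "1 \<in> I" and Idown: "x \<in> I \<Longrightarrow> y \<le> x \<Longrightarrow> y \<in> I"
    and Iadd: "x \<in> I \<Longrightarrow> y \<in> I \<Longrightarrow> x + y \<in> I" and Imult: "x \<in> I \<Longrightarrow> y \<in> I \<Longrightarrow> x * y \<in> I"
begin

definition ine :: "(nat \<Rightarrow> hm) \<Rightarrow> bool" where "ine e \<longleftrightarrow> (\<forall>n. e n \<in> I)"

lemma I0: "0 \<in> I" using I1 Idown[of 1 0] by simp

lemma ine_upd [simp]: "ine e \<Longrightarrow> d \<in> I \<Longrightarrow> ine (e(x := d))" by (auto simp: ine_def)
lemma ine_D [simp]: "ine e \<Longrightarrow> e n \<in> I" by (auto simp: ine_def)

lemma ev_I [simp]: "ine e \<Longrightarrow> ev MM e t \<in> I"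
  by (induction t) (auto intro: I0 I1 Iadd Imult)

lemma wfm_NN: "wfm (NN I)" using SS_ne by (auto simp: wfm_def I0 I1 Iadd Imult)

lemma hpair_I: "x \<in> I \<Longrightarrow> y \<in> I \<Longrightarrow> hpair x y \<in> I"
proof -
  assume "x \<in> I" "y \<in> I"
  then have "(x + y) * (x + y + 1) + (x + x) \<in> I" by (intro Iadd Imult I1)
  then have "2 * hpair x y \<in> I" unfolding hpair by (simp add: mult_2)
  then show ?thesis by (rule Idown) (simp add: mult_2)
qed

lemma Isub: "hfst z \<le> z" "hsnd z \<le> z" using hpair_ge(1)[of "hfst z" "hsnd z"] hpair_ge(2)[of "hsnd z" "hfst z"] by simp_all

lemma absolute: "bounded a \<Longrightarrow> ine e \<Longrightarrow> sat (NN I) e s a \<longleftrightarrow> sat MM e s a"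
proof (induction arbitrary: e rule: bounded.induct)
  case (6 x t a)
  have 1: "d \<in> I" if "d < ev MM e t" for d using Idown[OF ev_I[OF 6(4)]] that less_imp_le by blast
  have 2: "ev MM (e(x := d)) t = ev MM e t" for d by (rule ev_cong) (use 6(1) in auto)
  have 3: "sat (NN I) (e(x := d)) s a \<longleftrightarrow> sat MM (e(x := d)) s a" if "d \<in> I" for d
    by (rule 6(3)[OF ine_upd[OF 6(4) that]])
  have "sat (NN I) e s (FAll x (FImp (FLess (TV x) t) a)) \<longleftrightarrow> (\<forall>d\<in>I. d < ev MM e t \<longrightarrow> sat (NN I) (e(x := d)) s a)"
    by (simp add: 2 fun_upd_same del: fun_upd_apply)
  also have "\<dots> \<longleftrightarrow> (\<forall>d. d < ev MM e t \<longrightarrow> sat MM (e(x := d)) s a)" using 1 3 by blast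
  also have "\<dots> \<longleftrightarrow> sat MM e s (FAll x (FImp (FLess (TV x) t) a))" by (simp add: 2 fun_upd_same del: fun_upd_apply)
  finally show ?case .
next
  case (7 x t a)
  have 1: "d \<in> I" if "d < ev MM e t" for d using Idown[OF ev_I[OF 7(4)]] that less_imp_le by blast
  have 2: "ev MM (e(x := d)) t = ev MM e t" for d by (rule ev_cong) (use 7(1) in auto)
  have 3: "sat (NN I) (e(x := d)) s a \<longleftrightarrow> sat MM (e(x := d)) s a" if "d \<in> I" for d
    by (rule 7(3)[OF ine_upd[OF 7(4) that]])
  have "sat (NN I) e s (FEx x (FAnd (FLess (TV x) t) a)) \<longleftrightarrow> (\<exists>d\<in>I. d < ev MM e t \<and> sat (NN I) (e(x := d)) s a)"
    by (simp add: 2 fun_upd_same del: fun_upd_apply)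
  also have "\<dots> \<longleftrightarrow> (\<exists>d. d < ev MM e t \<and> sat MM (e(x := d)) s a)" using 1 3 by blast
  also have "\<dots> \<longleftrightarrow> sat MM e s (FEx x (FAnd (FLess (TV x) t) a))" by (simp add: 2 fun_upd_same del: fun_upd_apply)
  finally show ?case .
qed auto

lemma sat_NN_pairT [simp]: "sat (NN I) e s (pairT t u v) \<longleftrightarrow> ev MM e v = hpair (ev MM e t) (ev MM e u)"
  by (simp add: pairT_def tw_def hpair_eq)

lemma sat_pairInF:
  assumes "ine e" "h \<notin> fvt t" "h \<notin> fvt u"
  shows "sat (NN I) e s (pairInF h t u X) \<longleftrightarrow> hpair (ev MM e t) (ev MM e u) \<in> s X"
proof -
  have "ev MM (e(h := d)) t = ev MM e t" "ev MM (e(h := d)) u = ev MM e u" for d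
    by (rule ev_cong; use assms in auto)+
  then show ?thesis using hpair_I[of "ev MM e t" "ev MM e u"] assms(1) by (auto simp: pairInF_def)
qed

text \<open>The length, the two parameters of the beta function and the quotient are all bounded by
  the code of the sequence, so an initial segment contains every witness that the whole model
  has.\<close>

lemma sat_entF:
  assumes e: "ine e" and b: "s < b" "i < b" "v < b"
  shows "sat (NN I) e S (entF b s i v) \<longleftrightarrow> e i < hlen (e s) \<and> hent (e s) (e i) = e v"
proof -
  let ?m = "\<lambda>d. 1 + (e i + 1) * d"
  have "sat (NN I) e S (entF b s i v) \<longleftrightarrow>
    (\<exists>k\<in>I. \<exists>c\<in>I. \<exists>d\<in>I. \<exists>p\<in>I. p = hpair c d \<and> e s = hpair k p \<and> e i < k \<and> (\<exists>q\<in>I. c = q * ?m d + e v \<and> e v < ?m d))"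
    using b by (simp add: entF_def Let_def)
  also have "\<dots> \<longleftrightarrow> e i < hlen (e s) \<and> hent (e s) (e i) = e v"
  proof
    assume "\<exists>k\<in>I. \<exists>c\<in>I. \<exists>d\<in>I. \<exists>p\<in>I. p = hpair c d \<and> e s = hpair k p \<and> e i < k \<and> (\<exists>q\<in>I. c = q * ?m d + e v \<and> e v < ?m d)"
    then obtain k c d q where h: "e s = hpair k (hpair c d)" "e i < k" "c = q * ?m d + e v" "e v < ?m d" by blast
    have "hmod c (?m d) = e v" by (rule hmod_unique[OF h(3,4)])
    then show "e i < hlen (e s) \<and> hent (e s) (e i) = e v" using h(1,2) by (simp add: hlen_def hent_def)
  next
    assume h: "e i < hlen (e s) \<and> hent (e s) (e i) = e v"
    define k where "k = hfst (e s)"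
    define p where "p = hsnd (e s)"
    define c where "c = hfst p"
    define d where "d = hsnd p"
    have m0: "0 < ?m d" by (simp add: add_pos_nonneg)
    have cd: "hmod c (?m d) = e v" using h unfolding hent_def c_def d_def p_def by simp
    obtain q where q: "c = q * ?m d + e v" using hmod_ex[of c "?m d"] cd by auto
    have es: "e s \<in> I" using e by simp
    have pI: "p \<in> I" unfolding p_def by (rule Idown[OF es Isub(2)])
    have kI: "k \<in> I" unfolding k_def by (rule Idown[OF es Isub(1)])
    have cI: "c \<in> I" "d \<in> I" unfolding c_def d_def by (rule Idown[OF pI Isub(1)], rule Idown[OF pI Isub(2)])
    have "q \<le> q * ?m d" by (rule hm_le_mult[OF m0])
    also have "\<dots> \<le> c" by (simp add: q)
    finally have qI: "q \<in> I" by (rule Idown[OF cI(1)])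
    have "p = hpair c d" "e s = hpair k p" "e i < k" "e v < ?m d"
      using h hmod_less[OF m0, of c] cd by (simp_all add: c_def d_def k_def p_def hlen_def)
    then show "\<exists>k\<in>I. \<exists>c\<in>I. \<exists>d\<in>I. \<exists>p\<in>I. p = hpair c d \<and> e s = hpair k p \<and> e i < k \<and> (\<exists>q\<in>I. c = q * ?m d + e v \<and> e v < ?m d)"
      using q qI kI cI pI by blast
  qed
  finally show ?thesis .
qed

lemma sat_lhF:
  assumes e: "ine e" and b: "s < b" "l < b"
  shows "sat (NN I) e S (lhF b s l) \<longleftrightarrow> hlen (e s) = e l"
proof -
  have "sat (NN I) e S (lhF b s l) \<longleftrightarrow> (\<exists>c\<in>I. \<exists>d\<in>I. \<exists>p\<in>I. p = hpair c d \<and> e s = hpair (e l) p)"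
    using b by (simp add: lhF_def Let_def)
  also have "\<dots> \<longleftrightarrow> hlen (e s) = e l"
  proof
    assume h: "hlen (e s) = e l"
    have pI: "hsnd (e s) \<in> I" by (rule Idown[OF ine_D[OF e] Isub(2)])
    have "hfst (hsnd (e s)) \<in> I" "hsnd (hsnd (e s)) \<in> I" by (rule Idown[OF pI Isub(1)], rule Idown[OF pI Isub(2)])
    moreover have "hsnd (e s) = hpair (hfst (hsnd (e s))) (hsnd (hsnd (e s)))" "e s = hpair (e l) (hsnd (e s))"
      by simp (simp only: h[symmetric] hlen_def hpair_fst_snd)
    ultimately show "\<exists>c\<in>I. \<exists>d\<in>I. \<exists>p\<in>I. p = hpair c d \<and> e s = hpair (e l) p" using pI by blast
  qed (auto simp: hlen_def)
  finally show ?thesis .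
qed

lemma hlen_I: "s \<in> I \<Longrightarrow> i \<le> hlen s \<Longrightarrow> i \<in> I" using Idown hlen_le order_trans by blast
lemma hent_I: "s \<in> I \<Longrightarrow> hent s i \<in> I" using Idown hent_le by blast

lemma sat_ordF:
  assumes e: "ine e" and b: "x < b"
  shows "sat (NN I) e S (ordF b x) \<longleftrightarrow> isord (e x)"
proof -
  have x: "e x \<in> I" using e by simp
  have "sat (NN I) e S (ordF b x) \<longleftrightarrow> (\<forall>i\<in>I. \<forall>j\<in>I. \<forall>u\<in>I. \<forall>v\<in>I. (i < hlen (e x) \<and> hent (e x) i = u) \<and> (j < hlen (e x) \<and> hent (e x) j = v) \<and> i < j \<longrightarrow> v < u \<or> v = u)"
    using e b by (simp add: ordF_def Let_def sat_entF cong: ball_cong)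
  also have "\<dots> \<longleftrightarrow> isord (e x)"
  proof
    assume L: "\<forall>i\<in>I. \<forall>j\<in>I. \<forall>u\<in>I. \<forall>v\<in>I. (i < hlen (e x) \<and> hent (e x) i = u) \<and> (j < hlen (e x) \<and> hent (e x) j = v) \<and> i < j \<longrightarrow> v < u \<or> v = u"
    show "isord (e x)" unfolding isord_def
    proof (intro allI impI)
      fix j i assume ji: "j < hlen (e x)" "i < j"
      then have i: "i < hlen (e x)" by order
      have "i \<in> I" "j \<in> I" using hlen_I[OF x] ji(1) i less_imp_le by blast+
      then show "hent (e x) j \<le> hent (e x) i" using L hent_I[OF x] ji i unfolding le_less by blast
    qed
  next
    assume "isord (e x)"
    then show "\<forall>i\<in>I. \<forall>j\<in>I. \<forall>u\<in>I. \<forall>v\<in>I. (i < hlen (e x) \<and> hent (e x) i = u) \<and> (j < hlen (e x) \<and> hent (e x) j = v) \<and> i < j \<longrightarrow> v < u \<or> v = u"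
      unfolding isord_def by (auto simp: le_less)
  qed
  finally show ?thesis .
qed

lemma sat_ordLtF:
  assumes e: "ine e" and b: "x < b" "y < b"
  shows "sat (NN I) e S (ordLtF b x y) \<longleftrightarrow> drp 0 (e x) (e y)"
proof -
  have x: "e x \<in> I" "e y \<in> I" using e by simp_all
  let ?A = "\<lambda>i. (\<forall>j\<in>I. j < i \<longrightarrow> (\<forall>u\<in>I. (j < hlen (e x) \<and> hent (e x) j = u) \<longleftrightarrow> (j < hlen (e y) \<and> hent (e y) j = u)))"
  let ?B = "\<lambda>i. (hlen (e x) = i \<and> (\<exists>k\<in>I. hlen (e y) = k \<and> i < k)) \<or> (\<exists>u\<in>I. \<exists>v\<in>I. (i < hlen (e x) \<and> hent (e x) i = u) \<and> (i < hlen (e y) \<and> hent (e y) i = v) \<and> u < v)"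
  have "sat (NN I) e S (ordLtF b x y) \<longleftrightarrow> (\<exists>i\<in>I. ?A i \<and> ?B i)"
    using e b by (simp add: ordLtF_def Let_def sat_entF sat_lhF cong: ball_cong bex_cong)
  also have "\<dots> \<longleftrightarrow> drp 0 (e x) (e y)"
  proof
    assume "\<exists>i\<in>I. ?A i \<and> ?B i"
    then obtain i where i: "i \<in> I" "?A i" "?B i" by blast
    have iy: "i < hlen (e y)" using i(3) by auto
    have "j < hlen (e x) \<and> hent (e x) j = hent (e y) j" if "j < i" for j
    proof -
      have "j \<in> I" using Idown[OF i(1)] that by simp
      moreover have "j < hlen (e y)" using that iy by order
      ultimately show ?thesis using i(2) that hent_I[OF x(2)] by blast
    qed
    moreover have "hlen (e x) = i \<or> i < hlen (e x) \<and> hent (e x) i < hent (e y) i" using i(3) by auto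
    ultimately show "drp 0 (e x) (e y)" unfolding drp_def using iy by (intro exI[of _ i]) simp
  next
    assume "drp 0 (e x) (e y)"
    then obtain i where i: "i < hlen (e y)" "\<And>j. j < i \<Longrightarrow> j < hlen (e x) \<and> hent (e x) j = hent (e y) j" "hlen (e x) = i \<or> i < hlen (e x) \<and> hent (e x) i < hent (e y) i"
      unfolding drp_def by blast
    have "?A i"
    proof (intro ballI impI)
      fix j u assume "j < i"
      then have "j < hlen (e x)" "hent (e x) j = hent (e y) j" "j < hlen (e y)" using i(2)[of j] less_trans[OF _ i(1)] by blast+
      then show "(j < hlen (e x) \<and> hent (e x) j = u) \<longleftrightarrow> (j < hlen (e y) \<and> hent (e y) j = u)" by simp
    qed
    moreover have "?B i" using i(1,3) hlen_I[OF x(2)] hent_I[OF x(1)] hent_I[OF x(2)] by blast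
    moreover have "i \<in> I" using hlen_I[OF x(2)] i(1) by simp
    ultimately show "\<exists>i\<in>I. ?A i \<and> ?B i" by blast
  qed
  finally show ?thesis .
qed

definition dsc :: "hm set \<Rightarrow> hm \<Rightarrow> bool" where
  "dsc F \<alpha> \<longleftrightarrow> (\<forall>n\<in>I. \<exists>m\<in>I. hpair n m \<in> F) \<and> (\<forall>n\<in>I. \<forall>m\<in>I. \<forall>m'\<in>I. hpair n m \<in> F \<and> hpair n m' \<in> F \<longrightarrow> m = m') \<and>
     hpair 0 \<alpha> \<in> F \<and> (\<forall>n\<in>I. \<forall>u\<in>I. \<forall>v\<in>I. hpair n u \<in> F \<and> hpair (n + 1) v \<in> F \<longrightarrow> isord u \<and> drp 0 v u)"

lemma sat_woF:
  assumes e: "ine e" and b: "a < b"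
  shows "sat (NN I) e S (woF b a) \<longleftrightarrow> \<not> (\<exists>F\<in>SS. dsc F (e a))"
  using e b by (simp add: woF_def Let_def dsc_def sat_pairInF sat_ordF sat_ordLtF cong: ball_cong bex_cong)

lemma sat_ordStmt:
  assumes e: "ine e"
  shows "sat (NN I) e S (ordStmt a phi) \<longleftrightarrow> (\<forall>\<alpha>\<in>I. isord \<alpha> \<longrightarrow> \<not> (\<exists>F\<in>SS. dsc F \<alpha>) \<longrightarrow> sat (NN I) (e(a := \<alpha>)) S phi)"
  using e by (simp add: ordStmt_def sat_ordF sat_woF cong: ball_cong)

end

interpretation MMc: cut UNIV by unfold_locales auto

lemma rec_upd: "(\<And>n. rec (\<lambda>z. E z n)) \<Longrightarrow> rec d \<Longrightarrow> rec (\<lambda>z. ((E z)(x := d z)) n)"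
  by (cases "n = x") simp_all

text \<open>Truth of a bounded formula is decidable uniformly in an environment that depends
  recursively on a number; this generality is what the induction needs to pass under a bounded
  quantifier.\<close>

lemma dec_bounded:
  "bounded a \<Longrightarrow> (\<And>X. s X \<in> SS) \<Longrightarrow> (\<And>n. rec (\<lambda>z. E z n)) \<Longrightarrow> dec (\<lambda>z. sat MM (E z) s a)"
proof (induction arbitrary: E rule: bounded.induct)
  have rt: "rec (\<lambda>z. ev MM (E z) t)" if "\<And>n. rec (\<lambda>z. E z n)" for E :: "hm \<Rightarrow> nat \<Rightarrow> hm" and t
    using that by (induction t) (auto intro: rr0)
  {
    case (1 t u) then show ?case by (auto intro!: dec_eq rt)
  next
    case (2 t u) then show ?case by (auto intro!: dec_less rt)
  next
    case (3 t X) then show ?case by (auto intro!: dec_mem rt)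
  next
    case (4 a) then show ?case by (auto intro!: dec_not)
  next
    case (5 a b) then show ?case by (auto intro!: dec_imp)
  next
    case (6 x t a)
    have e: "ev MM ((E z)(x := d)) t = ev MM (E z) t" for d z by (rule ev_cong) (use 6(1) in auto)
    have "dec (\<lambda>w. sat MM ((E (hfst w))(x := hsnd w)) s a)"
      by (rule 6(3)) (rule 6(4), intro rec_upd rec_hsnd0 rec_comp[OF 6(5) rec_hfst0])
    then have "dec (\<lambda>z. \<forall>d<ev MM (E z) t. sat MM ((E z)(x := d)) s a)" by (rule dec_all) (rule rt, rule 6(5))
    then show ?case by (simp add: e)
  next
    case (7 x t a)
    have e: "ev MM ((E z)(x := d)) t = ev MM (E z) t" for d z by (rule ev_cong) (use 7(1) in auto)
    have "dec (\<lambda>w. sat MM ((E (hfst w))(x := hsnd w)) s a)"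
      by (rule 7(3)) (rule 7(4), intro rec_upd rec_hsnd0 rec_comp[OF 7(5) rec_hfst0])
    then have "dec (\<lambda>z. \<exists>d<ev MM (E z) t. sat MM ((E z)(x := d)) s a)" by (rule dec_ex) (rule rt, rule 7(5))
    then show ?case by (simp add: e)
  }
qed

lemma dec2_bounded:
  assumes "bounded a" "\<And>X. s X \<in> SS"
  shows "dec (\<lambda>z. sat MM (e(n := hfst z, m := hsnd z)) s a)"
  by (rule dec_bounded[OF assms]) (intro rec_upd rec_hfst0 rec_hsnd0 rec_const)

text \<open>\<open>sq w j\<close> is the least code of the characteristic sequence of \<open>w\<close> below \<open>j\<close>. A bound on these codes is what
  keeps the branching of a binary tree inside a cut.\<close>

definition sq :: "hm \<Rightarrow> hm \<Rightarrow> hm" where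
  "sq w j = (LEAST s. hlen s = j \<and> (\<forall>i<j. hent s i = (if hmem i w then 1 else 0)))"

lemma sq_dec: "dec (\<lambda>z. hlen (hsnd z) = hsnd (hfst z) \<and> (\<forall>i<hsnd (hfst z). hent (hsnd z) i = (if hmem i (hfst (hfst z)) then 1 else 0)))"
  by (intro rr5)

lemma sq_ex: "\<exists>s. hlen s = j \<and> (\<forall>i<j. hent s i = (if hmem i w then 1 else 0))"
proof -
  have "rec (\<lambda>i. if hmem i w then 1 else 0)" by (intro rr5)
  from seq_comp[OF this] show ?thesis .
qed

lemma sq: "hlen (sq w j) = j \<and> (\<forall>i<j. hent (sq w j) i = (if hmem i w then 1 else 0))"
proof -
  have d: "dec (\<lambda>s. hlen s = j \<and> (\<forall>i<j. hent s i = (if hmem i w then 1 else 0)))" by (intro rr5)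
  obtain t where "hlen t = j \<and> (\<forall>i<j. hent t i = (if hmem i w then 1 else 0))" using sq_ex by blast
  then show ?thesis unfolding sq_def by (rule dec_Least(1)[OF d])
qed

lemma rec_sq: assumes "rec s" "rec t" shows "rec (\<lambda>x. sq (s x) (t x))"
proof (rule rec2[where f = sq, OF _ assms])
  show "rec (\<lambda>z. sq (hfst z) (hsnd z))" unfolding sq_def by (rule rec_Least[OF sq_dec]) (rule sq_ex)
qed

lemma sq_lo: "sq (lo w j) j = sq w j"
proof -
  have "(hlen s = j \<and> (\<forall>i<j. hent s i = (if hmem i (lo w j) then 1 else 0))) \<longleftrightarrow> (hlen s = j \<and> (\<forall>i<j. hent s i = (if hmem i w then 1 else 0)))" for s
    by simp
  then show ?thesis unfolding sq_def by (simp only:)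
qed

definition cb :: "hm \<Rightarrow> hm" where "cb j = (LEAST c. \<forall>w<p2 j. sq w j \<le> c)"

lemma cb_dec: "dec (\<lambda>z. \<forall>w<p2 (hfst z). sq w (hfst z) \<le> hsnd z)" by (intro rr5 rec_sq)

lemma cb_ex: "\<exists>c. \<forall>w<p2 j. sq w j \<le> c"
proof -
  have "rec (\<lambda>w. sq w j)" by (intro rr5 rec_sq)
  from bound_ex[OF this, of "p2 j"] obtain c where "\<And>w. w < p2 j \<Longrightarrow> sq w j < c" by blast
  then show ?thesis by (meson less_imp_le)
qed

lemma rec_cb: "rec cb" unfolding cb_def by (rule rec_Least[where Q = "\<lambda>j c. \<forall>w<p2 j. sq w j \<le> c", OF cb_dec cb_ex])

text \<open>Only the bits of \<open>w\<close> below \<open>j\<close> matter, and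
  \<open>lo w j\<close> is one of the \<open>p2 j\<close> representatives over which the bound is
  taken.\<close>

lemma cb: "sq w j \<le> cb j"
proof -
  obtain c where "\<forall>w<p2 j. sq w j \<le> c" using cb_ex by blast
  moreover have "dec (\<lambda>c. \<forall>w<p2 j. sq w j \<le> c)" by (intro rr5 rec_sq)
  ultimately have "\<forall>w<p2 j. sq w j \<le> cb j" unfolding cb_def by (rule dec_Least(1)[rotated])
  moreover have "lo w j < p2 j" by (rule hset_bd) simp
  ultimately have "sq (lo w j) j \<le> cb j" by blast
  then show ?thesis by (simp only: sq_lo)
qed

text \<open>The Scott-style closure conditions: semiregularity gives induction and comprehension, the bound \<open>B\<close> outside of
  the cut turns a level of a tree above the cut into a path, and the last condition gives Ramsey's theorem.\<close>

locale gcut = cut +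
  fixes B :: hm
  assumes BI: "B \<notin> I"
    and semireg: "rec f \<Longrightarrow> b \<in> I \<Longrightarrow> \<exists>c\<in>I. \<forall>x\<le>b. f x \<in> I \<longrightarrow> f x \<le> c"
    and cbI: "j \<in> I \<Longrightarrow> cb j \<in> I"
    and ramseyI: "dec (\<lambda>z. \<chi> (hfst z) (hsnd z)) \<Longrightarrow> \<exists>F d. hom \<chi> d F \<and> (\<forall>b\<in>I. \<exists>x\<in>I. b < x \<and> hmem x F)"
begin

lemma I_less: "x \<in> I \<Longrightarrow> x < B" using BI Idown not_less by blast

text \<open>Induction in the cut becomes decidable once the witnesses have a common bound in the
  cut, and semiregularity applied to the least-witness function provides it.\<close>

lemma sig_ind_I:
  assumes d: "dec (\<lambda>z. Q (hfst z) (hsnd z))" and 0: "\<exists>y\<in>I. Q 0 y" and S: "\<And>n. n \<in> I \<Longrightarrow> \<exists>y\<in>I. Q n y \<Longrightarrow> \<exists>y\<in>I. Q (n + 1) y"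
    and n: "n \<in> I"
  shows "\<exists>y\<in>I. Q n y"
proof -
  \<comment> \<open>The default \<open>B\<close> lies outside of the cut, so \<open>f\<close> is
    total and a value in the cut is always a genuine witness.\<close>
  define f where "f k = (LEAST y. Q k y \<or> y = B)" for k
  have df: "dec (\<lambda>z. Q (hfst z) (hsnd z) \<or> hsnd z = B)" by (intro rr5 d)
  have "rec f" unfolding f_def by (rule rec_Least[OF df]) auto
  from semireg[OF this n] obtain c where c: "c \<in> I" "\<And>k. k \<le> n \<Longrightarrow> f k \<in> I \<Longrightarrow> f k \<le> c" by blast
  have fI: "\<exists>y\<le>c. Q k y" if kn: "k \<le> n" and y: "\<exists>y\<in>I. Q k y" for k
  proof -
    obtain y where y: "y \<in> I" "Q k y" using y by blast
    have "Q k (f k) \<or> f k = B" "f k \<le> y"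
      unfolding f_def by (rule dec_Least(1)[OF dec_section[OF df], of _ y], simp add: y, rule dec_Least(2)[OF dec_section[OF df], of _ y], simp add: y)
    then have "Q k (f k)" "f k \<in> I" using I_less[OF y(1)] Idown[OF y(1)] by auto
    then show ?thesis using c(2)[OF kn] by blast
  qed
  have "k \<le> n \<longrightarrow> (\<exists>y\<le>c. Q k y)" for k
  proof (rule dec_induct[of "\<lambda>k. k \<le> n \<longrightarrow> (\<exists>y\<le>c. Q k y)"])
    show "dec (\<lambda>k. k \<le> n \<longrightarrow> (\<exists>y\<le>c. Q k y))" by (intro rr5 d)
    show "0 \<le> n \<longrightarrow> (\<exists>y\<le>c. Q 0 y)" using fI[of 0] 0 by simp
    fix k assume IH: "k \<le> n \<longrightarrow> (\<exists>y\<le>c. Q k y)"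
    show "k + 1 \<le> n \<longrightarrow> (\<exists>y\<le>c. Q (k + 1) y)"
    proof
      assume k1: "k + 1 \<le> n"
      then have "k \<le> n" using hm_less_self[of k] by order
      then have "\<exists>y\<in>I. Q k y" using IH Idown[OF c(1)] by blast
      moreover have "k \<in> I" using Idown[OF n \<open>k \<le> n\<close>] .
      ultimately show "\<exists>y\<le>c. Q (k + 1) y" using S fI[OF k1] by blast
    qed
  qed
  then show ?thesis using Idown[OF c(1)] by blast
qed

lemma sigma1_form:
  assumes "sigma 1 a" "\<And>X. s X \<in> SS" "ine e"
  obtains Q where "dec (\<lambda>z. Q (hfst z) (hsnd z))" "\<And>d. d \<in> I \<Longrightarrow> sat (NN I) (e(n := d)) s a \<longleftrightarrow> (\<exists>y\<in>I. Q d y)"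
proof -
  consider "bounded a" | x b where "a = FEx x b" "bounded b" using assms(1) by auto
  then show ?thesis
  proof cases
    case 1
    obtain m where m: "m \<notin> insert n (fv a)" using ex_new_if_finite[OF infinite_UNIV_nat, of "insert n (fv a)"] by auto
    have e: "sat MM (e(n := d, m := y)) s a = sat MM (e(n := d)) s a" for d y by (rule sat_cong) (use m in auto)
    have "sat (NN I) (e(n := d)) s a \<longleftrightarrow> (\<exists>y\<in>I. sat MM (e(n := d, m := y)) s a)" if "d \<in> I" for d
      unfolding e absolute[OF 1 ine_upd[OF assms(3) that]] using I0 by blast
    then show ?thesis by (rule that[of "\<lambda>d y. sat MM (e(n := d, m := y)) s a", OF dec2_bounded[OF 1 assms(2)]])
  next
    case 2
    have "sat (NN I) (e(n := d)) s a \<longleftrightarrow> (\<exists>y\<in>I. sat MM (e(n := d, x := y)) s b)" if "d \<in> I" for d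
    proof -
      have "sat (NN I) (e(n := d, x := y)) s b \<longleftrightarrow> sat MM (e(n := d, x := y)) s b" if y: "y \<in> I" for y
        by (rule absolute[OF 2(2) ine_upd[OF ine_upd[OF assms(3) \<open>d \<in> I\<close>] y]])
      then show ?thesis unfolding 2(1) by (simp del: fun_upd_apply)
    qed
    then show ?thesis by (rule that[of "\<lambda>d y. sat MM (e(n := d, x := y)) s b", OF dec2_bounded[OF 2(2) assms(2)]])
  qed
qed

lemma pi1_form:
  assumes "pi 1 a" "\<And>X. s X \<in> SS" "ine e"
  obtains Q where "dec (\<lambda>z. Q (hfst z) (hsnd z))" "\<And>d. d \<in> I \<Longrightarrow> sat (NN I) (e(n := d)) s a \<longleftrightarrow> (\<forall>y\<in>I. Q d y)"
proof -
  have "sigma 1 (FNeg a) \<or> (\<exists>x b. a = FAll x b \<and> bounded b)" using assms(1) by (auto intro: bounded_intros)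
  then consider "sigma 1 (FNeg a)" | x b where "a = FAll x b" "bounded b" by blast
  then show ?thesis
  proof cases
    case 1
    obtain Q where Q: "dec (\<lambda>z. Q (hfst z) (hsnd z))" "\<And>d. d \<in> I \<Longrightarrow> sat (NN I) (e(n := d)) s (FNeg a) \<longleftrightarrow> (\<exists>y\<in>I. Q d y)"
      by (rule sigma1_form[where s = s and n = n, OF 1 assms(2,3)]) (rule that; assumption)
    show ?thesis
      by (rule that[of "\<lambda>d y. \<not> Q d y", OF dec_not[OF Q(1)]]) (use Q(2) in \<open>auto simp del: fun_upd_apply\<close>)
  next
    case 2
    have "sat (NN I) (e(n := d)) s a \<longleftrightarrow> (\<forall>y\<in>I. sat MM (e(n := d, x := y)) s b)" if "d \<in> I" for d
    proof -
      have "sat (NN I) (e(n := d, x := y)) s b \<longleftrightarrow> sat MM (e(n := d, x := y)) s b" if y: "y \<in> I" for y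
        by (rule absolute[OF 2(2) ine_upd[OF ine_upd[OF assms(3) \<open>d \<in> I\<close>] y]])
      then show ?thesis unfolding 2(1) by (simp del: fun_upd_apply)
    qed
    then show ?thesis by (rule that[of "\<lambda>d y. sat MM (e(n := d, x := y)) s b", OF dec2_bounded[OF 2(2) assms(2)]])
  qed
qed

lemma NN_basic: assumes "a \<in> basicAx" shows "sat (NN I) e s a"
proof -
  have ind: "(\<forall>A\<in>SS. 0 \<in> A \<and> (\<forall>d\<in>I. d \<in> A \<longrightarrow> d + 1 \<in> A) \<longrightarrow> (\<forall>d\<in>I. d \<in> A))"
  proof (intro ballI impI)
    fix A d assume A: "A \<in> SS" "0 \<in> A \<and> (\<forall>d\<in>I. d \<in> A \<longrightarrow> d + 1 \<in> A)" "d \<in> I"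
    have "k \<in> I \<longrightarrow> k \<le> d \<longrightarrow> k \<in> A" for k
    proof -
      have "k \<le> d \<longrightarrow> k \<in> A"
      proof (rule dec_induct[of "\<lambda>k. k \<le> d \<longrightarrow> k \<in> A"])
        show "dec (\<lambda>k. k \<le> d \<longrightarrow> k \<in> A)" by (intro rr5 dec_mem[OF A(1)])
        show "0 \<le> d \<longrightarrow> 0 \<in> A" using A(2) by blast
        fix k assume "k \<le> d \<longrightarrow> k \<in> A"
        moreover have "k + 1 \<le> d \<Longrightarrow> k \<le> d" using hm_less_self[of k] by order
        ultimately show "k + 1 \<le> d \<longrightarrow> k + 1 \<in> A" using A(2) Idown[OF A(3)] by blast
      qed
      then show ?thesis by blast
    qed
    then show "d \<in> A" using A(3) by blast
  qed
  from assms show ?thesis unfolding basicAx_def Let_def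
  proof (elim insertE emptyE)
    assume "a = FAllS 0 (FImp (FAnd (FMem TZ 0) (FAll 1 (FImp (FMem (TV 1) 0) (FMem (TPlus (TV 1) TO) 0)))) (FAll 1 (FMem (TV 1) 0)))"
    then show ?thesis using ind by (simp only: sat.simps sat_derived ev_NN ev.simps MM_simps NN_simps fun_upd_same)
  qed (simp_all add: hm_basic(1,2,7,8) distrib_left add.assoc)
qed

lemma NN_ind: assumes "a \<in> sigma1Ind" "wfe (NN I) e s" shows "sat (NN I) e s a"
proof -
  obtain b n where a: "a = FImp (FAnd (substf n TZ b) (FAll n (FImp b (substf n (TPlus (TV n) TO) b)))) (FAll n b)" "sigma 1 b"
    using assms(1) by (auto simp: sigma1Ind_def)
  have e: "ine e" "\<And>X. s X \<in> SS" using assms(2) by (auto simp: wfe_def ine_def)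
  obtain Q where Q: "dec (\<lambda>z. Q (hfst z) (hsnd z))" "\<And>d. d \<in> I \<Longrightarrow> sat (NN I) (e(n := d)) s b \<longleftrightarrow> (\<exists>y\<in>I. Q d y)"
    by (rule sigma1_form[where s = s and n = n, OF a(2) e(2,1)]) (rule that; assumption)
  show ?thesis unfolding a(1) sat_ind_instance
  proof (intro impI ballI)
    fix d assume h: "sat (NN I) (e(n := Z0 (NN I))) s b" "\<forall>d\<in>Dm (NN I). sat (NN I) (e(n := d)) s b \<longrightarrow> sat (NN I) (e(n := Pl (NN I) d (O1 (NN I)))) s b"
      and d: "d \<in> Dm (NN I)"
    have "\<exists>y\<in>I. Q d y"
    proof (rule sig_ind_I[OF Q(1)])
      show "\<exists>y\<in>I. Q 0 y" using h(1) Q(2)[OF I0] by (simp del: fun_upd_apply)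
      show "d \<in> I" using d by simp
      fix k assume k: "k \<in> I" "\<exists>y\<in>I. Q k y"
      then have "sat (NN I) (e(n := k)) s b" using Q(2) by blast
      then have "sat (NN I) (e(n := k + 1)) s b" using h(2)[rule_format, of k] k(1) by (simp del: fun_upd_apply)
      then show "\<exists>y\<in>I. Q (k + 1) y" using Q(2)[OF Iadd[OF k(1) I1]] by blast
    qed
    then show "sat (NN I) (e(n := d)) s b" using Q(2) d by (simp del: fun_upd_apply)
  qed
qed

lemma NN_ca: assumes "a \<in> delta1CA" "wfe (NN I) e s" shows "sat (NN I) e s a"
proof -
  obtain b c n X where a: "a = FImp (FAll n (FIff b c)) (FExS X (FAll n (FIff (FMem (TV n) X) b)))" "sigma 1 b" "pi 1 c" "X \<notin> fvs b"
    using assms(1) unfolding delta1CA_def by blast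
  have e: "ine e" "\<And>X. s X \<in> SS" using assms(2) by (auto simp: wfe_def ine_def)
  obtain Q where Q: "dec (\<lambda>z. Q (hfst z) (hsnd z))" "\<And>d. d \<in> I \<Longrightarrow> sat (NN I) (e(n := d)) s b \<longleftrightarrow> (\<exists>y\<in>I. Q d y)"
    by (rule sigma1_form[where s = s and n = n, OF a(2) e(2,1)]) (rule that; assumption)
  obtain R where R: "dec (\<lambda>z. R (hfst z) (hsnd z))" "\<And>d. d \<in> I \<Longrightarrow> sat (NN I) (e(n := d)) s c \<longleftrightarrow> (\<forall>y\<in>I. R d y)"
    by (rule pi1_form[where s = s and n = n, OF a(3) e(2,1)]) (rule that; assumption)
  show ?thesis unfolding a(1) sat_ca_instance[OF a(4)]
  proof
    assume h: "\<forall>d\<in>Dm (NN I). sat (NN I) (e(n := d)) s b \<longleftrightarrow> sat (NN I) (e(n := d)) s c"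
    \<comment> \<open>The search may leave the cut. If the first witness that is found lies in
      \<open>I\<close>, it confirms the existential form; if it lies above, the bounded conjunct has
      confirmed the universal form on all of \<open>I\<close>. Both forms agree by hypothesis, so
      \<open>A\<close> has the right trace.\<close>
    define A where "A = {d. \<exists>y\<le>B. Q d y \<and> (\<forall>z\<le>y. R d z)}"
    have "dec (\<lambda>d. \<exists>y\<le>B. Q d y \<and> (\<forall>z\<le>y. R d z))" by (intro rr5 dec2[OF Q(1)] dec2[OF R(1)])
    then have "A \<in> SS" by (simp add: A_def dec_def)
    moreover have "d \<in> A \<longleftrightarrow> sat (NN I) (e(n := d)) s b" if d: "d \<in> I" for d
    proof
      assume "d \<in> A"
      then obtain y where y: "y \<le> B" "Q d y" "\<forall>z\<le>y. R d z" by (auto simp: A_def)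
      show "sat (NN I) (e(n := d)) s b"
      proof (cases "y \<in> I")
        case True then show ?thesis using Q(2)[OF d] y(2) by blast
      next
        case False
        then have "z \<le> y" if "z \<in> I" for z using Idown[OF that] linear by blast
        then have "\<forall>z\<in>I. R d z" using y(3) by blast
        then show ?thesis using R(2)[OF d] h d by (simp del: fun_upd_apply)
      qed
    next
      assume sb: "sat (NN I) (e(n := d)) s b"
      then obtain y where y: "y \<in> I" "Q d y" using Q(2)[OF d] by blast
      have "sat (NN I) (e(n := d)) s c" using h sb d by (simp del: fun_upd_apply)
      then have "\<forall>z\<le>y. R d z" using R(2)[OF d] Idown[OF y(1)] by blast
      then show "d \<in> A" using y I_less[OF y(1)] less_imp_le by (auto simp: A_def)
    qed
    ultimately show "\<exists>A\<in>Ss (NN I). \<forall>d\<in>Dm (NN I). d \<in> A \<longleftrightarrow> sat (NN I) (e(n := d)) s b" by auto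
  qed
qed

lemma NN_rt22: assumes "ine e" shows "sat (NN I) e s rt22Ax"
proof -
  have "\<exists>H\<in>SS. (\<forall>n\<in>I. \<exists>m\<in>I. n < m \<and> m \<in> H) \<and> ((\<forall>x\<in>I. \<forall>y\<in>I. x \<in> H \<and> y \<in> H \<and> x < y \<longrightarrow> hpair x y \<notin> P) \<or> (\<forall>x\<in>I. \<forall>y\<in>I. x \<in> H \<and> y \<in> H \<and> x < y \<longrightarrow> hpair x y \<in> P))"
    if P: "P \<in> SS" for P
  proof -
    have "dec (\<lambda>z. hpair (hfst z) (hsnd z) \<in> P)" using SS_dec[OF P] by simp
    from ramseyI[where \<chi> = "\<lambda>x y. hpair x y \<in> P", OF this]
    obtain F d where F: "hom (\<lambda>x y. hpair x y \<in> P) d F" "\<forall>b\<in>I. \<exists>x\<in>I. b < x \<and> hmem x F" by blast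
    have "dec (\<lambda>x. hmem x F)" by (intro rr5)
    then have "{x. hmem x F} \<in> SS" by (simp add: dec_def)
    then show ?thesis using F unfolding hom_iff by (intro bexI[of _ "{x. hmem x F}"]) (cases d; auto)+
  qed
  then show ?thesis using assms by (simp add: rt22Ax_def Let_def sat_pairInF cong: ball_cong bex_cong)
qed

text \<open>A level above the cut is reached by overspill, and the bits of one node there form the
  path. Initial segments of the tree are addressed through the canonical codes
  \<open>sq w j\<close>, which stay in the cut by \<open>cbI\<close>.\<close>

lemma wkl_I:
  assumes T: "T \<in> SS" and bin: "\<And>s i. s \<in> I \<Longrightarrow> s \<in> T \<Longrightarrow> i < hlen s \<Longrightarrow> hent s i < 2"
    and tree: "\<And>s t. s \<in> I \<Longrightarrow> t \<in> I \<Longrightarrow> s \<in> T \<Longrightarrow> (\<And>i. i < hlen t \<Longrightarrow> i < hlen s \<and> hent s i = hent t i) \<Longrightarrow> t \<in> T"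
    and inf: "\<And>k. k \<in> I \<Longrightarrow> \<exists>s\<in>I. s \<in> T \<and> hlen s = k"
  shows "\<exists>P\<in>SS. \<forall>k\<in>I. \<exists>s\<in>I. s \<in> T \<and> hlen s = k \<and> (\<forall>i<k. hent s i = 1 \<longleftrightarrow> i \<in> P)"
proof -
  define Psi where "Psi k \<longleftrightarrow> (\<exists>w<p2 k. \<forall>j\<le>k. sq w j \<in> T)" for k
  have dPsi: "dec Psi" unfolding Psi_def by (intro rr5 rec_sq dec_mem[OF T])
  have sqI: "sq w j \<in> I" if "j \<in> I" for w j using Idown[OF cbI[OF that] cb] .
  have PI: "Psi k" if k: "k \<in> I" for k
  proof -
    obtain s where s: "s \<in> I" "s \<in> T" "hlen s = k" using inf[OF k] by blast
    define w where "w = hset (\<lambda>i. hent s i = 1) k"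
    have dw: "dec (\<lambda>i. hent s i = 1)" by (intro rr5)
    have w: "w < p2 k" "\<And>i. hmem i w \<longleftrightarrow> i < k \<and> hent s i = 1" unfolding w_def using hset_spec[OF dw] by blast+
    have "sq w j \<in> T" if j: "j \<le> k" for j
    proof (rule tree[OF s(1) sqI[OF Idown[OF k j]] s(2)])
      fix i assume "i < hlen (sq w j)"
      then have ij: "i < j" using sq by simp
      then have ik: "i < k" using j by order
      have "hent s i < 1 + 1" using bin[OF s(1,2)] ik s(3) by simp
      then have "hent s i = 0 \<or> hent s i = 1" unfolding hm_basic(8) by (metis add_0 hm_basic(7,8))
      then show "i < hlen s \<and> hent s i = hent (sq w j) i" using sq[of w j] ij ik s(3) w(2) by auto
    qed
    then show ?thesis unfolding Psi_def using w(1) by blast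
  qed
  \<comment> \<open>If \<open>Psi\<close> held only within \<open>I\<close>, induction on this
    decidable predicate would give it everywhere, in particular at \<open>B\<close>.\<close>
  have "\<exists>K. K \<notin> I \<and> Psi K"
  proof (rule ccontr)
    assume n: "\<nexists>K. K \<notin> I \<and> Psi K"
    have "Psi k" for k
    proof (rule dec_induct[OF dPsi])
      show "Psi 0" using PI[OF I0] .
      show "Psi (k + 1)" if "Psi k" for k using n that PI Iadd[OF _ I1] by blast
    qed
    then show False using n BI by blast
  qed
  then obtain K w where K: "K \<notin> I" "\<forall>j\<le>K. sq w j \<in> T" unfolding Psi_def by blast
  have "dec (\<lambda>i. hmem i w)" by (intro rr5)
  then have "{i. hmem i w} \<in> SS" by (simp add: dec_def)
  moreover have "\<exists>s\<in>I. s \<in> T \<and> hlen s = k \<and> (\<forall>i<k. hent s i = 1 \<longleftrightarrow> i \<in> {i. hmem i w})" if k: "k \<in> I" for k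
  proof (rule bexI[OF _ sqI[OF k]])
    have "k \<le> K" using K(1) Idown[OF k] linear by blast
    then show "sq w k \<in> T \<and> hlen (sq w k) = k \<and> (\<forall>i<k. hent (sq w k) i = 1 \<longleftrightarrow> i \<in> {i. hmem i w})" using K(2) sq[of w k] by simp
  qed
  ultimately show ?thesis by blast
qed

lemma NN_wkl: assumes "ine e" shows "sat (NN I) e S wklAx"
proof -
  let ?ent = "\<lambda>s i u. i < hlen s \<and> hent s i = u"
  have main: "\<exists>P\<in>SS. \<forall>k\<in>I. \<exists>s\<in>I. s \<in> T \<and> hlen s = k \<and> (\<forall>i\<in>I. \<forall>u\<in>I. ?ent s i u \<longrightarrow> (u = 1 \<longleftrightarrow> i \<in> P))"
    if T: "T \<in> SS" and h: "\<forall>s\<in>I. s \<in> T \<longrightarrow> (\<forall>i\<in>I. \<forall>u\<in>I. ?ent s i u \<longrightarrow> u < 1 + 1)"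
      "\<forall>s\<in>I. \<forall>t\<in>I. s \<in> T \<and> (\<forall>i\<in>I. \<forall>u\<in>I. ?ent t i u \<longrightarrow> ?ent s i u) \<longrightarrow> t \<in> T"
      "\<forall>k\<in>I. \<exists>s\<in>I. s \<in> T \<and> hlen s = k" for T
  proof -
    have "\<exists>P\<in>SS. \<forall>k\<in>I. \<exists>s\<in>I. s \<in> T \<and> hlen s = k \<and> (\<forall>i<k. hent s i = 1 \<longleftrightarrow> i \<in> P)"
    proof (rule wkl_I[OF T])
      show "hent s i < 2" if s: "s \<in> I" "s \<in> T" "i < hlen s" for s i
      proof -
        have "hent s i < 1 + 1" using h(1) s hent_I[OF s(1)] hlen_I[OF s(1) less_imp_le[OF s(3)]] by blast
        then show ?thesis by simp
      qed
      show "t \<in> T" if s: "s \<in> I" "t \<in> I" "s \<in> T" "\<And>i. i < hlen t \<Longrightarrow> i < hlen s \<and> hent s i = hent t i" for s t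
        using h(2) s by blast
      show "\<exists>s\<in>I. s \<in> T \<and> hlen s = k" if "k \<in> I" for k using h(3) that by blast
    qed
    then obtain P where P: "P \<in> SS" "\<And>k. k \<in> I \<Longrightarrow> \<exists>s\<in>I. s \<in> T \<and> hlen s = k \<and> (\<forall>i<k. hent s i = 1 \<longleftrightarrow> i \<in> P)" by blast
    have "\<exists>s\<in>I. s \<in> T \<and> hlen s = k \<and> (\<forall>i\<in>I. \<forall>u\<in>I. ?ent s i u \<longrightarrow> (u = 1 \<longleftrightarrow> i \<in> P))" if "k \<in> I" for k
      using P(2)[OF that] by blast
    then show ?thesis using P(1) by blast
  qed
  define bin where "bin = FAll 2 (FAll 3 (FImp (entF 5 0 2 3) (FLess (TV 3) tw)))"
  define sub where "sub = FAll 2 (FAll 3 (FImp (entF 5 1 2 3) (entF 5 0 2 3)))"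
  define pth where "pth = FAll 2 (FAll 3 (FImp (entF 5 0 2 3) (FIff (FEq (TV 3) TO) (FMem (TV 2) 1))))"
  have b: "sat (NN I) f s' bin \<longleftrightarrow> (\<forall>i\<in>I. \<forall>u\<in>I. ?ent (f 0) i u \<longrightarrow> u < 1 + 1)" if "ine f" for f s'
    using that unfolding bin_def tw_def by (simp add: sat_entF cong: ball_cong)
  have t: "sat (NN I) f s' sub \<longleftrightarrow> (\<forall>i\<in>I. \<forall>u\<in>I. ?ent (f 1) i u \<longrightarrow> ?ent (f 0) i u)" if "ine f" for f s'
    using that unfolding sub_def by (simp add: sat_entF cong: ball_cong)
  have p: "sat (NN I) f s' pth \<longleftrightarrow> (\<forall>i\<in>I. \<forall>u\<in>I. ?ent (f 0) i u \<longrightarrow> (u = 1 \<longleftrightarrow> i \<in> s' 1))" if "ine f" for f s'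
    using that unfolding pth_def by (simp add: sat_entF cong: ball_cong)
  have w: "wklAx = FAllS 0 (FImp (FAnd (FAnd (FAll 0 (FImp (FMem (TV 0) 0) bin)) (FAll 0 (FAll 1 (FImp (FAnd (FMem (TV 0) 0) sub) (FMem (TV 1) 0)))))
      (FAll 4 (FEx 0 (FAnd (FMem (TV 0) 0) (lhF 5 0 4))))) (FExS 1 (FAll 4 (FEx 0 (FAnd (FMem (TV 0) 0) (FAnd (lhF 5 0 4) pth))))))"
    unfolding wklAx_def Let_def bin_def sub_def pth_def by (rule refl)
  show ?thesis unfolding w sat.simps(7) NN_simps
  proof
    fix T assume T: "T \<in> SS"
    let ?S = "S(0 := T)"
    have 1: "sat (NN I) e ?S (FAll 0 (FImp (FMem (TV 0) 0) bin)) \<longleftrightarrow> (\<forall>s\<in>I. s \<in> T \<longrightarrow> (\<forall>i\<in>I. \<forall>u\<in>I. ?ent s i u \<longrightarrow> u < 1 + 1))"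
      using assms by (simp add: b cong: ball_cong)
    have 2: "sat (NN I) e ?S (FAll 0 (FAll 1 (FImp (FAnd (FMem (TV 0) 0) sub) (FMem (TV 1) 0)))) \<longleftrightarrow>
        (\<forall>s\<in>I. \<forall>t\<in>I. s \<in> T \<and> (\<forall>i\<in>I. \<forall>u\<in>I. ?ent t i u \<longrightarrow> ?ent s i u) \<longrightarrow> t \<in> T)"
      using assms by (simp add: t cong: ball_cong)
    have 3: "sat (NN I) e ?S (FAll 4 (FEx 0 (FAnd (FMem (TV 0) 0) (lhF 5 0 4)))) \<longleftrightarrow> (\<forall>k\<in>I. \<exists>s\<in>I. s \<in> T \<and> hlen s = k)"
      using assms by (simp add: sat_lhF cong: ball_cong bex_cong)
    have 4: "sat (NN I) e ?S (FExS 1 (FAll 4 (FEx 0 (FAnd (FMem (TV 0) 0) (FAnd (lhF 5 0 4) pth))))) \<longleftrightarrow>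
        (\<exists>P\<in>SS. \<forall>k\<in>I. \<exists>s\<in>I. s \<in> T \<and> hlen s = k \<and> (\<forall>i\<in>I. \<forall>u\<in>I. ?ent s i u \<longrightarrow> (u = 1 \<longleftrightarrow> i \<in> P)))"
      using assms by (simp add: sat_lhF p cong: ball_cong bex_cong)
    show "sat (NN I) e ?S (FImp (FAnd (FAnd (FAll 0 (FImp (FMem (TV 0) 0) bin)) (FAll 0 (FAll 1 (FImp (FAnd (FMem (TV 0) 0) sub) (FMem (TV 1) 0)))))
      (FAll 4 (FEx 0 (FAnd (FMem (TV 0) 0) (lhF 5 0 4))))) (FExS 1 (FAll 4 (FEx 0 (FAnd (FMem (TV 0) 0) (FAnd (lhF 5 0 4) pth))))))"
      unfolding sat.simps(5) sat_derived(1) 1 2 3 4 using main[OF T] by blast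
  qed
qed

theorem NN_models: "models (NN I) WKL0_RT22"
  unfolding models_def
proof (intro ballI allI impI)
  fix a e s assume a: "a \<in> WKL0_RT22" and w: "wfe (NN I) e s"
  have e: "ine e" using w by (simp add: wfe_def ine_def)
  from a consider "a = rt22Ax" | "a = wklAx" | "a \<in> basicAx" | "a \<in> sigma1Ind" | "a \<in> delta1CA"
    unfolding WKL0_RT22_def WKL0_def RCA0_def by blast
  then show "sat (NN I) e s a"
    by cases (use NN_rt22[OF e] NN_wkl[OF e] NN_basic NN_ind[OF _ w] NN_ca[OF _ w] in blast)+
qed

end

section \<open>Standard numbers and overspill\<close>

lemma below_std: "x \<le> of_nat j \<Longrightarrow> \<exists>i. x = (of_nat i :: hm)"
proof (induction j)
  case 0 then show ?case using hm_nonneg[of x] by (intro exI[of _ 0]) (simp add: order_antisym)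
next
  case (Suc j)
  show ?case
  proof (cases "x \<le> of_nat j")
    case False
    then have "of_nat j + 1 \<le> x" by (simp add: hm_Suc_le not_le)
    then have "x = of_nat (Suc j)" using Suc.prems by (simp add: add.commute order_antisym)
    then show ?thesis by blast
  qed (rule Suc.IH)
qed

definition nst :: "hm \<Rightarrow> bool" where "nst c \<longleftrightarrow> (\<forall>j. of_nat j < c)"

lemma nst_ex: assumes "CE phi0 a0" shows "\<exists>c. nst c"
proof -
  have e: "ev MM e (num n) = of_nat n" for e n by (induction n) (simp_all add: add.commute)
  show ?thesis using MM_counter(2)[OF assms] by (simp add: nst_def e)
qed

lemma not_nst: "\<not> nst k \<Longrightarrow> \<exists>i. k = of_nat i"
  unfolding nst_def using below_std by (meson not_less)

text \<open>If no nonstandard number satisfied the existential statement, it would hold exactly at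
  the standard numbers, and \<open>\<Sigma>\<^sup>0\<^sub>1\<close> induction would carry it up to
  \<open>c\<close>.\<close>

lemma overspill:
  assumes n: "nst c" and d: "dec (\<lambda>z. Q (hfst z) (hsnd z))" and Q: "\<And>j. \<exists>y. Q (of_nat j) y"
  shows "\<exists>k y. nst k \<and> Q k y"
proof (rule ccontr)
  assume a: "\<not> ?thesis"
  have "\<exists>y. Q c y"
  proof (rule sig_induct[OF d])
    show "\<exists>y. Q 0 y" using Q[of 0] by simp
    fix x y assume "Q x y"
    then have "\<not> nst x" using a by blast
    then obtain i where "x = of_nat i" using not_nst by blast
    then have "x + 1 = of_nat (Suc i)" by (simp add: add.commute)
    then show "\<exists>y. Q (x + 1) y" using Q[of "Suc i"] by simp
  qed
  then show False using n a by blast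
qed

text \<open>An external condition, as \<open>j\<close> ranges over standard numbers only. A finite
  multiple of the exponent can be spent any number of times without destroying it.\<close>

definition Big :: "hm \<Rightarrow> hm \<Rightarrow> bool" where "Big M F \<longleftrightarrow> (\<forall>j. lg (M * of_nat j) F)"

lemma Big_nst: assumes "nst k" "lg (M * k) F" "Sp F" shows "Big M F"
  unfolding Big_def
proof
  fix j show "lg (M * of_nat j) F"
  proof (rule lg_le[OF assms(2)])
    show "M * of_nat j \<le> M * k" using assms(1) unfolding nst_def by (intro mult_left_mono less_imp_le hm_nonneg) blast
  qed (rule Sp_pos[OF assms(3)])
qed

text \<open>One step of the construction: \<open>x\<close> becomes a point of the cut,
  \<open>T\<close> is a block set aside below everything that follows, and \<open>F'\<close> is what
  is left to continue with. The last conjunct says that no value \<open>f s\<close> with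
  \<open>s \<le> x\<close> separates two points of \<open>F'\<close>; such a value lies either below
  or beyond all of them.\<close>

definition Stg :: "(hm \<Rightarrow> hm) \<Rightarrow> (hm \<Rightarrow> hm \<Rightarrow> bool) \<Rightarrow> hm \<Rightarrow> hm \<Rightarrow> hm \<Rightarrow> hm \<Rightarrow> hm \<Rightarrow> bool" where
  "Stg f \<chi> M F F' x T \<longleftrightarrow> hsub F' F \<and> hmem x F \<and> hsub T F \<and> lg M T \<and> (\<forall>u\<le>F. hmem u F' \<longrightarrow> x < u \<and> (\<forall>v\<le>F. hmem v T \<longrightarrow> v < u)) \<and>
     (hom \<chi> True F' \<or> hom \<chi> False F') \<and> (\<forall>s\<le>x. cst (\<lambda>u. u \<le> f s) F')"

text \<open>The two outer exponents produce heads \<open>x\<close> and \<open>x1\<close>. Behind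
  them one block becomes \<open>T\<close>, which needs exponent \<open>M\<close>, and another
  becomes \<open>A\<close>, on which one exponent pays for \<open>family\<close> and
  \<open>8 * n + 8\<close> for the colouring.\<close>

lemma stage_std:
  assumes f: "rec f" and \<chi>: "dec (\<lambda>z. \<chi> (hfst z) (hsnd z))" and Sp: "Sp F" and l: "lg (8 * n + 8 + 1 + M + 1 + 1) F"
  shows "\<exists>F' x T. lg n F' \<and> Stg f \<chi> M F F' x T"
proof -
  let ?m = "8 * n + 8 + 1 + M"
  obtain x where x: "hmem x F" "lgs (?m + 1) x (hi F (x + 1))" using l lg_Suc by blast
  have "1 \<le> x" using Sp_pos[OF Sp x(1)] hm_Suc_le[of 0 x] by simp
  then have "lg (?m + 1) (hi F (x + 1))" using lgs_le[OF x(2)] lgs_1 by blast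
  then obtain x1 where x1: "hmem x1 (hi F (x + 1))" "lgs ?m x1 (hi (hi F (x + 1)) (x1 + 1))" using lg_Suc by blast
  have "gg x < x1" by (rule Sp_gg[OF Sp x(1)]) (use x1(1) in \<open>auto simp: hm_Suc_le\<close>)
  \<comment> \<open>The second head is above 1, so two blocks are available behind it: one to be
    reserved and one to be thinned.\<close>
  then have "1 + 1 \<le> x1" using gg_a[of x] unfolding hz_trans using ofm_nn[of x] by simp
  then have "lgs ?m (1 + 1) (hi (hi F (x + 1)) (x1 + 1))" using lgs_le[OF x1(2)] by blast
  from lgs_split[OF this] obtain p where p: "lgs ?m 1 (lo (hi (hi F (x + 1)) (x1 + 1)) p)" "lgs ?m 1 (hi (hi (hi F (x + 1)) (x1 + 1)) p)" by blast
  define T where "T = lo (hi (hi F (x + 1)) (x1 + 1)) p"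
  define A where "A = hi (hi (hi F (x + 1)) (x1 + 1)) p"
  have T: "lg ?m T" "lg ?m A" using p unfolding T_def A_def lgs_1 by blast+
  have TF: "hsub T F" "hsub A F" unfolding T_def A_def by (auto intro!: hsubI)
  have TA: "v < u" if "hmem v T" "hmem u A" for u v using that unfolding T_def A_def by auto
  have xA: "x < u" if "hmem u A" for u using that unfolding A_def by (auto simp: hm_Suc_le)
  have SpT: "0 < i" if "hmem i T" for i by (rule Sp_pos[OF Sp hsubD[OF TF(1) that]])
  have SpA: "Sp A" by (rule Sp_sub[OF Sp TF(2)])
  have "M \<le> ?m" unfolding hz_trans using ofm_nn[of n] by simp
  then have TM: "lg M T" using lg_le[OF T(1)] SpT by blast
  have "8 * n + 8 + 1 \<le> ?m" unfolding hz_trans using ofm_nn[of M] by simp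
  then have A1: "lg (8 * n + 8 + 1) A" using lg_le[OF T(2)] Sp_pos[OF SpA] by blast
  \<comment> \<open>There are \<open>x + 1\<close> predicates, one for each
    \<open>s \<le> x\<close>; every point past \<open>x\<close> exceeds the multiplicity that
    \<open>family\<close> needs for them.\<close>
  have "p2 (2 * (x + 1)) \<le> u" if "hmem u A" for u
    using Sp_gg[OF Sp x(1) hsubD[OF TF(2) that] xA[OF that]] gg_b[of x] by order
  with A1 obtain z where z: "lgs (8 * n + 8) (p2 (2 * (x + 1))) (hi A (z + 1))" using lg_lgs by blast
  have hA: "hsub (hi A (z + 1)) A" by simp
  have d: "dec (\<lambda>z. hsnd z \<le> f (hfst z))" by (intro rr5 rec_comp[OF f])
  from family[OF d Sp_sub[OF SpA hA] z]
  obtain Y where Y: "hsub Y (hi A (z + 1))" "lg (8 * n + 8) Y" "\<forall>s<x + 1. cst (\<lambda>u. u \<le> f s) Y" by blast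
  have YA: "hsub Y A" by (rule hsub_trans[OF Y(1) hA])
  obtain d F' where F': "hsub F' Y" "hom \<chi> d F'" "lg n F'" using ramsey_large[OF \<chi> Sp_sub[OF SpA YA] Y(2)] by blast
  have FA: "hsub F' A" by (rule hsub_trans[OF F'(1) YA])
  have "Stg f \<chi> M F F' x T" unfolding Stg_def
  proof (intro conjI allI impI)
    show "hsub F' F" by (rule hsub_trans[OF FA TF(2)])
    show "hmem x F" "hsub T F" "lg M T" by fact+
    show "x < u" if "hmem u F'" for u by (rule xA[OF hsubD[OF FA that]])
    show "v < u" if "hmem u F'" "hmem v T" for u v by (rule TA[OF that(2) hsubD[OF FA that(1)]])
    show "hom \<chi> True F' \<or> hom \<chi> False F'" using F'(2) by (cases d) auto
    show "cst (\<lambda>u. u \<le> f s) F'" if "s \<le> x" for s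
      by (rule cst_sub[OF _ F'(1)]) (use Y(3) that in \<open>simp add: hm_less_Suc\<close>)
  qed
  then show ?thesis using F'(3) by blast
qed

lemma dec_Stg:
  assumes f: "rec f" and \<chi>: "dec (\<lambda>z. \<chi> (hfst z) (hsnd z))" and r: "rec a" "rec b" "rec c"
  shows "dec (\<lambda>z. Stg f \<chi> M F (a z) (b z) (c z))"
proof -
  have d: "dec (\<lambda>z. hsnd z \<le> f (hfst z))" by (intro rr5 rec_comp[OF f])
  show ?thesis unfolding Stg_def by (intro rr5 dec_hom[OF \<chi>] r rec_comp[OF r(1)] rec_comp[OF r(2)] rec_comp[OF r(3)] dec_cst[OF d])
qed

lemma stage:
  assumes n: "nst c" and f: "rec f" and \<chi>: "dec (\<lambda>z. \<chi> (hfst z) (hsnd z))" and Sp: "Sp F" and B: "Big M F" and M: "1 \<le> M"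
  shows "\<exists>F' x T. Big M F' \<and> Stg f \<chi> M F F' x T"
proof -
  let ?Q = "\<lambda>k w. lg (M * k) (hfst w) \<and> Stg f \<chi> M F (hfst w) (hfst (hsnd w)) (hsnd (hsnd w))"
  have "\<exists>k w. nst k \<and> ?Q k w"
  proof (rule overspill[OF n])
    show "dec (\<lambda>z. ?Q (hfst z) (hsnd z))" by (intro rr5 dec_Stg[OF f \<chi>])
    fix j :: nat
    let ?n = "M * of_nat j"
    \<comment> \<open>The additive costs \<open>8 + 1 + M + 1 + 1\<close> are at most
      \<open>12 * M\<close> because \<open>1 \<le> M\<close>, so a standard multiple of
      \<open>M\<close> suffices.\<close>
    have "8 * ?n + 8 + 1 + M + 1 + 1 \<le> M * of_nat (8 * j + 12)"
      using M unfolding hz_trans by (simp add: algebra_simps)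
    then have "lg (8 * ?n + 8 + 1 + M + 1 + 1) F" using lg_le B Sp_pos[OF Sp] unfolding Big_def by blast
    from stage_std[OF f \<chi> Sp this] obtain F' x T where "lg ?n F' \<and> Stg f \<chi> M F F' x T" by blast
    then show "\<exists>w. ?Q (of_nat j) w" by (intro exI[of _ "hpair F' (hpair x T)"]) simp
  qed
  then obtain k w where k: "nst k" "?Q k w" by blast
  have "Sp (hfst w)" by (rule Sp_sub[OF Sp]) (use k(2) in \<open>simp add: Stg_def\<close>)
  then show ?thesis using Big_nst[OF k(1)] k(2) by blast
qed

section \<open>The generic initial segment\<close>

lemma StgD: assumes "Stg f \<chi> M F F' x T"
  shows "hsub F' F" "hmem x F" "hsub T F" "lg M T" "hmem u F' \<Longrightarrow> x < u" "hmem u F' \<Longrightarrow> hmem v T \<Longrightarrow> v < u"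
    "\<exists>d. hom \<chi> d F'" "s \<le> x \<Longrightarrow> cst (\<lambda>u. u \<le> f s) F'"
proof -
  show 1: "hsub F' F" "hmem x F" "hsub T F" "lg M T" and "\<exists>d. hom \<chi> d F'" and "s \<le> x \<Longrightarrow> cst (\<lambda>u. u \<le> f s) F'"
    using assms unfolding Stg_def by blast+
  have le: "u \<le> F" if "hmem u F'" for u using hmem_less[OF hsubD[OF 1(1) that]] by simp
  have le': "u \<le> F" if "hmem u T" for u using hmem_less[OF hsubD[OF 1(3) that]] by simp
  show "hmem u F' \<Longrightarrow> x < u" "hmem u F' \<Longrightarrow> hmem v T \<Longrightarrow> v < u"
    using assms le le' unfolding Stg_def by blast+
qed

text \<open>An enumeration in which every element recurs infinitely often. A function has to be
  treated again after the points of the cut have passed any given bound.\<close>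

definition renum :: "'a set \<Rightarrow> nat \<Rightarrow> 'a" where "renum A i = from_nat_into A (fst (prod_decode i))"

lemma renum_in: "x \<in> A \<Longrightarrow> renum A i \<in> A" unfolding renum_def by (rule from_nat_into) auto

lemma renum_hit: assumes "countable A" "x \<in> A" shows "\<exists>k\<ge>i. renum A k = x"
proof -
  have "renum A (prod_encode (to_nat_on A x, i)) = x" using assms by (simp add: renum_def)
  then show ?thesis using le_prod_encode_2 by blast
qed

lemma countable_rec: assumes "countable SS" shows "countable {f. rec f}"
proof (rule countable_image_inj_on)
  let ?h = "\<lambda>f. {z. hsnd z = f (hfst z)}"
  show "countable (?h ` {f. rec f})" by (rule countable_subset[OF _ assms]) (auto intro: graph_dec)
  show "inj_on ?h {f. rec f}"
  proof (rule inj_onI, rule ext)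
    fix f g x assume "?h f = ?h g"
    then have "hpair x (f x) \<in> ?h f \<longleftrightarrow> hpair x (f x) \<in> ?h g" by simp
    then show "f x = g x" by simp
  qed
qed

lemma countable_dec2: assumes "countable SS" shows "countable {\<chi>. dec (\<lambda>z. \<chi> (hfst z) (hsnd z))}"
proof (rule countable_image_inj_on)
  let ?h = "\<lambda>\<chi>. {z. \<chi> (hfst z) (hsnd z)}"
  show "countable (?h ` {\<chi>. dec (\<lambda>z. \<chi> (hfst z) (hsnd z))})" by (rule countable_subset[OF _ assms]) (auto intro: dec_SS)
  show "inj_on ?h {\<chi>. dec (\<lambda>z. \<chi> (hfst z) (hsnd z))}"
  proof (rule inj_onI, intro ext)
    fix f g :: "hm \<Rightarrow> hm \<Rightarrow> bool" and x y assume "?h f = ?h g"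
    then have "hpair x y \<in> ?h f \<longleftrightarrow> hpair x y \<in> ?h g" by simp
    then show "f x y = g x y" by simp
  qed
qed

text \<open>The points \<open>a i\<close> chosen at the stages are cofinal in \<open>I\<close>,
  while every set \<open>F i\<close> still has all later points as members. So a property imposed on
  \<open>F (Suc k)\<close> holds for cofinally many elements of the cut. The code \<open>F0\<close>
  exceeds its members and hence lies outside.\<close>

lemma generic_cut:
  assumes n: "nst c" and cS: "countable SS" and M: "1 \<le> M" and Sp: "Sp F0" and B: "Big M F0"
    and H: "\<And>x y. x \<le> y \<Longrightarrow> H x \<le> H y" "\<And>x y. hmem x F0 \<Longrightarrow> hmem y F0 \<Longrightarrow> x < y \<Longrightarrow> H x < y"
    and Hc: "\<And>x. cb x \<le> H x" "\<And>x. x + x \<le> H x" "\<And>x. x * x \<le> H x"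
    and P: "\<And>x. hmem x F0 \<Longrightarrow> P \<le> x"
  obtains I where "gcut I F0" "P \<in> I" "\<And>x. x \<in> I \<Longrightarrow> H x \<in> I"
    "\<And>g b. rec g \<Longrightarrow> (\<And>x. x \<in> I \<Longrightarrow> g x \<in> I) \<Longrightarrow> b \<in> I \<Longrightarrow>
       \<exists>T y. lg M T \<and> y \<in> I \<and> (\<forall>z. hmem z T \<longrightarrow> b < z \<and> z \<le> y) \<and> (\<forall>x y. hmem x T \<longrightarrow> hmem y T \<longrightarrow> x < y \<longrightarrow> g x < y)"
proof -
  let ?R = "{f. rec f}" and ?D = "{\<chi>. dec (\<lambda>z. \<chi> (hfst z) (hsnd z))}"
  have 1: "(\<lambda>x. x) \<in> ?R" and 2: "(\<lambda>x y. True) \<in> ?D" by (rule CollectI, rule rec_id, rule CollectI, rule dec_const)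
  define ff where "ff = renum ?R"
  define cc where "cc = renum ?D"
  have ff1: "rec (ff i)" for i unfolding ff_def by (rule CollectD[OF renum_in[OF 1]])
  have ff2: "\<exists>k\<ge>i. ff k = f" if "rec f" for f i unfolding ff_def by (rule renum_hit[OF countable_rec[OF cS]], rule CollectI, rule that)
  have cc1: "dec (\<lambda>z. cc i (hfst z) (hsnd z))" for i unfolding cc_def by (rule CollectD[OF renum_in[OF 2]])
  have cc2: "\<exists>k\<ge>i. cc k = \<chi>" if "dec (\<lambda>z. \<chi> (hfst z) (hsnd z))" for \<chi> i
    unfolding cc_def by (rule renum_hit[OF countable_dec2[OF cS]], rule CollectI, rule that)
  have "\<exists>F. \<forall>i. (Sp (F i) \<and> Big M (F i) \<and> (i = 0 \<longrightarrow> F i = F0)) \<and> (\<exists>x T. Stg (ff i) (cc i) M (F i) (F (Suc i)) x T)"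
  proof (rule dependent_nat_choice)
    show "\<exists>F. Sp F \<and> Big M F \<and> ((0::nat) = 0 \<longrightarrow> F = F0)" using Sp B by blast
    fix F and i :: nat assume a: "Sp F \<and> Big M F \<and> (i = 0 \<longrightarrow> F = F0)"
    then have "Sp F" "Big M F" by blast+
    from stage[OF n ff1[of i] cc1[of i] this M] obtain F' x T where F': "Big M F'" "Stg (ff i) (cc i) M F F' x T" by blast
    have "Sp F'" by (rule Sp_sub[OF \<open>Sp F\<close> StgD(1)[OF F'(2)]])
    then show "\<exists>F'. (Sp F' \<and> Big M F' \<and> (Suc i = 0 \<longrightarrow> F' = F0)) \<and> (\<exists>x T. Stg (ff i) (cc i) M F F' x T)" using F' by blast
  qed
  then obtain F where F: "F 0 = F0" "\<And>i. \<exists>x T. Stg (ff i) (cc i) M (F i) (F (Suc i)) x T" by blast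
  have "\<forall>i. \<exists>p. Stg (ff i) (cc i) M (F i) (F (Suc i)) (fst p) (snd p)" using F(2) by simp
  from choice[OF this] have "\<exists>a T. \<forall>i. Stg (ff i) (cc i) M (F i) (F (Suc i)) (a i) (T i)" by (elim exE) (intro exI, assumption)
  then obtain a T where St: "\<And>i. Stg (ff i) (cc i) M (F i) (F (Suc i)) (a i) (T i)" by blast
  have sub: "hsub (F j) (F i)" if "i \<le> j" for i j
    using that by (induction rule: nat_induct_at_least) (auto intro: hsub_trans StgD(1)[OF St])
  have sub0: "hsub (F i) F0" for i using sub[of 0 i] F(1) by simp
  have aF: "hmem (a j) (F i)" if "i \<le> j" for i j by (rule hsubD[OF sub[OF that] StgD(2)[OF St]])
  have aF0: "hmem (a j) F0" for j using aF[of 0 j] F(1) by simp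
  have alt: "a i < a j" if "i < j" for i j by (rule StgD(5)[OF St]) (use that in \<open>auto intro: aF\<close>)
  have ale: "a i \<le> a j" if "i \<le> j" for i j using alt[of i j] that by (cases "i = j") auto
  define I where "I = {x. \<exists>i. x \<le> a i}"
  have aI: "a i \<in> I" for i unfolding I_def by blast
  have down: "y \<in> I" if "x \<in> I" "y \<le> x" for x y using that unfolding I_def by (auto intro: order_trans)
  have HI: "H x \<in> I" if "x \<in> I" for x
  proof -
    obtain i where "x \<le> a i" using \<open>x \<in> I\<close> I_def by blast
    then have "H x \<le> a (Suc i)" using H(1)[of x "a i"] H(2)[OF aF0 aF0 alt[of i "Suc i"]] by simp
    then show ?thesis unfolding I_def by blast
  qed
  have mx: "\<exists>z\<in>I. x \<le> z \<and> y \<le> z" if "x \<in> I" "y \<in> I" for x y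
    using that linear[of x y] order_refl by blast
  interpret C: cut I
  proof
    show "1 \<in> I" using Sp_pos[OF Sp aF0[of 0]] hm_Suc_le[of 0 "a 0"] unfolding I_def by auto
    show "y \<in> I" if "x \<in> I" "y \<le> x" for x y by (rule down[OF that])
    show "x + y \<in> I" if xy: "x \<in> I" "y \<in> I" for x y
    proof -
      obtain z where z: "z \<in> I" "x \<le> z" "y \<le> z" using mx[OF xy] by blast
      have "x + y \<le> H z" using add_mono[OF z(2,3)] Hc(2)[of z] by order
      then show ?thesis by (rule down[OF HI[OF z(1)]])
    qed
    show "x * y \<in> I" if xy: "x \<in> I" "y \<in> I" for x y
    proof -
      obtain z where z: "z \<in> I" "x \<le> z" "y \<le> z" using mx[OF xy] by blast
      have "x * y \<le> H z" using mult_mono[OF z(2,3) hm_nonneg hm_nonneg] Hc(3)[of z] by order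
      then show ?thesis by (rule down[OF HI[OF z(1)]])
    qed
  qed
  have "gcut I F0"
  proof
    show "F0 \<notin> I"
    proof
      assume "F0 \<in> I"
      then obtain i where "F0 \<le> a i" using I_def by blast
      then show False using hmem_less[OF aF0[of i]] by simp
    qed
    show "cb j \<in> I" if "j \<in> I" for j by (rule down[OF HI[OF that] Hc(1)])
    show "\<exists>c\<in>I. \<forall>x\<le>b. f x \<in> I \<longrightarrow> f x \<le> c" if f: "rec f" and b: "b \<in> I" for f b
    proof -
      obtain i where i: "b \<le> a i" using b I_def by blast
      obtain k where k: "i \<le> k" "ff k = f" using ff2[OF f] by blast
      show ?thesis
      proof (intro bexI[OF _ aI[of "Suc k"]] allI impI)
        fix x assume x: "x \<le> b" "f x \<in> I"
        then obtain j where j: "f x \<le> a j" using I_def by blast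
        have "x \<le> a k" using x(1) i ale[OF k(1)] by order
        then have "cst (\<lambda>u. u \<le> f x) (F (Suc k))" using StgD(8)[OF St[of k]] k(2) by simp
        \<comment> \<open>The value \<open>f x\<close> lies in \<open>I\<close>, hence below some
          later point of \<open>F (Suc k)\<close>. As it separates no two points of that set, it is
          already below \<open>a (Suc k)\<close>.\<close>
        then have "a (Suc k) \<le> f x \<longleftrightarrow> a (Suc (j + k)) \<le> f x" unfolding cst_iff using aF by simp
        moreover have "a j < a (Suc (j + k))" by (rule alt) simp
        ultimately show "f x \<le> a (Suc k)" using j by auto
      qed
    qed
    show "\<exists>F d. hom \<chi> d F \<and> (\<forall>b\<in>I. \<exists>x\<in>I. b < x \<and> hmem x F)" if \<chi>: "dec (\<lambda>z. \<chi> (hfst z) (hsnd z))" for \<chi>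
    proof -
      obtain k where k: "cc k = \<chi>" using cc2[OF \<chi>, of 0] by blast
      obtain d where d: "hom \<chi> d (F (Suc k))" using StgD(7)[OF St[of k]] k by blast
      have "\<exists>x\<in>I. b < x \<and> hmem x (F (Suc k))" if b: "b \<in> I" for b
      proof -
        obtain i where "b \<le> a i" using b I_def by blast
        then have "b < a (Suc (i + k))" using alt[of i "Suc (i + k)"] by simp
        then show ?thesis using aI aF[of "Suc k" "Suc (i + k)"] by auto
      qed
      then show ?thesis using d by blast
    qed
  qed
  moreover have "P \<in> I" using P[OF aF0[of 0]] unfolding I_def by blast
  moreover have "\<exists>T y. lg M T \<and> y \<in> I \<and> (\<forall>z. hmem z T \<longrightarrow> b < z \<and> z \<le> y) \<and> (\<forall>x y. hmem x T \<longrightarrow> hmem y T \<longrightarrow> x < y \<longrightarrow> g x < y)"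
    if g: "rec g" and gI: "\<And>x. x \<in> I \<Longrightarrow> g x \<in> I" and b: "b \<in> I" for g b
  proof -
    \<comment> \<open>Sparseness for \<open>g\<close> is itself a colouring of pairs. Its
      homogeneous colour must be the positive one, as the value of \<open>g\<close> at a point of
      the cut stays in the cut and is exceeded by later points.\<close>
    have "dec (\<lambda>z. g (hfst z) < hsnd z)" by (intro rr5 rec_comp[OF g])
    from cc2[of "\<lambda>x y. g x < y", OF this, of 0] obtain k where k: "cc k = (\<lambda>x y. g x < y)" by blast
    obtain d where d: "hom (\<lambda>x y. g x < y) d (F (Suc k))" using StgD(7)[OF St[of k]] k by auto
    obtain j where j: "g (a (Suc k)) \<le> a j" using gI[OF aI] I_def by blast
    have "g (a (Suc k)) < a (Suc (Suc (j + k)))" using j alt[of j "Suc (Suc (j + k))"] by simp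
    moreover have "a (Suc k) < a (Suc (Suc (j + k)))" by (rule alt) simp
    ultimately have d1: "d" using d aF[of "Suc k" "Suc k"] aF[of "Suc k" "Suc (Suc (j + k))"] unfolding hom_iff by auto
    obtain i where i: "b \<le> a i" using b I_def by blast
    \<comment> \<open>Past stage \<open>i\<close> the block lies beyond \<open>b\<close>, past stage
      \<open>k\<close> it lies inside the set that is homogeneous for \<open>g\<close>.\<close>
    let ?j = "Suc (i + k)"
    have Tk: "hsub (T ?j) (F (Suc k))" by (rule hsub_trans[OF StgD(3)[OF St] sub]) simp
    have Ti: "hsub (T ?j) (F (Suc i))" by (rule hsub_trans[OF StgD(3)[OF St] sub]) simp
    have "b < z \<and> z \<le> a (Suc ?j)" if z: "hmem z (T ?j)" for z
    proof -
      have "a i < z" by (rule StgD(5)[OF St hsubD[OF Ti z]])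
      moreover have "z < a (Suc ?j)" by (rule StgD(6)[OF St StgD(2)[OF St] z])
      ultimately show ?thesis using i by auto
    qed
    moreover have "g x < y" if "hmem x (T ?j)" "hmem y (T ?j)" "x < y" for x y
      using d d1 that hsubD[OF Tk] unfolding hom_iff by blast
    ultimately show ?thesis using StgD(4)[OF St[of ?j]] aI[of "Suc ?j"] by blast
  qed
  ultimately show ?thesis using HI by (intro that) blast+
qed

section \<open>Counterexamples to the matrix survive in initial segments\<close>

lemma sigma2_cases:
  assumes "sigma 2 a"
  obtains "bounded a" | x b where "a = FEx x b" "bounded b" | x z b where "a = FEx x (FAll z b)" "bounded b"
proof -
  have "sigma (Suc (Suc 0)) a" using assms by (simp add: numeral_2_eq_2)
  then show ?thesis using that by auto
qed

text \<open>The Skolem function of the \<open>\<forall>\<exists>\<close> negation is the only closure condition on the segment.\<close>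
lemma neg_transfer:
  assumes "allSigma2 phi" "\<And>X. s X \<in> SS" "\<And>n. e n \<le> P" "\<not> sat MM e s phi"
  shows "\<exists>P H. rec H \<and> (\<forall>I. cut I \<longrightarrow> P \<in> I \<longrightarrow> (\<forall>x\<in>I. H x \<in> I) \<longrightarrow> \<not> sat (NN I) e s phi)"
  using assms
proof (induction arbitrary: e s P rule: allSigma2.induct)
  case (1 a)
  have ine: "cut.ine I e" if "cut I" "P \<in> I" for I
    unfolding cut.ine_def[OF that(1)] using cut.Idown[OF that] 1(3) by blast
  from 1(1) show ?case
  proof (cases rule: sigma2_cases)
    case b: 1
    show ?thesis using cut.absolute[OF _ b ine] 1(4) rec_id by blast
  next
    case b: (2 x b)
    have "\<not> sat (NN I) e s a" if I: "cut I" "P \<in> I" for I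
      using 1(4) cut.absolute[OF I(1) b(2) cut.ine_upd[OF I(1) ine[OF I]]] by (auto simp: b(1))
    then show ?thesis using rec_id by blast
  next
    case b: (3 x z b)
    let ?Q = "\<lambda>d y. \<not> sat MM (e(x := d, z := y)) s b"
    have ex: "\<exists>y. ?Q d y" for d using 1(4) by (simp add: b(1))
    have dc: "dec (\<lambda>w. ?Q (hfst w) (hsnd w))" by (intro dec_not dec2_bounded[OF b(2)] 1(2))
    define H where "H d = (LEAST y. ?Q d y)" for d
    have H: "?Q d (H d)" for d unfolding H_def using dec_Least(1)[OF dec_section[OF dc]] ex by blast
    have rH: "rec H" unfolding H_def by (rule rec_Least[where Q = ?Q, OF dc ex])
    have "\<not> sat (NN I) e s a" if I: "cut I" "P \<in> I" and HI: "\<forall>x\<in>I. H x \<in> I" for I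
    proof -
      have "\<not> sat (NN I) (e(x := d, z := H d)) s b" if d: "d \<in> I" for d
        using H[of d] cut.absolute[OF I(1) b(2) cut.ine_upd[OF I(1) cut.ine_upd[OF I(1) ine[OF I] d]]] HI d by blast
      then show ?thesis using HI by (auto simp: b(1) simp del: fun_upd_apply)
    qed
    then show ?thesis using rH by blast
  qed
next
  case (2 a x)
  then obtain d where d: "\<not> sat MM (e(x := d)) s a" by auto
  have "(e(x := d)) n \<le> P + d" for n using 2(4)[of n] hm_nonneg[of d] hm_nonneg[of P] by (auto intro: add_increasing add_increasing2)
  from 2(2)[OF 2(3) this d] obtain P' H where h: "rec H"
    "\<And>I. cut I \<Longrightarrow> P' \<in> I \<Longrightarrow> (\<forall>x\<in>I. H x \<in> I) \<Longrightarrow> \<not> sat (NN I) (e(x := d)) s a" by blast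
  \<comment> \<open>The counterexample \<open>d\<close> itself has to belong to the segment, so it
    is added to the parameter bound.\<close>
  have "\<not> sat (NN I) e s (FAll x a)" if I: "cut I" "P' + d \<in> I" "\<forall>x\<in>I. H x \<in> I" for I
  proof -
    have "P' \<in> I" "d \<in> I" using cut.Idown[OF I(1,2)] hm_nonneg by (simp_all add: add_increasing)
    then show ?thesis using h(2)[OF I(1) _ I(3)] by (auto simp del: fun_upd_apply)
  qed
  then show ?case using h(1) by blast
next
  case (3 a X)
  then obtain A where A: "A \<in> SS" "\<not> sat MM e (s(X := A)) a" by auto
  have "(s(X := A)) Y \<in> SS" for Y using A(1) 3(3) by simp
  from 3(2)[OF this 3(4) A(2)] obtain P' H where h: "rec H"
    "\<And>I. cut I \<Longrightarrow> P' \<in> I \<Longrightarrow> (\<forall>x\<in>I. H x \<in> I) \<Longrightarrow> \<not> sat (NN I) e (s(X := A)) a" by blast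
  have "\<not> sat (NN I) e s (FAllS X a)" if I: "cut I" "P' \<in> I" "\<forall>x\<in>I. H x \<in> I" for I
    using h(2)[OF I] A(1) by (auto simp del: fun_upd_apply)
  then show ?case using h(1) by blast
qed

section \<open>Conservation\<close>

text \<open>Monotonicity lets closure at the cofinal points of the cut give closure at all its
  elements.\<close>

lemma majorant_ex:
  assumes h: "rec h"
  obtains H where "rec H" "\<And>x y. x \<le> y \<Longrightarrow> H x \<le> H y" "\<And>x. h x \<le> H x"
proof -
  let ?Q = "\<lambda>x c. \<forall>y\<le>x. h y \<le> c"
  have d: "dec (\<lambda>z. ?Q (hfst z) (hsnd z))" by (intro rr5 rec_comp[OF h])
  have ex: "\<exists>c. ?Q x c" for x
  proof -
    obtain c where "\<And>i. i < x + 1 \<Longrightarrow> h i < c" using bound_ex[OF h, of "x + 1"] by blast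
    then show ?thesis by (meson hm_less_Suc less_imp_le)
  qed
  define H where "H x = (LEAST c. ?Q x c)" for x
  have r: "rec H" unfolding H_def by (rule rec_Least[where Q = ?Q, OF d ex])
  have H: "?Q x (H x)" for x
  proof -
    obtain c where "?Q x c" using ex by blast
    then show ?thesis unfolding H_def by (rule dec_Least(1)[OF dec_section[OF d]])
  qed
  have "H x \<le> H y" if "x \<le> y" for x y
    unfolding H_def[of x] by (rule dec_Least(2)[OF dec_section[OF d]]) (use H[of y] that in \<open>auto intro: order_trans\<close>)
  then show ?thesis using that r H by blast
qed

lemma sparse_set:
  assumes H: "rec H" "\<And>x y. x \<le> y \<Longrightarrow> H x \<le> H y"
  obtains X where "unb X" "\<And>x. x \<in> X \<Longrightarrow> P < x" "\<And>x y. x \<in> X \<Longrightarrow> y \<in> X \<Longrightarrow> x < y \<Longrightarrow> gg x < y \<and> H x < y"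
proof -
  define xs where "xs = prc (\<lambda>_. P + 1) (\<lambda>z. gg (hsnd (hsnd z)) + H (hsnd (hsnd z)) + 1) 0"
  have aux: "rec (\<lambda>_. P + 1)" "rec (\<lambda>z. gg (hsnd (hsnd z)) + H (hsnd (hsnd z)) + 1)" by (intro rr5 rec_gg rec_comp[OF H(1)])+
  have 0: "xs 0 = P + 1" and S: "xs (k + 1) = gg (xs k) + H (xs k) + 1" for k unfolding xs_def prc_0[OF aux] prc_Suc[OF aux] by simp_all
  have r: "rec xs" unfolding xs_def using rec_prc[OF aux rec_const rec_id] by simp
  have lt: "gg (xs k) < xs (k + 1) \<and> H (xs k) < xs (k + 1)" for k
    unfolding S hz_trans using ofm_nn[of "gg (xs k)"] ofm_nn[of "H (xs k)"] by simp
  have xg: "x < gg x" for x using gg_a[of x] unfolding hz_trans using ofm_nn[of x] by simp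
  have le: "xs k \<le> xs (k + 1)" for k using conjunct1[OF lt[of k]] xg[of "xs k"] by order
  have mono: "xs j \<le> xs k" if "j \<le> k" for j k by (rule mono_seq[OF r le that])
  have ge: "k \<le> xs k" for k
  proof (rule dec_induct[of "\<lambda>k. k \<le> xs k"])
    show "dec (\<lambda>k. k \<le> xs k)" by (intro rr5 rec_comp[OF r])
    fix k assume "k \<le> xs k" then show "k + 1 \<le> xs (k + 1)" using conjunct1[OF lt[of k]] xg[of "xs k"] unfolding hm_Suc_le by order
  qed simp
  define X where "X = {x. \<exists>k\<le>x. x = xs k}"
  have "dec (\<lambda>x. \<exists>k\<le>x. x = xs k)" by (intro rr5 rec_comp[OF r])
  then have XS: "X \<in> SS" unfolding X_def by (rule dec_SS)
  have xX: "xs k \<in> X" for k unfolding X_def using ge by blast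
  have "\<exists>x\<in>X. b < x" for b
  proof
    show "b < xs (b + 1)" using ge[of "b + 1"] by (simp add: hm_Suc_le)
  qed (rule xX)
  then have "unb X" using XS by (simp add: unb_def)
  moreover have "P < x" if "x \<in> X" for x
  proof -
    obtain k where "x = xs k" using \<open>x \<in> X\<close> X_def by blast
    then show ?thesis using mono[of 0 k] 0 by (simp add: hm_Suc_le hm_nonneg)
  qed
  moreover have "gg x < y \<and> H x < y" if xy: "x \<in> X" "y \<in> X" "x < y" for x y
  proof -
    obtain j k where jk: "x = xs j" "y = xs k" using xy(1,2) X_def by blast
    have "\<not> k \<le> j" using mono[of k j] xy(3) jk by auto
    then have "xs (j + 1) \<le> xs k" by (intro mono) (simp add: hm_Suc_le)
    then show ?thesis using lt[of j] jk by auto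
  qed
  ultimately show ?thesis by (rule that)
qed

text \<open>The induction on \<open>j\<close> takes place outside of the model, which is why only
  standard multiples are reached.\<close>

lemma LL_mult: assumes "LL M" shows "LL (M * of_nat j)"
proof (induction j)
  case 0
  have "\<exists>Z. (\<forall>i. hmem i Z \<longrightarrow> i \<in> X) \<and> lg 0 Z" if X: "unb X" for X
  proof -
    obtain x where "x \<in> X" using X unfolding unb_def by blast
    then show ?thesis by (intro exI[of _ "p2 x"]) (auto simp: lg_0 mem_sng)
  qed
  then show ?case by (simp add: LL_def)
next
  case (Suc j) then show ?case using LL_add[OF Suc assms] by (simp add: algebra_simps)
qed

text \<open>For one fixed \<open>X\<close> the existence of a large finite subset is an existential
  statement about a decidable relation, so overspill extends the standard multiples of
  \<open>M\<close> to a nonstandard one.\<close>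

lemma Big_ex:
  assumes n: "nst c" and L: "LL M" and X: "unb X" "\<And>x. x \<in> X \<Longrightarrow> 0 < x" "\<And>x y. x \<in> X \<Longrightarrow> y \<in> X \<Longrightarrow> x < y \<Longrightarrow> gg x < y"
  shows "\<exists>F. Sp F \<and> Big M F \<and> (\<forall>i. hmem i F \<longrightarrow> i \<in> X)"
proof -
  have XS: "X \<in> SS" using X(1) unfolding unb_def by blast
  let ?Q = "\<lambda>k F. lg (M * k) F \<and> (\<forall>i<F. hmem i F \<longrightarrow> i \<in> X)"
  have "\<exists>k F. nst k \<and> ?Q k F"
  proof (rule overspill[OF n])
    show "dec (\<lambda>z. ?Q (hfst z) (hsnd z))" by (intro rr5 dec_mem[OF XS])
    show "\<exists>F. ?Q (of_nat j) F" for j using LL_mult[OF L, of j] X(1) unfolding LL_def by blast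
  qed
  then obtain k F where F: "nst k" "lg (M * k) F" "\<And>i. hmem i F \<Longrightarrow> i \<in> X" using hmem_less by blast
  have "Sp F" unfolding Sp_iff using F(3) X(2,3) by blast
  then show ?thesis using Big_nst[OF F(1,2)] F(3) by blast
qed

text \<open>\<open>M\<close> is one more than the leading exponent, so no term of \<alpha> can be
  the place of a drop at level \<open>M\<close>; the additional exponent is supplied by
  \<open>LL_1\<close> and \<open>LL_add\<close>. The empty sequence has no leading exponent and gets
  \<open>M = 1\<close>.\<close>

lemma WO_LL:
  assumes \<alpha>: "isord \<alpha>" and wo: "\<not> (\<exists>F\<in>SS. MMc.dsc F \<alpha>)"
  obtains M where "1 \<le> M" "LL M" "\<And>e s. M \<le> e \<Longrightarrow> \<not> drp e s \<alpha>"
proof (cases "hlen \<alpha> = 0")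
  case True
  show ?thesis by (rule that[of 1]) (auto intro: LL_1 simp: drp_def True)
next
  case False
  have "\<not> (\<exists>f. rec f \<and> f 0 = \<alpha> \<and> (\<forall>n. isord (f n) \<and> drp 0 (f (n + 1)) (f n)))"
  proof
    assume "\<exists>f. rec f \<and> f 0 = \<alpha> \<and> (\<forall>n. isord (f n) \<and> drp 0 (f (n + 1)) (f n))"
    then obtain f where f: "rec f" "f 0 = \<alpha>" "\<And>n. isord (f n)" "\<And>n. drp 0 (f (n + 1)) (f n)" by blast
    have "MMc.dsc {z. hsnd z = f (hfst z)} \<alpha>" unfolding MMc.dsc_def using f(2-4) by simp
    then show False using wo graph_dec[OF f(1)] by blast
  qed
  from WO_large[OF \<alpha> _ this] have L: "LL (hent \<alpha> 0)" using False by (simp add: hm_gr0)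
  show ?thesis
  proof (rule that[of "hent \<alpha> 0 + 1"])
    show "LL (hent \<alpha> 0 + 1)" by (rule LL_add[OF L LL_1])
    show "1 \<le> hent \<alpha> 0 + 1" by (simp add: hm_nonneg)
    show "\<not> drp e s \<alpha>" if "hent \<alpha> 0 + 1 \<le> e" for e s
    proof
      assume "drp e s \<alpha>"
      then obtain i where i: "i < hlen \<alpha>" "e \<le> hent \<alpha> i" unfolding drp_def by blast
      then show False using isordD[OF \<alpha> hm_nonneg i(1)] that unfolding hm_Suc_le by order
    qed
  qed
qed

text \<open>A descending sequence in the cut is a recursive function of the model that descends at
  least on the cut. A block of exponent \<open>M\<close> inside the cut and beyond \<alpha> forces
  it to drop from \<alpha> at level \<open>M\<close>, which \<alpha> does not permit.\<close>

lemma (in cut) WO_cut: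
  assumes B: "B \<notin> I" and \<alpha>: "\<alpha> \<in> I" and M: "\<And>s. \<not> drp M s \<alpha>"
    and T: "\<And>g b. rec g \<Longrightarrow> (\<And>x. x \<in> I \<Longrightarrow> g x \<in> I) \<Longrightarrow> b \<in> I \<Longrightarrow>
       \<exists>T y. lg M T \<and> y \<in> I \<and> (\<forall>z. hmem z T \<longrightarrow> b < z \<and> z \<le> y) \<and> (\<forall>x y. hmem x T \<longrightarrow> hmem y T \<longrightarrow> x < y \<longrightarrow> g x < y)"
    and F: "F \<in> SS"
  shows "\<not> dsc F \<alpha>"
proof
  assume "dsc F \<alpha>"
  then have tot: "\<And>n. n \<in> I \<Longrightarrow> \<exists>m\<in>I. hpair n m \<in> F"
    and fn: "\<And>n m m'. n \<in> I \<Longrightarrow> m \<in> I \<Longrightarrow> m' \<in> I \<Longrightarrow> hpair n m \<in> F \<Longrightarrow> hpair n m' \<in> F \<Longrightarrow> m = m'"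
    and st: "hpair 0 \<alpha> \<in> F"
    and ds: "\<And>n u v. n \<in> I \<Longrightarrow> u \<in> I \<Longrightarrow> v \<in> I \<Longrightarrow> hpair n u \<in> F \<Longrightarrow> hpair (n + 1) v \<in> F \<Longrightarrow> isord u \<and> drp 0 v u"
    unfolding dsc_def by blast+
  let ?Q = "\<lambda>n y. hpair n y \<in> F \<or> y = B"
  have d: "dec (\<lambda>z. ?Q (hfst z) (hsnd z))" by (intro rr5 dec_mem[OF F])
  \<comment> \<open>Outside of the cut \<open>F\<close> may have no value; the default
    \<open>B\<close> makes \<open>g\<close> total, and within the cut a genuine value below
    \<open>B\<close> is found first.\<close>
  define g where "g n = (LEAST y. ?Q n y)" for n
  have r: "rec g" unfolding g_def by (rule rec_Least[where Q = ?Q, OF d]) blast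
  have g: "g n \<in> I \<and> hpair n (g n) \<in> F" if n: "n \<in> I" for n
  proof -
    obtain m where m: "m \<in> I" "hpair n m \<in> F" using tot[OF n] by blast
    then have "?Q n m" by blast
    from dec_Least(1,2)[OF dec_section[OF d], OF this]
    have "?Q n (g n)" "g n \<le> m" unfolding g_def by blast+
    then show ?thesis using Idown[OF m(1)] B by blast
  qed
  have g0: "g 0 = \<alpha>" using fn[OF I0 _ \<alpha> _ st] g[OF I0] by blast
  have od: "isord (g n) \<and> drp 0 (g (n + 1)) (g n)" if n: "n \<in> I" for n
    using ds[OF n] g[OF n] g[OF Iadd[OF n I1]] by blast
  have "\<And>x. x \<in> I \<Longrightarrow> g x \<in> I" using g by blast
  from T[OF r this \<alpha>] obtain T y where Ty: "lg M T" "y \<in> I" "\<And>z. hmem z T \<Longrightarrow> \<alpha> < z \<and> z \<le> y"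
    "\<And>x y. hmem x T \<Longrightarrow> hmem y T \<Longrightarrow> x < y \<Longrightarrow> g x < y" by blast
  have "drp M (g y) (g 0)"
  proof (rule descent_bound[OF r _ _ Ty(4) Ty(1) hsub_refl _ order_refl])
    show "isord (g n)" if "n \<le> y" for n using od Idown[OF Ty(2) that] by blast
    show "drp 0 (g (n + 1)) (g n)" if "n + 1 \<le> y" for n
      using od[of n] Idown[OF Ty(2), of n] that by (simp add: hm_Suc_le)
    show "0 < z \<and> g 0 < z \<and> z \<le> y" if "hmem z T" for z
      using Ty(3)[OF that] hm_nonneg[of \<alpha>] unfolding g0 by (auto intro: order_le_less_trans)
  qed
  then show False using M g0 by simp
qed

theorem theorem3p3:
  fixes phi :: fm and a :: nat
  assumes "allSigma2 phi"
    and "prov WKL0_RT22 (ordStmt a phi)"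
  shows "prov RCA0 (ordStmt a phi)"
proof (rule ccontr)
  assume "\<not> prov RCA0 (ordStmt a phi)"
  then have CE0: "CE phi a" using assms by (simp add: CE_def)
  \<comment> \<open>The model was fixed in advance, so it refutes some counterexample, not
    necessarily the given one. The contradiction is derived for the one it refutes.\<close>
  obtain psi b e0 s where ce: "CE psi b" "wfe MM e0 s" "\<not> sat MM e0 s (ordStmt b psi)" using MM_counter(3)[OF CE0] by blast
  have sS: "s X \<in> SS" for X using ce(2) by (simp add: wfe_def)
  let ?A = "fv (ordStmt b psi)"
  \<comment> \<open>Variables that do not occur free are reset to 0, so that one element of the
    model bounds the whole assignment and can be put into the cut.\<close>
  define e where "e n = (if n \<in> ?A then e0 n else 0)" for n
  have ns: "\<not> sat (NN UNIV) e s (ordStmt b psi)"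
    using ce(3) sat_cong[of "ordStmt b psi" e e0 s s MM] by (simp add: NN_UNIV e_def)
  have "finite (e0 ` ?A)" by simp
  then have bd: "e n \<le> sum id (e0 ` ?A)" for n
    unfolding e_def using member_le_sum[of "e0 n" "e0 ` ?A" id] hm_nonneg by (auto intro!: sum_nonneg)
  define Pe where "Pe = sum id (e0 ` ?A)"
  from ns obtain \<alpha> where \<alpha>: "isord \<alpha>" "\<not> (\<exists>F\<in>SS. MMc.dsc F \<alpha>)" "\<not> sat MM (e(b := \<alpha>)) s psi"
    using MMc.sat_ordStmt[of e s b psi] by (auto simp: MMc.ine_def NN_UNIV)
  have "(e(b := \<alpha>)) n \<le> Pe + \<alpha>" for n
    using bd[of n] hm_nonneg[of \<alpha>] hm_nonneg[of Pe] unfolding Pe_def by (auto intro: add_increasing add_increasing2)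
  with neg_transfer[OF _ sS _ \<alpha>(3)] ce(1) obtain P h where h: "rec h"
    "\<And>I. cut I \<Longrightarrow> P \<in> I \<Longrightarrow> (\<forall>x\<in>I. h x \<in> I) \<Longrightarrow> \<not> sat (NN I) (e(b := \<alpha>)) s psi" unfolding CE_def by blast
  obtain c where c: "nst c" using nst_ex[OF CE0] by blast
  obtain M where M: "1 \<le> M" "LL M" "\<And>e s. M \<le> e \<Longrightarrow> \<not> drp e s \<alpha>" using WO_LL[OF \<alpha>(1,2)] by blast
  have "rec (\<lambda>x. h x + cb x + (x + x) + x * x)" by (intro rr5 rec_comp[OF h(1)] rec_comp[OF rec_cb])
  from majorant_ex[OF this] obtain H where H: "rec H" "\<And>x y. x \<le> y \<Longrightarrow> H x \<le> H y" "\<And>x. h x + cb x + (x + x) + x * x \<le> H x" by blast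
  have s4: "a \<le> t \<and> b \<le> t \<and> c \<le> t \<and> d \<le> t" if "a + b + c + d \<le> t" for a b c d t :: hm
    using that unfolding hz_trans using ofm_nn[of a] ofm_nn[of b] ofm_nn[of c] ofm_nn[of d] by simp
  have Hs: "h x \<le> H x" "cb x \<le> H x" "x + x \<le> H x" "x * x \<le> H x" for x
    using s4[OF H(3)[of x]] by blast+
  \<comment> \<open>All of \<open>F0\<close> lies above this sum, so the cut contains the parameter
    bound of the Skolem function, the assignment and \<alpha>.\<close>
  let ?P = "P + Pe + \<alpha>"
  obtain X where X: "unb X" "\<And>x. x \<in> X \<Longrightarrow> ?P < x" "\<And>x y. x \<in> X \<Longrightarrow> y \<in> X \<Longrightarrow> x < y \<Longrightarrow> gg x < y \<and> H x < y"
    using sparse_set[OF H(1,2), of ?P] by blast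
  have "0 < x" if "x \<in> X" for x using X(2)[OF that] hm_nonneg[of ?P] by order
  with Big_ex[OF c M(2) X(1)] X(3) obtain F0 where F0: "Sp F0" "Big M F0" "\<And>i. hmem i F0 \<Longrightarrow> i \<in> X" by blast
  have FH: "\<And>x y. hmem x F0 \<Longrightarrow> hmem y F0 \<Longrightarrow> x < y \<Longrightarrow> H x < y" using F0(3) X(3) by blast
  have FP: "\<And>x. hmem x F0 \<Longrightarrow> ?P \<le> x" using F0(3) X(2) less_imp_le by blast
  obtain I where I: "gcut I F0" "?P \<in> I" "\<And>x. x \<in> I \<Longrightarrow> H x \<in> I"
    "\<And>g b. rec g \<Longrightarrow> (\<And>x. x \<in> I \<Longrightarrow> g x \<in> I) \<Longrightarrow> b \<in> I \<Longrightarrow>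
       \<exists>T y. lg M T \<and> y \<in> I \<and> (\<forall>z. hmem z T \<longrightarrow> b < z \<and> z \<le> y) \<and> (\<forall>x y. hmem x T \<longrightarrow> hmem y T \<longrightarrow> x < y \<longrightarrow> g x < y)"
    by (rule generic_cut[OF c MM_counter(1)[OF CE0] M(1) F0(1,2) H(2) FH Hs(2-4) FP]) (assumption+ | blast)+
  interpret G: gcut I F0 by (rule I(1))
  have PI: "P \<in> I" "Pe \<in> I" "\<alpha> \<in> I"
    by (rule G.Idown[OF I(2)]; unfold hz_trans; use ofm_nn[of P] ofm_nn[of Pe] ofm_nn[of \<alpha>] in simp)+
  have hI: "\<forall>x\<in>I. h x \<in> I" using G.Idown[OF I(3) Hs(1)] by blast
  have ine: "G.ine e" unfolding G.ine_def using G.Idown[OF PI(2)] bd Pe_def by blast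
  have "wfe (NN I) e s" using ine sS by (simp add: wfe_def G.ine_def)
  moreover have "prov WKL0_RT22 (ordStmt b psi)" using ce(1) by (simp add: CE_def)
  ultimately have "sat (NN I) e s (ordStmt b psi)" using soundness[OF _ G.wfm_NN G.NN_models] by blast
  moreover have "\<not> G.dsc F \<alpha>" if "F \<in> SS" for F
    by (rule G.WO_cut[OF G.BI PI(3) M(3)[OF order_refl] I(4) that])
  ultimately have "sat (NN I) (e(b := \<alpha>)) s psi" using G.sat_ordStmt[OF ine] PI(3) \<alpha>(1) by blast
  then show False using h(2)[OF G.cut_axioms PI(1) hI] by blast
qed

end
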